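(* Let $Q$ be a quiver whose underlying graph is a simply-laced Dynkin diagram $\Delta$, let $k$ be an algebraically closed field, and let $\mathcal C=D^b(kQ)/F$ be the cluster category. For all $\alpha,\beta\in\Phi_{\geq-1}$, $$(\alpha\|\beta)_Q=\dim_k\operatorname{Ext}^1_{\mathcal C}(M_Q(\alpha),M_Q(\beta)),$$ where $(\alpha\|\beta)_Q$ denotes the $Q$-compatibility degree of $\alpha$ and $\beta$.
   Context: Cluster category: let $\mathcal D=D^b(kQ)$, with shift $[1]$ and Auslander–Reiten translation $\tau$, and $F=\tau^{-1}[1]$. $\mathcal C=\mathcal D/F$ has as objects the $F$-orbits $\widetilde X$ of objects of $\mathcal D$, with $\operatorname{Hom}_{\mathcal C}(\widetilde X,\widetilde Y)=\coprod_{i\in\mathbb Z}\operatorname{Hom}_{\mathcal D}(F^iX,Y)$; it is triangulated, and $\operatorname{Ext}^1_{\mathcal C}(U,V)=\operatorname{Hom}_{\mathcal C}(U,V[1])$. Roots and labelling: $\Phi$ is the root system of type $\Delta$ with simple roots $\alpha_i$, and $\Phi_{\geq-1}$ is the set of positive roots together with the negative simple roots. Each indecomposable object of $\mathcal C$ is, uniquely up to isomorphism, $\widetilde X$ with $X$ either an indecomposable $kQ$-module or $X=P_i[1]$, with $P_i$ the indecomposable projective at vertex $i$. $M_Q(\alpha)$ is $\widetilde X$ with $X$ the indecomposable $kQ$-module of dimension vector $\alpha$ if $\alpha$ is positive, and $M_Q(-\alpha_i)=\widetilde{P_i[1]}$. $Q$-compatibility degree: let $\widetilde Q$ be the quiver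 obtained from $Q$ by adding a disjoint copy $\{i_-: i\in Q_0\}$ of its vertex set $Q_0$, with no arrows incident to new vertices. A $k\widetilde Q$-module (decorated representation) is $M=M^+\coprod V$ with $M^+=\coprod_{i\in Q_0}M_i^+$ a $kQ$-module and $V=\coprod_{i\in Q_0}V_i$ a $Q_0$-graded vector space. Its signed dimension vector is $\mathbf{sdim}(M)=\sum_i\dim(M_i^+)\alpha_i-\sum_i\dim(V_i)\alpha_i$; $\mathbf{sdim}$ is a bijection from isomorphism classes of indecomposable $k\widetilde Q$-modules to $\Phi_{\geq-1}$. For $M=M^+\coprod V$ and $N=N^+\coprod W$, set $$E_{kQ}(M,N)=\operatorname{Ext}^1_{kQ}(M^+,N^+)\coprod\operatorname{Ext}^1_{kQ}(N^+,M^+)\coprod\operatorname{Hom}^{Q_0}(M^+,W)\coprod\operatorname{Hom}^{Q_0}(V,N^+),$$ where $\operatorname{Hom}^{Q_0}$ denotes homomorphisms of $Q_0$-graded vector spaces. Then $(\alpha\|\beta)_Q=\dim_kE_{kQ}(M,N)$ for $M,N$ the indecomposable $k\widetilde Q$-modules with $\mathbf{sdim}(M)=\alpha$, $\mathbf{sdim}(N)=\beta$. *)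

theory Defs
  imports
    "Jordan_Normal_Form.VS_Connect"
    "Graph_Theory.Digraph"
    "HOL-Library.Function_Algebras"
    "HOL-Computational_Algebra.Polynomial"
begin

section \<open>Vector spaces\<close>

text \<open>
  Spaces whose elements are equivalence classes or families (\<open>Ext\<close>, morphisms of the derived and
  of the cluster category) are \<^typ>\<open>('k, 'x) module\<close> records over \<^term>\<open>class_ring\<close>. The fields
  \<^const>\<open>mult\<close> and \<^const>\<open>one\<close> of these records carry no meaning.
\<close>

abbreviation kdim :: "('k::field, 'x) module \<Rightarrow> nat" where
  "kdim V \<equiv> vectorspace.dim (class_ring :: 'k ring) V"

definition coprod_mod :: "(int \<Rightarrow> ('k, 'x) module) \<Rightarrow> ('k, int \<Rightarrow> 'x) module" where
  "coprod_mod V =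
     \<lparr>carrier = {x. (\<forall>i. x i \<in> carrier (V i)) \<and> finite {i. x i \<noteq> \<zero>\<^bsub>V i\<^esub>}},
      mult = (\<lambda>x y i. \<zero>\<^bsub>V i\<^esub>), one = (\<lambda>i. \<zero>\<^bsub>V i\<^esub>), zero = (\<lambda>i. \<zero>\<^bsub>V i\<^esub>),
      add = (\<lambda>x y i. x i \<oplus>\<^bsub>V i\<^esub> y i),
      smult = (\<lambda>c x i. c \<odot>\<^bsub>V i\<^esub> x i)\<rparr>"

text \<open>
  Finite-dimensional spaces are realised as subspaces of the ambient space \<^typ>\<open>nat \<Rightarrow> 'k\<close>, which
  contains a copy of each of them. A linear map between two such subspaces is represented by the
  function that agrees with it on the source and vanishes elsewhere, so that equality of linear
  maps is equality of functions and composition is composition of functions.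
\<close>

definition kscale :: "'k::field \<Rightarrow> (nat \<Rightarrow> 'k) \<Rightarrow> nat \<Rightarrow> 'k" where
  "kscale c x = (\<lambda>n. c * x n)"

interpretation kvec: vector_space "kscale :: 'k::field \<Rightarrow> (nat \<Rightarrow> 'k) \<Rightarrow> nat \<Rightarrow> 'k"
  by unfold_locales (auto simp: kscale_def fun_eq_iff algebra_simps)

definition fd_subspace :: "(nat \<Rightarrow> 'k::field) set \<Rightarrow> bool" where
  "fd_subspace U \<longleftrightarrow> (\<exists>B. finite B \<and> U = kvec.span B)"

definition lin_maps ::
  "(nat \<Rightarrow> 'k::field) set \<Rightarrow> (nat \<Rightarrow> 'k) set \<Rightarrow> ((nat \<Rightarrow> 'k) \<Rightarrow> nat \<Rightarrow> 'k) set" where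
  "lin_maps U W = {g. (\<forall>x\<in>U. g x \<in> W) \<and> (\<forall>x\<in>U. \<forall>y\<in>U. g (x + y) = g x + g y) \<and>
     (\<forall>c. \<forall>x\<in>U. g (kscale c x) = kscale c (g x)) \<and> (\<forall>x. x \<notin> U \<longrightarrow> g x = 0)}"

text \<open>A \<open>'v\<close>-graded map; components at indices outside the vertex set are required to be 0.\<close>

type_synonym ('v, 'k) gmap = "'v \<Rightarrow> (nat \<Rightarrow> 'k) \<Rightarrow> nat \<Rightarrow> 'k"

definition graded_hom ::
  "('v, 'e) pre_digraph \<Rightarrow> ('v \<Rightarrow> (nat \<Rightarrow> 'k::field) set) \<Rightarrow> ('v \<Rightarrow> (nat \<Rightarrow> 'k) set) \<Rightarrow>
    ('v, 'k) gmap set" where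
  "graded_hom Q A B = {f. (\<forall>v\<in>verts Q. f v \<in> lin_maps (A v) (B v)) \<and> (\<forall>v. v \<notin> verts Q \<longrightarrow> f v = 0)}"

definition gcomp :: "('v, 'k) gmap \<Rightarrow> ('v, 'k) gmap \<Rightarrow> ('v, 'k) gmap" where
  "gcomp g f = (\<lambda>v. g v \<circ> f v)"

definition gscale :: "'k::field \<Rightarrow> ('v, 'k) gmap \<Rightarrow> ('v, 'k) gmap" where
  "gscale c f = (\<lambda>v x. kscale c (f v x))"

definition hom_mod :: "('v, 'k::field) gmap set \<Rightarrow> ('k, ('v, 'k) gmap) module" where
  "hom_mod U = \<lparr>carrier = U, mult = (\<lambda>_ _. 0), one = 0, zero = 0, add = (+), smult = gscale\<rparr>"

text \<open>The quotient of a space \<open>U\<close> of graded maps by a subspace \<open>W\<close>; elements are cosets \<open>f + W\<close>.\<close>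

definition quot_mod ::
  "('v, 'k::field) gmap set \<Rightarrow> ('v, 'k) gmap set \<Rightarrow> ('k, ('v, 'k) gmap set) module" where
  "quot_mod U W =
     \<lparr>carrier = {(\<lambda>w. f + w) ` W | f. f \<in> U}, mult = (\<lambda>_ _. W), one = W, zero = W,
      add = (\<lambda>A B. {a + b | a b. a \<in> A \<and> b \<in> B}),
      smult = (\<lambda>c A. {gscale c a + w | a w. a \<in> A \<and> w \<in> W})\<rparr>"


section \<open>Dynkin quivers and roots\<close>

datatype dynkin = Dynkin_A nat | Dynkin_D nat | Dynkin_E nat

fun dynkin_rank :: "dynkin \<Rightarrow> nat" where
  "dynkin_rank (Dynkin_A n) = n"
| "dynkin_rank (Dynkin_D n) = n"
| "dynkin_rank (Dynkin_E n) = n"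

fun is_dynkin :: "dynkin \<Rightarrow> bool" where
  "is_dynkin (Dynkin_A n) \<longleftrightarrow> n \<ge> 1"
| "is_dynkin (Dynkin_D n) \<longleftrightarrow> n \<ge> 4"
| "is_dynkin (Dynkin_E n) \<longleftrightarrow> n \<in> {6, 7, 8}"

text \<open>
  The vertices are \<open>0, \<dots>, n - 1\<close>. In types \<open>D\<close> and \<open>E\<close> the vertices \<open>0, \<dots>, n - 2\<close> form a chain and
  vertex \<open>n - 1\<close> is attached to vertex \<open>n - 3\<close>, respectively vertex \<open>2\<close>.
\<close>

fun dynkin_edges :: "dynkin \<Rightarrow> nat set set" where
  "dynkin_edges (Dynkin_A n) = {{i, i + 1} | i. i + 1 < n}"
| "dynkin_edges (Dynkin_D n) = {{i, i + 1} | i. i + 1 < n - 1} \<union> {{n - 3, n - 1}}"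
| "dynkin_edges (Dynkin_E n) = {{i, i + 1} | i. i + 1 < n - 1} \<union> {{2, n - 1}}"

text \<open>Quivers are directed multigraphs; the bijection on arcs excludes loops and multiple arrows.\<close>

definition dynkin_quiver :: "dynkin \<Rightarrow> ('v, 'e) pre_digraph \<Rightarrow> bool" where
  "dynkin_quiver \<Delta> Q \<longleftrightarrow> is_dynkin \<Delta> \<and> fin_digraph Q \<and>
     (\<exists>b. bij_betw b (verts Q) {..<dynkin_rank \<Delta>} \<and>
          bij_betw (\<lambda>e. {b (tail Q e), b (head Q e)}) (arcs Q) (dynkin_edges \<Delta>))"

definition cartan :: "('v, 'e) pre_digraph \<Rightarrow> 'v \<Rightarrow> 'v \<Rightarrow> int" where
  "cartan Q i j = (if i = j then 2 else - int (card {e \<in> arcs Q. {tail Q e, head Q e} = {i, j}}))"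

definition simple_root :: "'v \<Rightarrow> 'v \<Rightarrow> int" where
  "simple_root i = (\<lambda>j. if j = i then 1 else 0)"

definition simple_reflection :: "('v, 'e) pre_digraph \<Rightarrow> 'v \<Rightarrow> ('v \<Rightarrow> int) \<Rightarrow> 'v \<Rightarrow> int" where
  "simple_reflection Q i x = (\<lambda>j. x j - (\<Sum>l\<in>verts Q. cartan Q i l * x l) * simple_root i j)"

text \<open>The root system is the Weyl group orbit of the simple roots, in coordinates \<open>\<Sum> x\<^sub>i \<alpha>\<^sub>i\<close>.\<close>

inductive_set roots :: "('v, 'e) pre_digraph \<Rightarrow> ('v \<Rightarrow> int) set" for Q where
  simple: "i \<in> verts Q \<Longrightarrow> simple_root i \<in> roots Q"
| reflect: "x \<in> roots Q \<Longrightarrow> i \<in> verts Q \<Longrightarrow> simple_reflection Q i x \<in> roots Q"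

definition positive_roots :: "('v, 'e) pre_digraph \<Rightarrow> ('v \<Rightarrow> int) set" where
  "positive_roots Q = {x \<in> roots Q. \<forall>i. x i \<ge> 0}"

definition almost_positive_roots :: "('v, 'e) pre_digraph \<Rightarrow> ('v \<Rightarrow> int) set" where
  "almost_positive_roots Q = positive_roots Q \<union> {- simple_root i | i. i \<in> verts Q}"


section \<open>Modules over the path algebra\<close>

text \<open>Finite-dimensional \<open>kQ\<close>-modules, as representations of \<open>Q\<close>.\<close>

record ('v, 'e, 'k) qrep =
  sp :: "'v \<Rightarrow> (nat \<Rightarrow> 'k) set"
  act :: "'e \<Rightarrow> (nat \<Rightarrow> 'k) \<Rightarrow> nat \<Rightarrow> 'k"

definition is_rep :: "('v, 'e) pre_digraph \<Rightarrow> ('v, 'e, 'k::field) qrep \<Rightarrow> bool" where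
  "is_rep Q M \<longleftrightarrow> (\<forall>v\<in>verts Q. fd_subspace (sp M v)) \<and>
     (\<forall>e\<in>arcs Q. act M e \<in> lin_maps (sp M (tail Q e)) (sp M (head Q e)))"

definition rep_hom ::
  "('v, 'e) pre_digraph \<Rightarrow> ('v, 'e, 'k::field) qrep \<Rightarrow> ('v, 'e, 'k) qrep \<Rightarrow> ('v, 'k) gmap set" where
  "rep_hom Q M N = {f \<in> graded_hom Q (sp M) (sp N).
     \<forall>e\<in>arcs Q. f (head Q e) \<circ> act M e = act N e \<circ> f (tail Q e)}"

definition rep_id :: "('v, 'e) pre_digraph \<Rightarrow> ('v, 'e, 'k::field) qrep \<Rightarrow> ('v, 'k) gmap" where
  "rep_id Q M = (\<lambda>v x. if v \<in> verts Q \<and> x \<in> sp M v then x else 0)"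

definition zero_rep :: "('v, 'e, 'k::field) qrep" where
  "zero_rep = \<lparr>sp = (\<lambda>v. {0}), act = (\<lambda>e x. 0)\<rparr>"

definition is_zero_rep :: "('v, 'e) pre_digraph \<Rightarrow> ('v, 'e, 'k::field) qrep \<Rightarrow> bool" where
  "is_zero_rep Q M \<longleftrightarrow> (\<forall>v\<in>verts Q. sp M v = {0})"

definition simple_rep :: "'v \<Rightarrow> ('v, 'e, 'k::field) qrep" where
  "simple_rep i = \<lparr>sp = (\<lambda>v. if v = i then kvec.span {\<lambda>n. if n = 0 then 1 else 0} else {0}),
     act = (\<lambda>e x. 0)\<rparr>"

definition subrep ::
  "('v, 'e) pre_digraph \<Rightarrow> ('v, 'e, 'k::field) qrep \<Rightarrow> ('v \<Rightarrow> (nat \<Rightarrow> 'k) set) \<Rightarrow> bool" where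
  "subrep Q M A \<longleftrightarrow> (\<forall>v\<in>verts Q. kvec.subspace (A v) \<and> A v \<subseteq> sp M v) \<and>
     (\<forall>e\<in>arcs Q. act M e ` A (tail Q e) \<subseteq> A (head Q e))"

definition rep_indec :: "('v, 'e) pre_digraph \<Rightarrow> ('v, 'e, 'k::field) qrep \<Rightarrow> bool" where
  "rep_indec Q M \<longleftrightarrow> is_rep Q M \<and> \<not> is_zero_rep Q M \<and>
     (\<forall>A B. subrep Q M A \<and> subrep Q M B \<and>
        (\<forall>v\<in>verts Q. A v \<inter> B v = {0} \<and> sp M v = {a + b | a b. a \<in> A v \<and> b \<in> B v}) \<longrightarrow>
        (\<forall>v\<in>verts Q. A v = {0}) \<or> (\<forall>v\<in>verts Q. B v = {0}))"

definition projective :: "('v, 'e) pre_digraph \<Rightarrow> ('v, 'e, 'k::field) qrep \<Rightarrow> bool" where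
  "projective Q P \<longleftrightarrow> is_rep Q P \<and>
     (\<forall>M N g f. is_rep Q M \<and> is_rep Q N \<and> g \<in> rep_hom Q M N \<and> f \<in> rep_hom Q P N \<and>
        (\<forall>v\<in>verts Q. g v ` sp M v = sp N v) \<longrightarrow> (\<exists>h\<in>rep_hom Q P M. f = gcomp g h))"

definition indec_rep :: "('v, 'e) pre_digraph \<Rightarrow> ('v \<Rightarrow> int) \<Rightarrow> ('v, 'e, 'k::field) qrep" where
  "indec_rep Q \<alpha> = (SOME M. rep_indec Q M \<and> (\<forall>v\<in>verts Q. int (kvec.dim (sp M v)) = \<alpha> v))"

text \<open>
  The indecomposable projective at \<open>i\<close> is the one with top \<open>S\<^sub>i\<close>; this does not depend on whether
  one works with left or right modules.
\<close>

definition proj_at :: "('v, 'e) pre_digraph \<Rightarrow> 'v \<Rightarrow> ('v, 'e, 'k::field) qrep" where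
  "proj_at Q i =
     (SOME P. projective Q P \<and> rep_indec Q P \<and> (\<exists>f\<in>rep_hom Q P (simple_rep i). f \<noteq> 0))"


section \<open>Complexes\<close>

record ('v, 'e, 'k) cplx =
  ob :: "int \<Rightarrow> ('v, 'e, 'k) qrep"
  df :: "int \<Rightarrow> ('v, 'k) gmap"

text \<open>Bounded cochain complexes; \<open>df X n\<close> goes from degree \<open>n\<close> to degree \<open>n + 1\<close>.\<close>

definition is_complex :: "('v, 'e) pre_digraph \<Rightarrow> ('v, 'e, 'k::field) cplx \<Rightarrow> bool" where
  "is_complex Q X \<longleftrightarrow> (\<forall>n. is_rep Q (ob X n)) \<and>
     (\<forall>n. df X n \<in> rep_hom Q (ob X n) (ob X (n + 1))) \<and>
     (\<forall>n. gcomp (df X (n + 1)) (df X n) = 0) \<and>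
     (\<exists>m. \<forall>n. \<bar>n\<bar> > m \<longrightarrow> is_zero_rep Q (ob X n))"

definition chain_map ::
  "('v, 'e) pre_digraph \<Rightarrow> ('v, 'e, 'k::field) cplx \<Rightarrow> ('v, 'e, 'k) cplx \<Rightarrow>
    (int \<Rightarrow> ('v, 'k) gmap) set" where
  "chain_map Q X Y = {f. (\<forall>n. f n \<in> rep_hom Q (ob X n) (ob Y n)) \<and>
     (\<forall>n. gcomp (f (n + 1)) (df X n) = gcomp (df Y n) (f n))}"

definition ccomp ::
  "(int \<Rightarrow> ('v, 'k) gmap) \<Rightarrow> (int \<Rightarrow> ('v, 'k) gmap) \<Rightarrow> int \<Rightarrow> ('v, 'k) gmap" where
  "ccomp g f = (\<lambda>n. gcomp (g n) (f n))"

definition cid :: "('v, 'e) pre_digraph \<Rightarrow> ('v, 'e, 'k::field) cplx \<Rightarrow> int \<Rightarrow> ('v, 'k) gmap" where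
  "cid Q X = (\<lambda>n. rep_id Q (ob X n))"

definition null_homotopic ::
  "('v, 'e) pre_digraph \<Rightarrow> ('v, 'e, 'k::field) cplx \<Rightarrow> ('v, 'e, 'k) cplx \<Rightarrow>
    (int \<Rightarrow> ('v, 'k) gmap) set" where
  "null_homotopic Q X Y = {f. \<exists>s. (\<forall>n. s n \<in> rep_hom Q (ob X n) (ob Y (n - 1))) \<and>
     (\<forall>n. f n = gcomp (df Y (n - 1)) (s n) + gcomp (s (n + 1)) (df X n))}"

text \<open>The two conditions say that \<open>s\<close> is injective and surjective on cohomology.\<close>

definition quasi_iso ::
  "('v, 'e) pre_digraph \<Rightarrow> ('v, 'e, 'k::field) cplx \<Rightarrow> ('v, 'e, 'k) cplx \<Rightarrow>
    (int \<Rightarrow> ('v, 'k) gmap) \<Rightarrow> bool" where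
  "quasi_iso Q X Y s \<longleftrightarrow> s \<in> chain_map Q X Y \<and> (\<forall>n. \<forall>v\<in>verts Q.
     (\<forall>x\<in>sp (ob X n) v. df X n v x = 0 \<and> s n v x \<in> df Y (n - 1) v ` sp (ob Y (n - 1)) v \<longrightarrow>
        x \<in> df X (n - 1) v ` sp (ob X (n - 1)) v) \<and>
     (\<forall>y\<in>sp (ob Y n) v. df Y n v y = 0 \<longrightarrow>
        (\<exists>x\<in>sp (ob X n) v. df X n v x = 0 \<and> y - s n v x \<in> df Y (n - 1) v ` sp (ob Y (n - 1)) v)))"

definition stalk :: "('v, 'e, 'k::field) qrep \<Rightarrow> ('v, 'e, 'k) cplx" where
  "stalk M = \<lparr>ob = (\<lambda>n. if n = 0 then M else zero_rep), df = 0\<rparr>"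

definition shift :: "int \<Rightarrow> ('v, 'e, 'k::field) cplx \<Rightarrow> ('v, 'e, 'k) cplx" where
  "shift k X = \<lparr>ob = (\<lambda>n. ob X (n + k)),
     df = (\<lambda>n. if even k then df X (n + k) else - df X (n + k))\<rparr>"

definition shift_map :: "int \<Rightarrow> (int \<Rightarrow> ('v, 'k) gmap) \<Rightarrow> int \<Rightarrow> ('v, 'k) gmap" where
  "shift_map k f = (\<lambda>n. f (n + k))"

text \<open>
  Direct sums inside the ambient space: \<open>pair\<close> identifies \<^typ>\<open>(nat \<Rightarrow> 'k) \<times> (nat \<Rightarrow> 'k)\<close> with
  \<^typ>\<open>nat \<Rightarrow> 'k\<close>, with inverse given by \<open>evens\<close> and \<open>odds\<close>.
\<close>

definition pair :: "(nat \<Rightarrow> 'k) \<Rightarrow> (nat \<Rightarrow> 'k) \<Rightarrow> nat \<Rightarrow> 'k" where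
  "pair x y = (\<lambda>n. if even n then x (n div 2) else y (n div 2))"

definition evens :: "(nat \<Rightarrow> 'k) \<Rightarrow> nat \<Rightarrow> 'k" where
  "evens z = (\<lambda>n. z (2 * n))"

definition odds :: "(nat \<Rightarrow> 'k) \<Rightarrow> nat \<Rightarrow> 'k" where
  "odds z = (\<lambda>n. z (2 * n + 1))"

definition sum_sp :: "('v, 'e, 'k) qrep \<Rightarrow> ('v, 'e, 'k) qrep \<Rightarrow> 'v \<Rightarrow> (nat \<Rightarrow> 'k) set" where
  "sum_sp M N v = {pair x y | x y. x \<in> sp M v \<and> y \<in> sp N v}"

definition rep_sum ::
  "('v, 'e) pre_digraph \<Rightarrow> ('v, 'e, 'k::field) qrep \<Rightarrow> ('v, 'e, 'k) qrep \<Rightarrow> ('v, 'e, 'k) qrep" where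
  "rep_sum Q M N = \<lparr>sp = sum_sp M N,
     act = (\<lambda>e z. if z \<in> sum_sp M N (tail Q e)
                  then pair (act M e (evens z)) (act N e (odds z)) else 0)\<rparr>"

text \<open>The mapping cone, with differential \<open>(a, b) \<mapsto> (- d a, f a + d b)\<close>.\<close>

definition cone ::
  "('v, 'e) pre_digraph \<Rightarrow> ('v, 'e, 'k::field) cplx \<Rightarrow> ('v, 'e, 'k) cplx \<Rightarrow>
    (int \<Rightarrow> ('v, 'k) gmap) \<Rightarrow> ('v, 'e, 'k) cplx" where
  "cone Q A B f = \<lparr>ob = (\<lambda>n. rep_sum Q (ob A (n + 1)) (ob B n)),
     df = (\<lambda>n v z. if v \<in> verts Q \<and> z \<in> sum_sp (ob A (n + 1)) (ob B n) v
       then pair (- df A (n + 1) v (evens z)) (f (n + 1) v (evens z) + df B n v (odds z)) else 0)\<rparr>"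

definition cone_in :: "('v, 'e) pre_digraph \<Rightarrow> ('v, 'e, 'k::field) cplx \<Rightarrow> int \<Rightarrow> ('v, 'k) gmap" where
  "cone_in Q B = (\<lambda>n v y. if v \<in> verts Q \<and> y \<in> sp (ob B n) v then pair 0 y else 0)"

definition cone_pr ::
  "('v, 'e) pre_digraph \<Rightarrow> ('v, 'e, 'k::field) cplx \<Rightarrow> ('v, 'e, 'k) cplx \<Rightarrow> int \<Rightarrow> ('v, 'k) gmap" where
  "cone_pr Q A B = (\<lambda>n v z.
     if v \<in> verts Q \<and> z \<in> sum_sp (ob A (n + 1)) (ob B n) v then evens z else 0)"


section \<open>\<open>Ext\<^sup>1\<close> of modules\<close>

definition proj_resolution ::
  "('v, 'e) pre_digraph \<Rightarrow> ('v, 'e, 'k::field) qrep \<Rightarrow> ('v, 'e, 'k) cplx \<Rightarrow> bool" where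
  "proj_resolution Q M P \<longleftrightarrow> is_complex Q P \<and> (\<forall>n. projective Q (ob P n)) \<and>
     (\<forall>n>0. is_zero_rep Q (ob P n)) \<and> (\<exists>\<epsilon>. quasi_iso Q P (stalk M) \<epsilon>)"

text \<open>The first cohomology of \<open>Hom(P, N)\<close> for a projective resolution \<open>P\<close> of \<open>M\<close>.\<close>

definition rep_Ext1 ::
  "('v, 'e) pre_digraph \<Rightarrow> ('v, 'e, 'k::field) qrep \<Rightarrow> ('v, 'e, 'k) qrep \<Rightarrow>
    ('k, ('v, 'k) gmap set) module" where
  "rep_Ext1 Q M N = (let P = (SOME P. proj_resolution Q M P) in
     quot_mod {f \<in> rep_hom Q (ob P (- 1)) N. gcomp f (df P (- 2)) = 0}
              {gcomp g (df P (- 1)) | g. g \<in> rep_hom Q (ob P 0) N})"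


section \<open>The bounded derived category\<close>

text \<open>
  The localisation of the homotopy category of bounded complexes at the quasi-isomorphisms.
  Objects are bounded complexes, and a morphism from \<open>X\<close> to \<open>Y\<close> is an equivalence class of
  roofs \<open>X \<leftarrow> W \<rightarrow> Y\<close> whose left leg is a quasi-isomorphism.
\<close>

type_synonym ('v, 'e, 'k) roof =
  "('v, 'e, 'k) cplx \<times> (int \<Rightarrow> ('v, 'k) gmap) \<times> (int \<Rightarrow> ('v, 'k) gmap)"

definition roofs ::
  "('v, 'e) pre_digraph \<Rightarrow> ('v, 'e, 'k::field) cplx \<Rightarrow> ('v, 'e, 'k) cplx \<Rightarrow> ('v, 'e, 'k) roof set" where
  "roofs Q X Y = {(W, s, f). is_complex Q W \<and> quasi_iso Q W X s \<and> f \<in> chain_map Q W Y}"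

definition roof_eq ::
  "('v, 'e) pre_digraph \<Rightarrow> ('v, 'e, 'k::field) cplx \<Rightarrow> ('v, 'e, 'k) cplx \<Rightarrow>
    (('v, 'e, 'k) roof \<times> ('v, 'e, 'k) roof) set" where
  "roof_eq Q X Y = {((W, s, f), (W', s', f')).
     (W, s, f) \<in> roofs Q X Y \<and> (W', s', f') \<in> roofs Q X Y \<and>
     (\<exists>U u u'. is_complex Q U \<and> u \<in> chain_map Q U W \<and> u' \<in> chain_map Q U W' \<and>
        quasi_iso Q U X (ccomp s u) \<and>
        ccomp s u - ccomp s' u' \<in> null_homotopic Q U X \<and>
        ccomp f u - ccomp f' u' \<in> null_homotopic Q U Y)}"

definition D_hom ::
  "('v, 'e) pre_digraph \<Rightarrow> ('v, 'e, 'k::field) cplx \<Rightarrow> ('v, 'e, 'k) cplx \<Rightarrow>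
    ('v, 'e, 'k) roof set set" where
  "D_hom Q X Y = roofs Q X Y // roof_eq Q X Y"

definition D_map ::
  "('v, 'e) pre_digraph \<Rightarrow> ('v, 'e, 'k::field) cplx \<Rightarrow> ('v, 'e, 'k) cplx \<Rightarrow>
    (int \<Rightarrow> ('v, 'k) gmap) \<Rightarrow> ('v, 'e, 'k) roof set" where
  "D_map Q X Y f = roof_eq Q X Y `` {(X, cid Q X, f)}"

definition D_id :: "('v, 'e) pre_digraph \<Rightarrow> ('v, 'e, 'k::field) cplx \<Rightarrow> ('v, 'e, 'k) roof set" where
  "D_id Q X = D_map Q X X (cid Q X)"

definition D_zero ::
  "('v, 'e) pre_digraph \<Rightarrow> ('v, 'e, 'k::field) cplx \<Rightarrow> ('v, 'e, 'k) cplx \<Rightarrow> ('v, 'e, 'k) roof set" where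
  "D_zero Q X Y = D_map Q X Y 0"

text \<open>Two morphisms are added by means of roofs with a common left leg.\<close>

definition D_add ::
  "('v, 'e) pre_digraph \<Rightarrow> ('v, 'e, 'k::field) cplx \<Rightarrow> ('v, 'e, 'k) cplx \<Rightarrow>
    ('v, 'e, 'k) roof set \<Rightarrow> ('v, 'e, 'k) roof set \<Rightarrow> ('v, 'e, 'k) roof set" where
  "D_add Q X Y \<xi> \<eta> =
     roof_eq Q X Y `` {(W, s, f + g) | W s f g. (W, s, f) \<in> \<xi> \<and> (W, s, g) \<in> \<eta>}"

definition D_scale ::
  "('v, 'e) pre_digraph \<Rightarrow> ('v, 'e, 'k::field) cplx \<Rightarrow> ('v, 'e, 'k) cplx \<Rightarrow>
    'k \<Rightarrow> ('v, 'e, 'k) roof set \<Rightarrow> ('v, 'e, 'k) roof set" where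
  "D_scale Q X Y c \<xi> = roof_eq Q X Y `` {(W, s, \<lambda>n. gscale c (f n)) | W s f. (W, s, f) \<in> \<xi>}"

definition D_hom_mod ::
  "('v, 'e) pre_digraph \<Rightarrow> ('v, 'e, 'k::field) cplx \<Rightarrow> ('v, 'e, 'k) cplx \<Rightarrow>
    ('k, ('v, 'e, 'k) roof set) module" where
  "D_hom_mod Q X Y = \<lparr>carrier = D_hom Q X Y, mult = (\<lambda>_ _. D_zero Q X Y), one = D_zero Q X Y,
     zero = D_zero Q X Y, add = D_add Q X Y, smult = D_scale Q X Y\<rparr>"

text \<open>
  \<open>D_comp Q X Y Z \<eta> \<xi>\<close> is \<open>\<eta> \<circ> \<xi>\<close> for \<open>\<xi>: X \<rightarrow> Y\<close> and \<open>\<eta>: Y \<rightarrow> Z\<close>, obtained by completing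
  \<open>W \<rightarrow> Y \<leftarrow> V\<close> to a square \<open>W \<leftarrow> U \<rightarrow> V\<close> that commutes up to homotopy.
\<close>

definition D_comp ::
  "('v, 'e) pre_digraph \<Rightarrow> ('v, 'e, 'k::field) cplx \<Rightarrow> ('v, 'e, 'k) cplx \<Rightarrow> ('v, 'e, 'k) cplx \<Rightarrow>
    ('v, 'e, 'k) roof set \<Rightarrow> ('v, 'e, 'k) roof set \<Rightarrow> ('v, 'e, 'k) roof set" where
  "D_comp Q X Y Z \<eta> \<xi> = roof_eq Q X Z ``
     {(U, ccomp s t', ccomp g f') | U W V s t' f f' t g.
        (W, s, f) \<in> \<xi> \<and> (V, t, g) \<in> \<eta> \<and> is_complex Q U \<and> quasi_iso Q U W t' \<and>
        f' \<in> chain_map Q U V \<and> ccomp f t' - ccomp t f' \<in> null_homotopic Q U Y}"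

definition D_shift ::
  "('v, 'e) pre_digraph \<Rightarrow> int \<Rightarrow> ('v, 'e, 'k::field) cplx \<Rightarrow> ('v, 'e, 'k) cplx \<Rightarrow>
    ('v, 'e, 'k) roof set \<Rightarrow> ('v, 'e, 'k) roof set" where
  "D_shift Q k X Y \<xi> = roof_eq Q (shift k X) (shift k Y) ``
     {(shift k W, shift_map k s, shift_map k f) | W s f. (W, s, f) \<in> \<xi>}"

definition D_iso ::
  "('v, 'e) pre_digraph \<Rightarrow> ('v, 'e, 'k::field) cplx \<Rightarrow> ('v, 'e, 'k) cplx \<Rightarrow>
    ('v, 'e, 'k) roof set \<Rightarrow> bool" where
  "D_iso Q X Y \<xi> \<longleftrightarrow> \<xi> \<in> D_hom Q X Y \<and>
     (\<exists>\<eta>\<in>D_hom Q Y X. D_comp Q X Y X \<eta> \<xi> = D_id Q X \<and> D_comp Q Y X Y \<xi> \<eta> = D_id Q Y)"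

definition D_is_zero :: "('v, 'e) pre_digraph \<Rightarrow> ('v, 'e, 'k::field) cplx \<Rightarrow> bool" where
  "D_is_zero Q X \<longleftrightarrow> D_id Q X = D_zero Q X X"

definition D_biproduct ::
  "('v, 'e) pre_digraph \<Rightarrow> ('v, 'e, 'k::field) cplx \<Rightarrow> ('v, 'e, 'k) cplx \<Rightarrow> ('v, 'e, 'k) cplx \<Rightarrow> bool" where
  "D_biproduct Q X A B \<longleftrightarrow>
     (\<exists>i\<in>D_hom Q A X. \<exists>j\<in>D_hom Q B X. \<exists>p\<in>D_hom Q X A. \<exists>q\<in>D_hom Q X B.
        D_comp Q A X A p i = D_id Q A \<and> D_comp Q B X B q j = D_id Q B \<and>
        D_comp Q A X B q i = D_zero Q A B \<and> D_comp Q B X A p j = D_zero Q B A \<and>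
        D_add Q X X (D_comp Q X A X i p) (D_comp Q X B X j q) = D_id Q X)"

definition D_indec :: "('v, 'e) pre_digraph \<Rightarrow> ('v, 'e, 'k::field) cplx \<Rightarrow> bool" where
  "D_indec Q X \<longleftrightarrow> is_complex Q X \<and> \<not> D_is_zero Q X \<and>
     (\<forall>A B. is_complex Q A \<and> is_complex Q B \<and> D_biproduct Q X A B \<longrightarrow>
        D_is_zero Q A \<or> D_is_zero Q B)"

text \<open>A triangle \<open>X \<rightarrow> Y \<rightarrow> Z \<rightarrow> X[1]\<close> isomorphic to the one of a mapping cone.\<close>

definition D_triangle ::
  "('v, 'e) pre_digraph \<Rightarrow> ('v, 'e, 'k::field) cplx \<Rightarrow> ('v, 'e, 'k) cplx \<Rightarrow> ('v, 'e, 'k) cplx \<Rightarrow>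
    ('v, 'e, 'k) roof set \<Rightarrow> ('v, 'e, 'k) roof set \<Rightarrow> ('v, 'e, 'k) roof set \<Rightarrow> bool" where
  "D_triangle Q X Y Z u v w \<longleftrightarrow> is_complex Q X \<and> is_complex Q Y \<and> is_complex Q Z \<and>
     u \<in> D_hom Q X Y \<and> v \<in> D_hom Q Y Z \<and> w \<in> D_hom Q Z (shift 1 X) \<and>
     (\<exists>A B f a b c. is_complex Q A \<and> is_complex Q B \<and> f \<in> chain_map Q A B \<and>
        D_iso Q X A a \<and> D_iso Q Y B b \<and> D_iso Q Z (cone Q A B f) c \<and>
        D_comp Q X A B (D_map Q A B f) a = D_comp Q X Y B b u \<and>
        D_comp Q Y B (cone Q A B f) (D_map Q B (cone Q A B f) (cone_in Q B)) b
          = D_comp Q Y Z (cone Q A B f) c v \<and>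
        D_comp Q Z (cone Q A B f) (shift 1 A) (D_map Q (cone Q A B f) (shift 1 A) (cone_pr Q A B)) c
          = D_comp Q Z (shift 1 X) (shift 1 A) (D_shift Q 1 X A a) w)"

text \<open>
  Auslander--Reiten triangles: \<open>X\<close> and \<open>Z\<close> are indecomposable, \<open>w \<noteq> 0\<close>, every morphism to \<open>Z\<close>
  that is not a split epimorphism factors through \<open>v\<close>, and every morphism from \<open>X\<close> that is not a
  split monomorphism factors through \<open>u\<close>.
\<close>

definition AR_triangle ::
  "('v, 'e) pre_digraph \<Rightarrow> ('v, 'e, 'k::field) cplx \<Rightarrow> ('v, 'e, 'k) cplx \<Rightarrow> ('v, 'e, 'k) cplx \<Rightarrow>
    ('v, 'e, 'k) roof set \<Rightarrow> ('v, 'e, 'k) roof set \<Rightarrow> ('v, 'e, 'k) roof set \<Rightarrow> bool" where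
  "AR_triangle Q X Y Z u v w \<longleftrightarrow> D_triangle Q X Y Z u v w \<and> D_indec Q X \<and> D_indec Q Z \<and>
     w \<noteq> D_zero Q Z (shift 1 X) \<and>
     (\<forall>W. \<forall>f\<in>D_hom Q W Z. is_complex Q W \<and> \<not> (\<exists>g\<in>D_hom Q Z W. D_comp Q Z W Z f g = D_id Q Z) \<longrightarrow>
        (\<exists>h\<in>D_hom Q W Y. D_comp Q W Y Z v h = f)) \<and>
     (\<forall>W. \<forall>f\<in>D_hom Q X W. is_complex Q W \<and> \<not> (\<exists>g\<in>D_hom Q W X. D_comp Q X W X g f = D_id Q X) \<longrightarrow>
        (\<exists>h\<in>D_hom Q Y W. D_comp Q X Y W h u = f))"

text \<open>
  The Auslander--Reiten translation \<open>\<tau>\<close> and its inverse, given on indecomposable objects, where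
  they are determined up to isomorphism by the Auslander--Reiten triangles \<open>\<tau>X \<rightarrow> E \<rightarrow> X \<rightarrow> \<tau>X[1]\<close>
  and \<open>X \<rightarrow> E \<rightarrow> \<tau>\<^sup>-\<^sup>1X \<rightarrow> X[1]\<close>. Functoriality of \<open>\<tau>\<close> is not needed to form the morphism spaces of
  the cluster category, only to compose morphisms there.
\<close>

definition AR_translation ::
  "('v, 'e) pre_digraph \<Rightarrow> (('v, 'e, 'k::field) cplx \<Rightarrow> ('v, 'e, 'k) cplx) \<Rightarrow>
    (('v, 'e, 'k) cplx \<Rightarrow> ('v, 'e, 'k) cplx) \<Rightarrow> bool" where
  "AR_translation Q \<tau> \<tau>inv \<longleftrightarrow> (\<forall>X. D_indec Q X \<longrightarrow>
     (\<exists>E u v w. AR_triangle Q (\<tau> X) E X u v w) \<and> (\<exists>E u v w. AR_triangle Q X E (\<tau>inv X) u v w))"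


section \<open>The cluster category\<close>

text \<open>\<open>F\<^sup>i\<close> for \<open>i \<in> \<int>\<close>, where \<open>F = \<tau>\<^sup>-\<^sup>1[1]\<close>.\<close>

definition F_pow ::
  "(('v, 'e, 'k::field) cplx \<Rightarrow> ('v, 'e, 'k) cplx) \<Rightarrow> (('v, 'e, 'k) cplx \<Rightarrow> ('v, 'e, 'k) cplx) \<Rightarrow>
    int \<Rightarrow> ('v, 'e, 'k) cplx \<Rightarrow> ('v, 'e, 'k) cplx" where
  "F_pow \<tau> \<tau>inv i = (if i \<ge> 0 then (\<lambda>X. shift 1 (\<tau>inv X)) ^^ nat i
                             else (\<lambda>X. \<tau> (shift (- 1) X)) ^^ nat (- i))"

text \<open>
  An object of the cluster category, that is, an orbit of \<open>F\<close>, is given by a representative in the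
  derived category.
\<close>

definition cluster_hom ::
  "('v, 'e) pre_digraph \<Rightarrow> (('v, 'e, 'k::field) cplx \<Rightarrow> ('v, 'e, 'k) cplx) \<Rightarrow>
    (('v, 'e, 'k) cplx \<Rightarrow> ('v, 'e, 'k) cplx) \<Rightarrow> ('v, 'e, 'k) cplx \<Rightarrow> ('v, 'e, 'k) cplx \<Rightarrow>
    ('k, int \<Rightarrow> ('v, 'e, 'k) roof set) module" where
  "cluster_hom Q \<tau> \<tau>inv X Y = coprod_mod (\<lambda>i. D_hom_mod Q (F_pow \<tau> \<tau>inv i X) Y)"

definition cluster_Ext1 ::
  "('v, 'e) pre_digraph \<Rightarrow> (('v, 'e, 'k::field) cplx \<Rightarrow> ('v, 'e, 'k) cplx) \<Rightarrow>
    (('v, 'e, 'k) cplx \<Rightarrow> ('v, 'e, 'k) cplx) \<Rightarrow> ('v, 'e, 'k) cplx \<Rightarrow> ('v, 'e, 'k) cplx \<Rightarrow>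
    ('k, int \<Rightarrow> ('v, 'e, 'k) roof set) module" where
  "cluster_Ext1 Q \<tau> \<tau>inv U V = cluster_hom Q \<tau> \<tau>inv U (shift 1 V)"

definition M_Q :: "('v, 'e) pre_digraph \<Rightarrow> ('v \<Rightarrow> int) \<Rightarrow> ('v, 'e, 'k::field) cplx" where
  "M_Q Q \<alpha> = (if \<alpha> \<in> positive_roots Q then stalk (indec_rep Q \<alpha>)
     else shift 1 (stalk (proj_at Q (THE i. i \<in> verts Q \<and> \<alpha> = - simple_root i))))"


section \<open>Decorated representations and the compatibility degree\<close>

text \<open>
  The quiver \<open>Q\<close> together with a disjoint copy \<open>Inr i\<close> of every vertex \<open>Inl i\<close>, without arrows at
  the new vertices.
\<close>

definition decorated_quiver :: "('v, 'e) pre_digraph \<Rightarrow> ('v + 'v, 'e) pre_digraph" where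
  "decorated_quiver Q = \<lparr>verts = Inl ` verts Q \<union> Inr ` verts Q, arcs = arcs Q,
     tail = Inl \<circ> tail Q, head = Inl \<circ> head Q\<rparr>"

definition plus_part :: "('v + 'v, 'e, 'k) qrep \<Rightarrow> ('v, 'e, 'k) qrep" where
  "plus_part M = \<lparr>sp = sp M \<circ> Inl, act = act M\<rparr>"

definition minus_part :: "('v + 'v, 'e, 'k) qrep \<Rightarrow> 'v \<Rightarrow> (nat \<Rightarrow> 'k) set" where
  "minus_part M = sp M \<circ> Inr"

definition sdim :: "('v, 'e) pre_digraph \<Rightarrow> ('v + 'v, 'e, 'k::field) qrep \<Rightarrow> 'v \<Rightarrow> int" where
  "sdim Q M = (\<lambda>i. if i \<in> verts Q
     then int (kvec.dim (sp (plus_part M) i)) - int (kvec.dim (minus_part M i)) else 0)"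

definition decorated_indec ::
  "('v, 'e) pre_digraph \<Rightarrow> ('v \<Rightarrow> int) \<Rightarrow> ('v + 'v, 'e, 'k::field) qrep" where
  "decorated_indec Q \<alpha> = (SOME M. rep_indec (decorated_quiver Q) M \<and> sdim Q M = \<alpha>)"

definition E_mod ::
  "('v, 'e) pre_digraph \<Rightarrow> ('v + 'v, 'e, 'k::field) qrep \<Rightarrow> ('v + 'v, 'e, 'k) qrep \<Rightarrow>
    ('k, ('v, 'k) gmap set \<times> ('v, 'k) gmap set \<times> ('v, 'k) gmap \<times> ('v, 'k) gmap) module" where
  "E_mod Q M N =
     direct_sum (rep_Ext1 Q (plus_part M) (plus_part N))
    (direct_sum (rep_Ext1 Q (plus_part N) (plus_part M))
    (direct_sum (hom_mod (graded_hom Q (sp (plus_part M)) (minus_part N)))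
                (hom_mod (graded_hom Q (minus_part M) (sp (plus_part N))))))"

definition compat_degree ::
  "'k::field itself \<Rightarrow> ('v, 'e) pre_digraph \<Rightarrow> ('v \<Rightarrow> int) \<Rightarrow> ('v \<Rightarrow> int) \<Rightarrow> nat" where
  "compat_degree _ Q \<alpha> \<beta> =
     kdim (E_mod Q (decorated_indec Q \<alpha> :: ('v + 'v, 'e, 'k) qrep) (decorated_indec Q \<beta>))"

end

(*
  A morphism X -> Y in the derived category is a homotopy class of chain maps from a projective
  resolution of X to Y. Composition with the last morphism of an Auslander--Reiten triangle
  tau X -> E -> X -> tau X [1], followed by a suitable linear functional, is a perfect pairing, so
  dim Hom(X, Y) = dim Hom(Y, tau X [1]). Since the form of a Dynkin quiver is positive,
  indecomposable representations are bricks without self-extensions and are determined by their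
  dimension vectors, which are the positive roots. Testing the duality on the projectives P_v
  locates the cohomology of F^i X and leaves only i = 0 and i = 1 in the coproduct; the two
  summands have the dimensions of Hom(X, Y[1]) and, by duality, Hom(Y, X[1]), which are the
  dimensions of the terms of the compatibility degree.
*)
theory Submission
  imports Defs
begin

section \<open>Linear algebra\<close>

text \<open>\<open>AR_translation\<close> fixes the translates of objects only through the existence
  of Auslander--Reiten triangles; there is no functor and no formula. So nothing is computed inside
  the category: all information on the powers of F is drawn from equalities of dimensions, and the
  pairing behind the duality rests on factorisations through the triangle. Vanishing of cohomology
  is the invariant suited to this. \<open>exact Z n\<close> can be tested by the dimensions of
  \<open>Hom(P_v[-n], Z)\<close>, and it is what the vanishing criterion needs: heredity kills
  \<open>Hom(X, W)\<close> as soon as the cohomology of \<open>X\<close> begins two degrees above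
  the end of that of \<open>W\<close>. The representations on the two sides of the theorem are
  chosen by \<open>SOME\<close>, independently of each other; therefore existence and uniqueness of
  indecomposables are proved and not only a count of dimensions. Dimensions are handled as a
  relation, an explicit linear bijection with \<open>k^n\<close>, because the records of morphism
  spaces are not known in advance to be vector spaces.\<close>

lemma fun_cong2: "f = g ==> f x y = g x y"
 by simp

text \<open>Carriers are subsets of function types, and source and target may have different
  scalings, so linearity is relative to a set and to both scalings.\<close>

definition lin_on :: "('k => 'a => 'a) => ('k => 'b => 'b) => 'a::plus set => ('a => 'b::plus) => bool" where
 "lin_on s1 s2 U f \<longleftrightarrow> (ALL x:U. ALL y:U. f (x + y) = f x + f y) & (ALL c. ALL x:U. f (s1 c x) = s2 c (f x))"

lemma lin_onI:
 assumes "!!x y. x : U ==> y : U ==> f (x + y) = f x + f y"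
  and "!!c x. x : U ==> f (s1 c x) = s2 c (f x)"
 shows "lin_on s1 s2 U f"
 using assms by (simp add: lin_on_def)

lemma lin_on_add: "lin_on s1 s2 U f ==> x : U ==> y : U ==> f (x + y) = f x + f y"
 and lin_on_scale: "lin_on s1 s2 U f ==> x : U ==> f (s1 c x) = s2 c (f x)"
 by (simp_all add: lin_on_def)

lemma lin_on_subset: "lin_on s1 s2 U f ==> S <= U ==> lin_on s1 s2 S f"
 unfolding lin_on_def by blast

section \<open>Finite-dimensional subspaces of an abstract vector space\<close>

context vector_space
begin

text \<open>Stated for an arbitrary \<open>vector_space\<close> because it is used with
  \<open>kscale\<close> for vectors, \<open>gscale\<close> for graded maps and \<open>cscale\<close>
  for families indexed by degrees.\<close>

definition fd :: "'b set => bool" where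
 "fd U \<longleftrightarrow> (EX B. finite B & U = span B)"

end

context vector_space
begin

lemma fd_subspace: "fd U ==> subspace U"
 by (auto simp: fd_def)

lemma subspace_basis:
 assumes "subspace U" "~ dependent B" "B <= U"
 obtains C where "B <= C" "~ dependent C" "span C = U"
proof -
 obtain C where "B <= C" "C <= U" "~ dependent C" "U <= span C"
  using maximal_independent_subset_extend[OF assms(3,2)] by blast
 thus ?thesis using that assms(1) span_minimal by (metis subset_antisym)
qed

lemma fd_basis_finite:
 assumes "fd U" "~ dependent C" "C <= U"
 shows "finite C"
 using assms independent_span_bound unfolding fd_def by blast

lemma fd_basis_extend:
 assumes "fd U" "~ dependent B" "B <= U"
 obtains C where "B <= C" "~ dependent C" "span C = U" "finite C" "card C = dim U"
proof -
 obtain C where C: "B <= C" "~ dependent C" "span C = U"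
  using subspace_basis[OF fd_subspace[OF assms(1)] assms(2,3)] by blast
 hence "finite C" using fd_basis_finite[OF assms(1)] span_superset by blast
 thus ?thesis using that C dim_eq_card by (metis span_span)
qed

lemma fd_basis:
 assumes "fd U"
 obtains C where "~ dependent C" "span C = U" "finite C" "card C = dim U"
 using fd_basis_extend[OF assms independent_empty] by blast

lemma fd_sub:
 assumes "fd U" "subspace S" "S <= U"
 shows "fd S" "dim S <= dim U" "dim S = dim U ==> S = U"
proof -
 obtain B where B: "~ dependent B" "span B = S"
  using subspace_basis[OF assms(2) independent_empty] by blast
 have BU: "B <= U" using B(2) assms(3) span_superset by blast
 have fB: "finite B" using fd_basis_finite[OF assms(1) B(1) BU] .
 thus "fd S" using B by (auto simp: fd_def)
 obtain C where C: "B <= C" "~ dependent C" "span C = U" "finite C" "card C = dim U"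
  using fd_basis_extend[OF assms(1) B(1) BU] by blast
 have dS: "dim S = card B" using dim_eq_card B by (metis span_span)
 show "dim S <= dim U" using dS C card_mono by metis
 show "dim S = dim U ==> S = U" using dS C B card_subset_eq by metis
qed

lemma fd_singleton_0 [simp]: "fd {0}" "dim {0} = 0"
proof -
 show "fd {0}" unfolding fd_def by (intro exI[of _ "{}"]) simp
 show "dim {0} = 0" using dim_eq_card[of "{}" "{0}"] by (simp add: independent_empty)
qed

lemma fd_dim_0: "fd U ==> dim U = 0 \<longleftrightarrow> U = {0}"
 using fd_singleton_0(2) fd_basis[of U] by (metis card_0_eq span_empty)

lemma fd_dim_1:
 assumes "fd U" "dim U = 1" "x : U" "x ~= 0" "y : U"
 obtains c where "y = scale c x"
proof -
 have "~ dependent {x}" using assms by (simp add: dependent_single)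
 then obtain C where C: "{x} <= C" "span C = U" "finite C" "card C = dim U"
  using fd_basis_extend[OF assms(1), of "{x}"] assms by blast
 hence "C = {x}" using assms(2) by (metis card_1_singletonE insert_subset singletonD)
 hence "y : span {x}" using C assms by simp
 thus ?thesis using that by (auto simp: span_singleton)
qed

text \<open>A basis \<open>B\<close> of \<open>W\<close> is extended to a basis \<open>C\<close> of
  \<open>U\<close>. The enumeration \<open>h\<close> of \<open>C - B\<close> turns the classes of
  these vectors into coordinates on the quotient of \<open>U\<close> by \<open>W\<close>.\<close>

lemma fd_complement:
 assumes "fd U" "subspace W" "W <= U"
 obtains B C and h :: "nat => 'b" where "B <= C" "~ dependent C" "span B = W" "span C = U" "finite C"
  "dim W <= dim U" "bij_betw h {..<dim U - dim W} (C - B)"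
proof -
 obtain B where B: "~ dependent B" "span B = W" "finite B" "card B = dim W"
  using fd_basis[OF fd_sub(1)[OF assms]] by blast
 have "B <= U" using B assms(3) span_superset by blast
 then obtain C where C: "B <= C" "~ dependent C" "span C = U" "finite C" "card C = dim U"
  using fd_basis_extend[OF assms(1) B(1)] by blast
 hence "card (C - B) = dim U - dim W" using B card_Diff_subset by metis
 then obtain h where "bij_betw h {..<dim U - dim W} (C - B)"
  using C(4) finite_same_card_bij[of "{..<dim U - dim W}" "C - B"] by auto
 thus ?thesis using that B C fd_sub(2)[OF assms] by blast
qed

lemma fd_span1: "x ~= 0 ==> fd (span {x})" "x ~= 0 ==> dim (span {x}) = 1"
 by (auto simp: fd_def dim_eq_card_independent)

end

lemma vs_pair: "vector_space s1 ==> vector_space s2 ==> vector_space_pair s1 s2"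
 by (simp add: vector_space_pair_def)

text \<open>Values on a basis of \<open>U\<close> determine a globally linear map; this gives access
  to the facts about linear maps on whole types.\<close>

lemma lin_on_extend:
 assumes "vector_space s1" "vector_space s2" "module.subspace s1 U" "lin_on s1 s2 U f"
 obtains g where "Vector_Spaces.linear s1 s2 g" "ALL x:U. g x = f x"
proof -
 interpret vector_space_pair s1 s2 by (rule vs_pair[OF assms(1,2)])
 obtain B where B: "vs1.independent B" "vs1.span B = U"
  using vs1.subspace_basis[OF assms(3) vs1.independent_empty] by blast
 obtain g where g: "Vector_Spaces.linear s1 s2 g" "ALL x:B. g x = f x"
  using linear_independent_extend[OF B(1)] by blast
 have f0: "f 0 = 0"
  using lin_on_scale[OF assms(4), of 0 0] vs1.subspace_0[OF assms(3)] by simp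
 \<comment> \<open>Membership in \<open>U\<close> is proved along with the equation because
   \<open>f\<close> is known to be additive only there.\<close>
 have "x : U & g x = f x" if "x : vs1.span B" for x
  using that
 proof (induction rule: vs1.span_induct_alt)
  case base
  thus ?case using f0 vs1.subspace_0[OF assms(3)] linear_0[OF g(1)] by simp
 next
  case (step c x y)
  have "x : U" using step(1) B(2) vs1.span_base by blast
  thus ?case using step g lin_on_add[OF assms(4)] lin_on_scale[OF assms(4)]
   linear_add[OF g(1)] linear_scale[OF g(1)] vs1.subspace_add[OF assms(3)] vs1.subspace_scale[OF assms(3)]
   by simp
 qed
 thus ?thesis using that g(1) B(2) by blast
qed

lemma lin_on_0:
 assumes "vector_space s1" "vector_space s2" "module.subspace s1 U" "lin_on s1 s2 U f"
 shows "f 0 = 0"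
proof -
 interpret vector_space_pair s1 s2 by (rule vs_pair[OF assms(1,2)])
 show ?thesis using lin_on_scale[OF assms(4), of 0 0] vs1.subspace_0[OF assms(3)] by simp
qed

lemma lin_on_kernel_subspace:
 assumes "vector_space s1" "vector_space s2" "module.subspace s1 U" "lin_on s1 s2 U f" "module.subspace s2 W"
 shows "module.subspace s1 {x : U. f x : W}"
proof -
 interpret vector_space_pair s1 s2 by (rule vs_pair[OF assms(1,2)])
 show ?thesis
  using assms lin_on_0[OF assms(1-4)]
  by (auto simp: vs1.subspace_def vs2.subspace_def lin_on_add[OF assms(4)] lin_on_scale[OF assms(4)])
qed

text \<open>\<open>f\<close> is replaced by a global linear \<open>g\<close>. A basis
  \<open>B\<close> of the kernel is extended to a basis \<open>C\<close> of \<open>U\<close>, and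
  \<open>C - B\<close> is carried bijectively to a basis of the image. Finite dimension of the image
  is a conclusion, since the target may be infinite-dimensional.\<close>

lemma rank_nullity:
 assumes "vector_space s1" "vector_space s2" "vector_space.fd s1 U" "lin_on s1 s2 U f"
 shows "vector_space.fd s2 (f ` U)"
  and "vector_space.dim s1 U = vector_space.dim s1 {x\<in>U. f x = 0} + vector_space.dim s2 (f ` U)"
proof -
 interpret vector_space_pair s1 s2 by (rule vs_pair[OF assms(1,2)])
 have sU: "vs1.subspace U" using assms(3) vs1.fd_subspace by blast
 obtain g where g: "Vector_Spaces.linear s1 s2 g" "ALL x:U. g x = f x"
  using lin_on_extend[OF assms(1,2) sU assms(4)] by blast
 define K where "K = {x\<in>U. g x = 0}"
 have K: "K = {x\<in>U. f x = 0}" using g by (auto simp: K_def)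
 have sK: "vs1.subspace K"
  using lin_on_kernel_subspace[OF assms(1,2) sU assms(4) vs2.subspace_single_0] K by simp
 have KU: "K <= U" by (auto simp: K_def)
 obtain B C and h :: "nat => _" where C: "B <= C" "vs1.independent C" "vs1.span B = K" "vs1.span C = U" "finite C"
  "vs1.dim K <= vs1.dim U" "bij_betw h {..<vs1.dim U - vs1.dim K} (C - B)"
  using vs1.fd_complement[OF assms(3) sK KU] by blast
 have DU: "vs1.span (C - B) <= U" using C vs1.span_mono by blast
 \<comment> \<open>A vector of the kernel in the span of \<open>C - B\<close> also lies in the span
   of \<open>B\<close>; its coordinates with respect to \<open>C\<close> are then supported on
   disjoint sets and vanish.\<close>
 have inj: "inj_on g (vs1.span (C - B))"
 proof (subst linear_inj_on_iff_eq_0[OF g(1) vs1.subspace_span], intro ballI impI)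
  fix x assume x: "x : vs1.span (C - B)" "g x = 0"
  hence xB: "x : vs1.span B" using DU C(3) K_def by auto
  have "vs1.representation B x = vs1.representation (C - B) x"
   using vs1.representation_extend[OF C(2)] x(1) xB C(1) by (metis Diff_subset)
  hence "vs1.representation B x v = 0" for v
   using vs1.representation_ne_zero[of B x v] vs1.representation_ne_zero[of "C - B" x v] by auto
  thus "x = 0"
   using vs1.sum_nonzero_representation_eq[OF vs1.independent_mono[OF C(2,1)] xB] by simp
 qed
 have ind: "vs2.independent (g ` (C - B))"
  using linear_independent_injective_image[OF g(1) _ inj] C(2) vs1.independent_mono by blast
 have crd: "card (g ` (C - B)) = card (C - B)"
  by (rule card_image[OF inj_on_subset[OF inj vs1.span_superset]])
 have gU: "g ` U = f ` U" using g by auto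
 have "g ` U <= vs2.span (g ` (C - B))"
 proof
  fix y assume "y : g ` U"
  hence "y : vs2.span (g ` C)" using linear_span_image[OF g(1), of C] C(4) by simp
  moreover have "g ` C <= vs2.span (g ` (C - B))"
  proof
   fix z assume "z : g ` C"
   then obtain c where c: "c : C" "z = g c" by blast
   show "z : vs2.span (g ` (C - B))"
   proof (cases "c : B")
    case True
    hence "g c = 0" using C(3) vs1.span_base K_def by blast
    thus ?thesis using c vs2.span_zero by simp
   qed (auto simp: c intro!: vs2.span_base)
  qed
  ultimately show "y : vs2.span (g ` (C - B))"
   using vs2.span_minimal[OF _ vs2.subspace_span] by blast
 qed
 moreover have "vs2.span (g ` (C - B)) <= g ` U"
  using linear_span_image[OF g(1), of "C - B"] DU by auto
 ultimately have sp: "vs2.span (g ` (C - B)) = f ` U" using gU by auto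
 show "vs2.fd (f ` U)" unfolding vs2.fd_def using sp C(5) by (metis finite_Diff finite_imageI)
 have "vs2.dim (f ` U) = card (C - B)"
  using vs2.dim_span_eq_card_independent[OF ind] sp crd by simp
 thus "vs1.dim U = vs1.dim {x\<in>U. f x = 0} + vs2.dim (f ` U)"
  using C(6) K bij_betw_same_card[OF C(7)] by simp
qed

lemma dim_inj:
 assumes "vector_space s1" "vector_space s2" "vector_space.fd s1 U" "lin_on s1 s2 U f"
  and "!!x. x : U ==> f x = 0 ==> x = 0"
 shows "vector_space.dim s2 (f ` U) = vector_space.dim s1 U"
proof -
 interpret vector_space_pair s1 s2 by (rule vs_pair[OF assms(1,2)])
 have "f 0 = 0" using lin_on_0[OF assms(1,2) vs1.fd_subspace[OF assms(3)] assms(4)] .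
 moreover have "0 : U" using vs1.fd_subspace[OF assms(3)] vs1.subspace_0 by blast
 ultimately have "{x\<in>U. f x = 0} = {0}" using assms(5) by auto
 thus ?thesis using rank_nullity(2)[OF assms(1-4)] by simp
qed

text \<open>Generators of the kernel and preimages of generators of the image together span
  \<open>U\<close>.\<close>

lemma fd_of_kernel_image:
 assumes "vector_space s1" "vector_space s2" "module.subspace s1 U" "lin_on s1 s2 U f"
  and "vector_space.fd s1 {x\<in>U. f x = 0}" "vector_space.fd s2 (f ` U)"
 shows "vector_space.fd s1 U"
proof -
 interpret vector_space_pair s1 s2 by (rule vs_pair[OF assms(1,2)])
 obtain g where g: "Vector_Spaces.linear s1 s2 g" "ALL x:U. g x = f x"
  using lin_on_extend[OF assms(1-4)] by blast
 obtain K where K: "finite K" "{x\<in>U. f x = 0} = vs1.span K" using assms(5) unfolding vs1.fd_def by blast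
 obtain L where L: "finite L" "f ` U = vs2.span L" using assms(6) unfolding vs2.fd_def by blast
 obtain L' where L': "L' <= U" "finite L'" "L = f ` L'"
  using finite_subset_image[OF L(1), of f U, unfolded L(2), OF vs2.span_superset] by blast
 have KU: "K <= U" using K(2) vs1.span_superset by blast
 have "x : vs1.span (K Un L')" if x: "x : U" for x
 proof -
  have "f x : g ` vs1.span L'"
   using x L L' g(2) linear_span_image[OF g(1), of L'] by (metis (no_types, lifting) image_cong imageI subset_iff)
  then obtain z where z: "z : vs1.span L'" "f x = g z" by blast
  have "z : U" using z(1) vs1.span_minimal[OF L'(1) assms(3)] by blast
  hence d: "x - z : U" using x vs1.subspace_diff[OF assms(3)] by blast
  hence "x - z : vs1.span K" unfolding K(2)[symmetric]
   using bspec[OF g(2) d] bspec[OF g(2) x] z(2) linear_diff[OF g(1), of x z] by simp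
  hence "(x - z) + z : vs1.span (K Un L')"
   using z(1) vs1.span_mono[of K "K Un L'"] vs1.span_mono[of L' "K Un L'"] by (blast intro: vs1.span_add)
  thus ?thesis by simp
 qed
 hence "U = vs1.span (K Un L')" using vs1.span_minimal[of "K Un L'" U] KU L'(1) assms(3) by blast
 thus ?thesis using K(1) L'(2) unfolding vs1.fd_def by blast
qed


subsection \<open>Coordinate spaces and dimensions of quotients\<close>

text \<open>The model of \<open>k^n\<close> inside the ambient space; coordinate maps take their
  values here.\<close>

definition cspace :: "nat => (nat => 'k::field) set" where
 "cspace n = {x. ALL i>=n. x i = 0}"

lemma kvec_vs: "vector_space (kscale :: 'k::field => (nat => 'k) => nat => 'k)"
 by (rule kvec.vector_space_axioms)

lemma fd_cspace: "kvec.span ((%i j. if j = i then 1 else 0) ` {..<n}) = (cspace n :: (nat => 'k::field) set)"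
 "kvec.fd (cspace n :: (nat => 'k::field) set)" "kvec.dim (cspace n :: (nat => 'k) set) = n"
proof -
 define u :: "nat => nat => 'k" where "u i = (%j. if j = i then 1 else 0)" for i
 define B where "B = u ` {..<n}"
 have inj: "inj_on u {..<n}" by (auto simp: inj_on_def u_def fun_eq_iff)
 have s: "(\<Sum>i<n. kscale (y i) (u i)) j = (if j < n then y j else 0)" for y j
 proof -
  have "(\<Sum>i<n. kscale (y i) (u i)) j = (\<Sum>i<n. kscale (y i) (u i) j)"
   by (induction n) auto
  also have "\<dots> = (\<Sum>i<n. if j = i then y j else 0)"
   by (intro sum.cong) (auto simp: kscale_def u_def)
  finally show ?thesis by simp
 qed
 have sp: "kvec.span B = cspace n"
 proof
  have "B <= cspace n" by (auto simp: B_def u_def cspace_def)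
  moreover have "kvec.subspace (cspace n)" by (auto simp: kvec.subspace_def cspace_def kscale_def)
  ultimately show "kvec.span B <= cspace n" using kvec.span_minimal by blast
  show "cspace n <= kvec.span B"
  proof
   fix y :: "nat => 'k" assume "y : cspace n"
   hence "y = (\<Sum>i<n. kscale (y i) (u i))" using s[of y] by (auto simp: cspace_def fun_eq_iff)
   also have "\<dots> : kvec.span B" by (intro kvec.span_sum kvec.span_scale kvec.span_base) (auto simp: B_def)
   finally show "y : kvec.span B" .
  qed
 qed
 moreover have "finite B" by (simp add: B_def)
 moreover have ind: "kvec.independent B"
 proof (rule kvec.independent_if_scalars_zero)
  fix f x assume f: "(SUM x:B. kscale (f x) x) = 0" and "x : B"
  then obtain i where i: "i < n" "x = u i" by (auto simp: B_def)
  have "(\<Sum>i<n. kscale (f (u i)) (u i)) = 0" using f by (simp add: B_def sum.reindex[OF inj] o_def)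
  thus "f x = 0" using s[of "%i. f (u i)" i] i by simp
 qed (simp add: B_def)
 moreover have "card B = n" using card_image[OF inj] by (simp add: B_def)
 ultimately show "kvec.fd (cspace n :: (nat => 'k) set)" "kvec.dim (cspace n :: (nat => 'k) set) = n"
  using kvec.dim_span_eq_card_independent[OF ind] by (auto simp: kvec.fd_def)
 show "kvec.span ((%i j. if j = i then 1 else 0) ` {..<n}) = (cspace n :: (nat => 'k) set)"
  using sp unfolding B_def u_def .
qed

text \<open>Quotient spaces are not formed. A linear map onto a coordinate space with kernel exactly
  \<open>W\<close> plays the role of the projection from \<open>U\<close> to the quotient by
  \<open>W\<close>.\<close>

lemma quot_coord:
 fixes s :: "'k::field => 'a::ab_group_add => 'a"
 assumes "vector_space s" "vector_space.fd s U" "module.subspace s W" "W <= U"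
 obtains T :: "'a => nat => 'k"
 where "lin_on s kscale U T" "T ` U = cspace (vector_space.dim s U - vector_space.dim s W)"
  "!!x. x : U ==> T x = 0 \<longleftrightarrow> x : W"
proof -
 interpret p: vector_space_pair s "kscale :: 'k => _" by (rule vs_pair[OF assms(1) kvec_vs])
 let ?n = "p.vs1.dim U - p.vs1.dim W"
 obtain B C and h :: "nat => 'a" where C: "B <= C" "p.vs1.independent C" "p.vs1.span B = W" "p.vs1.span C = U"
  "finite C" "p.vs1.dim W <= p.vs1.dim U" "bij_betw h {..<?n} (C - B)"
  by (rule p.vs1.fd_complement[OF assms(2-4)])
 define n where "n = ?n"
 note h = C(7)[folded n_def]
 define u :: "nat => nat => 'k" where "u i = (%j. if j = i then 1 else 0)" for i
 obtain T where T: "Vector_Spaces.linear s kscale T"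
  "ALL c:C. T c = (if c : B then 0 else u (the_inv_into {..<n} h c))"
  using p.linear_independent_extend[OF C(2), of "%c. if c : B then 0 else u (the_inv_into {..<n} h c)"] by blast
 have lin: "lin_on s kscale U T" by (simp add: lin_on_def p.linear_add[OF T(1)] p.linear_scale[OF T(1)])
 have Th: "T (h i) = u i & h i : C" if "i < n" for i
  using bspec[OF T(2), of "h i"] bij_betwE[OF h] that the_inv_into_f_f[of h "{..<n}" i] h by (simp add: bij_betw_def)
 have "T x : cspace n" if x: "x : C" for x
 proof (cases "x : B")
  case False
  then obtain i where "i < n" "x = h i" using h x by (auto simp: bij_betw_def)
  thus ?thesis using Th by (auto simp: u_def cspace_def)
 qed (use T(2) x in \<open>simp add: cspace_def\<close>)
 hence "kvec.span (T ` C) <= cspace n"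
  by (intro kvec.span_minimal) (auto simp: kvec.fd_subspace[OF fd_cspace(2)])
 moreover have "cspace n <= kvec.span (T ` C)"
  unfolding fd_cspace(1)[symmetric] u_def[symmetric]
  by (intro kvec.span_mono) (use Th in \<open>force simp: image_iff\<close>)
 ultimately have im: "T ` U = cspace n" using p.linear_span_image[OF T(1), of C] C(4) by simp
 have sK: "p.vs1.subspace {x : U. T x = 0}"
  using lin_on_kernel_subspace[OF assms(1) kvec_vs p.vs1.fd_subspace[OF assms(2)] lin kvec.subspace_single_0] by simp
 have "T x = 0" if "x : B" for x using T(2) C(1) that by auto
 hence "T x = 0" if "x : W" for x using p.linear_eq_0_on_span[OF T(1), of B x] C(3) that by blast
 hence WK: "W <= {x : U. T x = 0}" using assms(4) by blast
 have "p.vs1.dim W = p.vs1.dim {x : U. T x = 0}"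
  using rank_nullity(2)[OF assms(1) kvec_vs assms(2) lin] fd_cspace(3)[of n, where ?'k = 'k] C(6) by (simp add: im n_def)
 hence "W = {x : U. T x = 0}"
  using p.vs1.fd_sub(3)[OF p.vs1.fd_sub(1)[OF assms(2) sK] assms(3) WK] by blast
 thus ?thesis using that[OF lin] im n_def by blast
qed

text \<open>\<open>ker\<close> and \<open>surj\<close> say that \<open>f\<close> induces an
  isomorphism between the quotients, whose dimensions are the two differences.\<close>

lemma dim_quot_eq:
 fixes s1 :: "'k::field => 'a::ab_group_add => 'a" and s2 :: "'k => 'b::ab_group_add => 'b"
 assumes "vector_space s1" "vector_space s2"
  and "vector_space.fd s1 U" "module.subspace s1 W" "W <= U"
  and "vector_space.fd s2 U'" "module.subspace s2 W'" "W' <= U'"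
  and "lin_on s1 s2 U f" "f ` U <= U'"
  and ker: "!!x. x : U ==> f x : W' \<longleftrightarrow> x : W"
  and surj: "!!y. y : U' ==> EX x:U. y - f x : W'"
 shows "vector_space.dim s1 U - vector_space.dim s1 W = vector_space.dim s2 U' - vector_space.dim s2 W'"
proof -
 interpret vector_space_pair s1 s2 by (rule vs_pair[OF assms(1,2)])
 let ?n = "vs2.dim U' - vs2.dim W'"
 obtain T :: "'b => nat => 'k" where T: "lin_on s2 kscale U' T" "T ` U' = cspace ?n"
   "!!x. x : U' ==> T x = 0 \<longleftrightarrow> x : W'"
  by (rule quot_coord[OF assms(2,6-8)]) blast
 have fU: "f x : U'" if "x : U" for x using that assms(10) by blast
 have lin: "lin_on s1 kscale U (T o f)"
  using assms(9) T(1) fU by (simp add: lin_on_def)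
 have "T ` f ` U = T ` U'"
 proof
  show "T ` f ` U <= T ` U'" using assms(10) by blast
  show "T ` U' <= T ` f ` U"
  proof
   fix z assume "z : T ` U'"
   then obtain y where y: "y : U'" "z = T y" by blast
   obtain x where x: "x : U" "y - f x : W'" using surj[OF y(1)] by blast
   have "T y = T ((y - f x) + f x)" by simp
   also have "\<dots> = T (y - f x) + T (f x)"
    using T(1) x assms(8,10) by (intro lin_on_add[OF T(1)]) auto
   also have "T (y - f x) = 0" using T(3)[of "y - f x"] x(2) assms(8) by blast
   finally show "z : T ` f ` U" using x y by simp
  qed
 qed
 hence im: "(T o f) ` U = cspace ?n" using T(2) by (metis image_comp)
 have "{x : U. (T o f) x = 0} = W" using T(3)[OF fU] ker assms(5) by auto
 hence "vs1.dim U = vs1.dim W + ?n"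
  using rank_nullity(2)[OF assms(1) kvec_vs assms(3) lin] im fd_cspace(3)[of ?n, where ?'k='k] by simp
 thus ?thesis by simp
qed

text \<open>Nondegeneracy in the first argument embeds the quotient of \<open>U\<close> by
  \<open>W\<close> into the dual of the quotient of \<open>U'\<close> by \<open>W'\<close>. The
  embedding \<open>T\<close> evaluates against representatives \<open>h i\<close> of a basis of the
  latter.\<close>

lemma dim_pairing_le:
 fixes \<beta> :: "'a::ab_group_add => 'b::ab_group_add => 'k::field"
 assumes "vector_space s1" "vector_space s2"
  and "vector_space.fd s1 U" "module.subspace s1 W" "W <= U"
  and "vector_space.fd s2 U'" "module.subspace s2 W'" "W' <= U'"
  and lin1: "!!y. y : U' ==> lin_on s1 (*) U (%x. \<beta> x y)"
  and lin2: "!!x. x : U ==> lin_on s2 (*) U' (\<beta> x)"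
  and W: "!!x y. x : W ==> y : U' ==> \<beta> x y = 0"
  and W': "!!x y. x : U ==> y : W' ==> \<beta> x y = 0"
  and nondeg: "!!x. x : U ==> x ~: W ==> EX y:U'. \<beta> x y ~= 0"
 shows "vector_space.dim s1 U - vector_space.dim s1 W <= vector_space.dim s2 U' - vector_space.dim s2 W'"
proof -
 interpret vector_space_pair s1 s2 by (rule vs_pair[OF assms(1,2)])
 interpret k: vector_space "(*) :: 'k => 'k => 'k" by unfold_locales (auto simp: algebra_simps)
 let ?n = "vs2.dim U' - vs2.dim W'"
 obtain B C and h :: "nat => 'b" where C: "B <= C" "vs2.independent C" "vs2.span B = W'" "vs2.span C = U'"
  "finite C" "vs2.dim W' <= vs2.dim U'" "bij_betw h {..<?n} (C - B)"
  by (rule vs2.fd_complement[OF assms(6-8)])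
 define n where "n = ?n"
 note h = C(7)[folded n_def]
 have CU: "C <= U'" using C(4) vs2.span_superset by blast
 have hU: "h i : U'" if "i < n" for i using h that CU unfolding bij_betw_def by blast
 define T where "T x = (%i. if i < n then \<beta> x (h i) else 0)" for x
 have lin: "lin_on s1 kscale U T"
  using lin1[OF hU] by (auto simp: lin_on_def T_def fun_eq_iff kscale_def)
 have "{x : U. T x = 0} = W"
 proof (intro equalityI subsetI; (elim CollectE conjE)?)
  fix x assume x: "x : U" "T x = 0"
  have "\<beta> x c = 0" if c: "c : C" for c
  proof (cases "c : B")
   case True
   thus ?thesis using W'[OF x(1)] C(3) vs2.span_base by blast
  next
   case False
   then obtain i where "i < n" "c = h i" using h c unfolding bij_betw_def by blast
   thus ?thesis using fun_cong[OF x(2), of i] by (simp add: T_def)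
  qed
  hence "C <= {y : U'. \<beta> x y : {0}}" using CU by blast
  moreover have "vs2.subspace {y : U'. \<beta> x y : {0}}"
   by (rule lin_on_kernel_subspace[OF assms(2) k.vector_space_axioms vs2.fd_subspace[OF assms(6)] lin2[OF x(1)] k.subspace_single_0])
  ultimately have "ALL y:U'. \<beta> x y = 0" using vs2.span_minimal[of C] C(4) by blast
  thus "x : W" using nondeg[OF x(1)] by blast
 next
  fix x assume "x : W"
  thus "x : {x : U. T x = 0}" using W hU assms(5) by (auto simp: T_def)
 qed
 moreover have "kvec.dim (T ` U) <= n"
 proof -
  have "kvec.subspace (T ` U)"
   using rank_nullity(1)[OF assms(1) kvec_vs assms(3) lin] kvec.fd_subspace by blast
  moreover have "T ` U <= cspace n" by (auto simp: T_def cspace_def)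
  ultimately show ?thesis using kvec.fd_sub(2)[OF fd_cspace(2)] fd_cspace(3) by metis
 qed
 ultimately show ?thesis using rank_nullity(2)[OF assms(1) kvec_vs assms(3) lin] n_def by simp
qed

lemma linear_functional:
 fixes s :: "'k::field => 'a::ab_group_add => 'a"
 assumes "vector_space s" "module.subspace s W" "x ~: W"
 obtains th :: "'a => 'k" where "Vector_Spaces.linear s (*) th" "th x = 1" "!!y. y : W ==> th y = 0"
proof -
 interpret vector_space s by fact
 interpret k: vector_space "(*) :: 'k => 'k => 'k" by unfold_locales (auto simp: algebra_simps)
 interpret p: vector_space_pair s "(*) :: 'k => 'k => 'k" by unfold_locales
 obtain B where B: "~ dependent B" "span B = W"
  using subspace_basis[OF assms(2) independent_empty] by blast
 have "~ dependent (insert x B)" using B assms(3) independent_insertI by blast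
 then obtain th where t: "Vector_Spaces.linear s (*) th" "ALL y:insert x B. th y = (if y = x then 1 else 0)"
  using p.linear_independent_extend[of "insert x B" "%y. if y = x then 1 else 0"] by blast
 have "th y = 0" if "y : B" for y using t(2) that B(2) assms(3) span_base by (metis insertCI)
 hence "th y = 0" if "y : W" for y
  using p.linear_eq_0_on_span[OF t(1), of B] B(2) that by blast
 thus ?thesis using that t by auto
qed

subsection \<open>Dimensions of module records\<close>

text \<open>An explicit linear bijection from \<open>k^n\<close>. It asserts finite dimension as
  well as its value, and it makes sense before the record is known to be a vector space. The clause
  on \<open>0\<close> ties the field \<open>zero\<close> to the addition.\<close>

definition has_kdim :: "('k::field, 'x) module => nat => bool" where
 "has_kdim V n \<longleftrightarrow> (EX T :: (nat => 'k) => 'x. bij_betw T (cspace n) (carrier V) &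
   (ALL x:cspace n. ALL y:cspace n. T (x + y) = T x \<oplus>\<^bsub>V\<^esub> T y) &
   (ALL c. ALL x:cspace n. T (kscale c x) = c \<odot>\<^bsub>V\<^esub> T x) & T 0 = \<zero>\<^bsub>V\<^esub>)"

lemma cspace_closed:
 "x : cspace n ==> y : cspace n ==> x + y : cspace n"
 "x : cspace n ==> kscale c x : cspace n"
 "0 : cspace n" "x : cspace n ==> - x : cspace n"
 by (auto simp: cspace_def kscale_def)

text \<open>\<open>phi\<close> has the cosets of \<open>W\<close> as fibres, so it factors through
  the coordinate map \<open>T\<close> with kernel \<open>W\<close>. The section \<open>g\<close> of
  \<open>T\<close> makes the factor \<open>\<Phi>\<close> explicit; its linearity follows from
  \<open>\<Phi> (T x) = phi x\<close>.\<close>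

lemma has_kdim_quot:
 fixes s :: "'k::field => 'a::ab_group_add => 'a" and V :: "('k, 'x) module" (structure)
 assumes "vector_space s" "vector_space.fd s U" "module.subspace s W" "W <= U"
  and eq: "!!x y. x : U ==> y : U ==> phi x = phi y \<longleftrightarrow> x - y : W"
  and im: "phi ` U = carrier V"
  and add: "!!x y. x : U ==> y : U ==> phi (x + y) = phi x \<oplus> phi y"
  and scale: "!!c x. x : U ==> phi (s c x) = c \<odot> phi x"
  and zero: "phi 0 = \<zero>"
 shows "has_kdim V (vector_space.dim s U - vector_space.dim s W)"
proof -
 interpret v: vector_space s by fact
 have sU: "v.subspace U" using assms(2) v.fd_subspace by blast
 let ?n = "v.dim U - v.dim W"
 obtain T :: "'a => nat => 'k" where T: "lin_on s kscale U T" "T ` U = cspace ?n"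
  "!!x. x : U ==> T x = 0 \<longleftrightarrow> x : W"
  by (rule quot_coord[OF assms(1-4)]) blast
 have T0: "T 0 = 0" using T(3) v.subspace_0[OF assms(3)] v.subspace_0[OF sU] by simp
 have Teq: "T x = T y \<longleftrightarrow> x - y : W" if "x : U" "y : U" for x y
 proof -
  have "T x = T (x - y) + T y"
   using lin_on_add[OF T(1), of "x - y" y] that v.subspace_diff[OF sU] by simp
  thus ?thesis using T(3)[of "x - y"] that v.subspace_diff[OF sU] by auto
 qed
 define g where "g y = (SOME x. x : U & T x = y)" for y
 have g: "g y : U & T (g y) = y" if "y : cspace ?n" for y
  unfolding g_def by (rule someI_ex) (use that T(2) in \<open>metis imageE\<close>)
 define \<Phi> where "\<Phi> y = phi (g y)" for y
 have TC: "T x : cspace ?n" if "x : U" for x using that T(2) by blast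
 have \<Phi>T: "\<Phi> (T x) = phi x" if "x : U" for x
  using g[OF TC[OF that]] eq[of "g (T x)" x] Teq[of "g (T x)" x] that by (simp add: \<Phi>_def)
 have ex: "EX x:U. y = T x" if "y : cspace ?n" for y using that T(2) by blast
 have "\<Phi> (y + z) = \<Phi> y \<oplus> \<Phi> z" if yz: "y : cspace ?n" "z : cspace ?n" for y z
 proof -
  obtain a b where ab: "a : U" "y = T a" "b : U" "z = T b" using ex yz by blast
  hence "y + z = T (a + b)" using lin_on_add[OF T(1)] by simp
  thus ?thesis using ab \<Phi>T add v.subspace_add[OF sU] by simp
 qed
 moreover have "\<Phi> (kscale c y) = c \<odot> \<Phi> y" if y: "y : cspace ?n" for c y
 proof -
  obtain a where a: "a : U" "y = T a" using ex y by blast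
  hence "kscale c y = T (s c a)" using lin_on_scale[OF T(1)] by simp
  thus ?thesis using a \<Phi>T scale v.subspace_scale[OF sU] by simp
 qed
 moreover have "\<Phi> 0 = \<zero>" using \<Phi>T[OF v.subspace_0[OF sU]] T0 zero by simp
 moreover have "bij_betw \<Phi> (cspace ?n) (carrier V)"
 proof (rule bij_betw_imageI)
  show "inj_on \<Phi> (cspace ?n)"
  proof (rule inj_onI)
   fix y z assume yz: "y : cspace ?n" "z : cspace ?n" "\<Phi> y = \<Phi> z"
   obtain a b where ab: "a : U" "y = T a" "b : U" "z = T b" using ex yz by blast
   thus "y = z" using yz(3) \<Phi>T eq Teq by simp
  qed
  have "\<Phi> ` cspace ?n = phi ` U"
  proof (intro equalityI subsetI)
   fix y assume "y : \<Phi> ` cspace ?n"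
   thus "y : phi ` U" using ex \<Phi>T by fastforce
  next
   fix y assume "y : phi ` U"
   then obtain x where "x : U" "y = phi x" by blast
   thus "y : \<Phi> ` cspace ?n" using \<Phi>T TC by (metis imageI)
  qed
  thus "\<Phi> ` cspace ?n = carrier V" using im by simp
 qed
 ultimately show ?thesis unfolding has_kdim_def by (intro exI[of _ \<Phi>]) simp
qed

lemma has_kdim_vectorspace:
 fixes V :: "('k::field, 'x) module" (structure)
 assumes "has_kdim V n"
 shows "vectorspace class_ring V"
proof -
 obtain T :: "(nat => 'k) => 'x" where bij: "bij_betw T (cspace n) (carrier V)"
  and Ta: "!!x y. x : cspace n ==> y : cspace n ==> T x \<oplus> T y = T (x + y)"
  and Ts: "!!c x. x : cspace n ==> c \<odot> T x = T (kscale c x)"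
  and T0: "\<zero> = T 0"
  using assms unfolding has_kdim_def by metis
 have ex: "EX x:cspace n. v = T x" if "v : carrier V" for v
  using that bij unfolding bij_betw_def by blast
 have C: "T x : carrier V" if "x : cspace n" for x
  using that bij unfolding bij_betw_def by blast
 have ag: "abelian_group V"
 proof (rule abelian_groupI)
  fix x assume "x : carrier V"
  then obtain a where "x = T a" "a : cspace n" using ex by metis
  hence "T (- a) : carrier V" "T (- a) \<oplus> x = \<zero>"
   by (simp_all add: C cspace_closed Ta T0)
  thus "EX y:carrier V. y \<oplus> x = \<zero>" by blast
 qed (auto dest!: ex simp: C cspace_closed Ta T0 add_ac)
 have "Module.module class_ring V"
 proof (rule Module.moduleI)
  show "cring (class_ring :: 'k ring)"
   using class_field fieldE(1) by blast
 qed (use ag in \<open>auto dest!: ex simp: C cspace_closed Ts Ta kvec.scale_left_distrib kvec.scale_right_distrib\<close>)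
 thus ?thesis using class_field by (simp add: vectorspace_def)
qed

text \<open>The record is compared with \<open>carrier_vec n\<close>, whose dimension is
  known.\<close>

lemma has_kdim_kdim:
 fixes V :: "('k::field, 'x) module" (structure)
 assumes "has_kdim V n"
 shows "kdim V = n"
proof -
 obtain T :: "(nat => 'k) => 'x" where bij: "bij_betw T (cspace n) (carrier V)"
  and Ta: "!!x y. x : cspace n ==> y : cspace n ==> T (x + y) = T x \<oplus> T y"
  and Ts: "!!c x. x : cspace n ==> T (kscale c x) = c \<odot> T x"
  using assms unfolding has_kdim_def by metis
 interpret W: vec_space "TYPE('k)" n .
 interpret V: vectorspace class_ring V using has_kdim_vectorspace[OF assms] .
 define e :: "'k vec => nat => 'k" where "e x = (%i. if i < n then x $ i else 0)" for x
 have eC: "e x : cspace n" for x by (simp add: e_def cspace_def)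
 have ebij: "bij_betw e (carrier_vec n) (cspace n)"
 proof (rule bij_betw_byWitness[where f' = "%y. vec n y"])
  show "ALL a:carrier_vec n. vec n (e a) = a" by (auto simp: e_def)
  show "ALL a':cspace n. e (vec n a') = a'" by (auto simp: e_def cspace_def fun_eq_iff)
 qed (auto simp: e_def cspace_def)
 have 1: "(T o e) x : carrier V" for x using bij eC unfolding bij_betw_def by auto
 have 2: "(T o e) (x \<oplus>\<^bsub>module_vec TYPE('k) n\<^esub> y) = (T o e) x \<oplus> (T o e) y"
  if "x : carrier_vec n" "y : carrier_vec n" for x y
 proof -
  have "e (x + y) = e x + e y" using that by (auto simp: e_def fun_eq_iff)
  thus ?thesis using Ta[OF eC eC, of x y] by (simp add: module_vec_def)
 qed
 have 3: "(T o e) (r \<odot>\<^bsub>module_vec TYPE('k) n\<^esub> x) = r \<odot> (T o e) x"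
  if "x : carrier_vec n" for r x
 proof -
  have "e (r \<cdot>\<^sub>v x) = kscale r (e x)" using that by (auto simp: e_def fun_eq_iff kscale_def)
  thus ?thesis using Ts[OF eC, of r x] by (simp add: module_vec_def)
 qed
 have "T o e : LinearCombinations.module_hom class_ring (module_vec TYPE('k) n) V"
  unfolding LinearCombinations.module_hom_def using 1 2 3 by (simp add: module_vec_simps)
 hence lin: "linear_map class_ring (module_vec TYPE('k) n) V (T o e)"
  by (intro linear_map.intro mod_hom.intro mod_hom_axioms.intro W.vectorspace_axioms
   V.vectorspace_axioms W.module_axioms V.module_axioms)
 have "bij_betw (T o e) (carrier_vec n) (carrier V)" using bij_betw_trans[OF ebij bij] .
 hence "W.dim = V.dim"
  using linear_map.dim_eq[OF lin W.fin_dim] unfolding bij_betw_def by (simp add: module_vec_def)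
 thus ?thesis using W.dim_is_n by simp
qed

lemma has_kdim_direct_sum:
 fixes V :: "('k::field, 'x) module" and W :: "('k, 'y) module"
 assumes "has_kdim V m" "has_kdim W n"
 shows "has_kdim (direct_sum V W) (m + n)"
proof -
 obtain S :: "(nat => 'k) => 'x" where S: "bij_betw S (cspace m) (carrier V)"
  "ALL x:cspace m. ALL y:cspace m. S (x + y) = S x \<oplus>\<^bsub>V\<^esub> S y"
  "ALL c. ALL x:cspace m. S (kscale c x) = c \<odot>\<^bsub>V\<^esub> S x" "S 0 = \<zero>\<^bsub>V\<^esub>"
  using assms(1) unfolding has_kdim_def by metis
 obtain T :: "(nat => 'k) => 'y" where T: "bij_betw T (cspace n) (carrier W)"
  "ALL x:cspace n. ALL y:cspace n. T (x + y) = T x \<oplus>\<^bsub>W\<^esub> T y"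
  "ALL c. ALL x:cspace n. T (kscale c x) = c \<odot>\<^bsub>W\<^esub> T x" "T 0 = \<zero>\<^bsub>W\<^esub>"
  using assms(2) unfolding has_kdim_def by metis
 define a where "a x = (%i. if i < m then x i else 0)" for x :: "nat => 'k"
 define b where "b x = (%i. x (m + i))" for x :: "nat => 'k"
 have ab: "a (x + y) = a x + a y" "b (x + y) = b x + b y" "a (kscale c x) = kscale c (a x)"
  "b (kscale c x) = kscale c (b x)" "a 0 = 0" "b 0 = 0" "a x : cspace m" for x y c
  by (auto simp: a_def b_def fun_eq_iff kscale_def cspace_def)
 have b: "b x : cspace n" if "x : cspace (m + n)" for x using that by (simp add: b_def cspace_def)
 have bij: "bij_betw (%x. (a x, b x)) (cspace (m + n)) (cspace m \<times> cspace n)"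
  by (rule bij_betw_byWitness[where f' = "%(y, z) i. if i < m then y i else z (i - m)"])
    (auto simp: a_def b_def cspace_def fun_eq_iff)
 have "bij_betw (map_prod S T) (cspace m \<times> cspace n) (carrier V \<times> carrier W)"
  using S(1) T(1) by (rule bij_betw_map_prod)
 from bij_betw_trans[OF bij this]
 show ?thesis unfolding has_kdim_def
  by (intro exI[of _ "map_prod S T o (%x. (a x, b x))"])
    (use S T in \<open>simp add: direct_sum_def ab b o_def\<close>)
qed

lemma has_kdim_0D:
 fixes V :: "('k::field, 'x) module"
 assumes "has_kdim V 0"
 shows "carrier V = {\<zero>\<^bsub>V\<^esub>}"
proof -
 obtain T :: "(nat => 'k) => 'x" where "bij_betw T (cspace 0) (carrier V)" "T 0 = \<zero>\<^bsub>V\<^esub>"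
  using assms unfolding has_kdim_def by metis
 moreover have "cspace 0 = {0 :: nat => 'k}" by (auto simp: cspace_def)
 ultimately show ?thesis by (auto simp: bij_betw_def)
qed

text \<open>The shape in which the cluster category needs it: all summands except those at 0 and 1
  are points.\<close>

lemma has_kdim_coprod:
 fixes V :: "int => ('k::field, 'x) module"
 assumes "has_kdim (V 0) m" "has_kdim (V 1) n" "!!i. i ~= 0 ==> i ~= 1 ==> has_kdim (V i) 0"
 shows "has_kdim (coprod_mod V) (m + n)"
proof -
 have "has_kdim (direct_sum (V 0) (V 1)) (m + n)"
  using assms has_kdim_direct_sum by blast
 then obtain S :: "(nat => 'k) => 'x \<times> 'x" where S: "bij_betw S (cspace (m+n)) (carrier (V 0) \<times> carrier (V 1))"
  "ALL x:cspace (m+n). ALL y:cspace (m+n). S (x + y) = (fst (S x) \<oplus>\<^bsub>V 0\<^esub> fst (S y), snd (S x) \<oplus>\<^bsub>V 1\<^esub> snd (S y))"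
  "ALL c. ALL x:cspace (m+n). S (kscale c x) = (c \<odot>\<^bsub>V 0\<^esub> fst (S x), c \<odot>\<^bsub>V 1\<^esub> snd (S x))"
  "S 0 = (\<zero>\<^bsub>V 0\<^esub>, \<zero>\<^bsub>V 1\<^esub>)"
  unfolding has_kdim_def direct_sum_def by auto
 define h where "h p = (%i. if i = 0 then fst p else if i = 1 then snd p else \<zero>\<^bsub>V i\<^esub>)" for p
 have car: "carrier (V i) = {\<zero>\<^bsub>V i\<^esub>}" if "i ~= 0" "i ~= 1" for i
  using has_kdim_0D assms(3) that by blast
 \<comment> \<open>The carrier at \<open>i\<close> is a single point, but the operations of the
   record on it are known only through the bijection with \<open>k^0\<close>.\<close>
 have Vi: "\<zero>\<^bsub>V i\<^esub> \<oplus>\<^bsub>V i\<^esub> \<zero>\<^bsub>V i\<^esub> = \<zero>\<^bsub>V i\<^esub> & c \<odot>\<^bsub>V i\<^esub> \<zero>\<^bsub>V i\<^esub> = \<zero>\<^bsub>V i\<^esub>" if i: "i ~= 0" "i ~= 1" for i c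
 proof -
  obtain T :: "(nat => 'k) => 'x" where T: "bij_betw T (cspace 0) (carrier (V i))" "T 0 = \<zero>\<^bsub>V i\<^esub>"
   "ALL x:cspace 0. ALL y:cspace 0. T (x + y) = T x \<oplus>\<^bsub>V i\<^esub> T y"
   "ALL c. ALL x:cspace 0. T (kscale c x) = c \<odot>\<^bsub>V i\<^esub> T x"
   using assms(3)[OF i] unfolding has_kdim_def by metis
  have "0 : (cspace 0 :: (nat => 'k) set)" by (rule cspace_closed)
  thus ?thesis using T(2-4) by (metis add_0 kvec.scale_zero_right)
 qed
 have fin: "finite {i. h p i ~= \<zero>\<^bsub>V i\<^esub>}" for p
  by (rule finite_subset[of _ "{0, 1}"]) (auto simp: h_def)
 have bij: "bij_betw h (carrier (V 0) \<times> carrier (V 1)) (carrier (coprod_mod V))"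
 proof (rule bij_betw_byWitness[where f' = "%x. (x 0, x 1)"])
  show "ALL a':carrier (coprod_mod V). h (a' 0, a' 1) = a'"
  proof
   fix a' assume "a' : carrier (coprod_mod V)"
   hence *: "a' i : carrier (V i)" for i by (simp add: coprod_mod_def)
   show "h (a' 0, a' 1) = a'"
   proof (rule ext)
    fix i
    show "h (a' 0, a' 1) i = a' i"
     using *[of i] car[of i] unfolding h_def by (cases "i = 0"; cases "i = 1") simp_all
   qed
  qed
  show "h ` (carrier (V 0) \<times> carrier (V 1)) <= carrier (coprod_mod V)"
  proof (intro image_subsetI)
   fix p assume "p : carrier (V 0) \<times> carrier (V 1)"
   hence "h p i : carrier (V i)" for i using car[of i] by (auto simp: h_def)
   thus "h p : carrier (coprod_mod V)" using fin by (simp add: coprod_mod_def)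
  qed
 qed (auto simp: h_def coprod_mod_def)
 have add: "(h o S) (x + y) = (h o S) x \<oplus>\<^bsub>coprod_mod V\<^esub> (h o S) y"
  if "x : cspace (m+n)" "y : cspace (m+n)" for x y
  using S(2) that Vi unfolding coprod_mod_def h_def fun_eq_iff by simp
 have scale: "(h o S) (kscale c x) = c \<odot>\<^bsub>coprod_mod V\<^esub> (h o S) x" if "x : cspace (m+n)" for c x
  using S(3) that Vi unfolding coprod_mod_def h_def fun_eq_iff by simp
 have zero: "(h o S) 0 = \<zero>\<^bsub>coprod_mod V\<^esub>"
  using S(4) unfolding coprod_mod_def h_def fun_eq_iff by simp
 show ?thesis unfolding has_kdim_def
  using bij_betw_trans[OF S(1) bij] add scale zero by blast
qed

subsection \<open>Spaces of graded maps\<close>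

interpretation kk: vector_space_pair "kscale :: 'k::field => (nat => 'k) => nat => 'k" kscale
 by unfold_locales

interpretation gvec: vector_space "gscale :: 'k::field => ('v, 'k) gmap => ('v, 'k) gmap"
 by unfold_locales (auto simp: gscale_def fun_eq_iff kvec.scale_right_distrib kvec.scale_left_distrib)

lemma gvec_vs: "vector_space (gscale :: 'k::field => ('v, 'k) gmap => ('v, 'k) gmap)"
 by (rule gvec.vector_space_axioms)

lemmas fun_ops = zero_fun_apply plus_fun_apply minus_apply uminus_apply

declare fun_ops [simp del]

lemma fd_subspace_iff: "fd_subspace U \<longleftrightarrow> kvec.fd U"
 by (simp add: fd_subspace_def kvec.fd_def)

lemma lin_mapsI:
 assumes "!!x. x : U ==> g x : W" "!!x y. x : U ==> y : U ==> g (x + y) = g x + g y"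
  "!!c x. x : U ==> g (kscale c x) = kscale c (g x)" "!!x. x ~: U ==> g x = 0"
 shows "g : lin_maps U W"
 using assms by (simp add: lin_maps_def)

lemma lin_maps_mem: "g : lin_maps U W ==> x : U ==> g x : W"
 and lin_maps_add: "g : lin_maps U W ==> x : U ==> y : U ==> g (x + y) = g x + g y"
 and lin_maps_scale: "g : lin_maps U W ==> x : U ==> g (kscale c x) = kscale c (g x)"
 and lin_maps_out: "g : lin_maps U W ==> x ~: U ==> g x = 0"
 and lin_maps_lin_on: "g : lin_maps U W ==> lin_on kscale kscale U g"
 by (simp_all add: lin_maps_def lin_on_def)

lemma lin_maps_zero: "g : lin_maps U W ==> g 0 = 0"
 by (metis kvec.scale_zero_left lin_maps_out lin_maps_scale)

lemma lin_maps_uminus: "g : lin_maps U W ==> x : U ==> g (- x) = - g x"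
 using lin_maps_scale[of g U W x "- 1"] by simp

lemma lin_maps_diff: "g : lin_maps U W ==> kvec.subspace U ==> x : U ==> y : U ==> g (x - y) = g x - g y"
 using lin_maps_add[of g U W x "- y"] lin_maps_uminus[of g U W y] kvec.subspace_neg[of U y] by simp

lemma lin_maps_mem': "g : lin_maps U W ==> kvec.subspace W ==> g x : W"
 by (metis lin_maps_mem lin_maps_out kvec.subspace_0)

lemma lin_maps_sum:
 "g : lin_maps U W ==> kvec.subspace U ==> (!!i. i : I ==> f i : U) ==> g (sum f I) = (SUM i:I. g (f i))"
 by (induction I rule: infinite_finite_induct)
   (simp_all add: lin_maps_zero lin_maps_add kvec.subspace_sum)

lemma lin_maps_comp: "f : lin_maps U W ==> g : lin_maps W X ==> g o f : lin_maps U X"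
 by (rule lin_mapsI)
   (auto simp: lin_maps_mem lin_maps_add lin_maps_scale lin_maps_out lin_maps_zero)

lemma lin_maps_plus: "f : lin_maps U W ==> g : lin_maps U W ==> kvec.subspace W ==> f + g : lin_maps U W"
 and lin_maps_minus: "f : lin_maps U W ==> g : lin_maps U W ==> kvec.subspace W ==> f - g : lin_maps U W"
 and lin_maps_0: "kvec.subspace W ==> 0 : lin_maps U W"
 by (rule lin_mapsI; auto simp: lin_maps_mem lin_maps_add lin_maps_scale lin_maps_out
   kvec.subspace_add kvec.subspace_diff kvec.subspace_neg kvec.subspace_0 kvec.subspace_scale
   kvec.scale_right_distrib kvec.scale_right_diff_distrib algebra_simps fun_ops; fail)+

lemma lin_maps_scaled: "f : lin_maps U W ==> kvec.subspace W ==> (%x. kscale c (f x)) : lin_maps U W"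
 by (rule lin_mapsI) (auto simp: lin_maps_mem lin_maps_add lin_maps_scale lin_maps_out
   kvec.subspace_scale kvec.scale_right_distrib mult.commute)

lemma lin_maps_eqI: "f : lin_maps U W ==> g : lin_maps U W' ==> (!!x. x : U ==> f x = g x) ==> f = g"
 by (rule ext) (metis lin_maps_out)

lemma lin_maps_restrict:
 assumes "lin_on kscale kscale U g" "kvec.subspace U" "!!x. x : U ==> g x : W"
 shows "(%x. if x : U then g x else 0) : lin_maps U W"
 using assms by (auto intro!: lin_mapsI simp: lin_on_add lin_on_scale kvec.subspace_add kvec.subspace_scale)

lemma lin_maps_linear:
 assumes "f : lin_maps U W" "kvec.subspace U"
 obtains g where "Vector_Spaces.linear kscale kscale g" "!!x. x : U ==> g x = f x"
 using lin_on_extend[OF kvec_vs kvec_vs assms(2) lin_maps_lin_on[OF assms(1)]] by metis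

lemma linear_lin_on: "Vector_Spaces.linear kscale kscale g ==> lin_on kscale kscale U g"
 by (simp add: lin_on_def kk.linear_add kk.linear_scale)

lemma lin_on_comp:
 "lin_on s1 s2 U f ==> lin_on s2 s3 V g ==> f ` U <= V ==> lin_on s1 s3 U (%x. g (f x))"
 unfolding lin_on_def by (simp add: image_subset_iff)

lemma lin_maps_lift:
 assumes f: "f : lin_maps C B" and g: "g : lin_maps A B'" and "f ` C <= g ` A"
  and "kvec.subspace A" "kvec.subspace C"
 obtains h where "h : lin_maps C A" "!!x. x : C ==> g (h x) = f x"
proof -
 obtain g' where g': "Vector_Spaces.linear kscale kscale g'" "!!x. x : A ==> g' x = g x"
  using lin_maps_linear[OF g assms(4)] by blast
 obtain r where r: "range r <= A" "Vector_Spaces.linear kscale kscale r" "ALL v:g' ` A. g' (r v) = v"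
  using kk.linear_exists_right_inverse_on[OF g'(1) assms(4)] by blast
 define h where "h x = (if x : C then r (f x) else 0)" for x
 have "h : lin_maps C A"
  unfolding h_def
  by (rule lin_maps_restrict[OF lin_on_comp[OF lin_maps_lin_on[OF f] linear_lin_on[OF r(2), of UNIV]]])
    (use r assms in auto)
 moreover have "g (h x) = f x" if x: "x : C" for x
 proof -
  have "f x : g' ` A" using assms(3) x g'(2) by (metis (no_types, lifting) image_cong image_subset_iff)
  hence "g' (r (f x)) = f x" using r(3) by blast
  moreover have "r (f x) : A" using r(1) by blast
  ultimately show ?thesis using x g'(2) by (simp add: h_def)
 qed
 ultimately show ?thesis using that by blast
qed

lemma lin_maps_id: "kvec.subspace U ==> U <= W ==> (%x. if x : U then x else 0) : lin_maps U W"
 by (rule lin_maps_restrict) (auto simp: lin_on_def)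

lemma lin_maps_retraction:
 assumes "kvec.subspace U" "kvec.subspace S" "S <= U"
 obtains r where "r : lin_maps U S" "!!x. x : S ==> r x = x"
proof -
 obtain g where g: "range g <= S" "Vector_Spaces.linear kscale kscale g" "ALL v:S. g v = v"
  using kk.linear_exists_left_inverse_on[OF kvec.linear_id assms(2)] by auto
 show ?thesis
  by (rule that[of "%x. if x : U then g x else 0"])
    (use g assms in \<open>auto intro!: lin_maps_restrict linear_lin_on\<close>)
qed

lemma lin_maps_extend:
 assumes "kvec.subspace U" "kvec.subspace S" "S <= U" "f : lin_maps S W"
 obtains F where "F : lin_maps U W" "!!x. x : S ==> F x = f x"
proof -
 obtain r where r: "r : lin_maps U S" "!!x. x : S ==> r x = x"
  using lin_maps_retraction[OF assms(1-3)] by blast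
 show ?thesis by (rule that[of "f o r"]) (use r assms(4) in \<open>auto intro: lin_maps_comp\<close>)
qed

text \<open>The index set is arbitrary: it consists of vertices for families of vertex maps and of
  arrows for cocycles.\<close>

definition gh :: "'i set => ('i => (nat => 'k::field) set) => ('i => (nat => 'k) set) => ('i, 'k) gmap set" where
 "gh I A B = {f. (ALL i:I. f i : lin_maps (A i) (B i)) & (ALL i. i ~: I --> f i = 0)}"

lemma graded_hom_gh: "graded_hom Q A B = gh (verts Q) A B"
 by (simp add: graded_hom_def gh_def)

lemma ghI: "(!!i. i : I ==> f i : lin_maps (A i) (B i)) ==> (!!i. i ~: I ==> f i = 0) ==> f : gh I A B"
 by (simp add: gh_def)

lemma ghD: "f : gh I A B ==> i : I ==> f i : lin_maps (A i) (B i)"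
 and gh_out: "f : gh I A B ==> i ~: I ==> f i = 0"
 by (simp_all add: gh_def)

lemma gh_eqI:
 assumes "f : gh I A B" "g : gh I A B'" "!!i x. i : I ==> x : A i ==> f i x = g i x"
 shows "f = g"
proof (rule ext)
 fix i
 show "f i = g i"
  by (cases "i : I") (use assms in \<open>auto intro: lin_maps_eqI dest: ghD simp: gh_out\<close>)
qed

lemma gh_subspace:
 assumes "!!i. i : I ==> kvec.subspace (B i)"
 shows "gvec.subspace (gh I A B)"
proof (rule gvec.subspaceI)
 show "0 : gh I A B" using assms by (auto simp: gh_def fun_ops lin_maps_0)
 show "f + g : gh I A B" if "f : gh I A B" "g : gh I A B" for f g
  using that assms by (auto simp: gh_def plus_fun_apply[of f] lin_maps_plus)
 show "gscale c f : gh I A B" if "f : gh I A B" for c f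
 proof (rule ghI)
  fix i assume "i : I"
  thus "gscale c f i : lin_maps (A i) (B i)"
   unfolding gscale_def using lin_maps_scaled[OF ghD[OF that]] assms by blast
 qed (use that in \<open>simp add: gscale_def gh_out fun_eq_iff kscale_def fun_ops\<close>)
qed

text \<open>Maps are determined by their values on bases \<open>a i\<close>. The positions in
  \<open>S\<close> are freed one at a time: freeing a position \<open>(i, x)\<close> enlarges the
  space by the image of the evaluation at \<open>x\<close>, which is all of
  \<open>B i\<close>.\<close>

lemma gh_fd:
 fixes A B :: "'i => (nat => 'k::field) set"
 assumes I: "finite I" and A: "!!i. i : I ==> kvec.fd (A i)" and B: "!!i. i : I ==> kvec.fd (B i)"
 shows "gvec.fd (gh I A B)" "gvec.dim (gh I A B) = (SUM i:I. kvec.dim (A i) * kvec.dim (B i))"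
proof -
 have sub: "gvec.subspace (gh I A B)" by (rule gh_subspace) (rule kvec.fd_subspace[OF B])
 have "ALL i. EX a. i : I --> kvec.independent a & kvec.span a = A i & finite a & card a = kvec.dim (A i)"
  using A kvec.fd_basis by metis
 then obtain a where a: "!!i. i : I ==> kvec.independent (a i) & kvec.span (a i) = A i & finite (a i) & card (a i) = kvec.dim (A i)"
  by metis
 define S where "S = (SIGMA i:I. a i)"
 have aA: "x : A i" if "i : I" "x : a i" for i x using a[OF that(1)] kvec.span_base[OF that(2)] by simp
 define K where "K R = {f : gh I A B. ALL p:S - R. f (fst p) (snd p) = 0}" for R
 have sK: "gvec.subspace (K R)" for R
  by (rule gvec.subspaceI) (auto simp: K_def zero_fun_apply plus_fun_apply gscale_def[of _ "_ :: ('i, 'k) gmap", THEN fun_cong, THEN fun_cong]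
   intro: gvec.subspace_0[OF sub] gvec.subspace_add[OF sub] gvec.subspace_scale[OF sub])
 have "gvec.fd (K R) & gvec.dim (K R) = (SUM p:R. kvec.dim (B (fst p)))" if "finite R" "R <= S" for R
  using that
 proof (induction R rule: finite_induct)
  case empty
  have "f = 0" if f: "f : K {}" for f
  proof (rule gh_eqI[OF _ gvec.subspace_0[OF sub]])
   show fG: "f : gh I A B" using f by (simp add: K_def)
   fix i u assume i: "i : I" and u: "u : A i"
   obtain g where g: "Vector_Spaces.linear kscale kscale g" "!!x. x : A i ==> g x = f i x"
    using lin_maps_linear[OF ghD[OF fG i] kvec.fd_subspace[OF A[OF i]]] by blast
   have "g u = 0"
    by (rule kk.linear_eq_0_on_span[OF g(1), of "a i"]) (use f i u a[OF i] aA[OF i] g(2) in \<open>auto simp: K_def S_def\<close>)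
   thus "f i u = (0 :: ('i, 'k) gmap) i u" using g(2) u by (simp add: fun_ops)
  qed
  hence "K {} = {0}" using gvec.subspace_0[OF sK] by blast
  thus ?case by simp
 next
  case (insert p R)
  obtain i x where p: "p = (i, x)" "i : I" "x : a i" using insert.prems by (auto simp: S_def)
  let ?e = "%f. f i x" and ?K = "K (insert p R)"
  have lin: "lin_on gscale kscale ?K ?e" by (simp add: lin_on_def gscale_def plus_fun_apply)
  have "S - R = insert p (S - insert p R)" using insert by blast
  hence ker: "{f : ?K. f i x = 0} = K R" unfolding K_def by (auto simp: p(1))
  have im: "?e ` ?K = B i"
  proof (intro equalityI subsetI)
   fix y assume y: "y : B i"
   obtain g where g: "Vector_Spaces.linear kscale kscale g" "ALL z:a i. g z = (if z = x then y else 0)"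
    using kk.linear_independent_extend[of "a i" "%z. if z = x then y else 0"] a[OF p(2)] by blast
   define f where "f j = (if j = i then (%u. if u : A i then g u else 0) else 0)" for j
   have "g ` a i <= B i" using g(2) y kvec.subspace_0[OF kvec.fd_subspace[OF B[OF p(2)]]] by auto
   hence "g ` A i <= B i"
    using kk.linear_span_image[OF g(1), of "a i"] a[OF p(2)] kvec.span_minimal kvec.fd_subspace[OF B[OF p(2)]] by metis
   hence "f : gh I A B"
    using p(2) by (intro ghI) (auto simp: f_def intro!: lin_maps_restrict linear_lin_on g kvec.fd_subspace A lin_maps_0 B)
   hence "f : ?K" using g(2) aA by (auto simp: K_def f_def S_def p(1) zero_fun_apply)
   moreover have "f i x = y" using g(2) p aA by (simp add: f_def)
   ultimately show "y : ?e ` ?K" by blast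
  qed (use p aA in \<open>auto simp: K_def intro: lin_maps_mem ghD\<close>)
  have "gvec.fd ?K"
   using fd_of_kernel_image[OF gvec_vs kvec_vs sK lin] insert B[OF p(2)] unfolding ker im by blast
  thus ?case using rank_nullity(2)[OF gvec_vs kvec_vs _ lin] insert unfolding ker im by (simp add: p(1))
 qed
 moreover have "finite S" using I a by (simp add: S_def)
 moreover have "K S = gh I A B" by (simp add: K_def)
 moreover have "(SUM p:S. kvec.dim (B (fst p))) = (SUM i:I. kvec.dim (A i) * kvec.dim (B i))"
  using I a sum.Sigma[of I a "%i _. kvec.dim (B i)"] by (simp add: S_def split_def)
 ultimately show "gvec.fd (gh I A B)" "gvec.dim (gh I A B) = (SUM i:I. kvec.dim (A i) * kvec.dim (B i))"
  by (metis order_refl)+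
qed

lemma lin_maps_codom: "f : lin_maps U W ==> (!!x. x : U ==> f x : W') ==> f : lin_maps U W'"
 by (simp add: lin_maps_def)

section \<open>Representations of a finite quiver\<close>

locale quiver = fin_digraph Q for Q :: "('v, 'e) pre_digraph"
begin

abbreviation "vs == verts Q"
abbreviation "tgt == head Q"
abbreviation "src == tail Q"
abbreviation "zrep == is_zero_rep Q"
abbreviation "indec == rep_indec Q"
abbreviation "proj == projective Q"
abbreviation "qis == quasi_iso Q"
abbreviation "DC == D_comp Q"
abbreviation "DH == D_hom Q"
abbreviation "D0 == D_zero Q"
abbreviation "DM == D_map Q"
abbreviation "DS == D_shift Q"
abbreviation "DI == D_id Q"
abbreviation "Dind == D_indec Q"
abbreviation "Cone == cone Q"

abbreviation rep :: "('v, 'e, 'k::field) qrep => bool" where "rep == is_rep Q"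
abbreviation Hom :: "('v, 'e, 'k::field) qrep => ('v, 'e, 'k) qrep => ('v, 'k) gmap set" where
 "Hom == rep_hom Q"
abbreviation ident :: "('v, 'e, 'k::field) qrep => ('v, 'k) gmap" where "ident == rep_id Q"
abbreviation C0 :: "('v, 'e, 'k::field) qrep => ('v, 'e, 'k) qrep => ('v, 'k) gmap set" where
 "C0 M N == gh vs (sp M) (sp N)"
abbreviation C1 :: "('v, 'e, 'k::field) qrep => ('v, 'e, 'k) qrep => ('e, 'k) gmap set" where
 "C1 M N == gh (arcs Q) (%e. sp M (src e)) (%e. sp N (tgt e))"

lemmas zrep_def = is_zero_rep_def

lemma rep_fd: "rep M ==> v : vs ==> kvec.fd (sp M v)"
 by (simp add: is_rep_def fd_subspace_iff)

lemma rep_sub: "rep M ==> v : vs ==> kvec.subspace (sp M v)"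
 using rep_fd kvec.fd_subspace by blast

lemma rep_0: "rep M ==> v : vs ==> 0 : sp M v"
 by (rule kvec.subspace_0[OF rep_sub])

lemma act_lin: "rep M ==> e : arcs Q ==> act M e : lin_maps (sp M (src e)) (sp M (tgt e))"
 by (simp add: is_rep_def)

lemma act_mem: "rep M ==> e : arcs Q ==> x : sp M (src e) ==> act M e x : sp M (tgt e)"
 using act_lin lin_maps_mem by blast

lemma hom_lin: "f : Hom M N ==> v : vs ==> f v : lin_maps (sp M v) (sp N v)"
 and hom_out: "f : Hom M N ==> v ~: vs ==> f v = 0"
 by (simp_all add: rep_hom_def graded_hom_def)

lemma hom_gh: "f : Hom M N ==> f : C0 M N"
 by (simp add: rep_hom_def graded_hom_gh)

lemma hom_mem: "f : Hom M N ==> v : vs ==> x : sp M v ==> f v x : sp N v"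
 using hom_lin lin_maps_mem by blast

lemma hom_zero: "f : Hom M N ==> f v 0 = 0"
 by (cases "v : vs") (auto simp: hom_out fun_ops dest: hom_lin intro: lin_maps_zero)

lemma hom_comm: "f : Hom M N ==> e : arcs Q ==> f (tgt e) (act M e x) = act N e (f (src e) x)"
 unfolding rep_hom_def by (auto dest!: bspec fun_cong[where x = x])

lemma homI:
 assumes "rep M" "rep N" "f : C0 M N"
  and "!!e x. e : arcs Q ==> x : sp M (src e) ==> f (tgt e) (act M e x) = act N e (f (src e) x)"
 shows "f : Hom M N"
proof -
 have "f (tgt e) o act M e = act N e o f (src e)" if e: "e : arcs Q" for e
 proof
  fix x
  have l: "act M e : lin_maps (sp M (src e)) (sp M (tgt e))" "act N e : lin_maps (sp N (src e)) (sp N (tgt e))"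
   "f (tgt e) : lin_maps (sp M (tgt e)) (sp N (tgt e))" "f (src e) : lin_maps (sp M (src e)) (sp N (src e))"
   using assms e by (auto intro: act_lin ghD)
  show "(f (tgt e) o act M e) x = (act N e o f (src e)) x"
  proof (cases "x : sp M (src e)")
   case False
   thus ?thesis
    using lin_maps_out[OF l(1)] lin_maps_out[OF l(4)] lin_maps_zero[OF l(2)] lin_maps_zero[OF l(3)] by simp
  qed (use assms(4) e in simp)
 qed
 thus ?thesis using assms(3) by (simp add: rep_hom_def graded_hom_gh)
qed

lemma hom_eqI:
 "f : Hom M N ==> g : Hom M N' ==> (!!v x. v : vs ==> x : sp M v ==> f v x = g v x) ==> f = g"
 by (rule gh_eqI[OF hom_gh hom_gh])

lemma hom_subspace: assumes "rep M" "rep N" shows "gvec.subspace (Hom M N)"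
proof (rule gvec.subspaceI)
 have s: "gvec.subspace (C0 M N)" by (rule gh_subspace) (rule rep_sub[OF assms(2)])
 have lN: "act N e : lin_maps (sp N (src e)) (sp N (tgt e))" if "e : arcs Q" for e
  using act_lin[OF assms(2) that] .
 show "0 : Hom M N"
  by (rule homI[OF assms gvec.subspace_0[OF s]]) (simp add: fun_ops lin_maps_zero[OF lN])
 show "f + g : Hom M N" if "f : Hom M N" "g : Hom M N" for f g
  by (rule homI[OF assms gvec.subspace_add[OF s hom_gh[OF that(1)] hom_gh[OF that(2)]]])
    (use that in \<open>simp add: plus_fun_apply[of f] plus_fun_apply[of "f _"] hom_comm lin_maps_add[OF lN] hom_mem\<close>)
 show "gscale c f : Hom M N" if "f : Hom M N" for c f
  by (rule homI[OF assms gvec.subspace_scale[OF s hom_gh[OF that]]])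
    (use that in \<open>simp add: gscale_def hom_comm lin_maps_scale[OF lN] hom_mem\<close>)
qed

lemmas hom_0 = gvec.subspace_0[OF hom_subspace]
 and hom_add = gvec.subspace_add[OF hom_subspace]
 and hom_diff = gvec.subspace_diff[OF hom_subspace]
 and hom_neg = gvec.subspace_neg[OF hom_subspace]
 and hom_scale = gvec.subspace_scale[OF hom_subspace]

lemma gh_comp:
 assumes "f : gh I A B" "g : gh I B C"
 shows "gcomp g f : gh I A C"
proof (rule ghI)
 show "i : I ==> gcomp g f i : lin_maps (A i) (C i)" for i
  using lin_maps_comp[OF ghD[OF assms(1)] ghD[OF assms(2)]] by (simp add: gcomp_def)
 show "i ~: I ==> gcomp g f i = 0" for i
  using gh_out[OF assms(2), of i] by (simp add: gcomp_def fun_eq_iff fun_ops)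
qed

lemma hom_comp:
 assumes "f : Hom M N" "g : Hom N L"
 shows "gcomp g f : Hom M L"
 using gh_comp[OF hom_gh[OF assms(1)] hom_gh[OF assms(2)]]
 by (auto simp: rep_hom_def graded_hom_gh gcomp_def hom_comm[OF assms(1)] hom_comm[OF assms(2)] intro!: ext)

lemma ident_hom: "rep M ==> ident M : Hom M M"
proof (rule homI)
 show "rep M ==> ident M : C0 M M"
  using lin_maps_id[OF rep_sub order_refl]
  by (intro ghI) (auto simp: rep_id_def fun_ops)
qed (auto simp: rep_id_def act_mem)

lemma gcomp_assoc: "gcomp h (gcomp g f) = gcomp (gcomp h g) f"
 by (simp add: gcomp_def o_assoc)

lemma gcomp_apply: "gcomp g f v x = g v (f v x)"
 by (simp add: gcomp_def)

lemma gcomp_ident_left: "f : gh vs A (sp M) ==> rep M ==> gcomp (ident M) f = f"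
proof (intro ext)
 fix v x n assume f: "f : gh vs A (sp M)" and M: "rep M"
 show "gcomp (ident M) f v x n = f v x n"
  using lin_maps_mem'[OF ghD[OF f] rep_sub[OF M], of v x] gh_out[OF f, of v]
  by (cases "v : vs") (auto simp: gcomp_def rep_id_def fun_ops)
qed

lemma gcomp_ident_right: "f : gh vs (sp M) B ==> gcomp f (ident M) = f"
proof (intro ext)
 fix v x n assume f: "f : gh vs (sp M) B"
 show "gcomp f (ident M) v x n = f v x n"
  using lin_maps_out[OF ghD[OF f], of v x] lin_maps_zero[OF ghD[OF f], of v] gh_out[OF f, of v]
  by (cases "v : vs") (auto simp: gcomp_def rep_id_def fun_ops)
qed

lemma gcomp_add_left: "gcomp (g + h) f = gcomp g f + gcomp h f"
 and gcomp_diff_left: "gcomp (g - h) f = gcomp g f - gcomp h f"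
 and gcomp_neg_left: "gcomp (- g) f = - gcomp g f"
 and gcomp_zero_left: "gcomp 0 f = 0"
 and gcomp_scale_left: "gcomp (gscale c g) f = gscale c (gcomp g f)"
 by (auto simp: gcomp_def fun_eq_iff fun_ops gscale_def)

lemma gcomp_add_right:
 assumes "g : gh vs A B" "f : gh vs X A" "h : gh vs X A" "!!v. v : vs ==> kvec.subspace (A v)"
 shows "gcomp g (f + h) = gcomp g f + gcomp g h"
proof (intro ext)
 fix v x n
 show "gcomp g (f + h) v x n = (gcomp g f + gcomp g h) v x n"
 proof (cases "v : vs")
  case True
  have "f v x : A v" "h v x : A v" by (rule lin_maps_mem'[OF ghD[OF assms(2) True] assms(4)[OF True]] lin_maps_mem'[OF ghD[OF assms(3) True] assms(4)[OF True]])+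
  thus ?thesis using lin_maps_add[OF ghD[OF assms(1) True]] by (simp add: gcomp_def fun_ops plus_fun_def)
 qed (simp add: gcomp_def gh_out[OF assms(1)] fun_ops)
qed

lemma gcomp_zero_right: "g : gh vs A B ==> gcomp g 0 = 0"
proof (rule ext)
 fix v assume "g : gh vs A B"
 thus "gcomp g 0 v = 0 v"
  using lin_maps_zero[OF ghD, of g vs A B v] gh_out[of g vs A B v]
  by (cases "v : vs") (auto simp: gcomp_def fun_eq_iff fun_ops)
qed

lemma gcomp_scale_right:
 assumes "g : gh vs A B" "f : gh vs X A" "!!v. v : vs ==> kvec.subspace (A v)"
 shows "gcomp g (gscale c f) = gscale c (gcomp g f)"
proof (intro ext)
 fix v x n
 show "gcomp g (gscale c f) v x n = gscale c (gcomp g f) v x n"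
 proof (cases "v : vs")
  case True
  have "f v x : A v" by (rule lin_maps_mem'[OF ghD[OF assms(2) True] assms(3)[OF True]])
  thus ?thesis using lin_maps_scale[OF ghD[OF assms(1) True]] by (simp add: gcomp_def gscale_def)
 qed (simp add: gcomp_def gh_out[OF assms(1)] gscale_def fun_ops)
qed

lemma gcomp_neg_right:
 assumes "g : gh vs A B" "f : gh vs X A" "!!v. v : vs ==> kvec.subspace (A v)"
 shows "gcomp g (- f) = - gcomp g f"
 using gcomp_scale_right[OF assms, of "- 1"] by simp

lemma gcomp_diff_right:
 assumes "g : gh vs A B" "f : gh vs X A" "h : gh vs X A" "!!v. v : vs ==> kvec.subspace (A v)"
 shows "gcomp g (f - h) = gcomp g f - gcomp g h"
 using gcomp_add_right[OF assms(1,2) gvec.subspace_neg[OF gh_subspace assms(3)] assms(4)]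
  gcomp_neg_right[OF assms(1,3,4)] assms(4) by simp

lemma comp_add: "g : Hom N L ==> f : Hom M N ==> h : Hom M N ==> rep N ==> gcomp g (f + h) = gcomp g f + gcomp g h"
 and comp_diff: "g : Hom N L ==> f : Hom M N ==> h : Hom M N ==> rep N ==> gcomp g (f - h) = gcomp g f - gcomp g h"
 and comp_neg: "g : Hom N L ==> f : Hom M N ==> rep N ==> gcomp g (- f) = - gcomp g f"
 and comp_scale: "g : Hom N L ==> f : Hom M N ==> rep N ==> gcomp g (gscale c f) = gscale c (gcomp g f)"
 and comp_zero: "g : Hom N L ==> gcomp g 0 = 0"
 by (rule gcomp_add_right[OF hom_gh hom_gh hom_gh rep_sub] gcomp_diff_right[OF hom_gh hom_gh hom_gh rep_sub]
    gcomp_neg_right[OF hom_gh hom_gh rep_sub] gcomp_scale_right[OF hom_gh hom_gh rep_sub]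
    gcomp_zero_right[OF hom_gh]; assumption)+

lemma ident_left: "f : Hom M N ==> rep N ==> gcomp (ident N) f = f"
 and ident_right: "f : Hom M N ==> gcomp f (ident M) = f"
 using gcomp_ident_left gcomp_ident_right hom_gh by blast+


subsection \<open>The standard resolution\<close>

text \<open>Kernel \<open>Hom(M, N)\<close> and cokernel \<open>Ext^1(M, N)\<close>: this is the
  complex obtained by applying \<open>Hom(-, N)\<close> to the standard projective resolution of
  \<open>M\<close>.\<close>

definition dd :: "('v, 'e, 'k::field) qrep => ('v, 'e, 'k) qrep => ('v, 'k) gmap => ('e, 'k) gmap" where
 "dd M N f = (%e. if e : arcs Q then (%x. act N e (f (src e) x) - f (tgt e) (act M e x)) else 0)"

text \<open>\<open>Ext\<^sup>1(M, N) = 0\<close>\<close>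

definition
 "ext0 M N \<longleftrightarrow> (ALL c:C1 M N. EX f:C0 M N. dd M N f = c)"

lemma dd_C1: assumes "rep M" "rep N" "f : C0 M N" shows "dd M N f : C1 M N"
proof (rule ghI)
 fix e assume e: "e : arcs Q"
 have v: "src e : vs" "tgt e : vs" using e by simp_all
 have "(act N e o f (src e)) - (f (tgt e) o act M e) : lin_maps (sp M (src e)) (sp N (tgt e))"
  using lin_maps_minus[OF lin_maps_comp[OF ghD[OF assms(3) v(1)] act_lin[OF assms(2) e]]
   lin_maps_comp[OF act_lin[OF assms(1) e] ghD[OF assms(3) v(2)]] rep_sub[OF assms(2) v(2)]] .
 thus "dd M N f e : lin_maps (sp M (src e)) (sp N (tgt e))"
  using e by (simp add: dd_def fun_diff_def o_def)
qed (simp add: dd_def)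

lemma dd_lin: assumes "rep M" "rep N" shows "lin_on gscale gscale (C0 M N) (dd M N)"
proof (rule lin_onI; rule ext)
 fix f g e assume fg: "f : C0 M N" "g : C0 M N"
 show "dd M N (f + g) e = (dd M N f + dd M N g) e"
 proof (cases "e : arcs Q")
  case e: True
  have "f (src e) x : sp N (src e)" "g (src e) x : sp N (src e)" for x
   by (rule lin_maps_mem'[OF ghD[OF fg(1)] rep_sub[OF assms(2)]] lin_maps_mem'[OF ghD[OF fg(2)] rep_sub[OF assms(2)]], simp_all add: e)+
  thus ?thesis using e lin_maps_add[OF act_lin[OF assms(2) e]]
   by (auto simp: dd_def plus_fun_apply[of f] plus_fun_apply[of "f _"] plus_fun_apply[of "%e. _ e"] fun_eq_iff fun_ops)
 qed (simp add: dd_def fun_ops)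
next
 fix c f e assume f: "f : C0 M N"
 show "dd M N (gscale c f) e = gscale c (dd M N f) e"
 proof (cases "e : arcs Q")
  case e: True
  have "f (src e) x : sp N (src e)" for x
   by (rule lin_maps_mem'[OF ghD[OF f] rep_sub[OF assms(2)]]) (simp_all add: e)
  thus ?thesis using e lin_maps_scale[OF act_lin[OF assms(2) e]]
   by (auto simp: dd_def gscale_def kvec.scale_right_diff_distrib)
 qed (simp add: dd_def fun_ops gscale_def fun_eq_iff)
qed

lemma dd_kernel: assumes "rep M" "rep N" shows "{f : C0 M N. dd M N f = 0} = Hom M N"
proof (intro equalityI subsetI; (elim CollectE conjE)?)
 fix f assume f: "f : C0 M N" "dd M N f = 0"
 show "f : Hom M N"
 proof (rule homI[OF assms f(1)])
  fix e x assume "e : arcs Q"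
  hence "act N e (f (src e) x) - f (tgt e) (act M e x) = 0"
   using fun_cong[OF f(2), of e] by (simp add: dd_def fun_ops fun_eq_iff)
  thus "f (tgt e) (act M e x) = act N e (f (src e) x)" by simp
 qed
next
 fix f assume "f : Hom M N"
 moreover from this have "dd M N f = 0"
  by (intro ext) (simp add: dd_def hom_comm fun_ops)
 ultimately show "f : {f : C0 M N. dd M N f = 0}" using hom_gh by blast
qed

lemma C0_fd:
 assumes "rep M" "rep N"
 shows "gvec.fd (C0 M N)" "gvec.dim (C0 M N) = (SUM v:vs. kvec.dim (sp M v) * kvec.dim (sp N v))"
 by (rule gh_fd; simp add: rep_fd assms)+

lemma C1_fd:
 assumes "rep M" "rep N"
 shows "gvec.fd (C1 M N)" "gvec.dim (C1 M N) = (SUM e:arcs Q. kvec.dim (sp M (src e)) * kvec.dim (sp N (tgt e)))"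
 by (rule gh_fd; simp add: rep_fd assms)+

lemma hom_fd: "rep M ==> rep N ==> gvec.fd (Hom M N)"
 using gvec.fd_sub(1)[OF C0_fd(1) hom_subspace, of M N M N] hom_gh by blast

text \<open>The Euler form of the quiver, with value \<open>dim Hom - dim Ext^1\<close> on the
  dimension vectors of two representations.\<close>

definition eform :: "('v => int) => ('v => int) => int" where
 "eform a b = (SUM v:vs. a v * b v) - (SUM e:arcs Q. a (src e) * b (tgt e))"

definition dimv :: "('v, 'e, 'k::field) qrep => 'v => int" where
 "dimv M = (%v. if v : vs then int (kvec.dim (sp M v)) else 0)"

lemma dd_image:
 assumes "rep M" "rep N"
 shows "gvec.fd (dd M N ` C0 M N)" "gvec.dim (C0 M N) = gvec.dim (Hom M N) + gvec.dim (dd M N ` C0 M N)"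
  "dd M N ` C0 M N <= C1 M N" "ext0 M N \<longleftrightarrow> dd M N ` C0 M N = C1 M N"
proof -
 show "gvec.fd (dd M N ` C0 M N)" "gvec.dim (C0 M N) = gvec.dim (Hom M N) + gvec.dim (dd M N ` C0 M N)"
  using rank_nullity[OF gvec_vs gvec_vs C0_fd(1)[OF assms] dd_lin[OF assms]]
  unfolding dd_kernel[OF assms] by auto
 show s: "dd M N ` C0 M N <= C1 M N" using dd_C1 assms by blast
 show "ext0 M N \<longleftrightarrow> dd M N ` C0 M N = C1 M N"
 proof
  assume "ext0 M N"
  hence "c : dd M N ` C0 M N" if "c : C1 M N" for c
   using that by (auto simp: ext0_def image_iff eq_commute[of c])
  thus "dd M N ` C0 M N = C1 M N" by (intro equalityI s subsetI)
 next
  assume im: "dd M N ` C0 M N = C1 M N"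
  have "EX f:C0 M N. dd M N f = c" if "c : C1 M N" for c
   using that unfolding im[symmetric] image_iff by (simp add: eq_commute[of c])
  thus "ext0 M N" by (simp add: ext0_def)
 qed
qed

lemma eform_dimv:
 assumes "rep M" "rep N"
 shows "eform (dimv M) (dimv N) = int (gvec.dim (C0 M N)) - int (gvec.dim (C1 M N))"
 unfolding eform_def using C0_fd(2)[OF assms] C1_fd(2)[OF assms] by (simp add: dimv_def)

text \<open>Rank and nullity for \<open>dd\<close>: the form equals the dimension of its kernel
  minus the codimension of its image, and \<open>ext0\<close> says that this codimension is
  0.\<close>

lemma euler:
 assumes "rep M" "rep N"
 shows "eform (dimv M) (dimv N) <= int (gvec.dim (Hom M N))"
  and "ext0 M N \<longleftrightarrow> eform (dimv M) (dimv N) = int (gvec.dim (Hom M N))"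
proof -
 note d = dd_image[OF assms]
 have "gvec.dim (dd M N ` C0 M N) <= gvec.dim (C1 M N)"
  using gvec.fd_sub(2)[OF C1_fd(1) gvec.fd_subspace[OF d(1)] d(3)] assms by blast
 thus "eform (dimv M) (dimv N) <= int (gvec.dim (Hom M N))"
  using d(2) eform_dimv[OF assms] by linarith
 have "dd M N ` C0 M N = C1 M N \<longleftrightarrow> gvec.dim (dd M N ` C0 M N) = gvec.dim (C1 M N)"
  using gvec.fd_sub(3)[OF C1_fd(1) gvec.fd_subspace[OF d(1)] d(3)] assms by auto
 thus "ext0 M N \<longleftrightarrow> eform (dimv M) (dimv N) = int (gvec.dim (Hom M N))"
  using d(2,4) eform_dimv[OF assms] by linarith
qed


subsection \<open>Subrepresentations and idempotents\<close>

text \<open>The action is set to 0 off \<open>A\<close>, in accordance with the convention that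
  linear maps vanish outside their source.\<close>

definition
 "sub_rep M A = \<lparr>sp = A, act = (%e x. if x : A (src e) then act M e x else 0)\<rparr>"

lemma sp_sub_rep [simp]: "sp (sub_rep M A) = A"
 by (simp add: sub_rep_def)

lemma act_sub_rep: "x : A (src e) ==> act (sub_rep M A) e x = act M e x"
 by (simp add: sub_rep_def)

lemma subrepD:
 assumes "subrep Q M A"
 shows "v : vs ==> kvec.subspace (A v)" "v : vs ==> A v <= sp M v"
  "e : arcs Q ==> x : A (src e) ==> act M e x : A (tgt e)"
 using assms unfolding subrep_def by blast+

lemma sub_rep_rep:
 assumes "rep M" "subrep Q M A"
 shows "rep (sub_rep M A)"
 unfolding is_rep_def
proof (intro conjI ballI)
 show "fd_subspace (sp (sub_rep M A) v)" if "v : vs" for v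
  using kvec.fd_sub(1)[OF rep_fd[OF assms(1) that] subrepD(1,2)[OF assms(2) that]] by (simp add: fd_subspace_iff)
 fix e assume e: "e : arcs Q"
 show "act (sub_rep M A) e : lin_maps (sp (sub_rep M A) (src e)) (sp (sub_rep M A) (tgt e))"
  unfolding sub_rep_def qrep.simps
  using lin_on_subset[OF lin_maps_lin_on[OF act_lin[OF assms(1) e]]] subrepD[OF assms(2)] e
  by (auto intro!: lin_maps_restrict)
qed

lemma hom_sub_rep:
 assumes "rep M" "rep N" "subrep Q N A" "f : Hom M N" "!!v x. v : vs ==> x : sp M v ==> f v x : A v"
 shows "f : Hom M (sub_rep N A)"
proof (rule homI[OF assms(1) sub_rep_rep[OF assms(2,3)]])
 show "f : C0 M (sub_rep N A)"
  using lin_maps_codom[OF hom_lin[OF assms(4)]] assms(5) by (intro ghI) (auto simp: hom_out[OF assms(4)])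
 fix e x assume "e : arcs Q" "x : sp M (src e)"
 thus "f (tgt e) (act M e x) = act (sub_rep N A) e (f (src e) x)"
  using hom_comm[OF assms(4)] assms(5) by (simp add: act_sub_rep)
qed

lemma sub_rep_incl:
 assumes "rep M" "rep N" "subrep Q N A" "f : Hom M (sub_rep N A)"
 shows "f : Hom M N"
proof (rule homI[OF assms(1,2)])
 show "f : C0 M N"
 proof (rule ghI)
  fix v assume v: "v : vs"
  show "f v : lin_maps (sp M v) (sp N v)"
   using subsetD[OF subrepD(2)[OF assms(3) v]] hom_mem[OF assms(4) v]
   by (intro lin_maps_codom[OF hom_lin[OF assms(4) v]]) simp
 qed (rule hom_out[OF assms(4)])
 fix e x assume "e : arcs Q" "x : sp M (src e)"
 thus "f (tgt e) (act M e x) = act N e (f (src e) x)"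
  using hom_comm[OF assms(4), of e x] hom_mem[OF assms(4), of "src e" x] by (simp add: act_sub_rep)
qed

definition
 "restr A f = (%v x. if v : vs & x : A v then f v x else 0)"

lemma restr_hom:
 assumes "rep M" "rep N" "subrep Q N A" "f : Hom N M"
 shows "restr A f : Hom (sub_rep N A) M"
proof (rule homI[OF sub_rep_rep[OF assms(2,3)] assms(1)])
 show "restr A f : C0 (sub_rep N A) M"
 proof (rule ghI)
  fix v assume v: "v : vs"
  have "(%x. if x : A v then f v x else 0) : lin_maps (A v) (sp M v)"
  proof (rule lin_maps_restrict[OF lin_on_subset[OF lin_maps_lin_on[OF hom_lin[OF assms(4) v]]]])
   show "A v <= sp N v" "kvec.subspace (A v)" using subrepD[OF assms(3)] v by auto
   thus "!!x. x : A v ==> f v x : sp M v" using hom_mem[OF assms(4) v] by blast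
  qed
  thus "restr A f v : lin_maps (sp (sub_rep N A) v) (sp M v)" using v by (simp add: restr_def)
 qed (simp add: restr_def zero_fun_def)
 fix e x assume "e : arcs Q" "x : sp (sub_rep N A) (src e)"
 thus "restr A f (tgt e) (act (sub_rep N A) e x) = act M e (restr A f (src e) x)"
  using hom_comm[OF assms(4)] subrepD(3)[OF assms(3)] by (simp add: restr_def act_sub_rep)
qed

lemma subrep_image:
 assumes "rep M" "rep N" "f : Hom M N"
 shows "subrep Q N (%v. f v ` sp M v)"
 unfolding subrep_def
proof (intro conjI ballI)
 fix v assume v: "v : vs"
 show "kvec.subspace (f v ` sp M v)"
  using rank_nullity(1)[OF kvec_vs kvec_vs rep_fd[OF assms(1) v] lin_maps_lin_on[OF hom_lin[OF assms(3) v]]]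
   kvec.fd_subspace by blast
 show "f v ` sp M v <= sp N v" using hom_mem[OF assms(3) v] by blast
next
 fix e assume "e : arcs Q"
 thus "act N e ` f (src e) ` sp M (src e) <= f (tgt e) ` sp M (tgt e)"
  using hom_comm[OF assms(3), symmetric] act_mem[OF assms(1)] by auto
qed

lemma subrep_kernel:
 assumes "rep M" "rep N" "f : Hom M N"
 shows "subrep Q M (%v. {x : sp M v. f v x = 0})"
 unfolding subrep_def
proof (intro conjI ballI)
 fix v assume v: "v : vs"
 show "kvec.subspace {x : sp M v. f v x = 0}"
  using lin_on_kernel_subspace[OF kvec_vs kvec_vs rep_sub[OF assms(1) v] lin_maps_lin_on[OF hom_lin[OF assms(3) v]] kvec.subspace_single_0]
  by simp
next
 fix e assume e: "e : arcs Q"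
 have "act N e 0 = 0" using lin_maps_zero[OF act_lin[OF assms(2) e]] .
 thus "act M e ` {x : sp M (src e). f (src e) x = 0} <= {x : sp M (tgt e). f (tgt e) x = 0}"
  using hom_comm[OF assms(3) e] act_mem[OF assms(1) e] by auto
qed auto

lemma zero_rep_iff: "rep M ==> zrep M \<longleftrightarrow> ident M = 0"
proof
 assume "zrep M"
 thus "ident M = 0" by (auto simp: zrep_def rep_id_def fun_eq_iff fun_ops)
next
 assume M: "rep M" and 0: "ident M = 0"
 have "x = 0" if "v : vs" "x : sp M v" for v x
  using fun_cong2[OF 0, of v x] that by (simp add: rep_id_def fun_ops)
 thus "zrep M" using kvec.subspace_0[OF rep_sub[OF M]] by (auto simp: zrep_def)
qed

text \<open>A decomposition yields the projection to \<open>A\<close> along \<open>B\<close>;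
  conversely an idempotent splits \<open>M\<close> into its image and its kernel.\<close>

lemma rep_indec_iff:
 "indec M \<longleftrightarrow> rep M & ~ zrep M &
   (ALL e:Hom M M. gcomp e e = e --> e = 0 \<or> e = ident M)" (is "?L \<longleftrightarrow> ?R")
proof
 assume L: ?L
 hence M: "rep M" by (simp add: rep_indec_def)
 have "e = 0 \<or> e = ident M" if e: "e : Hom M M" "gcomp e e = e" for e
 proof -
  let ?A = "%v. e v ` sp M v" and ?B = "%v. {x : sp M v. e v x = 0}"
  have ee: "e v (e v x) = e v x" for v x using fun_cong2[OF e(2)] by (simp add: gcomp_def)
  have "?A v Int ?B v = {0} & sp M v = {a + b | a b. a : ?A v & b : ?B v}" if v: "v : vs" for v
  proof
   have z: "0 : sp M v" using rep_0[OF M v] .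
   show "?A v Int ?B v = {0}"
   proof -
    have "0 : ?A v" using z hom_zero[OF e(1), of v] by (metis image_eqI)
    thus ?thesis using z hom_zero[OF e(1), of v] ee by auto
   qed
   show "sp M v = {a + b | a b. a : ?A v & b : ?B v}"
   proof (intro equalityI subsetI)
    fix x assume x: "x : sp M v"
    hence "x - e v x : ?B v"
     using lin_maps_diff[OF hom_lin[OF e(1) v] rep_sub[OF M v]] hom_mem[OF e(1) v] ee
      kvec.subspace_diff[OF rep_sub[OF M v]] by simp
    moreover have "x = e v x + (x - e v x)" by simp
    ultimately show "x : {a + b | a b. a : ?A v & b : ?B v}" using x by blast
   qed (use hom_mem[OF e(1) v] kvec.subspace_add[OF rep_sub[OF M v]] in auto)
  qed
  hence "(ALL v:vs. ?A v = {0}) \<or> (ALL v:vs. ?B v = {0})"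
   using L subrep_image[OF M M e(1)] subrep_kernel[OF M M e(1)] unfolding rep_indec_def by blast
  thus ?thesis
  proof
   assume A: "ALL v:vs. ?A v = {0}"
   have "e = 0"
    by (rule hom_eqI[OF e(1) hom_0[OF M M]]) (use A in \<open>auto simp: fun_ops\<close>)
   thus ?thesis by simp
  next
   assume B: "ALL v:vs. ?B v = {0}"
   have "e = ident M"
   proof (rule hom_eqI[OF e(1) ident_hom[OF M]])
    fix v x assume v: "v : vs" "x : sp M v"
    hence "x - e v x : ?B v"
     using lin_maps_diff[OF hom_lin[OF e(1) v(1)] rep_sub[OF M v(1)]] hom_mem[OF e(1)] ee
      kvec.subspace_diff[OF rep_sub[OF M v(1)]] by simp
    hence "x - e v x = 0" using B v(1) by blast
    thus "e v x = ident M v x" using v by (simp add: rep_id_def)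
   qed
   thus ?thesis by simp
  qed
 qed
 thus ?R using L by (simp add: rep_indec_def)
next
 assume R: ?R
 hence M: "rep M" by simp
 have "(ALL v:vs. A v = {0}) \<or> (ALL v:vs. B v = {0})"
  if A: "subrep Q M A" and B: "subrep Q M B"
   and AB: "!!v. v : vs ==> A v Int B v = {0}" "!!v. v : vs ==> sp M v = {a + b | a b. a : A v & b : B v}" for A B
 proof -
  have uniq: "a = a'" if "v : vs" "a : A v" "a' : A v" "b : B v" "b' : B v" "a + b = a' + b'" for v a a' b b'
  proof -
   have "a - a' = b' - b" using that(6) by (simp add: algebra_simps)
   hence "a - a' : A v Int B v"
    using that kvec.subspace_diff[OF subrepD(1)[OF A]] kvec.subspace_diff[OF subrepD(1)[OF B]] by (metis IntI)
   thus ?thesis using AB(1)[OF that(1)] by simp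
  qed
  \<comment> \<open>The projection to \<open>A\<close> along \<open>B\<close>; the description is
    well defined by \<open>uniq\<close>.\<close>
  define e where "e v x = (if v : vs & x : sp M v then THE a. a : A v & (EX b:B v. x = a + b) else 0)" for v x
  have e: "e v (a + b) = a" if "v : vs" "a : A v" "b : B v" for v a b
  proof -
   have "a + b : sp M v" using that AB(2) by blast
   moreover have "(THE a'. a' : A v & (EX b':B v. a + b = a' + b')) = a"
    using that uniq by (intro the_equality) blast+
   ultimately show ?thesis using that by (simp add: e_def)
  qed
  have ex: "EX a:A v. EX b:B v. x = a + b" if "v : vs" "x : sp M v" for v x using that AB(2) by blast
  have eh: "e : Hom M M"
  proof (rule homI[OF M M])
   show "e : C0 M M"
   proof (rule ghI)
    fix v assume v: "v : vs"
    note sA = subrepD(1)[OF A v] and sB = subrepD(1)[OF B v]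
    show "e v : lin_maps (sp M v) (sp M v)"
    proof (rule lin_mapsI)
     fix x assume "x : sp M v"
     then obtain a b where "a : A v" "b : B v" "x = a + b" using ex[OF v] by blast
     thus "e v x : sp M v" "e v (kscale c x) = kscale c (e v x)" for c
      using e[OF v] subrepD(2)[OF A v] kvec.subspace_scale[OF sA] kvec.subspace_scale[OF sB]
      by (auto simp: kvec.scale_right_distrib)
    next
     fix x y assume "x : sp M v" "y : sp M v"
     then obtain a b a' b' where *: "a : A v" "b : B v" "x = a + b" "a' : A v" "b' : B v" "y = a' + b'"
      using ex[OF v] by metis
     have xy: "x + y = (a + a') + (b + b')" using * by (simp add: algebra_simps)
     have 1: "e v (x + y) = a + a'"
      unfolding xy by (rule e[OF v kvec.subspace_add[OF sA *(1,4)] kvec.subspace_add[OF sB *(2,5)]])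
     have 2: "e v x = a" "e v y = a'" using e[OF v *(1,2)] e[OF v *(4,5)] *(3,6) by simp_all
     show "e v (x + y) = e v x + e v y" by (simp only: 1 2)
    qed (simp add: e_def)
   qed (simp add: e_def fun_eq_iff fun_ops)
   fix d x assume d: "d : arcs Q" "x : sp M (src d)"
   then obtain a b where ab: "a : A (src d)" "b : B (src d)" "x = a + b" using ex[of "src d" x] by auto
   have "act M d x = act M d a + act M d b"
    using ab lin_maps_add[OF act_lin[OF M d(1)]] subrepD(2)[OF A] subrepD(2)[OF B] d(1) by (metis subsetD tail_in_verts)
   thus "e (tgt d) (act M d x) = act M d (e (src d) x)"
    using e[of "tgt d" "act M d a" "act M d b"] e[of "src d" a b] ab d(1) subrepD(3)[OF A d(1)] subrepD(3)[OF B d(1)]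
    by simp
  qed
  have "gcomp e e = e"
  proof (rule hom_eqI[OF hom_comp[OF eh eh] eh])
   fix v x assume v: "v : vs" "x : sp M v"
   then obtain a b where ab: "a : A v" "b : B v" "x = a + b" using ex by blast
   moreover have "0 : B v" using kvec.subspace_0[OF subrepD(1)[OF B v(1)]] .
   ultimately show "gcomp e e v x = e v x" using e[OF v(1)] e[OF v(1), of a 0] by (simp add: gcomp_def)
  qed
  hence "e = 0 \<or> e = ident M" using R eh by blast
  thus ?thesis
  proof
   assume 0: "e = 0"
   have "a = 0" if v: "v : vs" "a : A v" for v a
    using e[OF v, of 0] kvec.subspace_0[OF subrepD(1)[OF B v(1)]] by (simp add: 0 fun_ops)
   thus ?thesis using kvec.subspace_0[OF subrepD(1)[OF A]] by blast
  next
   assume 1: "e = ident M"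
   have "b = 0" if v: "v : vs" "b : B v" for v b
    using e[OF v(1) _ v(2), of 0] kvec.subspace_0[OF subrepD(1)[OF A v(1)]] subrepD(2)[OF B v(1)] v
    by (auto simp: 1 rep_id_def)
   thus ?thesis using kvec.subspace_0[OF subrepD(1)[OF B]] by blast
  qed
 qed
 note main = this
 show ?L unfolding rep_indec_def
  by (intro conjI allI impI; (elim conjE)?; (rule main)?) (use R in simp_all)
qed

end

lemma lin_maps_left_inverse:
 assumes "f : lin_maps U W" "kvec.subspace U" "kvec.subspace W" "!!x. x : U ==> f x = 0 ==> x = 0"
 obtains s where "s : lin_maps W U" "!!x. x : U ==> s (f x) = x"
proof -
 obtain g where g: "Vector_Spaces.linear kscale kscale g" "!!x. x : U ==> g x = f x"
  using lin_maps_linear[OF assms(1,2)] by blast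
 have "inj_on g U" using kk.linear_inj_on_iff_eq_0[OF g(1) assms(2)] g(2) assms(4) by simp
 then obtain r where r: "range r <= U" "Vector_Spaces.linear kscale kscale r" "ALL v:U. r (g v) = v"
  using kk.linear_exists_left_inverse_on[OF g(1) assms(2)] by blast
 define s where "s x = (if x : W then r x else 0)" for x
 have "s : lin_maps W U" unfolding s_def
  by (rule lin_maps_restrict[OF linear_lin_on[OF r(2)] assms(3)]) (use r(1) in blast)
 moreover have "s (f x) = x" if "x : U" for x
  using that r(3) g(2) lin_maps_mem[OF assms(1)] by (simp add: s_def)
 ultimately show ?thesis using that by blast
qed

lemma gh_mono:
 assumes "f : gh I A B" "!!i. i : I ==> B i <= B' i"
 shows "f : gh I A B'"
proof (rule ghI)
 fix i assume i: "i : I"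
 show "f i : lin_maps (A i) (B' i)"
  using assms(2)[OF i] lin_maps_mem[OF ghD[OF assms(1) i]] by (intro lin_maps_codom[OF ghD[OF assms(1) i]]) blast
qed (rule gh_out[OF assms(1)])

text \<open>The vectors \<open>u, T u, ..., T^n u\<close> with \<open>n = dim U\<close> are
  dependent, so \<open>p(T) u = 0\<close> for some nonzero \<open>p\<close>. Splitting off linear
  factors one at a time, the last nonzero vector met is an eigenvector.\<close>

lemma eigenvector_exists:
 fixes T :: "(nat => 'k::alg_closed_field) => nat => 'k"
 assumes "T : lin_maps U U" "kvec.fd U" "U ~= {0}"
 obtains c x where "x : U" "x ~= 0" "T x = kscale c x"
proof -
 have sU: "kvec.subspace U" using assms(2) kvec.fd_subspace by blast
 obtain u where u: "u : U" "u ~= 0" using assms(3) kvec.subspace_0[OF sU] by blast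
 define n where "n = kvec.dim U"
 \<comment> \<open>\<open>pe p\<close> is \<open>p(T) u\<close>, evaluated by Horner's rule.\<close>
 define pe where "pe p = fold_coeffs (%a y. kscale a u + T y) p 0" for p
 have pe: "pe (pCons a p) = kscale a u + T (pe p)" "pe 0 = 0" for a p
  by (cases "p = 0 & a = 0"; auto simp: pe_def lin_maps_zero[OF assms(1)])+
 have peU: "pe p : U" for p
  by (induction p) (auto simp: pe kvec.subspace_0[OF sU] lin_maps_mem[OF assms(1)] kvec.subspace_add[OF sU] kvec.subspace_scale[OF sU] u)
 have add: "pe (p + q) = pe p + pe q" for p q
  by (induction p q rule: poly_induct2) (simp_all add: pe lin_maps_add[OF assms(1)] peU kvec.scale_left_distrib)
 have scale: "pe (Polynomial.smult c p) = kscale c (pe p)" for c p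
  by (induction p) (simp_all add: pe lin_maps_scale[OF assms(1)] peU kvec.scale_right_distrib)
 have step: "pe ([:- c, 1:] * q) = T (pe q) - kscale c (pe q)" for c q
 proof -
  show ?thesis using add[of "pCons 0 q" "Polynomial.smult (- c) q"] scale[of "- c" q] by (simp add: pe)
 qed
 have "EX p. p ~= 0 & pe p = 0"
 proof (rule ccontr)
  assume no: "~ ?thesis"
  define P where "P y = Poly (map y [0..<Suc n])" for y :: "nat => 'k"
  have P: "coeff (P y) j = (if j <= n then y j else 0)" for y j
   by (simp add: P_def nth_default_def less_Suc_eq_le del: upt_Suc)
  have "P (y + z) = P y + P z" "P (kscale c y) = Polynomial.smult c (P y)" for y z c
   by (simp_all add: poly_eq_iff P plus_fun_apply kscale_def)
  hence lin: "lin_on kscale kscale (cspace (Suc n)) (%y. pe (P y))"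
   by (simp add: lin_on_def add scale)
  have inj: "y = 0" if y: "y : cspace (Suc n)" "pe (P y) = 0" for y
  proof
   fix j
   have "P y = 0" using no y(2) by blast
   thus "y j = 0 j" using y(1) P[of y j] by (cases "j <= n") (auto simp: cspace_def zero_fun_apply)
  qed
  have "kvec.dim ((%y. pe (P y)) ` cspace (Suc n)) = Suc n"
   using dim_inj[OF kvec_vs kvec_vs fd_cspace(2) lin inj] fd_cspace(3)[of "Suc n", where ?'k = 'k] by simp
  moreover have "kvec.subspace ((%y. pe (P y)) ` cspace (Suc n))"
   using rank_nullity(1)[OF kvec_vs kvec_vs fd_cspace(2) lin] kvec.fd_subspace by blast
  ultimately show False using kvec.fd_sub(2)[OF assms(2), of "(%y. pe (P y)) ` cspace (Suc n)"] peU n_def by auto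
 qed
 then obtain p where p: "p ~= 0" "pe p = 0" by blast
 have "EX c x. x : U & x ~= 0 & T x = kscale c x"
  using p
 proof (induction "degree p" arbitrary: p rule: less_induct)
  case less
  show ?case
  proof (cases "degree p = 0")
   case True
   then obtain a where "p = [:a:]" by (rule degree_eq_zeroE)
   thus ?thesis using less.prems u(2) by (simp add: pe lin_maps_zero[OF assms(1)])
  next
   case False
   then obtain c where "poly p c = 0" using alg_closed_imp_poly_has_root[of p] by blast
   then obtain q where q: "p = [:- c, 1:] * q" by (metis dvdE poly_eq_0_iff_dvd)
   have q0: "q ~= 0" using q less.prems(1) by auto
   have dq: "degree q < degree p" using q0 unfolding q by (subst degree_mult_eq) auto
   show ?thesis
   proof (cases "pe q = 0")
    case True
    thus ?thesis using less.hyps[OF dq q0] by blast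
   next
    case False
    have "T (pe q) = kscale c (pe q)" using step[of c q] less.prems(2) q by simp
    thus ?thesis using peU False by blast
   qed
  qed
 qed
 thus ?thesis using that by blast
qed

section \<open>Bricks, extension of morphisms and indecomposable summands\<close>

context quiver
begin

lemma restr_apply: "v : vs ==> x : A v ==> restr A f v x = f v x"
 by (simp add: restr_def)

lemma restr_gh:
 assumes "!!v. v : vs ==> kvec.subspace (A v)" "!!v. v : vs ==> lin_on kscale kscale (A v) (f v)"
  "!!v x. v : vs ==> x : A v ==> f v x : B v"
 shows "restr A f : gh vs A B"
proof (rule ghI)
 fix v assume v: "v : vs"
 hence "(%x. if x : A v then f v x else 0) : lin_maps (A v) (B v)"
  using assms by (intro lin_maps_restrict) auto
 thus "restr A f v : lin_maps (A v) (B v)" using v by (simp add: restr_def)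
qed (simp add: restr_def fun_eq_iff fun_ops)

definition
 "tdim M = (SUM v:vs. kvec.dim (sp M v))"

definition
 "rank M f = (SUM v:vs. kvec.dim (f v ` sp M v))"

lemma image_fd:
 assumes "rep M" "f : gh vs (sp M) B" "v : vs"
 shows "kvec.fd (f v ` sp M v)"
 by (rule rank_nullity(1)[OF kvec_vs kvec_vs rep_fd[OF assms(1,3)] lin_maps_lin_on[OF ghD[OF assms(2,3)]]])

definition
 "brick M \<longleftrightarrow> rep M & gvec.dim (Hom M M) = 1"

lemma brick_not_zero: "brick M ==> ident M ~= 0"
proof
 assume M: "brick M" "ident M = 0"
 hence r: "rep M" by (simp add: brick_def)
 have "f = 0" if "f : Hom M M" for f
  using ident_left[OF that r] M(2) by (simp add: gcomp_zero_left)
 hence "Hom M M = {0}" using hom_0[OF r r] by blast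
 thus False using M(1) by (simp add: brick_def)
qed

lemma brick_scalar:
 assumes "brick M" "f : Hom M M"
 obtains c where "f = gscale c (ident M)"
proof -
 have r: "rep M" using assms by (simp add: brick_def)
 show ?thesis
  using gvec.fd_dim_1[OF hom_fd[OF r r] _ ident_hom[OF r] brick_not_zero[OF assms(1)] assms(2)] that assms(1)
  unfolding brick_def by blast
qed

lemma brick_indec: assumes "brick M" shows "indec M"
 unfolding rep_indec_iff
proof (intro conjI ballI impI)
 show r: "rep M" using assms by (simp add: brick_def)
 show "~ zrep M" using zero_rep_iff[OF r] brick_not_zero[OF assms] by simp
 fix e assume e: "e : Hom M M" "gcomp e e = e"
 obtain c where c: "e = gscale c (ident M)" using brick_scalar[OF assms e(1)] .
 have "gcomp e e = gscale (c * c) (ident M)"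
  using ident_left[OF ident_hom[OF r] r] comp_scale[OF e(1) ident_hom[OF r] r]
  by (simp add: c gcomp_scale_left)
 hence "c * c = c" using e(2) c brick_not_zero[OF assms] by simp
 thus "e = 0 \<or> e = ident M" using c by (cases "c = 0") auto
qed

text \<open>A non-scalar endomorphism \<open>f\<close> has an eigenvalue \<open>c\<close> at some
  vertex; \<open>f - c\<close> is then nonzero but kills an eigenvector.\<close>

lemma nonbrick_endo:
 fixes M :: "('v, 'e, 'k::alg_closed_field) qrep"
 assumes "rep M" "~ zrep M" "~ brick M"
 obtains th v x where "th : Hom M M" "th ~= 0" "v : vs" "x : sp M v" "x ~= 0" "th v x = 0"
proof -
 have i0: "ident M ~= 0" using zero_rep_iff assms by blast
 have "EX f:Hom M M. ALL c. f ~= gscale c (ident M)"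
 proof (rule ccontr)
  assume "~ ?thesis"
  hence "Hom M M <= gvec.span {ident M}" by (auto simp: gvec.span_singleton)
  moreover have "gvec.span {ident M} <= Hom M M"
   using gvec.span_minimal[of "{ident M}" "Hom M M", OF _ hom_subspace[OF assms(1,1)]] ident_hom[OF assms(1)]
   by simp
  ultimately have "gvec.dim (Hom M M) = 1" using gvec.fd_span1(2)[OF i0] by simp
  thus False using assms by (simp add: brick_def)
 qed
 then obtain f where f: "f : Hom M M" "!!c. f ~= gscale c (ident M)" by blast
 obtain v where v: "v : vs" "sp M v ~= {0}" using assms(2) by (auto simp: zrep_def)
 obtain c x where x: "x : sp M v" "x ~= 0" "f v x = kscale c x"
  using eigenvector_exists[OF hom_lin[OF f(1) v(1)] rep_fd[OF assms(1) v(1)] v(2)] by blast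
 show ?thesis
 proof (rule that[of "f - gscale c (ident M)" v x])
  show "f - gscale c (ident M) : Hom M M"
   using assms(1) f(1) hom_diff hom_scale ident_hom by blast
  show "f - gscale c (ident M) ~= 0" using f(2)[of c] by simp
  show "(f - gscale c (ident M)) v x = 0"
   using x v by (simp add: minus_apply[of f] minus_apply[of "f v"] gscale_def rep_id_def)
 qed (use v x in auto)
qed

end

lemma gh_choice:
 assumes "!!i. i : I ==> EX f:lin_maps (A i) (B i). R i f"
 shows "EX f:gh I A B. ALL i:I. R i (f i)"
proof -
 have "ALL i. EX f. i : I --> f : lin_maps (A i) (B i) & R i f" using assms by blast
 then obtain f where f: "!!i. i : I --> f i : lin_maps (A i) (B i) & R i (f i)" by metis
 show ?thesis by (rule bexI[of _ "%i. if i : I then f i else 0"]) (use f in \<open>auto intro: ghI\<close>)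
qed

context quiver
begin

text \<open>The left inverse is a graded map only; in general it does not commute with the
  arrows.\<close>

lemma gh_left_inverse:
 assumes "rep M" "rep N" "f : Hom M N" "ALL v:vs. ALL x:sp M v. f v x = 0 --> x = 0"
 shows "EX s:C0 N M. ALL v:vs. ALL x:sp M v. s v (f v x) = x"
proof (rule gh_choice)
 fix v assume v: "v : vs"
 have i: "x = 0" if "x : sp M v" "f v x = 0" for x using assms(4) v that by blast
 obtain g where "g : lin_maps (sp N v) (sp M v)" "!!x. x : sp M v ==> g (f v x) = x"
  by (rule lin_maps_left_inverse[OF hom_lin[OF assms(3) v] rep_sub[OF assms(1) v] rep_sub[OF assms(2) v] i]) blast+
 thus "EX g:lin_maps (sp N v) (sp M v). ALL x:sp M v. g (f v x) = x" by blast
qed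

definition
 "riso M N \<longleftrightarrow> (EX f:Hom M N. EX g:Hom N M. gcomp g f = ident M & gcomp f g = ident N)"

lemma hom_inverse:
 assumes "rep M" "rep N" "f : Hom M N"
  and inj: "ALL v:vs. ALL x:sp M v. f v x = 0 --> x = 0"
  and surj: "!!v. v : vs ==> sp N v <= f v ` sp M v"
 obtains g where "g : Hom N M" "gcomp g f = ident M" "gcomp f g = ident N"
proof -
 obtain g where g0: "g : C0 N M" "ALL v:vs. ALL x:sp M v. g v (f v x) = x"
  using gh_left_inverse[OF assms(1-4)] by blast
 have gf: "g v (f v x) = x" if "v : vs" "x : sp M v" for v x using g0(2) that by blast
 have ex: "EX x:sp M v. y = f v x" if "v : vs" "y : sp N v" for v y using surj[OF that(1)] that(2) by blast
 have fg: "f v (g v y) = y" if "v : vs" "y : sp N v" for v y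
  using ex[OF that] gf[OF that(1)] by auto
 have g: "g : Hom N M"
 proof (rule homI[OF assms(2,1) g0(1)])
  fix d y assume d: "d : arcs Q" and y: "y : sp N (src d)"
  have v: "src d : vs" "tgt d : vs" using d by simp_all
  obtain x where x: "x : sp M (src d)" "y = f (src d) x" using ex[OF v(1) y] by blast
  have "act N d y = f (tgt d) (act M d x)" using hom_comm[OF assms(3) d] x by simp
  thus "g (tgt d) (act N d y) = act M d (g (src d) y)"
   using gf[OF v(2) act_mem[OF assms(1) d x(1)]] gf[OF v(1) x(1)] x(2) by simp
 qed
 moreover have "gcomp g f = ident M"
  by (rule hom_eqI[OF hom_comp[OF assms(3) g] ident_hom[OF assms(1)]]) (simp add: gcomp_def gf rep_id_def)
 moreover have "gcomp f g = ident N"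
  by (rule hom_eqI[OF hom_comp[OF g assms(3)] ident_hom[OF assms(2)]]) (simp add: gcomp_def fg rep_id_def)
 ultimately show ?thesis using that by blast
qed

lemma risoI:
 assumes "rep M" "rep N" "f : Hom M N"
  and "!!v x. v : vs ==> x : sp M v ==> f v x = 0 ==> x = 0" "!!v. v : vs ==> sp N v <= f v ` sp M v"
 shows "riso M N"
proof -
 have "ALL v:vs. ALL x:sp M v. f v x = 0 --> x = 0" using assms(4) by (intro ballI impI)
 thus ?thesis
  by (rule hom_inverse[OF assms(1-3) _ assms(5)]) (use assms(3) in \<open>auto simp: riso_def\<close>)
qed

lemma inj_surj_dim:
 assumes "rep M" "rep N" "f : Hom M N" "dimv M = dimv N" "v : vs"
 shows "(ALL x:sp M v. f v x = 0 --> x = 0) \<longleftrightarrow> f v ` sp M v = sp N v"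
proof -
 note l = lin_maps_lin_on[OF hom_lin[OF assms(3,5)]]
 note rn = rank_nullity[OF kvec_vs kvec_vs rep_fd[OF assms(1,5)] l]
 have d: "kvec.dim (sp M v) = kvec.dim (sp N v)"
  using fun_cong[OF assms(4), of v] assms(5) by (simp add: dimv_def)
 have sub: "f v ` sp M v <= sp N v" using hom_mem[OF assms(3,5)] by blast
 have 0: "f v 0 = 0" "0 : sp M v" using hom_zero[OF assms(3)] kvec.subspace_0[OF rep_sub[OF assms(1,5)]] by auto
 have fk: "kvec.fd {x : sp M v. f v x = 0}"
  using lin_on_kernel_subspace[OF kvec_vs kvec_vs rep_sub[OF assms(1,5)] l kvec.subspace_single_0]
  by (intro kvec.fd_sub(1)[OF rep_fd[OF assms(1,5)]]) auto
 show ?thesis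
 proof
  assume "ALL x:sp M v. f v x = 0 --> x = 0"
  hence "{x : sp M v. f v x = 0} = {0}" using 0 by blast
  hence "kvec.dim (f v ` sp M v) = kvec.dim (sp N v)" using rn(2) d by simp
  thus "f v ` sp M v = sp N v"
   using kvec.fd_sub(3)[OF rep_fd[OF assms(2,5)] kvec.fd_subspace[OF rn(1)] sub] by simp
 next
  assume "f v ` sp M v = sp N v"
  hence "kvec.dim {x : sp M v. f v x = 0} = 0" using rn(2) d by simp
  hence "{x : sp M v. f v x = 0} = {0}" using kvec.fd_dim_0[OF fk] by simp
  thus "ALL x:sp M v. f v x = 0 --> x = 0" by blast
 qed
qed

text \<open>\<open>Ext^1(-, N)\<close> turns monomorphisms into epimorphisms since there is no
  \<open>Ext^2\<close>. Concretely, a cocycle on \<open>I\<close> is extended to \<open>L\<close>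
  along a graded retraction \<open>s\<close> of \<open>f\<close>, and the solution found on
  \<open>L\<close> is restricted to \<open>I\<close>.\<close>

lemma ext0_mono:
 assumes I: "rep I" and L: "rep L" and N: "rep N" and f: "f : Hom I L" "ALL v:vs. ALL x:sp I v. f v x = 0 --> x = 0"
  and e: "ext0 L N"
 shows "ext0 I N"
 unfolding ext0_def
proof
 fix c assume c: "c : C1 I N"
 obtain s where s: "s : C0 L I" "ALL v:vs. ALL x:sp I v. s v (f v x) = x" using gh_left_inverse[OF I L f] by blast
 have "(%d. if d : arcs Q then c d o s (src d) else 0) : C1 L N"
  by (rule ghI) (simp_all add: lin_maps_comp[OF ghD[OF s(1)] ghD[OF c]])
 then obtain h where h: "h : C0 L N" "dd L N h = (%d. if d : arcs Q then c d o s (src d) else 0)"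
  using e unfolding ext0_def by blast
 have hf: "gcomp h f : C0 I N" by (rule gh_comp[OF hom_gh[OF f(1)] h(1)])
 have "dd I N (gcomp h f) = c"
 proof (rule gh_eqI[OF dd_C1[OF I N hf] c])
  fix d x assume d: "d : arcs Q" "x : sp I (src d)"
  have "dd I N (gcomp h f) d x = dd L N h d (f (src d) x)"
   using d by (simp add: dd_def gcomp_def hom_comm[OF f(1)])
  thus "dd I N (gcomp h f) d x = c d x" using d s(2) by (simp add: h(2))
 qed
 thus "EX h:C0 I N. dd I N h = c" using hf by blast
qed

lemma gh_lift:
 assumes "!!i. i : I ==> kvec.subspace (A i)" "!!i. i : I ==> kvec.subspace (C i)"
  "!!i. i : I ==> g i : lin_maps (A i) (B i)" "!!i. i : I ==> B i <= g i ` A i" "f : gh I C B"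
 shows "EX h:gh I C A. ALL i:I. ALL x:C i. g i (h i x) = f i x"
proof (rule gh_choice)
 fix i assume i: "i : I"
 have "f i ` C i <= g i ` A i" using lin_maps_mem[OF ghD[OF assms(5) i]] assms(4)[OF i] by blast
 then obtain h where "h : lin_maps (C i) (A i)" "!!x. x : C i ==> g i (h x) = f i x"
  by (rule lin_maps_lift[OF ghD[OF assms(5) i] assms(3)[OF i] _ assms(1,2)[OF i]]) blast
 thus "EX h:lin_maps (C i) (A i). ALL x:C i. g i (h x) = f i x" by blast
qed

text \<open>Dual to \<open>ext0_mono\<close>: a cocycle with values in \<open>N'\<close> is lifted
  to \<open>N\<close>, solved there and pushed forward.\<close>

lemma ext0_epi:
 assumes M: "rep M" and N: "rep N" and N': "rep N'" and g: "g : Hom N N'" "!!v. v : vs ==> sp N' v <= g v ` sp N v"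
  and e: "ext0 M N"
 shows "ext0 M N'"
 unfolding ext0_def
proof
 fix c assume c: "c : C1 M N'"
 have "EX b:C1 M N. ALL d:arcs Q. ALL x:sp M (src d). g (tgt d) (b d x) = c d x"
  by (rule gh_lift[OF _ _ _ _ c]) (simp_all add: rep_sub M N hom_lin[OF g(1)] g(2))
 then obtain b where b: "b : C1 M N" "ALL d:arcs Q. ALL x:sp M (src d). g (tgt d) (b d x) = c d x" by blast
 obtain h where h: "h : C0 M N" "dd M N h = b" using e b(1) unfolding ext0_def by blast
 have gh: "gcomp g h : C0 M N'" by (rule gh_comp[OF h(1) hom_gh[OF g(1)]])
 have "dd M N' (gcomp g h) = c"
 proof (rule gh_eqI[OF dd_C1[OF M N' gh] c])
  fix d x assume d: "d : arcs Q" and x: "x : sp M (src d)"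
  have v: "src d : vs" "tgt d : vs" using d by simp_all
  have "g (tgt d) (dd M N h d x) = dd M N' (gcomp g h) d x"
   using d x lin_maps_diff[OF hom_lin[OF g(1) v(2)] rep_sub[OF N v(2)] act_mem[OF N d lin_maps_mem[OF ghD[OF h(1) v(1)] x]]
    lin_maps_mem[OF ghD[OF h(1) v(2)] act_mem[OF M d x]]]
   by (simp add: dd_def gcomp_def hom_comm[OF g(1)])
  thus "dd M N' (gcomp g h) d x = c d x" using b(2) d x h(2) by simp
 qed
 thus "EX h:C0 M N'. dd M N' h = c" using gh by blast
qed

text \<open>The obstruction to extending \<open>p\<close> from the kernel of \<open>th\<close> to
  \<open>M\<close> lies in \<open>Ext^1(J, L)\<close>.\<close>

lemma hom_extend:
 assumes M: "rep M" and L: "rep L" and J: "rep J" and th: "th : Hom M J" "!!v. v : vs ==> sp J v <= th v ` sp M v"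
  and p: "p : Hom (sub_rep M (%v. {x : sp M v. th v x = 0})) L" and ext: "ext0 J L"
 shows "EX r:Hom M L. ALL v:vs. ALL x:sp M v. th v x = 0 --> r v x = p v x"
proof -
 let ?K = "%v. {x : sp M v. th v x = 0}"
 have sK: "subrep Q M ?K" by (rule subrep_kernel[OF M J th(1)])
 have "EX E:C0 M L. ALL v:vs. ALL x:?K v. E v x = p v x"
 proof (rule gh_choice)
  fix v assume v: "v : vs"
  obtain E where "E : lin_maps (sp M v) (sp L v)" "!!x. x : ?K v ==> E x = p v x"
   by (rule lin_maps_extend[OF rep_sub[OF M v] subrepD(1,2)[OF sK v]  hom_lin[OF p v, unfolded sp_sub_rep]]) blast
  thus "EX E:lin_maps (sp M v) (sp L v). ALL x:?K v. E x = p v x" by blast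
 qed
 then obtain E where E: "E : C0 M L" "ALL v:vs. ALL x:?K v. E v x = p v x" by blast
 have "EX t:C0 J M. ALL v:vs. ALL x:sp J v. th v (t v x) = ident J v x"
  by (rule gh_lift) (use rep_sub[OF M] rep_sub[OF J] hom_lin[OF th(1)] th(2) hom_gh[OF ident_hom[OF J]] in auto)
 then obtain t where t: "t : C0 J M" "ALL v:vs. ALL x:sp J v. th v (t v x) = x" by (auto simp: rep_id_def)
 note D = dd_C1[OF M L E(1)]
 have "(%d. if d : arcs Q then dd M L E d o t (src d) else 0) : C1 J L"
  by (rule ghI) (simp_all add: lin_maps_comp[OF ghD[OF t(1)] ghD[OF D]])
 then obtain h where h: "h : C0 J L" "dd J L h = (%d. if d : arcs Q then dd M L E d o t (src d) else 0)"
  using ext unfolding ext0_def by blast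
 \<comment> \<open>The defect of the graded extension \<open>E\<close> vanishes on the kernel of
   \<open>th\<close>, so it descends to a cocycle on \<open>J\<close>. Subtracting the solution
   \<open>h\<close> found there makes \<open>E\<close> a morphism without changing it on the
   kernel.\<close>
 define r where "r = E - gcomp h th"
 have rx: "r v x = E v x - h v (th v x)" for v x by (simp add: r_def gcomp_def minus_apply[of E] minus_apply[of "E v"])
 have r: "r : C0 M L" unfolding r_def
  by (rule gvec.subspace_diff[OF gh_subspace[OF rep_sub[OF L]] E(1) gh_comp[OF hom_gh[OF th(1)] h(1)]])
 have "r : Hom M L"
 proof (rule homI[OF M L r])
  fix d x assume d: "d : arcs Q" and x: "x : sp M (src d)"
  have v: "src d : vs" "tgt d : vs" using d by simp_all
  let ?y = "th (src d) x"
  have y: "?y : sp J (src d)" by (rule hom_mem[OF th(1) v(1) x])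
  have ty: "t (src d) ?y : sp M (src d)" by (rule lin_maps_mem[OF ghD[OF t(1) v(1)] y])
  let ?z = "x - t (src d) ?y"
  have z: "?z : ?K (src d)"
   using lin_maps_diff[OF hom_lin[OF th(1) v(1)] rep_sub[OF M v(1)] x ty] t(2) v(1) y
    kvec.subspace_diff[OF rep_sub[OF M v(1)] x ty] by simp
  have "dd M L E d ?z = act L d (p (src d) ?z) - p (tgt d) (act M d ?z)"
   using E(2) z subrepD(3)[OF sK d z] d v by (simp add: dd_def)
  also have "\<dots> = 0" using hom_comm[OF p d, of ?z] z by (simp add: act_sub_rep)
  finally have "dd M L E d x = dd J L h d ?y"
   using lin_maps_diff[OF ghD[OF D d] rep_sub[OF M v(1)] x ty] d by (simp add: h(2))
  hence "act L d (E (src d) x) - E (tgt d) (act M d x) = act L d (h (src d) ?y) - h (tgt d) (th (tgt d) (act M d x))"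
   using d by (simp add: dd_def hom_comm[OF th(1)])
  hence "act L d (E (src d) x) - act L d (h (src d) ?y) = E (tgt d) (act M d x) - h (tgt d) (th (tgt d) (act M d x))"
   by (simp add: algebra_simps)
  moreover have "act L d (r (src d) x) = act L d (E (src d) x) - act L d (h (src d) ?y)"
   unfolding rx using lin_maps_diff[OF act_lin[OF L d] rep_sub[OF L v(1)] lin_maps_mem[OF ghD[OF E(1) v(1)] x]
    lin_maps_mem[OF ghD[OF h(1) v(1)] y]] .
  ultimately show "r (tgt d) (act M d x) = act L d (r (src d) x)" by (simp add: rx[of "tgt d"])
 qed
 moreover have "h v 0 = 0" if "v : vs" for v by (rule lin_maps_zero[OF ghD[OF h(1) that]])
 ultimately show ?thesis using E(2) by (intro bexI[of _ r]) (simp_all add: rx)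
qed

text \<open>Ranks can only drop at each vertex, so a total rank that does not drop forces
  \<open>g\<close> to be injective on the image of \<open>f\<close> at every vertex.\<close>

lemma rank_comp_inj:
 assumes M: "rep M" and N: "rep N" and f: "f : Hom M N" and g: "g : C0 N L" and L: "rep L"
  and le: "rank M f <= rank M (gcomp g f)"
  and v: "v : vs" and x: "x : f v ` sp M v" "g v x = 0"
 shows "x = 0"
proof -
 let ?I = "%v. f v ` sp M v"
 have fd: "kvec.fd (?I u)" if "u : vs" for u by (rule image_fd[OF M hom_gh[OF f] that])
 have lin: "lin_on kscale kscale (?I u) (g u)" if "u : vs" for u
  by (rule lin_on_subset[OF lin_maps_lin_on[OF ghD[OF g that]]]) (use hom_mem[OF f that] in blast)
 note rn = rank_nullity(2)[OF kvec_vs kvec_vs fd lin]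
 have le1: "kvec.dim (g u ` ?I u) <= kvec.dim (?I u)" if "u : vs" for u using rn[OF that that] by linarith
 have "(SUM u:vs. kvec.dim (?I u)) <= (SUM u:vs. kvec.dim (g u ` ?I u))"
  using le by (simp add: rank_def gcomp_def image_comp o_def)
 hence "kvec.dim (g v ` ?I v) = kvec.dim (?I v)"
  by (intro sum_mono_inv[OF antisym[OF sum_mono[OF le1]] le1 v]) simp_all
 hence "kvec.dim {x : ?I v. g v x = 0} = 0" using rn[OF v v] by simp
 moreover have "kvec.fd {x : ?I v. g v x = 0}"
  using lin_on_kernel_subspace[OF kvec_vs kvec_vs kvec.fd_subspace[OF fd[OF v]] lin[OF v] kvec.subspace_single_0]
  by (intro kvec.fd_sub(1)[OF fd[OF v]]) auto
 ultimately have "{x : ?I v. g v x = 0} = {0}" using kvec.fd_dim_0 by blast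
 thus ?thesis using x by blast
qed

lemma tdim_sub_rep:
 assumes "rep M" "subrep Q M A"
 shows "tdim (sub_rep M A) <= tdim M" "v : vs ==> x : sp M v ==> x ~: A v ==> tdim (sub_rep M A) < tdim M"
proof -
 have le: "kvec.dim (A u) <= kvec.dim (sp M u)" if "u : vs" for u
  by (rule kvec.fd_sub(2)[OF rep_fd[OF assms(1) that] subrepD(1,2)[OF assms(2) that]])
 thus "tdim (sub_rep M A) <= tdim M" by (simp add: tdim_def sum_mono)
 assume v: "v : vs" "x : sp M v" "x ~: A v"
 hence "kvec.dim (A v) ~= kvec.dim (sp M v)"
  using kvec.fd_sub(3)[OF rep_fd[OF assms(1) v(1)] subrepD(1,2)[OF assms(2) v(1)]] by auto
 hence "kvec.dim (A v) < kvec.dim (sp M v)" using le[OF v(1)] by simp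
 thus "tdim (sub_rep M A) < tdim M" using le v(1) by (auto simp: tdim_def intro!: sum_strict_mono_ex1)
qed

text \<open>Splitting \<open>K\<close> by idempotents terminates by the total dimension; at each
  stage a summand in which \<open>x\<close> has a nonzero component is kept.\<close>

lemma indec_summand:
 assumes "rep K" "v : vs" "x : sp K v" "x ~= 0"
 shows "EX L i p. indec L & i : Hom L K & p : Hom K L & gcomp p i = ident L & p v x ~= 0 & tdim L <= tdim K"
 using assms
proof (induction "tdim K" arbitrary: K x rule: less_induct)
 case less
 note K = less.prems(1) and x = less.prems(2-4)
 have z: "~ zrep K" using x by (auto simp: zrep_def)
 show ?case
 proof (cases "indec K")
  case True
  have "ident K v x ~= 0" using x by (simp add: rep_id_def)
  thus ?thesis using True ident_hom[OF K] ident_left[OF ident_hom[OF K] K] by blast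
 next
  case False
  then obtain g where g: "g : Hom K K" "gcomp g g = g" "g ~= 0" "g ~= ident K"
   using K z unfolding rep_indec_iff by blast
  have g': "gcomp (ident K - g) (ident K - g) = ident K - g"
   using comp_diff[OF hom_diff[OF K K ident_hom[OF K] g(1)] ident_hom[OF K] g(1) K] g(2) ident_right[OF hom_diff[OF K K ident_hom[OF K] g(1)]]
    ident_left[OF g(1) K] by (simp add: gcomp_diff_left)
  \<comment> \<open>One of \<open>g\<close> and \<open>ident K - g\<close> does not kill
    \<open>x\<close>, and neither of them is the identity.\<close>
  have "EX e:Hom K K. gcomp e e = e & e ~= ident K & e v x ~= 0"
  proof (cases "g v x = 0")
   case True
   hence "(ident K - g) v x ~= 0" using x by (simp add: minus_apply rep_id_def)
   thus ?thesis using g(3) g' hom_diff[OF K K ident_hom[OF K] g(1)] by (intro bexI[of _ "ident K - g"]) auto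
  qed (use g in blast)
  then obtain e where e: "e : Hom K K" "gcomp e e = e" "e ~= ident K" "e v x ~= 0" by blast
  have ee: "e u (e u y) = e u y" for u y using fun_cong2[OF e(2)] by (simp add: gcomp_def)
  let ?A = "%v. e v ` sp K v"
  have sA: "subrep Q K ?A" by (rule subrep_image[OF K K e(1)])
  note A = sub_rep_rep[OF K sA]
  have "EX u:vs. EX y:sp K u. e u y ~= y"
  proof (rule ccontr)
   assume "~ ?thesis"
   hence "e = ident K" by (intro hom_eqI[OF e(1) ident_hom[OF K]]) (simp add: rep_id_def)
   thus False using e(3) by simp
  qed
  then obtain u y where uy: "u : vs" "y : sp K u" "e u y ~= y" by blast
  hence "y ~: ?A u" using ee by auto
  hence lt: "tdim (sub_rep K ?A) < tdim K" by (rule tdim_sub_rep(2)[OF K sA uy(1,2)])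
  obtain L i p where L: "indec L" "i : Hom L (sub_rep K ?A)" "p : Hom (sub_rep K ?A) L" "gcomp p i = ident L"
   "p v (e v x) ~= 0" "tdim L <= tdim (sub_rep K ?A)"
   using less.hyps[OF lt A x(1) _ e(4)] x(2) by auto
  have eA: "e : Hom K (sub_rep K ?A)" by (rule hom_sub_rep[OF K K sA e(1)]) simp
  have rL: "rep L" using L(1) by (simp add: rep_indec_def)
  have iK: "i : Hom L K" by (rule sub_rep_incl[OF rL K sA L(2)])
  have pe: "gcomp p e : Hom K L" by (rule hom_comp[OF eA L(3)])
  have "e u (i u y) = i u y" if "u : vs" "y : sp L u" for u y
   using hom_mem[OF L(2) that] ee by auto
  hence "gcomp (gcomp p e) i = gcomp p i"
   by (intro hom_eqI[OF hom_comp[OF iK pe] hom_comp[OF L(2,3)]]) (simp add: gcomp_def)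
  thus ?thesis using L lt iK pe by (intro exI[of _ L] exI[of _ i] exI[of _ "gcomp p e"]) (auto simp: gcomp_def)
 qed
qed

end

text \<open>Positivity of the Euler form is the one property of Dynkin quivers used for
  representations and for the derived category; it excludes loops, multiple arrows and oriented
  cycles.\<close>

locale positive_quiver = quiver Q for Q :: "('v, 'e) pre_digraph" +
 assumes eform_pos: "(!!v. v ~: vs ==> x v = 0) ==> x ~= 0 ==> eform x x > 0"
begin

lemma dimv_nonzero: "rep M ==> ~ zrep M ==> dimv M ~= 0"
proof
 assume M: "rep M" "~ zrep M" "dimv M = 0"
 have "sp M v = {0}" if v: "v : vs" for v
  using fun_cong[OF M(3), of v] v kvec.fd_dim_0[OF rep_fd[OF M(1) v]] by (simp add: dimv_def fun_ops)
 thus False using M(2) by (simp add: zrep_def)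
qed

lemma dimv_eform_pos: "rep M ==> ~ zrep M ==> eform (dimv M) (dimv M) >= 1"
 using eform_pos[of "dimv M"] dimv_nonzero[of M] by (simp add: dimv_def)

text \<open>The form is at least 1 at a nonzero dimension vector and at most the dimension 1 of the
  endomorphism space; equality means \<open>Ext^1(M, M) = 0\<close>.\<close>

lemma brick_rigid:
 assumes "brick M"
 shows "ext0 M M" "eform (dimv M) (dimv M) = 1"
proof -
 have r: "rep M" using assms by (simp add: brick_def)
 have "eform (dimv M) (dimv M) >= 1"
  using dimv_eform_pos[OF r] zero_rep_iff[OF r] brick_not_zero[OF assms] by blast
 thus "eform (dimv M) (dimv M) = 1" using euler(1)[OF r r] assms by (simp add: brick_def)
 thus "ext0 M M" using euler(2)[OF r r] assms by (simp add: brick_def)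
qed

text \<open>
 If \<open>M\<close> is not a brick, a nonzero non-invertible endomorphism \<open>th\<close> of minimal rank has square zero.
 By minimality the projection to some indecomposable summand \<open>L\<close> of its kernel is injective on its
 image \<open>I\<close>. By induction \<open>L\<close> is rigid, hence \<open>Ext\<^sup>1(I, L) = 0\<close>, and \<open>L\<close> splits off \<open>M\<close>.
\<close>

theorem indec_brick:
 fixes M :: "('v, 'e, 'k::alg_closed_field) qrep"
 assumes "indec M"
 shows "brick M"
 using assms
proof (induction "tdim M" arbitrary: M rule: less_induct)
 case less
 have M: "rep M" "~ zrep M" using less.prems by (simp_all add: rep_indec_def)
 have idem: "e = 0 \<or> e = ident M" if "e : Hom M M" "gcomp e e = e" for e
  using less.prems that unfolding rep_indec_iff by blast
 show ?case
 proof (rule ccontr)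
  assume nb: "~ brick M"
  define P where "P th \<longleftrightarrow> th : Hom M M & th ~= 0 & (EX v:vs. EX x:sp M v. x ~= 0 & th v x = 0)" for th
  have "EX th. P th" using nonbrick_endo[OF M nb] unfolding P_def by metis
  then obtain th where Pth: "P th" and min: "!!\<psi>. P \<psi> ==> rank M th <= rank M \<psi>"
   using ex_has_least_nat[of P _ "rank M"] by blast
  have th: "th : Hom M M" "th ~= 0" using Pth by (auto simp: P_def)
  obtain v0 x0 where v0: "v0 : vs" "x0 : sp M v0" "x0 ~= 0" "th v0 x0 = 0" using Pth by (auto simp: P_def)
  \<comment> \<open>Nonzero composites \<open>g th\<close> still kill \<open>x0\<close>, so they
    compete with \<open>th\<close> for the minimal rank.\<close>
  have minc: "rank M th <= rank M (gcomp g th)" if "g : Hom N M" "th : Hom M N" "gcomp g th ~= 0" for g N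
  proof (rule min)
   have "gcomp g th v0 x0 = 0" using v0(4) hom_zero[OF that(1)] by (simp add: gcomp_def)
   thus "P (gcomp g th)" using hom_comp[OF that(2,1)] that(3) v0 unfolding P_def by blast
  qed
  have "EX v:vs. EX x:sp M v. th v x ~= 0"
  proof (rule ccontr)
   assume "~ ?thesis"
   hence "th = 0" by (intro hom_eqI[OF th(1) hom_0[OF M(1,1)]]) (auto simp: fun_ops)
   thus False using th(2) by simp
  qed
  then obtain v1 x1 where v1: "v1 : vs" "x1 : sp M v1" "th v1 x1 ~= 0" by blast
  define I where "I = (%v. th v ` sp M v)"
  define K where "K = (%v. {x : sp M v. th v x = 0})"
  have sI: "subrep Q M I" using subrep_image[OF M(1) M(1) th(1)] by (simp add: I_def)
  have sK: "subrep Q M K" using subrep_kernel[OF M(1) M(1) th(1)] by (simp add: K_def)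
  have IR: "rep (sub_rep M I)" and KR: "rep (sub_rep M K)" by (rule sub_rep_rep[OF M(1) sI] sub_rep_rep[OF M(1) sK])+
  have thI: "th : Hom M (sub_rep M I)" by (rule hom_sub_rep[OF M(1,1) sI th(1)]) (simp add: I_def)
  \<comment> \<open>Otherwise minimality would make \<open>th\<close> injective on its image
    \<open>I\<close>, hence invertible there. With \<open>g\<close> the inverse, \<open>g th\<close>
    is an idempotent that kills \<open>x0\<close> without being 0.\<close>
  have sq: "gcomp th th = 0"
  proof (rule ccontr)
   assume n0: "gcomp th th ~= 0"
   let ?t = "restr I th"
   have t: "?t : Hom (sub_rep M I) (sub_rep M I)" by (rule restr_hom[OF IR M(1) sI thI])
   have inj: "ALL x:sp (sub_rep M I) v. ?t v x = 0 --> x = 0" if v: "v : vs" for v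
    using rank_comp_inj[OF M(1,1) th(1) hom_gh[OF th(1)] M(1) minc[OF th(1,1) n0] v] v by (auto simp: restr_def I_def)
   have surj: "sp (sub_rep M I) v <= ?t v ` sp (sub_rep M I) v" if v: "v : vs" for v
    using inj_surj_dim[OF IR IR t refl v] inj[OF v] by blast
   obtain g where g: "g : Hom (sub_rep M I) (sub_rep M I)" "gcomp g ?t = ident (sub_rep M I)"
    by (rule hom_inverse[OF IR IR t _ surj]) (use inj in blast)+
   have gt: "g v (th v y) = y" if "v : vs" "y : I v" for v y
    using fun_cong2[OF g(2), of v, of y] that by (simp add: gcomp_def restr_def rep_id_def)
   note eI = hom_comp[OF thI g(1)]
   have eM: "gcomp g th : Hom M M" by (rule sub_rep_incl[OF M(1,1) sI eI])
   have "gcomp (gcomp g th) (gcomp g th) = gcomp g th"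
   proof (rule hom_eqI[OF hom_comp[OF eM eM] eM])
    fix v x assume v: "v : vs" "x : sp M v"
    show "gcomp (gcomp g th) (gcomp g th) v x = gcomp g th v x"
     using gt[OF v(1) hom_mem[OF eI v, unfolded sp_sub_rep]] by (simp add: gcomp_def)
   qed
   from idem[OF eM this] show False
   proof
    assume 0: "gcomp g th = 0"
    have y: "th v1 x1 : I v1" using v1 by (simp add: I_def)
    have "g v1 (th v1 (th v1 x1)) = 0" using fun_cong2[OF 0, of v1] by (simp add: gcomp_def fun_ops)
    thus False using gt[OF v1(1) y] v1(3) by simp
   next
    assume 1: "gcomp g th = ident M"
    have "gcomp g th v0 x0 = 0" using v0(4) hom_zero[OF g(1)] by (simp add: gcomp_def)
    thus False using v0 by (simp add: 1 rep_id_def)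
   qed
  qed
  have sq': "th v (th v x) = 0" for v x using fun_cong2[OF sq] by (simp add: gcomp_def fun_ops)
  have IK: "I v <= K v" if "v : vs" for v using sq' hom_mem[OF th(1) that] by (auto simp: I_def K_def)
  have thK: "th : Hom M (sub_rep M K)" by (rule hom_sub_rep[OF M(1,1) sK th(1)]) (use IK I_def in blast)
  have y1: "th v1 x1 : sp (sub_rep M K) v1" using IK[OF v1(1)] v1 by (auto simp: I_def)
  \<comment> \<open>The summand \<open>L\<close> is chosen so that the component of
    \<open>th x1\<close> in it is nonzero; this keeps \<open>i p th\<close> from vanishing, as
    \<open>minc\<close> requires.\<close>
  obtain L i p where L: "indec L" "i : Hom L (sub_rep M K)" "p : Hom (sub_rep M K) L" "gcomp p i = ident L"
   "p v1 (th v1 x1) ~= 0" "tdim L <= tdim (sub_rep M K)"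
   using indec_summand[OF KR v1(1) y1 v1(3)] by blast
  have rL: "rep L" "~ zrep L" using L(1) by (simp_all add: rep_indec_def)
  have pi: "p v (i v y) = y" if "v : vs" "y : sp L v" for v y
   using fun_cong2[OF L(4), of v, of y] that by (simp add: gcomp_def rep_id_def)
  have "tdim (sub_rep M K) < tdim M"
   by (rule tdim_sub_rep(2)[OF M(1) sK v1(1,2)]) (use v1(3) in \<open>simp add: K_def\<close>)
  hence rigid: "ext0 L L" using less.hyps[OF _ L(1)] L(6) brick_rigid(1) by force
  have iM: "i : Hom L M" by (rule sub_rep_incl[OF rL(1) M(1) sK L(2)])
  note ip = hom_comp[OF L(3) iM]
  have "i v1 (p v1 (th v1 x1)) ~= 0"
  proof
   assume "i v1 (p v1 (th v1 x1)) = 0"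
   hence "p v1 (i v1 (p v1 (th v1 x1))) = 0" using hom_zero[OF L(3)] by simp
   thus False using pi[OF v1(1) hom_mem[OF L(3) v1(1) y1]] L(5) by simp
  qed
  hence "gcomp (gcomp i p) th v1 x1 ~= 0" by (simp add: gcomp_def)
  hence ne: "gcomp (gcomp i p) th ~= 0" by (auto simp: fun_ops)
  have pI: "restr I p : Hom (sub_rep M I) L"
  proof -
   have "ident (sub_rep M I) : Hom (sub_rep M I) (sub_rep M K)"
    by (rule hom_sub_rep[OF IR M(1) sK sub_rep_incl[OF IR M(1) sI ident_hom[OF IR]]]) (use IK in \<open>auto simp: rep_id_def\<close>)
   moreover have "gcomp p (ident (sub_rep M I)) = restr I p"
    by (auto simp: fun_eq_iff gcomp_def rep_id_def restr_def hom_zero[OF L(3)])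
   ultimately show ?thesis using hom_comp[OF _ L(3)] by metis
  qed
  have "ext0 (sub_rep M I) L"
  proof (intro ext0_mono[OF IR rL(1,1) pI _ rigid] ballI impI)
   fix v x assume v: "v : vs" and x: "x : sp (sub_rep M I) v" "restr I p v x = 0"
   hence "gcomp i p v x = 0" using hom_zero[OF iM] by (simp add: restr_def gcomp_def)
   thus "x = 0"
    using rank_comp_inj[OF M(1) KR thK hom_gh[OF ip] M(1) minc[OF ip thK ne] v] x by (simp add: I_def)
  qed
  then obtain r where r: "r : Hom M L" "ALL v:vs. ALL x:sp M v. th v x = 0 --> r v x = p v x"
   using hom_extend[OF M(1) rL(1) IR thI _ L(3)[unfolded K_def]] by (auto simp: I_def)
  have iK: "i v y : sp M v" "th v (i v y) = 0" if "v : vs" "y : sp L v" for v y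
   using hom_mem[OF L(2) that] by (simp_all add: K_def)
  have ri: "r v (i v y) = y" if "v : vs" "y : sp L v" for v y using r(2) iK[OF that] pi[OF that] that(1) by simp
  note ir = hom_comp[OF r(1) iM]
  have "gcomp (gcomp i r) (gcomp i r) = gcomp i r"
  proof (rule hom_eqI[OF hom_comp[OF ir ir] ir])
   fix v x assume v: "v : vs" "x : sp M v"
   show "gcomp (gcomp i r) (gcomp i r) v x = gcomp i r v x"
    using ri[OF v(1) hom_mem[OF r(1) v]] by (simp add: gcomp_def)
  qed
  from idem[OF ir this] show False
  proof
   assume 0: "gcomp i r = 0"
   let ?y = "p v1 (th v1 x1)"
   have y: "?y : sp L v1" by (rule hom_mem[OF L(3) v1(1) y1])
   have "gcomp i r v1 (i v1 ?y) = i v1 ?y" using ri[OF v1(1) y] by (simp add: gcomp_def)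
   thus False using \<open>i v1 ?y \<noteq> 0\<close> by (simp add: 0 fun_ops)
  next
   \<comment> \<open>Then \<open>M\<close> would equal the image of \<open>i\<close>, which lies in
     the kernel of \<open>th\<close>.\<close>
   assume 1: "gcomp i r = ident M"
   have "i v1 (r v1 x1) = x1" using fun_cong2[OF 1, of v1, of x1] v1 by (simp add: gcomp_def rep_id_def)
   thus False using iK(2)[OF v1(1) hom_mem[OF r(1) v1(1,2)]] v1(3) by simp
  qed
 qed
qed

end

section \<open>Existence and uniqueness of indecomposables with a given dimension vector\<close>

lemma dim_le_of_kernel_image:
 assumes "vector_space s1" "vector_space s2" "vector_space.fd s1 U" "vector_space.fd s1 V" "lin_on s1 s2 U T" "lin_on s1 s2 V T"
  and "{x : U. T x = 0} = {x : V. T x = 0}" "T ` U <= T ` V"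
 shows "vector_space.dim s1 U <= vector_space.dim s1 V" "T ` U ~= T ` V ==> vector_space.dim s1 U < vector_space.dim s1 V"
proof -
 interpret vs2: vector_space s2 by fact
 note u = rank_nullity[OF assms(1-3,5)] and v = rank_nullity[OF assms(1,2,4,6)]
 note s = vs2.fd_sub[OF v(1) vs2.fd_subspace[OF u(1)] assms(8)]
 show "vector_space.dim s1 U <= vector_space.dim s1 V" using u(2) v(2) assms(7) s(2) by simp
 show "T ` U ~= T ` V ==> vector_space.dim s1 U < vector_space.dim s1 V"
  using u(2) v(2) assms(7) s(2,3) by fastforce
qed

context quiver
begin

lemma hom_iff:
 "rep M ==> rep N ==> f : Hom M N \<longleftrightarrow>
  f : C0 M N & (ALL d:arcs Q. ALL x:sp M (src d). f (tgt d) (act M d x) = act N d (f (src d) x))"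
 using homI[of M N f] hom_gh[of f M N] hom_comm[of f M N] by blast

text \<open>
 Deforming \<open>M = A \<oplus> B\<close> along a cocycle \<open>c: B \<rightarrow> A\<close> that is not a coboundary lowers the dimension of
 the endomorphism space. The idempotent \<open>p\<close> is the projection to \<open>A\<close>. The deformation \<open>E\<close> is an
 extension of \<open>B\<close> by \<open>A\<close>, so that \<open>dim Hom(E, E) \<le> dim Hom(M, E) < dim Hom(M, M)\<close>, where the second
 inequality is strict because \<open>M \<rightarrow> B\<close> does not lift to \<open>E\<close>.
\<close>

definition
 "deform M c = \<lparr>sp = sp M, act = (%d. act M d + c d)\<rparr>"

lemma sp_deform [simp]: "sp (deform M c) = sp M"
 and act_deform: "act (deform M c) d x = act M d x + c d x"
 by (simp_all add: deform_def plus_fun_apply)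

lemma deform_rep: assumes "rep M" "c : C1 M M" shows "rep (deform M c)"
 unfolding is_rep_def
proof (intro conjI ballI)
 show "fd_subspace (sp (deform M c) v)" if "v : vs" for v
  using rep_fd[OF assms(1) that] by (simp add: fd_subspace_iff)
 fix d assume d: "d : arcs Q"
 hence v: "tgt d : vs" by simp
 show "act (deform M c) d : lin_maps (sp (deform M c) (src d)) (sp (deform M c) (tgt d))"
  using lin_maps_plus[OF act_lin[OF assms(1) d] ghD[OF assms(2) d] rep_sub[OF assms(1) v]]
  by (simp add: deform_def)
qed

lemma deform_dim_end:
 fixes M :: "('v, 'e, 'k::field) qrep"
 assumes M: "rep M" and p: "p : Hom M M" "gcomp p p = p" and c: "c : C1 M M"
  and pc: "!!d x. d : arcs Q ==> x : sp M (src d) ==> p (tgt d) (c d x) = c d x"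
  and cp: "!!d x. d : arcs Q ==> x : sp M (src d) ==> c d (p (src d) x) = 0"
  and nc: "!!h. h : C0 M M ==> (!!v x. v : vs ==> x : sp M v ==> p v (h v x) = h v x) ==>
   EX d:arcs Q. EX x:sp M (src d). act M d (h (src d) x) - h (tgt d) (act M d x) ~= c d x"
 shows "gvec.dim (Hom (deform M c) (deform M c)) < gvec.dim (Hom M M)"
proof -
 define E where "E = deform M c"
 have E: "rep E" unfolding E_def by (rule deform_rep[OF M c])
 have spE [simp]: "sp E = sp M" by (simp add: E_def)
 have actE: "act E d x = act M d x + c d x" for d x by (simp add: E_def act_deform)
 define q where "q = ident M - p"
 have q: "q : Hom M M" unfolding q_def by (rule hom_diff[OF M M ident_hom[OF M] p(1)])
 have qx: "q v x = x - p v x" if "v : vs" "x : sp M v" for v x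
  using that by (simp add: q_def minus_apply rep_id_def)
 have pp: "p v (p v x) = p v x" for v x using fun_cong2[OF p(2)] by (simp add: gcomp_def)
 note pm = hom_mem[OF p(1)]
 have qp: "q v (p v x) = 0" if "v : vs" "x : sp M v" for v x using qx[OF that(1) pm[OF that]] pp by simp
 have qq: "gcomp q q = q"
 proof (rule hom_eqI[OF hom_comp[OF q q] q])
  fix v x assume v: "v : vs" "x : sp M v"
  show "gcomp q q v x = q v x"
   using lin_maps_diff[OF hom_lin[OF q v(1)] rep_sub[OF M v(1)] v(2) pm[OF v]] qp[OF v] qx[OF v] by (simp add: gcomp_def)
 qed
 have cm: "c d x : sp M (tgt d)" if "d : arcs Q" "x : sp M (src d)" for d x
  using lin_maps_mem[OF ghD[OF c that(1)] that(2)] .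
 have qc: "q (tgt d) (c d x) = 0" if "d : arcs Q" "x : sp M (src d)" for d x
  using qx[OF _ cm[OF that]] pc[OF that] that by simp
 have fc: "f (tgt d) (act E d x) = f (tgt d) (act M d x) + f (tgt d) (c d x)"
  if "f : C0 M M" "d : arcs Q" "x : sp M (src d)" for f d x
  using lin_maps_add[OF ghD[OF that(1)] act_mem[OF M that(2,3)] cm[OF that(2,3)]] that(2) by (simp add: actE)
 have pE: "p : Hom M E"
  by (rule homI[OF M E]) (simp_all add: hom_gh[OF p(1)] hom_comm[OF p(1)] actE cp)
 have qE: "q : Hom E M"
  by (rule homI[OF E M]) (simp_all add: hom_gh[OF q] fc qc hom_comm[OF q])
 have C: "f : C0 M M" if "f : Hom E E \<or> f : Hom M E" for f using that hom_gh by fastforce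
 \<comment> \<open>Compared along composition with \<open>p\<close>: a map \<open>f\<close> with
   \<open>f p = 0\<close> kills the image of \<open>c\<close>, so it does not see the difference
   between the actions of \<open>M\<close> and \<open>E\<close> on its source.\<close>
 have "gvec.dim (Hom E E) <= gvec.dim (Hom M E)"
 proof (rule dim_le_of_kernel_image(1)[OF gvec_vs gvec_vs hom_fd[OF E E] hom_fd[OF M E]])
  let ?T = "%f. gcomp f p"
  show "lin_on gscale gscale (Hom E E) ?T" "lin_on gscale gscale (Hom M E) ?T"
   by (simp_all add: lin_on_def gcomp_add_left gcomp_scale_left)
  show "?T ` Hom E E <= ?T ` Hom M E"
  proof (rule image_subsetI)
   fix f assume "f : Hom E E"
   moreover have "?T f = ?T (?T f)" by (simp add: gcomp_assoc[symmetric] p(2))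
   ultimately show "?T f : ?T ` Hom M E" using hom_comp[OF pE] by blast
  qed
  have "f : Hom E E \<longleftrightarrow> f : Hom M E" if f: "f : C0 M M" "?T f = 0" for f
  proof -
   have "f (tgt d) (c d x) = 0" if "d : arcs Q" "x : sp M (src d)" for d x
    using fun_cong2[OF f(2), of "tgt d", of "c d x"] pc[OF that] by (simp add: gcomp_def fun_ops)
   hence e: "f (tgt d) (act E d x) = f (tgt d) (act M d x)" if "d : arcs Q" "x : sp M (src d)" for d x
    using fc[OF f(1) that] that by simp
   show ?thesis
    unfolding hom_iff[OF E E] hom_iff[OF M E] using e by simp
  qed
  thus "{f : Hom E E. ?T f = 0} = {f : Hom M E. ?T f = 0}" using C by blast
 qed
 \<comment> \<open>Compared along composition with \<open>q\<close>: a map with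
   \<open>q f = 0\<close> takes its values in the image of \<open>p\<close>, where \<open>c\<close>
   vanishes, so the actions on its target agree.\<close>
 also have "\<dots> < gvec.dim (Hom M M)"
 proof (rule dim_le_of_kernel_image(2)[OF gvec_vs gvec_vs hom_fd[OF M E] hom_fd[OF M M]])
  let ?T = "%f. gcomp q f"
  show "lin_on gscale gscale (Hom M E) ?T" "lin_on gscale gscale (Hom M M) ?T"
   by (simp_all add: lin_on_def comp_add[OF qE] comp_scale[OF qE] comp_add[OF q] comp_scale[OF q] M E)
  show "?T ` Hom M E <= ?T ` Hom M M"
  proof (rule image_subsetI)
   fix f assume "f : Hom M E"
   moreover have "?T f = ?T (?T f)" by (simp add: gcomp_assoc qq)
   ultimately show "?T f : ?T ` Hom M M" using hom_comp[OF _ qE] by blast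
  qed
  have px: "y = p v y + q v y" if "v : vs" "y : sp M v" for v y using qx[OF that] by simp
  have "f : Hom M E \<longleftrightarrow> f : Hom M M" if f: "f : C0 M M" "?T f = 0" for f
  proof -
   have "act E d (f (src d) x) = act M d (f (src d) x)" if d: "d : arcs Q" "x : sp M (src d)" for d x
   proof -
    have v: "src d : vs" using d by simp
    have m: "f (src d) x : sp M (src d)" using lin_maps_mem[OF ghD[OF f(1) v] d(2)] .
    have "q (src d) (f (src d) x) = 0" using fun_cong2[OF f(2)] by (simp add: gcomp_def fun_ops)
    hence "f (src d) x = p (src d) (f (src d) x)" using px[OF v m] by simp
    hence "c d (f (src d) x) = 0" using cp[OF d(1) m] by simp
    thus ?thesis by (simp add: actE)
   qed
   thus ?thesis
    unfolding hom_iff[OF M E] hom_iff[OF M M] by simp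
  qed
  thus "{f : Hom M E. ?T f = 0} = {f : Hom M M. ?T f = 0}" using C hom_gh by blast
  \<comment> \<open>A morphism \<open>f\<close> into \<open>E\<close> with \<open>q f = q\<close>
    would make \<open>c\<close> the coboundary of \<open>- p f\<close>.\<close>
  show "?T ` Hom M E ~= ?T ` Hom M M"
  proof
   assume "?T ` Hom M E = ?T ` Hom M M"
   moreover have "q : ?T ` Hom M M" using q qq by force
   ultimately obtain f where f: "f : Hom M E" "gcomp q f = q" by (metis imageE)
   define h where "h = - gcomp p f"
   have hx: "h v x = - p v (f v x)" for v x by (simp add: h_def fun_ops gcomp_apply)
   have "h : C0 M M" unfolding h_def
    using gvec.subspace_neg[OF gh_subspace[OF rep_sub[OF M]] gh_comp[OF C hom_gh[OF p(1)]]] f(1) by simp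
   then obtain d x where d: "d : arcs Q" "x : sp M (src d)"
    and ne: "act M d (- p (src d) (f (src d) x)) + p (tgt d) (f (tgt d) (act M d x)) ~= c d x"
    using nc[of h] lin_maps_uminus[OF hom_lin[OF p(1)] pm] hom_mem[OF f(1)] pp by (auto simp: hx)
   have v: "src d : vs" "tgt d : vs" using d by simp_all
   have qf: "q v (f v y) = q v y" for v y using fun_cong2[OF f(2)] by (simp add: gcomp_def)
   have f1: "f v y = p v (f v y) + q v y" if "v : vs" "y : sp M v" for v y
    using px[OF that(1) hom_mem[OF f(1) that, unfolded spE]] unfolding qf .
   let ?y = "f (src d) x"
   have y: "?y : sp M (src d)" using hom_mem[OF f(1) v(1) d(2)] by simp
   have qd: "q (src d) x : sp M (src d)" using hom_mem[OF q v(1) d(2)] .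
   have "c d ?y = c d (q (src d) x)"
    using f1[OF v(1) d(2)] lin_maps_add[OF ghD[OF c d(1)] pm[OF v(1) y] qd] cp[OF d(1) y] by simp
   also have "\<dots> = c d x"
    using lin_maps_diff[OF ghD[OF c d(1)] rep_sub[OF M v(1)] d(2) pm[OF v(1) d(2)]] cp[OF d] qx[OF v(1) d(2)] by simp
   finally have "f (tgt d) (act M d x) = act M d ?y + c d x" using hom_comm[OF f(1) d(1)] by (simp add: actE)
   moreover have "act M d ?y = act M d (p (src d) ?y) + q (tgt d) (act M d x)"
    using f1[OF v(1) d(2)] lin_maps_add[OF act_lin[OF M d(1)] pm[OF v(1) y] qd] hom_comm[OF q d(1)] by simp
   moreover have "f (tgt d) (act M d x) = p (tgt d) (f (tgt d) (act M d x)) + q (tgt d) (act M d x)"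
    by (rule f1[OF v(2) act_mem[OF M d]])
   ultimately have "p (tgt d) (f (tgt d) (act M d x)) = act M d (p (src d) ?y) + c d x" by simp
   thus False
    using ne lin_maps_uminus[OF act_lin[OF M d(1)] pm[OF v(1) y]] by simp
  qed
 qed
 finally show ?thesis by (simp add: E_def)
qed

end

context quiver
begin

lemma eform_add: "eform (a + b) c = eform a c + eform b c" "eform c (a + b) = eform c a + eform c b"
 by (simp_all add: eform_def plus_fun_apply sum.distrib distrib_left distrib_right)

lemma hom_to_zero: "f : Hom M N ==> zrep N ==> f = 0"
proof (rule ext, rule ext)
 fix v x assume f: "f : Hom M N" and N: "zrep N"
 show "f v x = 0 v x"
 proof (cases "v : vs & x : sp M v")
  case True
  thus ?thesis using hom_mem[OF f] N by (auto simp: zrep_def fun_ops)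
 next
  case False
  thus ?thesis using hom_out[OF f] lin_maps_out[OF hom_lin[OF f]] by (cases "v : vs") (auto simp: fun_ops)
 qed
qed

lemma dimv_deform: "dimv (deform M c) = dimv M"
 by (rule ext) (simp add: dimv_def)

lemma idem_dimv:
 assumes "rep M" "e : Hom M M" "gcomp e e = e"
 shows "dimv M = dimv (sub_rep M (%v. e v ` sp M v)) + dimv (sub_rep M (%v. (ident M - e) v ` sp M v))"
proof (rule ext)
 fix v
 have ee: "e v (e v x) = e v x" for x using fun_cong2[OF assms(3)] by (simp add: gcomp_def)
 show "dimv M v = (dimv (sub_rep M (%v. e v ` sp M v)) + dimv (sub_rep M (%v. (ident M - e) v ` sp M v))) v"
 proof (cases "v : vs")
  case v: True
  have q: "(ident M - e) v x = x - e v x" if "x : sp M v" for x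
   using that v by (simp add: minus_apply rep_id_def)
  have "{x : sp M v. e v x = 0} = (ident M - e) v ` sp M v"
  proof (intro equalityI subsetI)
   fix x assume "x : {x : sp M v. e v x = 0}"
   hence "x : sp M v" "x = (ident M - e) v x" using q by auto
   thus "x : (ident M - e) v ` sp M v" by blast
  next
   fix y assume "y : (ident M - e) v ` sp M v"
   then obtain x where x: "x : sp M v" "y = x - e v x" using q by auto
   note m = hom_mem[OF assms(2) v x(1)]
   have "e v y = 0" using lin_maps_diff[OF hom_lin[OF assms(2) v] rep_sub[OF assms(1) v] x(1) m] ee x(2) by simp
   thus "y : {x : sp M v. e v x = 0}" using kvec.subspace_diff[OF rep_sub[OF assms(1) v] x(1) m] x(2) by simp
  qed
  thus ?thesis
   using rank_nullity(2)[OF kvec_vs kvec_vs rep_fd[OF assms(1) v] lin_maps_lin_on[OF hom_lin[OF assms(2) v]]] v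
   by (simp add: dimv_def plus_fun_apply)
 qed (simp add: dimv_def plus_fun_apply)
qed

text \<open>If some cocycle from the complement of the image of \<open>p\<close> to that image were
  not a coboundary, deforming along it would lower the dimension of the endomorphism space below the
  minimum.\<close>

lemma min_end_ext0:
 fixes M :: "('v, 'e, 'k::field) qrep"
 assumes M: "rep M" and min: "!!c. c : C1 M M ==> gvec.dim (Hom M M) <= gvec.dim (Hom (deform M c) (deform M c))"
  and p: "p : Hom M M" "gcomp p p = p"
 shows "ext0 (sub_rep M (%v. (ident M - p) v ` sp M v)) (sub_rep M (%v. p v ` sp M v))"
proof -
 define q where "q = ident M - p"
 define A where "A v = p v ` sp M v" for v
 define B where "B v = q v ` sp M v" for v
 have q: "q : Hom M M" unfolding q_def by (rule hom_diff[OF M M ident_hom[OF M] p(1)])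
 have qx: "q v x = x - p v x" if "v : vs" "x : sp M v" for v x
  using that by (simp add: q_def minus_apply rep_id_def)
 have pp: "p v (p v x) = p v x" for v x using fun_cong2[OF p(2)] by (simp add: gcomp_def)
 have sA: "subrep Q M A" using subrep_image[OF M M p(1)] by (simp add: A_def[abs_def])
 have sB: "subrep Q M B" using subrep_image[OF M M q] by (simp add: B_def[abs_def])
 have pA: "p v x = x" if "x : A v" for v x using that pp by (auto simp: A_def)
 have AM: "A v <= sp M v" and BM: "B v <= sp M v" if "v : vs" for v
  using subrepD(2)[OF sA that] subrepD(2)[OF sB that] by auto
 have qB: "q v x = x" "p v x = 0" if vx: "v : vs" "x : B v" for v x
 proof -
  obtain y where y: "y : sp M v" "x = y - p v y" using vx(2) qx[OF vx(1)] by (auto simp: B_def)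
  show "p v x = 0"
   using lin_maps_diff[OF hom_lin[OF p(1) vx(1)] rep_sub[OF M vx(1)] y(1) hom_mem[OF p(1) vx(1) y(1)]] pp y(2) by simp
  thus "q v x = x" using qx[OF vx(1)] BM[OF vx(1)] vx(2) by auto
 qed
 have qm: "q v x : B v" if "x : sp M v" for v x using that by (simp add: B_def)
 have "EX h:C0 (sub_rep M B) (sub_rep M A). dd (sub_rep M B) (sub_rep M A) h = c"
  if c: "c : C1 (sub_rep M B) (sub_rep M A)" for c
 proof -
  \<comment> \<open>The cocycle is extended to \<open>M\<close> by the projection \<open>q\<close>
    to \<open>B\<close>, so that it kills \<open>A\<close> and takes its values in
    \<open>A\<close>.\<close>
  define c' where "c' d = (if d : arcs Q then c d o q (src d) else 0)" for d
  have c'm: "c' d : lin_maps (sp M (src d)) (A (tgt d))" if d: "d : arcs Q" for d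
  proof -
   have "q (src d) : lin_maps (sp M (src d)) (B (src d))"
    by (rule lin_maps_codom[OF hom_lin[OF q]]) (use d qm in auto)
   thus ?thesis using lin_maps_comp ghD[OF c d] d by (simp add: c'_def lin_maps_comp)
  qed
  have c': "c' : C1 M M"
  proof (rule gh_mono)
   show "c' : gh (arcs Q) (%d. sp M (src d)) (%d. A (tgt d))"
    using c'm by (intro ghI) (auto simp: c'_def)
  qed (simp add: AM)
  have pc: "p (tgt d) (c' d x) = c' d x" if "d : arcs Q" "x : sp M (src d)" for d x
   using pA[OF lin_maps_mem[OF c'm[OF that(1)] that(2)]] .
  have cp: "c' d (p (src d) x) = 0" if d: "d : arcs Q" and x: "x : sp M (src d)" for d x
  proof -
   have "q (src d) (p (src d) x) = 0" using qx[OF _ hom_mem[OF p(1) _ x]] pp d by simp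
   thus ?thesis using lin_maps_zero[OF ghD[OF c d]] d by (simp add: c'_def)
  qed
  obtain h where h: "h : C0 M M" "!!v x. v : vs ==> x : sp M v ==> p v (h v x) = h v x"
   "!!d x. d : arcs Q ==> x : sp M (src d) ==> act M d (h (src d) x) - h (tgt d) (act M d x) = c' d x"
   using deform_dim_end[OF M p c' pc cp] min[OF c'] by (metis not_less)
  define h' where "h' = restr B h"
  have hA: "h v x : A v" if "v : vs" "x : sp M v" for v x
   using h(2)[OF that] lin_maps_mem[OF ghD[OF h(1) that(1)] that(2)] by (metis A_def imageI)
  have h': "h' : C0 (sub_rep M B) (sub_rep M A)"
   unfolding h'_def sp_sub_rep
   by (rule restr_gh[OF subrepD(1)[OF sB] lin_on_subset[OF lin_maps_lin_on[OF ghD[OF h(1)]] BM]]) (use hA BM in auto)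
  moreover have "dd (sub_rep M B) (sub_rep M A) h' = c"
  proof (rule gh_eqI[OF dd_C1[OF sub_rep_rep[OF M sB] sub_rep_rep[OF M sA] h'] c])
   fix d x assume d: "d : arcs Q" and x: "x : sp (sub_rep M B) (src d)"
   have v: "src d : vs" "tgt d : vs" using d by simp_all
   have xB: "x : B (src d)" "x : sp M (src d)" using x BM[OF v(1)] by auto
   have "dd (sub_rep M B) (sub_rep M A) h' d x = act M d (h (src d) x) - h (tgt d) (act M d x)"
    using d v xB hA[OF v(1) xB(2)] subrepD(3)[OF sB d xB(1)] by (simp add: dd_def h'_def restr_def act_sub_rep)
   thus "dd (sub_rep M B) (sub_rep M A) h' d x = c d x"
    using h(3)[OF d xB(2)] d qB(1)[OF v(1) xB(1)] by (simp add: c'_def)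
  qed
  ultimately show ?thesis by blast
 qed
 thus ?thesis unfolding ext0_def A_def B_def q_def by blast
qed

end

context positive_quiver
begin

text \<open>Take \<open>M\<close> of dimension vector \<open>a\<close> with an endomorphism space of
  least dimension. If \<open>M\<close> were a sum of nonzero \<open>A\<close> and \<open>B\<close>,
  both mixed \<open>Ext^1\<close> would vanish, and \<open>eform a a\<close> would be at least 1 + 1
  plus nonnegative cross terms.\<close>

theorem indec_exists:
 assumes "!!v. v ~: vs ==> a v = 0" "!!v. a v >= 0" "eform a a = 1"
 shows "EX M :: ('v, 'e, 'k::field) qrep. indec M & dimv M = a"
proof -
 \<comment> \<open>The representation with zero action shows that the dimension vector
   \<open>a\<close> occurs at all.\<close>
 define Z :: "('v, 'e, 'k) qrep" where "Z = \<lparr>sp = (%v. cspace (nat (a v))), act = (%d. 0)\<rparr>"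
 have cs: "kvec.subspace (cspace n :: (nat => 'k) set)" for n by (rule kvec.fd_subspace[OF fd_cspace(2)])
 have "rep Z" unfolding is_rep_def using lin_maps_0[OF cs]
  by (auto simp: Z_def fd_subspace_iff fd_cspace(2) lin_maps_0[OF cs])
 moreover have "dimv Z = a" using assms(1,2) by (auto simp: dimv_def Z_def fd_cspace(3) fun_eq_iff)
 ultimately have "EX M :: ('v, 'e, 'k) qrep. rep M & dimv M = a" by blast
 then obtain M :: "('v, 'e, 'k) qrep" where M: "rep M" "dimv M = a"
  and min: "!!N :: ('v, 'e, 'k) qrep. rep N ==> dimv N = a ==> gvec.dim (Hom M M) <= gvec.dim (Hom N N)"
  using ex_has_least_nat[of "%M. rep M & dimv M = a" _ "%M. gvec.dim (Hom M M)"] by blast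
 have min': "gvec.dim (Hom M M) <= gvec.dim (Hom (deform M c) (deform M c))" if "c : C1 M M" for c
  by (rule min[OF deform_rep[OF M(1) that]]) (use M(2) in \<open>simp add: dimv_deform\<close>)
 have "indec M" unfolding rep_indec_iff
 proof (intro conjI M(1) ballI impI)
  show "~ zrep M"
  proof
   assume "zrep M"
   hence "dimv M = 0" by (auto simp: dimv_def zrep_def fun_eq_iff fun_ops)
   thus False using assms(3) M(2) by (simp add: eform_def fun_ops)
  qed
  fix e assume e: "e : Hom M M" "gcomp e e = e"
  show "e = 0 \<or> e = ident M"
  proof (rule ccontr)
   assume ne: "~ (e = 0 \<or> e = ident M)"
   define q where "q = ident M - e"
   have q: "q : Hom M M" unfolding q_def by (rule hom_diff[OF M(1,1) ident_hom[OF M(1)] e(1)])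
   have "gcomp q q = gcomp (ident M) q - gcomp e q" by (simp add: q_def gcomp_diff_left)
   also have "gcomp e q = 0"
    using comp_diff[OF e(1) ident_hom[OF M(1)] e(1) M(1)] ident_right[OF e(1)] e(2) by (simp add: q_def)
   finally have qq: "gcomp q q = q" using ident_left[OF q M(1)] by simp
   have eq: "ident M - q = e" by (simp add: q_def)
   define A where "A = sub_rep M (%v. e v ` sp M v)"
   define B where "B = sub_rep M (%v. q v ` sp M v)"
   have A: "rep A" unfolding A_def by (rule sub_rep_rep[OF M(1) subrep_image[OF M(1,1) e(1)]])
   have B: "rep B" unfolding B_def by (rule sub_rep_rep[OF M(1) subrep_image[OF M(1,1) q]])
   have BA: "ext0 B A" using min_end_ext0[OF M(1) min' e] by (simp add: A_def B_def q_def)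
   have AB: "ext0 A B" using min_end_ext0[OF M(1) min' q qq] by (simp add: A_def B_def eq)
   have nz: "~ zrep (sub_rep M (%v. f v ` sp M v))" if f: "f : Hom M M" "f ~= 0" for f
   proof
    assume z: "zrep (sub_rep M (%v. f v ` sp M v))"
    have "f = 0"
     by (rule hom_eqI[OF f(1) hom_0[OF M(1,1)]]) (use z in \<open>auto simp: zrep_def fun_ops\<close>)
    thus False using f(2) by simp
   qed
   have d: "a = dimv A + dimv B" using idem_dimv[OF M(1) e] M(2) by (simp add: A_def B_def q_def)
   have "eform a a = eform (dimv A) (dimv A) + eform (dimv B) (dimv B) + eform (dimv A) (dimv B) + eform (dimv B) (dimv A)"
    by (simp add: d eform_add)
   moreover have "eform (dimv A) (dimv A) >= 1" "eform (dimv B) (dimv B) >= 1"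
    using dimv_eform_pos[OF A] dimv_eform_pos[OF B] nz[OF e(1)] nz[OF q] ne by (auto simp: A_def B_def q_def)
   moreover have "eform (dimv A) (dimv B) >= 0" "eform (dimv B) (dimv A) >= 0"
    using euler(2)[OF A B] AB euler(2)[OF B A] BA by simp_all
   ultimately show False using assms(3) by linarith
  qed
 qed
 thus ?thesis using M(2) by blast
qed

text \<open>The form gives a nonzero \<open>f : M -> N\<close>. With \<open>I\<close> its image and
  \<open>x = dimv M - dimv I\<close>, vanishing of \<open>Ext^1(I, N)\<close> and
  \<open>Ext^1(M, I)\<close> makes the mixed terms of \<open>x\<close> and \<open>dimv I\<close>
  nonnegative, while the form is at least 1 at \<open>dimv I\<close>. As the total is 1,
  \<open>eform x x <= 0\<close>, so \<open>x = 0\<close> and \<open>f\<close> is an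
  isomorphism.\<close>

theorem indec_unique:
 fixes M N :: "('v, 'e, 'k::alg_closed_field) qrep"
 assumes "indec M" "indec N" "dimv M = dimv N"
 shows "riso M N"
proof -
 have M: "brick M" "rep M" and N: "brick N" "rep N"
  using indec_brick[OF assms(1)] indec_brick[OF assms(2)] by (simp_all add: brick_def)
 have q1: "eform (dimv M) (dimv N) = 1" using brick_rigid(2)[OF M(1)] assms(3) by simp
 have "Hom M N ~= {0}" using euler(1)[OF M(2) N(2)] q1 by auto
 then obtain f where f: "f : Hom M N" "f ~= 0" using hom_0[OF M(2) N(2)] by blast
 define I where "I = sub_rep N (%v. f v ` sp M v)"
 have sI: "subrep Q N (%v. f v ` sp M v)" by (rule subrep_image[OF M(2) N(2) f(1)])
 have I: "rep I" unfolding I_def by (rule sub_rep_rep[OF N(2) sI])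
 have fI: "f : Hom M I" unfolding I_def by (rule hom_sub_rep[OF M(2) N(2) sI f(1)]) simp
 have surj: "sp I v <= f v ` sp M v" for v by (simp add: I_def)
 have iN: "ident I : Hom I N" using sub_rep_incl[OF I[unfolded I_def] N(2) sI] ident_hom[OF I] by (simp add: I_def)
 have "ext0 I N" by (rule ext0_mono[OF I N(2,2) iN _ brick_rigid(1)[OF N(1)]]) (simp add: rep_id_def)
 moreover have "gvec.dim (Hom I I) <= gvec.dim (Hom I N)"
 proof (rule gvec.fd_sub(2)[OF hom_fd[OF I N(2)] hom_subspace[OF I I]])
  show "Hom I I <= Hom I N" using sub_rep_incl[OF I N(2) sI] by (auto simp: I_def)
 qed
 ultimately have 1: "eform (dimv I) (dimv I) <= eform (dimv I) (dimv N)"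
  using euler(1)[OF I I] euler(2)[OF I N(2)] by simp
 have "ext0 M I" by (rule ext0_epi[OF M(2,2) I fI surj brick_rigid(1)[OF M(1)]])
 moreover have "gvec.dim (Hom I I) <= gvec.dim (Hom M I)"
 proof -
  let ?T = "%g. gcomp g f"
  have l: "lin_on gscale gscale (Hom I I) ?T" by (simp add: lin_on_def gcomp_add_left gcomp_scale_left)
  have inj: "g = 0" if g: "g : Hom I I" "?T g = 0" for g
  proof (rule hom_eqI[OF g(1) hom_0[OF I I]])
   fix v y assume "v : vs" "y : sp I v"
   then obtain x where "y = f v x" by (auto simp: I_def)
   thus "g v y = (0 :: ('v, 'k) gmap) v y" using fun_cong2[OF g(2)] by (simp add: gcomp_def fun_ops)
  qed
  show ?thesis
   using dim_inj[OF gvec_vs gvec_vs hom_fd[OF I I] l inj] hom_comp[OF fI]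
    gvec.fd_sub(2)[OF hom_fd[OF M(2) I] gvec.fd_subspace[OF rank_nullity(1)[OF gvec_vs gvec_vs hom_fd[OF I I] l]]]
   by (simp add: image_subset_iff)
 qed
 ultimately have 2: "eform (dimv I) (dimv I) <= eform (dimv M) (dimv I)"
  using euler(1)[OF I I] euler(2)[OF M(2) I] by simp
 let ?a = "dimv M - dimv I"
 have "dimv M = ?a + dimv I" by simp
 hence "eform (dimv M) (dimv I) = eform ?a (dimv I) + eform (dimv I) (dimv I)"
  "eform (dimv I) (dimv M) = eform (dimv I) ?a + eform (dimv I) (dimv I)"
  "eform (dimv M) (dimv M) = eform ?a ?a + eform ?a (dimv I) + eform (dimv I) ?a + eform (dimv I) (dimv I)"
  by (metis (no_types, lifting) eform_add add.assoc)+
 moreover have "eform (dimv I) (dimv I) >= 1"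
 proof (rule dimv_eform_pos[OF I])
  show "~ zrep I" using hom_to_zero[OF fI] f(2) by blast
 qed
 ultimately have "~ eform ?a ?a > 0" using 1 2 q1 assms(3) by simp
 hence "?a = 0" using eform_pos[of ?a] by (force simp: dimv_def minus_apply)
 hence d: "dimv M = dimv I" by simp
 have fN: "f v ` sp M v = sp N v" if v: "v : vs" for v
 proof -
  have "kvec.dim (f v ` sp M v) = kvec.dim (sp N v)"
   using fun_cong[OF d, of v] fun_cong[OF assms(3), of v] v by (simp add: dimv_def I_def)
  thus ?thesis using kvec.fd_sub(3)[OF rep_fd[OF N(2) v] subrepD(1,2)[OF sI v]] by simp
 qed
 show ?thesis
  by (rule risoI[OF M(2) N(2) f(1)]) (use fN inj_surj_dim[OF M(2) N(2) f(1) assms(3)] in auto)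
qed

end

section \<open>Dynkin quivers\<close>

text \<open>Squares are completed one vertex at a time. The constant \<open>p / (2 (p + 1))\<close>
  is the largest share that a chain of \<open>p\<close> vertices can take from the square at the
  next vertex; it is attained for \<open>y i\<close> proportional to \<open>i + 1\<close>.\<close>

lemma chain_form:
 fixes y :: "nat => real"
 defines "S == %p. (\<Sum>i<p. (y i)\<^sup>2) - (\<Sum>i<p. y i * y (Suc i))"
 shows "S p + real p / (2 * (real p+1)) * (y p)\<^sup>2 >= 0"
  and "S p <= 0 ==> y p = 0 ==> i < p ==> y i = 0"
proof -
 have *: "S (Suc p) + real (Suc p) / (2 * (real (Suc p) + 1)) * (y (Suc p))\<^sup>2
   = (S p + real p / (2 * (real p+1)) * (y p)\<^sup>2)
    + (real p + 2) / (2 * (real p+1)) * (y p - (real p+1) / (real p + 2) * y (Suc p))\<^sup>2" for p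
 proof -
  \<comment> \<open>The identity for \<open>a = p + 1\<close> and \<open>b = p + 2\<close>; with the
    inverses of \<open>a\<close> and \<open>b\<close> as variables it becomes polynomial.\<close>
  have pq: "u\<^sup>2 - u * v + a / (2 * b) * v\<^sup>2 = (a-1) / (2 * a) * u\<^sup>2 + b / (2 * a) * (u - a / b * v)\<^sup>2"
   if "a > 0" "b = a+1" for a b u v :: real
  proof -
   have "b / (2 * a) * (u - a / b * v)\<^sup>2 = b / (2 * a) * u\<^sup>2 - u * v + a / (2 * b) * v\<^sup>2"
   proof -
    define i j where "i = inverse a" and "j = inverse b"
    have ij: "a * i = 1" "b * j = 1" using that by (simp_all add: i_def j_def)
    have "b * i * (u - a * j * v)\<^sup>2
      = b * i * u\<^sup>2 - 2 * ((a * i) * (b * j) * (u * v)) + (a * i) * (b * j) * (a * j * v\<^sup>2)"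
     by (simp add: power2_eq_square algebra_simps)
    hence "b * i * (u - a * j * v)\<^sup>2 = b * i * u\<^sup>2 - 2 * (u * v) + a * j * v\<^sup>2" unfolding ij by simp
    moreover have "b / (2 * a) = (b * i) / 2" "a / b = a * j" "a / (2 * b) = (a * j) / 2"
     by (simp_all only: i_def j_def divide_inverse inverse_mult_distrib mult_ac)
    ultimately show ?thesis by (simp only: times_divide_eq_left) (simp add: diff_divide_distrib add_divide_distrib)
   qed
   moreover have "(a-1) / (2 * a) * u\<^sup>2 + b / (2 * a) * u\<^sup>2 = u\<^sup>2"
    using that by (simp add: add_divide_distrib[symmetric] distrib_right[symmetric])
   ultimately show ?thesis by linarith
  qed
  have "(y p)\<^sup>2 - y p * y (Suc p) + (real p+1) / (2 * (real p + 2)) * (y (Suc p))\<^sup>2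
    = real p / (2 * (real p+1)) * (y p)\<^sup>2
    + (real p + 2) / (2 * (real p+1)) * (y p - (real p+1) / (real p + 2) * y (Suc p))\<^sup>2"
   using pq[of "real p+1" "real p + 2" "y p" "y (Suc p)"] by simp
  thus ?thesis by (simp add: S_def algebra_simps)
 qed
 show nn: "S p + real p / (2 * (real p+1)) * (y p)\<^sup>2 >= 0" for p
 proof (induction p)
  case (Suc p)
  have "(real p + 2) / (2 * (real p+1)) * (y p - (real p+1) / (real p + 2) * y (Suc p))\<^sup>2 >= 0" by simp
  thus ?case using Suc * by simp
 qed (simp add: S_def)
 show "S p <= 0 ==> y p = 0 ==> i < p ==> y i = 0"
 proof (induction p arbitrary: i)
  case (Suc p)
  let ?a = "S p + real p / (2 * (real p+1)) * (y p)\<^sup>2"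
  let ?b = "(real p + 2) / (2 * (real p+1)) * (y p - (real p+1) / (real p + 2) * y (Suc p))\<^sup>2"
  have "?a + ?b <= 0" using *[of p] Suc.prems(1,2) by simp
  moreover have "?b >= 0" by simp
  ultimately have ab: "?a = 0" "?b = 0" using nn[of p] by linarith+
  hence "y p = 0" using Suc.prems(2) by (simp add: add_nonneg_eq_0_iff)
  thus ?case using ab(1) Suc by (cases "i = p") auto
 qed simp
qed

text \<open>The same estimate for an arm attached at its left end, by reversing the
  numbering.\<close>

lemma chain_form_rev:
 fixes w :: "nat => real"
 defines "S == %r. (\<Sum>i<r. (w (Suc i))\<^sup>2) - (\<Sum>i<r. w i * w (Suc i))"
 shows "S r + real r / (2 * (real r+1)) * (w 0)\<^sup>2 >= 0"
  and "S r <= 0 ==> w 0 = 0 ==> i <= r ==> w i = 0"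
proof -
 define y where "y i = w (r - i)" for i
 have 1: "(\<Sum>i<r. (y i)\<^sup>2) = (\<Sum>i<r. (w (Suc i))\<^sup>2)"
  by (subst sum.nat_diff_reindex[symmetric]) (auto simp: y_def Suc_diff_Suc intro!: sum.cong)
 have 2: "(\<Sum>i<r. y i * y (Suc i)) = (\<Sum>i<r. w i * w (Suc i))"
  by (subst sum.nat_diff_reindex[symmetric]) (auto simp: y_def Suc_diff_Suc intro!: sum.cong)
 show "S r + real r / (2 * (real r+1)) * (w 0)\<^sup>2 >= 0"
  using chain_form(1)[of y r] unfolding 1 2 by (simp add: S_def y_def)
 assume *: "S r <= 0" "w 0 = 0" "i <= r"
 show "w i = 0"
 proof (cases "i = 0")
  case False
  hence "y (r - i) = 0"
   using chain_form(2)[of y r "r - i"] *(1,2,3) unfolding 1 2 by (simp add: S_def y_def)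
  thus ?thesis using *(3) by (simp add: y_def)
 qed (use * in simp)
qed

lemma sum_lessThan_add:
 fixes f :: "nat => 'a::comm_monoid_add"
 shows "sum f {..<a + b} = sum f {..<a} + (\<Sum>i<b. f (a + i))"
 by (induction b) (simp_all add: add.assoc)

text \<open>Completing squares along arms of \<open>c\<close>, \<open>r\<close> and 1 vertices that
  meet at vertex \<open>c\<close> leaves the coefficient
  \<open>1 - c/(2(c+1)) - r/(2(r+1)) - 1/4\<close> for the square at the branch vertex. Its
  positivity is the classical condition \<open>1/(c+1) + 1/(r+1) + 1/2 > 1\<close>.\<close>

lemma branched_form_pos:
 fixes y :: "nat => real"
 assumes q: "(\<Sum>i<c+1 + r. (y i)\<^sup>2) + t\<^sup>2 - (\<Sum>i<c + r. y i * y (Suc i)) - y c * t <= 0"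
  and cr: "real c / (2 * (real c+1)) + real r / (2 * (real r+1)) < 3 / 4"
 shows "t = 0 & (ALL i<c+1 + r. y i = 0)"
proof -
 define w where "w i = y (c + i)" for i
 define L where "L = (\<Sum>i<c. (y i)\<^sup>2) - (\<Sum>i<c. y i * y (Suc i))"
 define R where "R = (\<Sum>i<r. (w (Suc i))\<^sup>2) - (\<Sum>i<r. w i * w (Suc i))"
 have e: "(\<Sum>i<c+1 + r. (y i)\<^sup>2) - (\<Sum>i<c + r. y i * y (Suc i)) = L + R + (y c)\<^sup>2"
  unfolding sum_lessThan_add by (simp add: L_def R_def w_def)
 have L: "L + real c / (2 * (real c+1)) * (y c)\<^sup>2 >= 0"
  using chain_form(1)[where p = c and y = y] by (simp add: L_def)
 have R: "R + real r / (2 * (real r+1)) * (y c)\<^sup>2 >= 0"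
  using chain_form_rev(1)[where r = r and w = w] by (simp add: R_def w_def)
 define a where "a = 3 / 4 - real c / (2 * (real c+1)) - real r / (2 * (real r+1))"
 have a: "a > 0" using cr unfolding a_def by linarith
 \<comment> \<open>The arm with the single vertex \<open>t\<close> takes the share 1/4.\<close>
 have sq: "t\<^sup>2 - y c * t = (t - y c / 2)\<^sup>2 - (y c)\<^sup>2 / 4" by (simp add: power2_eq_square field_simps)
 have "a * (y c)\<^sup>2 = (y c)\<^sup>2 - (y c)\<^sup>2 / 4 - real c / (2 * (real c+1)) * (y c)\<^sup>2 - real r / (2 * (real r+1)) * (y c)\<^sup>2"
  by (simp add: a_def algebra_simps)
 hence "a * (y c)\<^sup>2 + (t - y c / 2)\<^sup>2 <= 0" using q e L R sq by linarith
 moreover have "a * (y c)\<^sup>2 >= 0" using a by simp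
 moreover have "(t - y c / 2)\<^sup>2 >= 0" by simp
 ultimately have "a * (y c)\<^sup>2 = 0" "(t - y c / 2)\<^sup>2 = 0" by linarith+
 hence y0: "y c = 0" and t0: "t = 0" using a by auto
 have "L >= 0" "R >= 0" "L + R <= 0" using L R q e y0 t0 by simp_all
 hence LR: "L <= 0" "R <= 0" by simp_all
 have "y i = 0" if "i < c+1 + r" for i
 proof (cases "i < c")
  case True
  show ?thesis using LR(1) unfolding L_def by (rule chain_form(2)[where p = c and y = y, OF _ y0 True])
 next
  case False
  have "w (i - c) = 0"
  proof (rule chain_form_rev(2)[where r = r and w = w])
   show "(\<Sum>i<r. (w (Suc i))\<^sup>2) - (\<Sum>i<r. w i * w (Suc i)) <= 0" using LR(2) unfolding R_def .
   show "w 0 = 0" using y0 by (simp add: w_def)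
   show "i - c <= r" using that by simp
  qed
  thus ?thesis using False by (simp add: w_def)
 qed
 thus ?thesis using t0 by blast
qed

definition edge_prod :: "(nat => real) => nat set => real" where
 "edge_prod y E = (\<Prod>j\<in>E. y j)"

lemma chain_edges: "{{i, i+1} | i. i+1 < m} = (%i. {i, Suc i}) ` {..<m-1}"
 by auto

lemma edge_prod_pair: "i ~= j ==> edge_prod y {i, j} = y i * y j"
 by (simp add: edge_prod_def)

lemma chain_edge_sum: "(SUM E:{{i, i+1} | i. i+1 < m}. edge_prod y E) = (\<Sum>i<m-1. y i * y (Suc i))"
proof -
 have "inj_on (%i. {i, Suc i}) {..<m-1}" by (auto simp: inj_on_def doubleton_eq_iff)
 thus ?thesis unfolding chain_edges by (simp add: sum.reindex edge_prod_pair o_def)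
qed

lemma branch_edge_sum:
 assumes "c+1 < m"
 shows "(SUM E:{{i, i+1} | i. i+1 < m} Un {{c, m}}. edge_prod y E) = (\<Sum>i<m-1. y i * y (Suc i)) + y c * y m"
proof -
 have "finite {{i, i+1} | i. i+1 < m}" unfolding chain_edges by simp
 moreover have "{c, m} ~: {{i, i+1} | i. i+1 < m}" using assms by (auto simp: doubleton_eq_iff)
 ultimately show ?thesis using assms chain_edge_sum[of y m] by (simp add: edge_prod_pair)
qed

text \<open>Type A is a single chain whose last vertex keeps its full square, more than the rest can
  take. Type D has arms with \<open>n - 3\<close>, 1 and 1 vertices, type E has arms with 2,
  \<open>n - 4\<close> and 1 vertices.\<close>

lemma dynkin_form_pos:
 fixes y :: "nat => real"
 assumes "is_dynkin \<Delta>" "(\<Sum>i<dynkin_rank \<Delta>. (y i)\<^sup>2) - (SUM E:dynkin_edges \<Delta>. edge_prod y E) <= 0" "i < dynkin_rank \<Delta>"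
 shows "y i = 0"
proof (cases \<Delta>)
 case (Dynkin_A n)
 then obtain p where n: "n = Suc p" using assms(1) by (cases n) auto
 have "(\<Sum>i<Suc p. (y i)\<^sup>2) - (\<Sum>i<p. y i * y (Suc i)) <= 0"
  using assms(2) chain_edge_sum[of y n] by (simp add: Dynkin_A n)
 hence le: "(\<Sum>i<p. (y i)\<^sup>2) - (\<Sum>i<p. y i * y (Suc i)) + (y p)\<^sup>2 <= 0" by simp
 define a where "a = real p / (2 * (real p+1))"
 have a: "a < 1" by (simp add: a_def field_simps)
 have "(\<Sum>i<p. (y i)\<^sup>2) - (\<Sum>i<p. y i * y (Suc i)) + a * (y p)\<^sup>2 >= 0"
  using chain_form(1)[where p = p and y = y] by (simp add: a_def)
 hence "(1 - a) * (y p)\<^sup>2 <= 0" using le by (simp add: algebra_simps)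
 moreover have "(1 - a) * (y p)\<^sup>2 >= 0" using a by simp
 ultimately have "(1 - a) * (y p)\<^sup>2 = 0" by linarith
 hence "y p = 0" using a by simp
 thus ?thesis using chain_form(2)[where p = p and y = y and i = i] le assms(3) n Dynkin_A by (cases "i = p") auto
next
 case (Dynkin_D n)
 then obtain c where n: "n = c + 3" "c >= 1" using assms(1) by (intro that[of "n - 3"]) auto
 have "(\<Sum>i<c+1 + 1. (y i)\<^sup>2) + (y (c + 2))\<^sup>2 - (\<Sum>i<c+1. y i * y (Suc i)) - y c * y (c + 2) <= 0"
  using assms(2) branch_edge_sum[of c "c + 2" y] by (simp add: Dynkin_D n numeral_3_eq_3)
 moreover have "real c / (2 * (real c+1)) + real 1 / (2 * (real 1 + 1)) < 3 / 4" by (simp add: field_simps)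
 ultimately have "y (c + 2) = 0 & (ALL i<c+1 + 1. y i = 0)" by (rule branched_form_pos)
 thus ?thesis using assms(3) by (cases "i = c + 2") (auto simp: Dynkin_D n)
next
 case (Dynkin_E n)
 then obtain r where n: "n = r + 4" "r : {2, 3, 4}" using assms(1) by (intro that[of "n - 4"]) auto
 have "(\<Sum>i<2 + 1 + r. (y i)\<^sup>2) + (y (r + 3))\<^sup>2 - (\<Sum>i<2 + r. y i * y (Suc i)) - y 2 * y (r + 3) <= 0"
  using assms(2) branch_edge_sum[of 2 "r + 3" y] n(2) by (auto simp: Dynkin_E n(1) eval_nat_numeral)
 moreover have "real 2 / (2 * (real 2 + 1)) + real r / (2 * (real r+1)) < 3 / 4" using n(2) by auto
 ultimately have "y (r + 3) = 0 & (ALL i<2 + 1 + r. y i = 0)" by (rule branched_form_pos)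
 thus ?thesis using assms(3) by (cases "i = r + 3") (auto simp: Dynkin_E n(1))
qed

lemma dynkin_edge_card: "E : dynkin_edges \<Delta> ==> is_dynkin \<Delta> ==> card E = 2"
 by (cases \<Delta>) (auto simp: card_insert_if)

locale dynkin_quiver_loc =
 fixes \<Delta> :: dynkin and Q :: "('v, 'e) pre_digraph"
 assumes dynkin: "dynkin_quiver \<Delta> Q"
begin

sublocale quiver Q
 using dynkin by (simp add: dynkin_quiver_def quiver_def)

lemma no_loop: "e : arcs Q ==> src e ~= tgt e"
proof
 assume e: "e : arcs Q" "src e = tgt e"
 obtain b where "bij_betw (%e. {b (tail Q e), b (head Q e)}) (arcs Q) (dynkin_edges \<Delta>)"
  using dynkin by (auto simp: dynkin_quiver_def)
 hence "{b (src e), b (tgt e)} : dynkin_edges \<Delta>" using e(1) by (auto simp: bij_betw_def)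
 hence "card {b (src e), b (tgt e)} = 2" using dynkin_edge_card dynkin by (auto simp: dynkin_quiver_def)
 thus False using e(2) by simp
qed

text \<open>The value at \<open>(x, x)\<close> does not depend on the orientation; after relabelling
  by \<open>b\<close> it is the form of the diagram, taken over the reals so that squares can be
  completed.\<close>

lemma eform_positive:
 assumes "!!v. v ~: vs ==> x v = 0" "x ~= 0"
 shows "eform x x > 0"
proof (rule ccontr)
 assume n: "~ eform x x > 0"
 obtain b where b: "bij_betw b vs {..<dynkin_rank \<Delta>}"
  "bij_betw (%e. {b (src e), b (tgt e)}) (arcs Q) (dynkin_edges \<Delta>)"
  using dynkin by (auto simp: dynkin_quiver_def)
 have D: "is_dynkin \<Delta>" using dynkin by (simp add: dynkin_quiver_def)
 define y where "y i = real_of_int (x (the_inv_into vs b i))" for i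
 have yb: "y (b v) = x v" if "v : vs" for v
  using the_inv_into_f_f[of b vs v] b(1) that by (simp add: y_def bij_betw_def)
 have "(\<Sum>i<dynkin_rank \<Delta>. (y i)\<^sup>2) = (SUM v:vs. (y (b v))\<^sup>2)"
  using sum.reindex_bij_betw[OF b(1), of "%i. (y i)\<^sup>2"] by simp
 also have "\<dots> = (SUM v:vs. real_of_int (x v * x v))" by (intro sum.cong) (auto simp: yb power2_eq_square)
 finally have s1: "(\<Sum>i<dynkin_rank \<Delta>. (y i)\<^sup>2) = real_of_int (SUM v:vs. x v * x v)" by simp
 have "(SUM E:dynkin_edges \<Delta>. edge_prod y E) = (SUM e:arcs Q. edge_prod y {b (src e), b (tgt e)})"
  using sum.reindex_bij_betw[OF b(2), of "edge_prod y"] by simp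
 also have "\<dots> = (SUM e:arcs Q. real_of_int (x (src e) * x (tgt e)))"
 proof (rule sum.cong)
  fix e assume e: "e : arcs Q"
  hence v: "src e : vs" "tgt e : vs" by simp_all
  hence "b (src e) ~= b (tgt e)" using b(1) no_loop[OF e] by (auto simp: bij_betw_def inj_on_def)
  thus "edge_prod y {b (src e), b (tgt e)} = real_of_int (x (src e) * x (tgt e))"
   using v by (simp add: edge_prod_pair yb)
 qed simp
 finally have s2: "(SUM E:dynkin_edges \<Delta>. edge_prod y E) = real_of_int (SUM e:arcs Q. x (src e) * x (tgt e))" by simp
 have le: "(\<Sum>i<dynkin_rank \<Delta>. (y i)\<^sup>2) - (SUM E:dynkin_edges \<Delta>. edge_prod y E) <= 0"
  using n unfolding s1 s2 eform_def by linarith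
 have "x v = 0" if "v : vs" for v
 proof -
  have "b v < dynkin_rank \<Delta>" using b(1) that by (auto simp: bij_betw_def)
  thus ?thesis using dynkin_form_pos[OF D le] yb[OF that] by simp
 qed
 hence "x = 0" using assms(1) by (metis ext zero_fun_apply)
 thus False using assms(2) by simp
qed

sublocale positive_quiver Q
 by unfold_locales (rule eform_positive)

lemma eform_simple_left:
 assumes "i : vs"
 shows "eform (simple_root i) x = x i - (SUM e:{e\<in>arcs Q. src e = i}. x (tgt e))"
  "eform x (simple_root i) = x i - (SUM e:{e\<in>arcs Q. tgt e = i}. x (src e))"
proof -
 have 1: "(SUM v:vs. simple_root i v * x v) = x i"
  using assms by (simp add: simple_root_def if_distrib[of "%a. a * _"] cong: if_cong)
 have 2: "(SUM v:vs. x v * simple_root i v) = x i"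
  using assms by (simp add: simple_root_def if_distrib[of "%a. _ * a"] cong: if_cong)
 have 3: "(SUM e:arcs Q. simple_root i (src e) * x (tgt e)) = (SUM e:{e\<in>arcs Q. src e = i}. x (tgt e))"
  by (simp add: sum.inter_filter[OF finite_arcs] simple_root_def if_distrib[of "%a. a * _"] cong: if_cong)
 have 4: "(SUM e:arcs Q. x (src e) * simple_root i (tgt e)) = (SUM e:{e\<in>arcs Q. tgt e = i}. x (src e))"
  by (simp add: sum.inter_filter[OF finite_arcs] simple_root_def if_distrib[of "%a. _ * a"] cong: if_cong)
 show "eform (simple_root i) x = x i - (SUM e:{e\<in>arcs Q. src e = i}. x (tgt e))"
  "eform x (simple_root i) = x i - (SUM e:{e\<in>arcs Q. tgt e = i}. x (src e))"
  unfolding eform_def 1 2 3 4 by simp_all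
qed

text \<open>The Cartan matrix is that of the symmetrised Euler form.\<close>

lemma cartan_eform:
 assumes i: "i : vs"
 shows "(SUM l:vs. cartan Q i l * x l) = eform (simple_root i) x + eform x (simple_root i)"
proof -
 let ?a = "%e l. if src e = i & tgt e = l then 1 else 0 :: int" and ?b = "%e l. if tgt e = i & src e = l then 1 else 0 :: int"
 have c: "cartan Q i l = (if l = i then 2 else 0) - (SUM e:arcs Q. ?a e l + ?b e l)" for l
 proof (cases "l = i")
  case True
  have "(SUM e:arcs Q. ?a e i + ?b e i) = 0" by (intro sum.neutral) (auto dest: no_loop)
  thus ?thesis using True by (simp add: cartan_def)
 next
  case False
  have "int (card {e : arcs Q. {src e, tgt e} = {i, l}}) = (SUM e:arcs Q. if {src e, tgt e} = {i, l} then 1 else 0)"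
   by (simp add: sum.inter_filter[OF finite_arcs, symmetric])
  also have "\<dots> = (SUM e:arcs Q. ?a e l + ?b e l)"
   using False by (intro sum.cong) (auto simp: doubleton_eq_iff)
  finally show ?thesis using False by (simp add: cartan_def)
 qed
 have "cartan Q i l * x l = (if i = l then 2 * x l else 0) - (SUM e:arcs Q. ?a e l * x l + ?b e l * x l)" for l
  unfolding c left_diff_distrib sum_distrib_right distrib_right
  by (rule arg_cong2[of _ _ _ _ "(-)"], simp, rule refl)
 hence "(SUM l:vs. cartan Q i l * x l)
   = (SUM l:vs. if i = l then 2 * x l else 0) - (SUM l:vs. SUM e:arcs Q. ?a e l * x l + ?b e l * x l)"
  by (simp only: sum_subtractf)
 also have "(SUM l:vs. if i = l then 2 * x l else 0) = 2 * x i" using i by simp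
 also have "(SUM l:vs. SUM e:arcs Q. ?a e l * x l + ?b e l * x l) = (SUM e:arcs Q. SUM l:vs. ?a e l * x l + ?b e l * x l)"
  by (rule sum.swap)
 also have "\<dots> = (SUM e:arcs Q. (if src e = i then x (tgt e) else 0) + (if tgt e = i then x (src e) else 0))"
  by (intro sum.cong refl) (simp add: i sum.distrib if_distrib[of "%a. a * _"] cong: if_cong)
 also have "\<dots> = (SUM e:{e\<in>arcs Q. src e = i}. x (tgt e)) + (SUM e:{e\<in>arcs Q. tgt e = i}. x (src e))"
  by (simp add: sum.distrib sum.inter_filter[OF finite_arcs])
 finally show ?thesis using eform_simple_left[OF i, of x] by simp
qed

lemma eform_simple: "i : vs ==> eform (simple_root i) (simple_root i) = 1"
proof -
 assume i: "i : vs"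
 have "(SUM e:{e\<in>arcs Q. src e = i}. simple_root i (tgt e)) = 0"
  using no_loop by (intro sum.neutral) (auto simp: simple_root_def)
 thus ?thesis using eform_simple_left(1)[OF i, of "simple_root i"] by (simp add: simple_root_def)
qed

lemma eform_scale_left: "eform (%v. c * a v) b = c * eform a b" "eform a (%v. c * b v) = c * eform a b"
 by (simp_all add: eform_def right_diff_distrib sum_distrib_left mult.assoc mult.left_commute)

text \<open>Simple reflections preserve the quadratic form, and each of them changes only the
  coordinate at one vertex.\<close>

lemma roots_support_eform:
 assumes "x : roots Q"
 shows "(ALL v. v ~: vs --> x v = 0) & eform x x = 1"
 using assms
proof induction
 case (simple i)
 thus ?case using eform_simple by (auto simp: simple_root_def)
next
 case (reflect x i)
 let ?a = "simple_root i"
 define t A B where "t = (SUM l:vs. cartan Q i l * x l)" and "A = eform ?a x" and "B = eform x ?a"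
 have t: "t = A + B" unfolding t_def A_def B_def by (rule cartan_eform[OF reflect.hyps(2)])
 have s: "simple_reflection Q i x = x + (%v. (- t) * ?a v)"
  by (simp add: simple_reflection_def t_def fun_eq_iff plus_fun_apply)
 have "eform (simple_reflection Q i x) (simple_reflection Q i x)
   = eform x x + (- t) * B + (- t) * A + (- t) * ((- t) * eform ?a ?a)"
  unfolding s eform_add eform_scale_left A_def B_def by (simp only: add.assoc distrib_left)
 also have "\<dots> = eform x x" unfolding eform_simple[OF reflect.hyps(2)] t by (simp add: algebra_simps)
 finally show ?case using reflect by (auto simp: simple_reflection_def simple_root_def)
qed

end

context positive_quiver
begin

text \<open>A finite set of vertices without a source in it would have a nonpositive value of the form.\<close>

lemma wf_arrows: "wf {(src e, tgt e) | e. e : arcs Q}"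
proof (rule wfI_min)
 fix x :: 'v and S assume x: "x : S"
 show "EX z:S. ALL y. (y, z) : {(src e, tgt e) | e. e : arcs Q} --> y ~: S"
 proof (rule ccontr)
  assume "~ ?thesis"
  hence "ALL z:S. EX e:arcs Q. tgt e = z & src e : S" by auto
  then obtain f where f: "!!z. z : S ==> f z : arcs Q & tgt (f z) = z & src (f z) : S" by metis
  have SV: "S <= vs"
  proof
   fix z assume "z : S"
   thus "z : vs" using f[of z] head_in_verts[of "f z"] by auto
  qed
  hence fin: "finite S" using finite_verts finite_subset by blast
  define y where "y v = (if v : S then 1 else 0 :: int)" for v
  have "(SUM v:vs. y v * y v) = int (card S)"
  proof -
   have "(SUM v:vs. y v * y v) = (SUM v:S. 1)" using SV by (intro sum.mono_neutral_cong_right) (auto simp: y_def)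
   thus ?thesis by simp
  qed
  \<comment> \<open>\<open>f\<close> chooses different arrows for different targets, so there are at
    least as many arrows within \<open>S\<close> as vertices.\<close>
  moreover have "(SUM e:arcs Q. y (src e) * y (tgt e)) >= int (card S)"
  proof -
   have "inj_on f S"
   proof (rule inj_onI)
    fix a b assume "a : S" "b : S" "f a = f b"
    thus "a = b" using f[of a] f[of b] by metis
   qed
   hence "int (card S) = (SUM e:f ` S. 1)" by (simp add: card_image)
   also have "\<dots> = (SUM e:f ` S. y (src e) * y (tgt e))" using f by (intro sum.cong) (auto simp: y_def)
   also have "\<dots> <= (SUM e:arcs Q. y (src e) * y (tgt e))"
    using f by (intro sum_mono2) (auto simp: y_def)
   finally show ?thesis .
  qed
  ultimately have "eform y y <= 0" by (simp add: eform_def)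
  moreover have "y ~= 0"
  proof
   assume "y = 0"
   hence "y x = 0" by (simp add: fun_ops)
   thus False using x by (simp add: y_def)
  qed
  moreover have "y v = 0" if "v ~: vs" for v using SV that by (auto simp: y_def)
  ultimately show False using eform_pos[of y] by force
 qed
qed

end

section \<open>Projective representations\<close>

text \<open>The pairing of natural numbers splits the ambient space into countably many copies of
  itself; \<open>cmp j\<close> and \<open>put j\<close> are the projection to the
  \<open>j\<close>-th copy and its inclusion. They encode families of vectors as single
  vectors.\<close>

definition
 "cmp j z = (%n. z (prod_encode (j, n)))"

definition
 "put j x = (%m. if fst (prod_decode m) = j then x (snd (prod_decode m)) else 0)"

lemma cmp_put: "cmp j (put i x) = (if i = j then x else 0)"
 by (auto simp: cmp_def put_def fun_ops)

lemma cmp_eqI: assumes "!!j. cmp j z = cmp j z'" shows "z = z'"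
proof
 fix m
 obtain j n where m: "m = prod_encode (j, n)" by (metis prod_decode_inverse surj_pair)
 show "z m = z' m" using fun_cong[OF assms[of j], of n] by (simp add: cmp_def m)
qed

lemma cmp_lin: "cmp j (x + y) = cmp j x + cmp j y" "cmp j (kscale c x) = kscale c (cmp j x)" "cmp j 0 = 0"
 by (auto simp: cmp_def fun_ops kscale_def)

lemma put_lin: "put j (x + y) = put j x + put j y" "put j (kscale c x) = kscale c (put j x)" "put j 0 = 0"
 by (auto simp: put_def fun_ops kscale_def)

lemma put_linear: "Vector_Spaces.linear kscale kscale (put j :: (nat => 'k::field) => nat => 'k)"
 by unfold_locales (simp_all add: put_lin)

lemma cmp_sum:
 fixes f :: "'i => nat => 'k::field"
 shows "cmp j (sum f I) = (SUM i:I. cmp j (f i))"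
 by (induction I rule: infinite_finite_induct) (simp_all add: cmp_lin)

lemma put_decomp:
 fixes z :: "nat => 'k::field"
 assumes "finite J" "!!j. j ~: J ==> cmp j z = 0"
 shows "z = (SUM j:J. put j (cmp j z))"
proof (rule cmp_eqI)
 fix i
 have "cmp i (SUM j:J. put j (cmp j z)) = (SUM j:J. if j = i then cmp j z else 0)"
  by (simp add: cmp_sum cmp_put)
 also have "\<dots> = cmp i z" using assms by (simp add: sum.delta)
 finally show "cmp i z = cmp i (SUM j:J. put j (cmp j z))" by simp
qed

context quiver
begin

definition aix :: "'e => nat" where
 "aix = (SOME f. inj_on f (arcs Q))"

text \<open>Labels of arrows are positive because 0 labels the trivial path in
  \<open>P0mem\<close>.\<close>

definition
 "ix e = Suc (aix e)"

lemma ix_inj: "inj_on ix (arcs Q)"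
proof -
 have "EX f :: 'e => nat. inj_on f (arcs Q)" using finite_imp_inj_to_nat_seg[OF finite_arcs] by blast
 hence "inj_on aix (arcs Q)" unfolding aix_def by (rule someI_ex)
 thus ?thesis by (auto simp: inj_on_def ix_def)
qed

lemma ix_nonzero [simp]: "ix e ~= 0" by (simp add: ix_def)

abbreviation "into w == {e\<in>arcs Q. tgt e = w}"

text \<open>
 The representation freely generated by \<open>M\<close>: the space at \<open>w\<close> is the sum of copies of \<open>M\<^sub>v\<close> over all
 paths from \<open>v\<close> to \<open>w\<close>, arranged by the last arrow of the path. Component 0 belongs to the
 trivial path.
\<close>

inductive P0mem :: "('v, 'e, 'k::field) qrep => 'v => (nat => 'k) => bool" for M where
 P0memI: "cmp 0 z : sp M w ==> (!!e. e : into w ==> P0mem M (src e) (cmp (ix e) z)) ==>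
   (!!j. j ~= 0 ==> j ~: ix ` into w ==> cmp j z = 0) ==> P0mem M w z"

definition
 "P0 M = \<lparr>sp = (%w. {z. P0mem M w z}), act = (%e z. if P0mem M (src e) z then put (ix e) z else 0)\<rparr>"

lemma P0_mem_iff: "z : sp (P0 M) w \<longleftrightarrow> cmp 0 z : sp M w & (ALL e:into w. cmp (ix e) z : sp (P0 M) (src e)) &
   (ALL j. j ~= 0 --> j ~: ix ` into w --> cmp j z = 0)"
 unfolding P0_def by (simp, subst P0mem.simps) blast

lemma P0_act: "z : sp (P0 M) (src e) ==> act (P0 M) e z = put (ix e) z"
 by (simp add: P0_def)

lemma P0_decomp:
 assumes "z : sp (P0 M) w"
 shows "z = put 0 (cmp 0 z) + (SUM e:into w. act (P0 M) e (cmp (ix e) z))"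
proof -
 have fin: "finite (into w)" by simp
 have "z = (SUM j:insert 0 (ix ` into w). put j (cmp j z))"
  using assms fin by (intro put_decomp) (auto simp: P0_mem_iff[of z])
 also have "\<dots> = put 0 (cmp 0 z) + (SUM j:ix ` into w. put j (cmp j z))"
  using fin by (subst sum.insert) auto
 also have "(SUM j:ix ` into w. put j (cmp j z)) = (SUM e:into w. put (ix e) (cmp (ix e) z))"
  using inj_on_subset[OF ix_inj, of "into w"] by (subst sum.reindex) auto
 also have "\<dots> = (SUM e:into w. act (P0 M) e (cmp (ix e) z))"
  using assms by (intro sum.cong) (auto simp: P0_act P0_mem_iff[of z])
 finally show ?thesis .
qed

end

context positive_quiver
begin

lemma vertex_induct [consumes 1, case_names step]:
 assumes "w : vs" "!!w. w : vs ==> (!!e. e : into w ==> P (src e)) ==> P w"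
 shows "P w"
 using wf_arrows assms(1)
proof (induction w rule: wf_induct_rule)
 case (less w)
 show ?case
 proof (rule assms(2)[OF less.prems])
  fix e assume "e : into w"
  thus "P (src e)" by (intro less.IH) auto
 qed
qed

lemma P0_subspace:
 assumes M: "rep M" and w: "w : vs"
 shows "kvec.subspace (sp (P0 M) w)"
 using w
proof (induction w rule: vertex_induct)
 case (step w)
 have s: "kvec.subspace (sp M w)" using rep_sub[OF M step.hyps] .
 show ?case
 proof (rule kvec.subspaceI)
  show "0 : sp (P0 M) w"
   using kvec.subspace_0[OF s] kvec.subspace_0[OF step.IH] by (subst P0_mem_iff) (simp add: cmp_lin)
  fix x y assume x: "x : sp (P0 M) w" and y: "y : sp (P0 M) w"
  show "x + y : sp (P0 M) w"
   using x y kvec.subspace_add[OF s] kvec.subspace_add[OF step.IH]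
   unfolding P0_mem_iff[of _ M w] by (simp add: cmp_lin)
 next
  fix c x assume x: "x : sp (P0 M) w"
  show "kscale c x : sp (P0 M) w"
   using x kvec.subspace_scale[OF s] kvec.subspace_scale[OF step.IH]
   unfolding P0_mem_iff[of _ M w] by (simp add: cmp_lin)
 qed
qed

lemma P0_put0:
 assumes "rep M" "w : vs" "x : sp M w"
 shows "put 0 x : sp (P0 M) w"
proof -
 have "0 : sp (P0 M) (src e)" if "e : into w" for e
  using kvec.subspace_0[OF P0_subspace[OF assms(1), of "src e"]] that by simp
 thus ?thesis using assms(3) by (subst P0_mem_iff) (auto simp: cmp_put)
qed

lemma P0_put: 
 assumes "rep M" "e : arcs Q" "z : sp (P0 M) (src e)" 
 shows "put (ix e) z : sp (P0 M) (tgt e)"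
proof -
 have "0 : sp M (tgt e)" using kvec.subspace_0[OF rep_sub[OF assms(1)]] assms(2) by simp
 moreover have "cmp (ix d) (put (ix e) z) : sp (P0 M) (src d)" if "d : into (tgt e)" for d
  using that assms inj_onD[OF ix_inj, of e d] kvec.subspace_0[OF P0_subspace[OF assms(1), of "src d"]]
  by (auto simp: cmp_put)
 ultimately show ?thesis using assms(2) by (subst P0_mem_iff) (auto simp: cmp_put)
qed

lemma P0_rep:
 fixes M :: "('v, 'e, 'k::field) qrep"
 assumes M: "rep M"
 shows "rep (P0 M)"
 unfolding is_rep_def fd_subspace_iff
proof (intro conjI ballI)
 fix w assume "w : vs"
 thus "kvec.fd (sp (P0 M) w)"
 proof (induction w rule: vertex_induct)
  case (step w)
  obtain B0 where B0: "finite B0" "sp M w = kvec.span B0" using rep_fd[OF M step.hyps] by (auto simp: kvec.fd_def)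
  have "ALL e:into w. EX B. finite B & sp (P0 M) (src e) = kvec.span B" using step.IH by (auto simp: kvec.fd_def)
  then obtain B where B: "ALL e:into w. finite (B e) & sp (P0 M) (src e) = kvec.span (B e)" by metis
  define C where "C = put 0 ` B0 Un (\<Union>e\<in>into w. put (ix e) ` B e)"
  have "finite C" unfolding C_def using B0 B by auto
  have put_span: "put j x : kvec.span C" if "x : kvec.span D" "put j ` D <= C" for j x and D :: "(nat => 'k) set"
  proof -
   have "put j x : put j ` kvec.span D" using that by simp
   also have "\<dots> = kvec.span (put j ` D)" by (rule kk.linear_span_image[OF put_linear, symmetric])
   finally show ?thesis using kvec.span_mono[OF that(2)] by blast
  qed
  have "sp (P0 M) w <= kvec.span C"
  proof
   fix z assume z: "z : sp (P0 M) w"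
   have "put 0 (cmp 0 z) : kvec.span C"
    using z B0 by (intro put_span[of _ B0]) (auto simp: P0_mem_iff[of z] C_def)
   moreover have "act (P0 M) e (cmp (ix e) z) : kvec.span C" if e: "e : into w" for e
   proof -
    have m: "cmp (ix e) z : sp (P0 M) (src e)" using z e by (auto simp: P0_mem_iff[of z])
    hence "put (ix e) (cmp (ix e) z) : kvec.span C"
     using B e by (intro put_span[of _ "B e"]) (auto simp: C_def)
    thus ?thesis by (simp add: P0_act[OF m])
   qed
   ultimately show "z : kvec.span C"
    by (subst P0_decomp[OF z]) (intro kvec.span_add kvec.span_sum)
  qed
  moreover have "kvec.fd (kvec.span C)" unfolding kvec.fd_def using \<open>finite C\<close> by blast
  ultimately show ?case using kvec.fd_sub(1) P0_subspace[OF M step.hyps] by blast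
 qed
next
 fix e assume e: "e : arcs Q"
 show "act (P0 M) e : lin_maps (sp (P0 M) (src e)) (sp (P0 M) (tgt e))"
 proof (rule lin_mapsI)
  have s: "kvec.subspace (sp (P0 M) (src e))" using P0_subspace[OF M] e by simp
  fix x assume x: "x : sp (P0 M) (src e)"
  show "act (P0 M) e x : sp (P0 M) (tgt e)" unfolding P0_act[OF x] by (rule P0_put[OF M e x])
  show "act (P0 M) e (kscale c x) = kscale c (act (P0 M) e x)" for c
   unfolding P0_act[OF x] P0_act[OF kvec.subspace_scale[OF s x]] by (rule put_lin)
  fix y assume y: "y : sp (P0 M) (src e)"
  show "act (P0 M) e (x + y) = act (P0 M) e x + act (P0 M) e y"
   unfolding P0_act[OF x] P0_act[OF y] P0_act[OF kvec.subspace_add[OF s x y]] by (rule put_lin)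
 qed (simp add: P0_def)
qed

text \<open>The solution \<open>F\<close> of \<open>dd F = c\<close> with values \<open>g\<close> on
  trivial paths: the equation reads \<open>F (act e z) = act e (F z) - c e z\<close> and determines
  \<open>F\<close> on the paths that end with the arrow \<open>e\<close>. The recursion stops as
  there are no oriented cycles.\<close>

function ext_fun :: "('v, 'e, 'k::field) qrep => ('v, 'k) gmap => ('e, 'k) gmap => 'v => (nat => 'k) => nat => 'k" where
 "ext_fun N g c w z = g w (cmp 0 z) +
   (SUM e:into w. act N e (ext_fun N g c (src e) (cmp (ix e) z)) - c e (cmp (ix e) z))"
 by auto
termination
 by (relation "inv_image {(src e, tgt e) | e. e : arcs Q} (%(N, g, c, w, z). w)") (auto simp: wf_arrows)

declare ext_fun.simps [simp del]

lemma ext_fun_lin: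
 assumes M: "rep M" and N: "rep N" and g: "g : C0 M N" and c: "c : C1 (P0 M) N" and w: "w : vs"
 shows "(ALL x:sp (P0 M) w. ext_fun N g c w x : sp N w) & lin_on kscale kscale (sp (P0 M) w) (ext_fun N g c w)"
 using w
proof (induction w rule: vertex_induct)
 case (step w)
 let ?F = "ext_fun N g c"
 have gl: "g w : lin_maps (sp M w) (sp N w)" using ghD[OF g step.hyps] .
 have Nw: "kvec.subspace (sp N w)" using rep_sub[OF N step.hyps] .
 define t where "t e z = act N e (?F (src e) (cmp (ix e) z)) - c e (cmp (ix e) z)" for e z
 have F: "?F w z = g w (cmp 0 z) + (SUM e:into w. t e z)" for z
  by (subst ext_fun.simps) (simp add: t_def)
 have comp: "cmp 0 x : sp M w" "!!e. e : into w ==> cmp (ix e) x : sp (P0 M) (src e)" if "x : sp (P0 M) w" for x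
  using that by (auto simp: P0_mem_iff[of x])
 have ce: "c e : lin_maps (sp (P0 M) (src e)) (sp N w)" "act N e : lin_maps (sp N (src e)) (sp N w)"
  if "e : into w" for e using that ghD[OF c, of e] act_lin[OF N, of e] by auto
 have t_mem: "t e x : sp N w" if x: "x : sp (P0 M) w" and e: "e : into w" for e x
  unfolding t_def
  using kvec.subspace_diff[OF Nw lin_maps_mem[OF ce(2)[OF e]] lin_maps_mem[OF ce(1)[OF e]]] step.IH[OF e] comp(2)[OF x e]
  by blast
 have t_add: "t e (x + y) = t e x + t e y" if x: "x : sp (P0 M) w" and y: "y : sp (P0 M) w" and e: "e : into w" for e x y
 proof -
  note cx = comp(2)[OF x e] and cy = comp(2)[OF y e]
  have "?F (src e) (cmp (ix e) (x + y)) = ?F (src e) (cmp (ix e) x) + ?F (src e) (cmp (ix e) y)"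
   using lin_on_add[OF conjunct2[OF step.IH[OF e]] cx cy] by (simp add: cmp_lin)
  moreover have "?F (src e) (cmp (ix e) x) : sp N (src e)" "?F (src e) (cmp (ix e) y) : sp N (src e)"
   using step.IH[OF e] cx cy by auto
  ultimately show ?thesis
   using lin_maps_add[OF ce(1)[OF e] cx cy] lin_maps_add[OF ce(2)[OF e]] by (simp add: t_def cmp_lin)
 qed
 have t_scale: "t e (kscale a x) = kscale a (t e x)" if x: "x : sp (P0 M) w" and e: "e : into w" for e x a
 proof -
  note cx = comp(2)[OF x e]
  have "?F (src e) (cmp (ix e) (kscale a x)) = kscale a (?F (src e) (cmp (ix e) x))"
   using lin_on_scale[OF conjunct2[OF step.IH[OF e]] cx] by (simp add: cmp_lin)
  moreover have "?F (src e) (cmp (ix e) x) : sp N (src e)"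
   using step.IH[OF e] cx by auto
  ultimately show ?thesis
   using lin_maps_scale[OF ce(1)[OF e] cx] lin_maps_scale[OF ce(2)[OF e]]
   by (simp add: t_def cmp_lin kvec.scale_right_diff_distrib)
 qed
 show ?case
 proof (intro conjI ballI lin_onI)
  fix x assume x: "x : sp (P0 M) w"
  have "(SUM e:into w. t e x) : sp N w" by (rule kvec.subspace_sum[OF Nw]) (rule t_mem[OF x])
  thus "?F w x : sp N w" unfolding F
   by (rule kvec.subspace_add[OF Nw lin_maps_mem[OF gl comp(1)[OF x]]])
  have "(SUM e:into w. t e (kscale a x)) = (SUM e:into w. kscale a (t e x))" for a
   using t_scale[OF x] by (intro sum.cong) auto
  thus "?F w (kscale a x) = kscale a (?F w x)" for a
   unfolding F cmp_lin lin_maps_scale[OF gl comp(1)[OF x]] kvec.scale_right_distrib kvec.scale_sum_right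
   by simp
  fix y assume y: "y : sp (P0 M) w"
  have "(SUM e:into w. t e (x + y)) = (SUM e:into w. t e x) + (SUM e:into w. t e y)"
   unfolding sum.distrib[symmetric] using t_add[OF x y] by (intro sum.cong) auto
  thus "?F w (x + y) = ?F w x + ?F w y"
   unfolding F cmp_lin lin_maps_add[OF gl comp(1)[OF x] comp(1)[OF y]] by (simp add: algebra_simps)
 qed
qed

definition
 "P0ext M N g c = restr (sp (P0 M)) (ext_fun N g c)"

text \<open>With \<open>c = 0\<close> this gives the freeness of \<open>P0 M\<close>, with
  \<open>g = 0\<close> the vanishing of \<open>Ext^1(P0 M, N)\<close>.\<close>

lemma P0ext:
 assumes M: "rep M" and N: "rep N" and g: "g : C0 M N" and c: "c : C1 (P0 M) N"
 shows "P0ext M N g c : C0 (P0 M) N"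
  "w : vs ==> x : sp M w ==> P0ext M N g c w (put 0 x) = g w x"
  "dd (P0 M) N (P0ext M N g c) = c"
proof -
 note L = ext_fun_lin[OF M N g c]
 let ?F = "P0ext M N g c"
 have app: "?F w z = ext_fun N g c w z" if "w : vs" "z : sp (P0 M) w" for w z
  unfolding P0ext_def by (rule restr_apply) (use that in auto)
 show F: "?F : C0 (P0 M) N"
  unfolding P0ext_def using L P0_subspace[OF M] by (intro restr_gh) blast+
 have F0: "ext_fun N g c v 0 = 0" if "v : vs" for v
  using app[OF that kvec.subspace_0[OF P0_subspace[OF M that]]] lin_maps_zero[OF ghD[OF F that]] by simp
 have c0: "c e 0 = 0" "act N e 0 = 0" if "e : arcs Q" for e
  using lin_maps_zero[OF ghD[OF c that]] lin_maps_zero[OF act_lin[OF N that]] by simp_all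
 show "?F w (put 0 x) = g w x" if w: "w : vs" and x: "x : sp M w" for w x
 proof -
  have "?F w (put 0 x) = g w x + (SUM e:into w. 0)"
   unfolding app[OF w P0_put0[OF M w x]] ext_fun.simps[of N g c w] using F0 c0
   by (intro arg_cong2[of _ _ _ _ "(+)"] sum.cong) (auto simp: cmp_put)
  thus ?thesis by simp
 qed
 show "dd (P0 M) N ?F = c"
 proof (rule gh_eqI[OF dd_C1[OF P0_rep[OF M] N F] c])
  fix e z assume e: "e : arcs Q" and z: "z : sp (P0 M) (src e)"
  have se: "src e : vs" "tgt e : vs" using e by simp_all
  let ?s = "%d. act N d (ext_fun N g c (src d) (cmp (ix d) (put (ix e) z))) - c d (cmp (ix d) (put (ix e) z))"
  have "?s d = (if d = e then act N e (ext_fun N g c (src e) z) - c e z else 0)" if "d : into (tgt e)" for d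
   using that e inj_onD[OF ix_inj, of e d] F0 c0 by (auto simp: cmp_put)
  hence "(SUM d:into (tgt e). ?s d) = (SUM d:into (tgt e). if d = e then act N e (ext_fun N g c (src e) z) - c e z else 0)"
   by (intro sum.cong) auto
  also have "\<dots> = act N e (ext_fun N g c (src e) z) - c e z" using e by (simp add: sum.delta)
  finally have "(SUM d:into (tgt e). ?s d) = act N e (ext_fun N g c (src e) z) - c e z" .
  moreover have "g (tgt e) 0 = 0" using lin_maps_zero[OF ghD[OF g se(2)]] .
  ultimately have "?F (tgt e) (act (P0 M) e z) = act N e (ext_fun N g c (src e) z) - c e z"
   unfolding P0_act[OF z] app[OF se(2) P0_put[OF M e z]] ext_fun.simps[of N g c "tgt e"]
   by (simp add: cmp_put)
  thus "dd (P0 M) N ?F e z = c e z" using e app[OF se(1) z] by (simp add: dd_def)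
 qed
qed

text \<open>\<open>P0 M\<close> is generated by the trivial paths: by \<open>P0_decomp\<close>,
  every vector is such a generator plus images of vectors at the sources of arrows, to which the
  induction applies.\<close>

lemma P0_hom_zero:
 assumes M: "rep M" and N: "rep N" and F: "F : Hom (P0 M) N"
  and z: "!!w x. w : vs ==> x : sp M w ==> F w (put 0 x) = 0"
 shows "F = 0"
proof (rule hom_eqI[OF F hom_0[OF P0_rep[OF M] N]])
 fix w x assume "w : vs" "x : sp (P0 M) w"
 hence "F w x = 0"
 proof (induction w arbitrary: x rule: vertex_induct)
  case (step w)
  let ?A = "%e. act (P0 M) e (cmp (ix e) x)"
  have m: "cmp 0 x : sp M w" "!!e. e : into w ==> cmp (ix e) x : sp (P0 M) (src e)"
   using step.prems by (auto simp: P0_mem_iff[of x])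
  have A: "?A e : sp (P0 M) w" if "e : into w" for e
   using act_mem[OF P0_rep[OF M] _ m(2)[OF that]] that by auto
  have sub: "kvec.subspace (sp (P0 M) w)" by (rule P0_subspace[OF M step.hyps])
  have "F w x = F w (put 0 (cmp 0 x) + (SUM e:into w. ?A e))" using P0_decomp[OF step.prems] by simp
  also have "\<dots> = F w (put 0 (cmp 0 x)) + (SUM e:into w. F w (?A e))"
  proof -
   have "(SUM e:into w. ?A e) : sp (P0 M) w" by (rule kvec.subspace_sum[OF sub]) (rule A)
   moreover have "F w (SUM e:into w. ?A e) = (SUM e:into w. F w (?A e))"
    by (rule lin_maps_sum[OF hom_lin[OF F step.hyps] sub]) (rule A)
   ultimately show ?thesis
    using lin_maps_add[OF hom_lin[OF F step.hyps] P0_put0[OF M step.hyps m(1)]] by simp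
  qed
  also have "\<dots> = 0 + (SUM e:into w. 0)"
  proof (intro arg_cong2[of _ _ _ _ "(+)"] sum.cong refl)
   show "F w (put 0 (cmp 0 x)) = 0" by (rule z[OF step.hyps m(1)])
   fix e assume e: "e : into w"
   hence "F w (?A e) = act N e (F (src e) (cmp (ix e) x))" using hom_comm[OF F, of e] by auto
   also have "\<dots> = 0" using step.IH[OF e m(2)[OF e]] lin_maps_zero[OF act_lin[OF N, of e]] e by simp
   finally show "F w (?A e) = 0" .
  qed
  finally show ?case by simp
 qed
 thus "F w x = 0 w x" by (simp add: fun_ops)
qed

end

section \<open>Direct sums and a criterion for projectivity\<close>

lemma evens_pair [simp]: "evens (pair x y) = x" and odds_pair [simp]: "odds (pair x y) = y"
 by (auto simp: evens_def odds_def pair_def)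

lemma pair_evens_odds [simp]: "pair (evens z) (odds z) = z"
 by (auto simp: evens_def odds_def pair_def fun_eq_iff)

lemma pair_lin: "pair x y + pair x' y' = pair (x + x') (y + y')" "kscale c (pair x y) = pair (kscale c x) (kscale c y)"
  "pair 0 0 = 0"
 by (auto simp: pair_def fun_ops kscale_def)

lemma evens_lin: "evens (x + y) = evens x + evens y" "evens (kscale c x) = kscale c (evens x)" "evens 0 = 0"
 and odds_lin: "odds (x + y) = odds x + odds y" "odds (kscale c x) = kscale c (odds x)" "odds 0 = 0"
 by (auto simp: evens_def odds_def fun_ops kscale_def)

lemma pair_eq_iff: "pair x y = pair x' y' \<longleftrightarrow> x = x' & y = y'"
 by (metis evens_pair odds_pair)

lemma sum_sp_iff: "z : sum_sp M N v \<longleftrightarrow> evens z : sp M v & odds z : sp N v"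
 by (auto simp: sum_sp_def) (metis pair_evens_odds)

lemma pair_sum_sp [simp]: "pair x y : sum_sp M N v \<longleftrightarrow> x : sp M v & y : sp N v"
 by (simp add: sum_sp_iff)

context quiver
begin

lemma sum_sp_fd:
 fixes M N :: "('v, 'e, 'k::field) qrep"
 assumes "kvec.fd (sp M v)" "kvec.fd (sp N v)"
 shows "kvec.fd (sum_sp M N v)"
proof -
 obtain B C where B: "finite B" "sp M v = kvec.span B" and C: "finite C" "sp N v = kvec.span C"
  using assms by (auto simp: kvec.fd_def)
 have lin1: "Vector_Spaces.linear kscale kscale (%x :: nat => 'k. pair x 0)"
  by unfold_locales (simp_all add: pair_lin)
 have lin2: "Vector_Spaces.linear kscale kscale (%x :: nat => 'k. pair 0 x)"
  by unfold_locales (simp_all add: pair_lin)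
 let ?D = "(%x. pair x 0) ` B Un (%x. pair 0 x) ` C"
 have "sum_sp M N v <= kvec.span ?D"
 proof
  fix z assume z: "z : sum_sp M N v"
  have "pair (evens z) 0 : kvec.span ((%x. pair x 0) ` B)"
   using z B(2) kk.linear_span_image[OF lin1, of B] by (auto simp: sum_sp_iff)
  moreover have "pair 0 (odds z) : kvec.span ((%x. pair 0 x) ` C)"
   using z C(2) kk.linear_span_image[OF lin2, of C] by (auto simp: sum_sp_iff)
  ultimately have "pair (evens z) 0 + pair 0 (odds z) : kvec.span ?D"
   by (intro kvec.span_add) (meson kvec.span_mono in_mono Un_upper1 Un_upper2)+
  thus "z : kvec.span ?D" by (simp add: pair_lin)
 qed
 moreover have "kvec.fd (kvec.span ?D)" unfolding kvec.fd_def by (intro exI[of _ ?D] conjI) (simp_all add: B(1) C(1))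
 moreover have "kvec.subspace (sum_sp M N v)"
  using kvec.fd_subspace[OF assms(1)] kvec.fd_subspace[OF assms(2)]
  by (auto simp: kvec.subspace_def sum_sp_iff evens_lin odds_lin)
 ultimately show ?thesis using kvec.fd_sub(1) by blast
qed

lemma sp_rep_sum [simp]: "sp (rep_sum Q M N) = sum_sp M N"
 by (simp add: rep_sum_def)

lemma act_rep_sum: "z : sum_sp M N (src e) ==> act (rep_sum Q M N) e z = pair (act M e (evens z)) (act N e (odds z))"
 by (simp add: rep_sum_def)

lemma rep_sum_rep:
 assumes "rep M" "rep N"
 shows "rep (rep_sum Q M N)"
 unfolding is_rep_def fd_subspace_iff
proof (intro conjI ballI)
 fix v assume "v : vs"
 thus "kvec.fd (sp (rep_sum Q M N) v)" using sum_sp_fd[OF rep_fd[OF assms(1)] rep_fd[OF assms(2)]] by simp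
next
 fix e assume e: "e : arcs Q"
 note M = act_lin[OF assms(1) e] and N = act_lin[OF assms(2) e]
 have sub: "kvec.subspace (sum_sp M N (src e))"
  using kvec.fd_subspace[OF sum_sp_fd[OF rep_fd[OF assms(1)] rep_fd[OF assms(2)]]] e by simp
 show "act (rep_sum Q M N) e : lin_maps (sp (rep_sum Q M N) (src e)) (sp (rep_sum Q M N) (tgt e))"
  unfolding sp_rep_sum
 proof (rule lin_mapsI)
  fix x assume x: "x : sum_sp M N (src e)"
  show "act (rep_sum Q M N) e x : sum_sp M N (tgt e)"
   using x act_mem[OF assms(1) e] act_mem[OF assms(2) e] by (auto simp: act_rep_sum sum_sp_iff)
  show "act (rep_sum Q M N) e (kscale c x) = kscale c (act (rep_sum Q M N) e x)" for c
   using x lin_maps_scale[OF M, of "evens x"] lin_maps_scale[OF N, of "odds x"] kvec.subspace_scale[OF sub x, of c]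
   by (simp add: act_rep_sum pair_lin evens_lin odds_lin sum_sp_iff)
  fix y assume y: "y : sum_sp M N (src e)"
  show "act (rep_sum Q M N) e (x + y) = act (rep_sum Q M N) e x + act (rep_sum Q M N) e y"
   using x y lin_maps_add[OF M, of "evens x" "evens y"] lin_maps_add[OF N, of "odds x" "odds y"] kvec.subspace_add[OF sub x y]
   by (simp add: act_rep_sum pair_lin evens_lin odds_lin sum_sp_iff)
 qed (simp add: rep_sum_def)
qed

lemma projective_rep: "proj P ==> rep P"
 and projective_lift: "proj P ==> rep M ==> rep N ==> g : Hom M N ==> f : Hom P N ==>
  (!!v. v : vs ==> g v ` sp M v = sp N v) ==> EX h:Hom P M. f = gcomp g h"
 unfolding projective_def by blast+

text \<open>With \<open>K\<close> the kernel of \<open>g\<close>, the Euler form is additive and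
  equals \<open>dim Hom(P, -)\<close> at \<open>M\<close>, \<open>K\<close> and \<open>N\<close>.
  Hence composition with \<open>g\<close> has an image of dimension \<open>dim Hom(P, N)\<close>,
  and every morphism to \<open>N\<close> lifts.\<close>

lemma ext0_projective:
 fixes P :: "('v, 'e, 'k::field) qrep"
 assumes P: "rep P" and ext: "!!N :: ('v, 'e, 'k) qrep. rep N ==> ext0 P N"
 shows "proj P"
 unfolding projective_def
proof (intro conjI allI impI P)
 fix M N :: "('v, 'e, 'k) qrep" and g f
 assume *: "rep M & rep N & g : Hom M N & f : Hom P N & (ALL v:vs. g v ` sp M v = sp N v)"
 hence M: "rep M" and N: "rep N" and g: "g : Hom M N" by blast+
 let ?K = "sub_rep M (%v. {x : sp M v. g v x = 0})" and ?T = "%h. gcomp g h"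
 have sK: "subrep Q M (%v. {x : sp M v. g v x = 0})" by (rule subrep_kernel[OF M N g])
 have K: "rep ?K" by (rule sub_rep_rep[OF M sK])
 have lin: "lin_on gscale gscale (Hom P M) ?T"
  by (simp add: lin_on_def comp_add[OF g] comp_scale[OF g] M)
 have "{h : Hom P M. ?T h = 0} = Hom P ?K"
 proof (intro equalityI subsetI)
  fix h assume "h : {h : Hom P M. ?T h = 0}"
  hence h: "h : Hom P M" "?T h = 0" by auto
  have "g v (h v x) = 0" for v x using fun_cong2[OF h(2)] by (simp add: gcomp_def fun_ops)
  thus "h : Hom P ?K" by (intro hom_sub_rep[OF P M sK h(1)]) (simp add: hom_mem[OF h(1)])
 next
  fix h assume h: "h : Hom P ?K"
  note hM = sub_rep_incl[OF P M sK h]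
  have "?T h = 0"
   by (rule hom_eqI[OF hom_comp[OF hM g] hom_0[OF P N]]) (use hom_mem[OF h] in \<open>simp add: gcomp_def fun_ops\<close>)
  thus "h : {h : Hom P M. ?T h = 0}" using hM by simp
 qed
 hence "gvec.dim (Hom P M) = gvec.dim (Hom P ?K) + gvec.dim (?T ` Hom P M)"
  using rank_nullity(2)[OF gvec_vs gvec_vs hom_fd[OF P M] lin] by simp
 moreover have "dimv M v = dimv ?K v + dimv N v" for v
  using rank_nullity(2)[OF kvec_vs kvec_vs rep_fd[OF M] lin_maps_lin_on[OF hom_lin[OF g]], of v] * by (simp add: dimv_def)
 hence "dimv M = dimv ?K + dimv N" by (simp add: fun_eq_iff plus_fun_apply)
 ultimately have "gvec.dim (?T ` Hom P M) = gvec.dim (Hom P N)"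
  using euler(2)[OF P M] euler(2)[OF P N] euler(2)[OF P K] ext[OF M] ext[OF N] ext[OF K] by (simp add: eform_add)
 hence "?T ` Hom P M = Hom P N"
  using hom_comp[OF _ g]
  by (intro gvec.fd_sub(3)[OF hom_fd[OF P N] gvec.fd_subspace[OF rank_nullity(1)[OF gvec_vs gvec_vs hom_fd[OF P M] lin]]])
   (simp_all add: image_subset_iff)
 thus "EX h:Hom P M. f = gcomp g h" using * by (metis imageE)
qed

lemma hom_from_zero: "f : Hom M N ==> zrep M ==> f = 0"
proof (rule ext, rule ext)
 fix v x assume f: "f : Hom M N" and M: "zrep M"
 show "f v x = 0 v x"
 proof (cases "v : vs & x ~= 0")
  case True
  hence "x ~: sp M v" using M by (auto simp: zrep_def)
  thus ?thesis using lin_maps_out[OF hom_lin[OF f]] True by (simp add: fun_ops)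
 next
  case False
  thus ?thesis using hom_out[OF f] hom_zero[OF f] by (cases "v : vs") (auto simp: fun_ops)
 qed
qed

lemma projective_zero:
 assumes "rep P" "zrep P"
 shows "proj P"
 unfolding projective_def
proof (intro conjI allI impI assms(1))
 fix M N g f
 assume *: "rep M & rep N & g : Hom M N & f : Hom P N & (ALL v:vs. g v ` sp M v = sp N v)"
 hence "f = gcomp g 0" using hom_from_zero[OF _ assms(2)] comp_zero by metis
 thus "EX h:Hom P M. f = gcomp g h" using hom_0[OF assms(1)] * by blast
qed

end

section \<open>Free representations and heredity\<close>

context positive_quiver
begin

lemma P0_ext0:
 assumes M: "rep M" and N: "rep N"
 shows "ext0 (P0 M) N"
 unfolding ext0_def
proof
 fix c assume c: "c : C1 (P0 M) N"
 have "0 : C0 M N" using gvec.subspace_0[OF gh_subspace] rep_sub[OF N] by blast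
 from P0ext[OF M N this c] show "EX f:C0 (P0 M) N. dd (P0 M) N f = c" by blast
qed

lemma P0_projective: "rep M ==> proj (P0 M)"
 by (rule ext0_projective[OF P0_rep P0_ext0])

text \<open>The morphism out of the free representation that extends a graded map out of
  \<open>M\<close>.\<close>

definition
 "P0hom M N g = P0ext M N g 0"

lemma P0hom:
 assumes M: "rep M" and N: "rep N" and g: "g : C0 M N"
 shows "P0hom M N g : Hom (P0 M) N"
  "w : vs ==> x : sp M w ==> P0hom M N g w (put 0 x) = g w x"
proof -
 have c: "0 : C1 (P0 M) N"
  by (rule gvec.subspace_0[OF gh_subspace]) (use rep_sub[OF N] in auto)
 note P = P0ext[OF M N g c]
 show "w : vs ==> x : sp M w ==> P0hom M N g w (put 0 x) = g w x"
  using P(2) by (simp add: P0hom_def)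
 show "P0hom M N g : Hom (P0 M) N"
  using P(1,3) dd_kernel[OF P0_rep[OF M] N] unfolding P0hom_def by blast
qed

lemma P0_hom_eqI:
 assumes M: "rep M" and N: "rep N" and F: "F : Hom (P0 M) N" and G: "G : Hom (P0 M) N"
  and z: "!!w x. w : vs ==> x : sp M w ==> F w (put 0 x) = G w (put 0 x)"
 shows "F = G"
proof -
 have "F - G = 0"
  by (rule P0_hom_zero[OF M N hom_diff[OF P0_rep[OF M] N F G]]) (simp add: z minus_apply)
 thus ?thesis by simp
qed

text \<open>The counit of the free construction; \<open>P0in\<close> below is its graded section,
  which need not be a morphism.\<close>

definition
 "eps M = P0hom M M (ident M)"

definition P0in :: "('v, 'e, 'k::field) qrep => ('v, 'k) gmap" where
 "P0in M = (%w x. if w : vs & x : sp M w then put 0 x else 0)"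

definition
 "P0map M N f = P0hom M (P0 N) (gcomp (P0in N) f)"

lemma P0in_C0:
 assumes M: "rep M"
 shows "P0in M : C0 M (P0 M)"
proof (rule ghI)
 fix w assume w: "w : vs"
 show "P0in M w : lin_maps (sp M w) (sp (P0 M) w)"
  using w P0_put0[OF M w] kvec.subspace_add[OF rep_sub[OF M w]] kvec.subspace_scale[OF rep_sub[OF M w]]
  by (intro lin_mapsI) (auto simp: P0in_def put_lin)
qed (auto simp: P0in_def fun_eq_iff fun_ops)

lemma eps_hom: "rep M ==> eps M : Hom (P0 M) M"
 and eps_put: "rep M ==> w : vs ==> x : sp M w ==> eps M w (put 0 x) = x"
 using P0hom[of M M "ident M"] hom_gh[OF ident_hom, of M] by (simp_all add: eps_def rep_id_def)

lemma eps_surj: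
 assumes "rep M" "w : vs"
 shows "eps M w ` sp (P0 M) w = sp M w"
proof
 show "eps M w ` sp (P0 M) w <= sp M w" using hom_mem[OF eps_hom[OF assms(1)] assms(2)] by blast
 show "sp M w <= eps M w ` sp (P0 M) w"
 proof
  fix x assume x: "x : sp M w"
  show "x : eps M w ` sp (P0 M) w"
   using eps_put[OF assms x] P0_put0[OF assms x] by (metis image_eqI)
 qed
qed

text \<open>\<open>P\<close> embeds into \<open>P0 P\<close> by splitting \<open>eps P\<close>, and
  \<open>ext0\<close> passes to subrepresentations.\<close>

lemma projective_ext0:
 assumes P: "proj P" and N: "rep N"
 shows "ext0 P N"
proof -
 note r = projective_rep[OF P]
 obtain s where s: "s : Hom P (P0 P)" "ident P = gcomp (eps P) s"
  using projective_lift[OF P P0_rep[OF r] r eps_hom[OF r] ident_hom[OF r] eps_surj[OF r]] by blast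
 show ?thesis
 proof (intro ext0_mono[OF r P0_rep[OF r] N s(1) _ P0_ext0[OF r N]] ballI impI)
  fix v x assume x: "v : vs" "x : sp P v" "s v x = 0"
  have "x = eps P v (s v x)" using fun_cong2[OF s(2), of v, of x] x(1,2) by (simp add: rep_id_def gcomp_def)
  thus "x = 0" using hom_zero[OF eps_hom[OF r]] x(3) by simp
 qed
qed

text \<open>Heredity: vanishing of \<open>Ext^1\<close> passes to subrepresentations by
  \<open>ext0_mono\<close> and characterises projectives.\<close>

lemma projective_sub_rep:
 assumes P: "proj P" and A: "subrep Q P A"
 shows "proj (sub_rep P A)"
proof -
 note r = projective_rep[OF P]
 note S = sub_rep_rep[OF r A]
 have "ext0 (sub_rep P A) N" if "rep N" for N
  by (rule ext0_mono[OF S r that sub_rep_incl[OF S r A ident_hom[OF S]] _ projective_ext0[OF P that]]) (simp add: rep_id_def)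
 thus ?thesis by (rule ext0_projective[OF S])
qed

lemma P0map_hom:
 assumes "rep M" "rep N" "f : Hom M N"
 shows "P0map M N f : Hom (P0 M) (P0 N)"
  "w : vs ==> x : sp M w ==> P0map M N f w (put 0 x) = put 0 (f w x)"
proof -
 have g: "gcomp (P0in N) f : C0 M (P0 N)" by (rule gh_comp[OF hom_gh[OF assms(3)] P0in_C0[OF assms(2)]])
 note P = P0hom[OF assms(1) P0_rep[OF assms(2)] g]
 show "P0map M N f : Hom (P0 M) (P0 N)" unfolding P0map_def by (rule P(1))
 show "w : vs ==> x : sp M w ==> P0map M N f w (put 0 x) = put 0 (f w x)"
  using P(2) hom_mem[OF assms(3)] by (simp add: P0map_def gcomp_apply P0in_def)
qed

lemma P0map_comp_zero:
 assumes "rep M" "rep N" "rep L" "f : Hom M N" "g : Hom N L" "gcomp g f = 0"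
 shows "gcomp (P0map N L g) (P0map M N f) = 0"
proof (rule P0_hom_zero[OF assms(1) P0_rep[OF assms(3)]])
 show "gcomp (P0map N L g) (P0map M N f) : Hom (P0 M) (P0 L)"
  by (rule hom_comp[OF P0map_hom(1)[OF assms(1,2,4)] P0map_hom(1)[OF assms(2,3,5)]])
 fix w x assume w: "w : vs" and x: "x : sp M w"
 have "g w (f w x) = 0" using fun_cong2[OF assms(6), of w, of x] by (simp add: gcomp_apply fun_ops)
 thus "gcomp (P0map N L g) (P0map M N f) w (put 0 x) = 0"
  using P0map_hom(2)[OF assms(1,2,4) w x] P0map_hom(2)[OF assms(2,3,5) w hom_mem[OF assms(4) w x]]
  by (simp add: gcomp_apply put_lin)
qed

lemma eps_natural:
 assumes "rep M" "rep N" "f : Hom M N"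
 shows "gcomp (eps N) (P0map M N f) = gcomp f (eps M)"
proof (rule P0_hom_eqI[OF assms(1,2)])
 show "gcomp (eps N) (P0map M N f) : Hom (P0 M) N" "gcomp f (eps M) : Hom (P0 M) N"
  by (rule hom_comp[OF P0map_hom(1)[OF assms] eps_hom[OF assms(2)]], rule hom_comp[OF eps_hom[OF assms(1)] assms(3)])
 fix w x assume w: "w : vs" and x: "x : sp M w"
 show "gcomp (eps N) (P0map M N f) w (put 0 x) = gcomp f (eps M) w (put 0 x)"
  using P0map_hom(2)[OF assms w x] eps_put[OF assms(1) w x] eps_put[OF assms(2) w hom_mem[OF assms(3) w x]]
  by (simp add: gcomp_apply)
qed

lemma P0_zero: assumes "rep M" "zrep M" shows "zrep (P0 M)"
proof -
 have "ident (P0 M) = 0"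
 proof (rule P0_hom_zero[OF assms(1) P0_rep[OF assms(1)] ident_hom[OF P0_rep[OF assms(1)]]])
  fix w x assume "w : vs" "x : sp M w"
  hence "x = 0" using assms(2) by (auto simp: zrep_def)
  thus "ident (P0 M) w (put 0 x) = 0" by (simp add: put_lin rep_id_def)
 qed
 thus ?thesis using zero_rep_iff[OF P0_rep[OF assms(1)]] by simp
qed

lemma P0_hom_dim:
 assumes M: "rep M" and N: "rep N"
 shows "gvec.dim (Hom (P0 M) N) = gvec.dim (C0 M N)"
proof -
 define phi where "phi F = gcomp F (P0in M)" for F :: "('v, 'a) gmap"
 have lin: "lin_on gscale gscale (Hom (P0 M) N) phi"
  by (rule lin_onI) (simp_all add: phi_def gcomp_add_left gcomp_scale_left)
 have app: "phi F w x = F w (put 0 x)" if "w : vs" "x : sp M w" for F w x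
  using that by (simp add: phi_def gcomp_apply P0in_def)
 have mem: "phi F : C0 M N" if "F : Hom (P0 M) N" for F
  unfolding phi_def by (rule gh_comp[OF P0in_C0[OF M] hom_gh[OF that]])
 have "phi ` Hom (P0 M) N = C0 M N"
 proof
  show "phi ` Hom (P0 M) N <= C0 M N" using mem by blast
  show "C0 M N <= phi ` Hom (P0 M) N"
  proof
   fix g assume g: "g : C0 M N"
   have "phi (P0hom M N g) = g"
    by (rule gh_eqI[OF mem[OF P0hom(1)[OF M N g]] g]) (simp add: app P0hom(2)[OF M N g])
   thus "g : phi ` Hom (P0 M) N" using P0hom(1)[OF M N g] by (metis image_eqI)
  qed
 qed
 moreover have "F = 0" if "F : Hom (P0 M) N" "phi F = 0" for F
 proof (rule P0_hom_zero[OF M N that(1)])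
  fix w x assume "w : vs" "x : sp M w"
  thus "F w (put 0 x) = 0" using app[of w x F] that(2) by (simp add: fun_ops)
 qed
 ultimately show ?thesis
  using dim_inj[OF gvec_vs gvec_vs hom_fd[OF P0_rep[OF M] N] lin] by simp
qed

end

section \<open>Complexes\<close>

definition
 "cscale c f = (%n. gscale c (f n))"

interpretation cvec: vector_space "cscale :: 'k::field => (int => ('v, 'k) gmap) => int => ('v, 'k) gmap"
 by unfold_locales
  (auto simp: cscale_def fun_eq_iff fun_ops gvec.scale_right_distrib gvec.scale_left_distrib)

lemma cvec_vs: "vector_space (cscale :: 'k::field => (int => ('v, 'k) gmap) => int => ('v, 'k) gmap)"
 by unfold_locales

declare fun_ops [simp del]

lemma cfun_ops:
 fixes f g :: "int => ('v, 'k::field) gmap"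
 shows "(f + g) n = f n + g n" "(f - g) n = f n - g n" "(- f) n = - f n" "(0 :: int => ('v, 'k) gmap) n = 0"
  "cscale c f n = gscale c (f n)"
 by (simp_all add: fun_ops cscale_def)

lemma (in vector_space) fd_sum:
 assumes "fd A" "fd B" "subspace U" "!!u. u : U ==> EX a:A. EX b:B. u = a + b"
 shows "fd U"
proof -
 obtain C D where C: "finite C" "A = span C" and D: "finite D" "B = span D"
  using assms(1,2) by (auto simp: fd_def)
 have "U <= span (C Un D)"
 proof
  fix u assume "u : U"
  then obtain a b where ab: "a : A" "b : B" "u = a + b" using assms(4) by blast
  have "a : span (C Un D)" "b : span (C Un D)"
   using ab C(2) D(2) span_mono[of C "C Un D"] span_mono[of D "C Un D"] by auto
  thus "u : span (C Un D)" unfolding ab(3) by (rule span_add)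
 qed
 moreover have "fd (span (C Un D))" unfolding fd_def
  by (intro exI[of _ "C Un D"] conjI) (simp_all add: C(1) D(1))
 ultimately show ?thesis using fd_sub(1) assms(3) by blast
qed

context quiver
begin

abbreviation "cx == is_complex Q"
abbreviation "Ch == chain_map Q"
abbreviation "nul == null_homotopic Q"

lemma cx_rep: "cx X ==> rep (ob X n)"
 and cx_df: "cx X ==> df X n : Hom (ob X n) (ob X (n+1))"
 and cx_dd: "cx X ==> gcomp (df X (n+1)) (df X n) = 0"
 by (simp_all add: is_complex_def)

lemma cx_df': "cx X ==> df X (n-1) : Hom (ob X (n-1)) (ob X n)"
 using cx_df[of X "n-1"] by simp

lemma cx_dd': "cx X ==> gcomp (df X n) (df X (n-1)) = 0"
 using cx_dd[of X "n-1"] by simp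

lemma gcomp_zeroD: assumes "gcomp g f = 0" shows "g v (f v x) = 0"
proof -
 have "gcomp g f v x = 0" unfolding assms by (simp add: fun_ops)
 thus ?thesis by (simp add: gcomp_apply)
qed

lemma cx_dd_apply: "cx X ==> df X (n+1) v (df X n v x) = 0"
 and cx_dd_apply': "cx X ==> df X n v (df X (n-1) v x) = 0"
 using gcomp_zeroD[OF cx_dd] gcomp_zeroD[OF cx_dd'] by blast+

lemma ch_hom: "f : Ch X Y ==> f n : Hom (ob X n) (ob Y n)"
 and ch_comm: "f : Ch X Y ==> gcomp (f (n+1)) (df X n) = gcomp (df Y n) (f n)"
 by (simp_all add: chain_map_def)

lemma ch_comm': "f : Ch X Y ==> gcomp (f n) (df X (n-1)) = gcomp (df Y (n-1)) (f (n-1))"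
 using ch_comm[of f X Y "n-1"] by simp

lemma gcomp_eqD: assumes "gcomp g f = gcomp h k" shows "g v (f v x) = h v (k v x)"
proof -
 have "gcomp g f v x = gcomp h k v x" unfolding assms ..
 thus ?thesis by (simp add: gcomp_apply)
qed

lemma ch_comm_apply: "f : Ch X Y ==> f (n+1) v (df X n v x) = df Y n v (f n v x)"
 using gcomp_eqD[OF ch_comm] by blast

lemma ch_comm_apply': "f : Ch X Y ==> f n v (df X (n-1) v x) = df Y (n-1) v (f (n-1) v x)"
 using gcomp_eqD[OF ch_comm'] by blast

lemma ch_mem: "f : Ch X Y ==> v : vs ==> x : sp (ob X n) v ==> f n v x : sp (ob Y n) v"
 using hom_mem[OF ch_hom] by blast

lemma chI:
 assumes "!!n. f n : Hom (ob X n) (ob Y n)" "!!n. gcomp (f (n+1)) (df X n) = gcomp (df Y n) (f n)"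
 shows "f : Ch X Y"
 using assms by (simp add: chain_map_def)

lemma hom_gcomp_eqI:
 assumes "f : Hom A B" "g : Hom B C" "f' : Hom A B'" "g' : Hom B' C"
  and "!!v x. v : vs ==> x : sp A v ==> g v (f v x) = g' v (f' v x)"
 shows "gcomp g f = gcomp g' f'"
 by (rule hom_eqI[OF hom_comp[OF assms(1,2)] hom_comp[OF assms(3,4)]]) (simp add: gcomp_apply assms(5))

lemma chI':
 assumes "cx X" "cx Y" "!!n. f n : Hom (ob X n) (ob Y n)"
  and "!!n v x. v : vs ==> x : sp (ob X n) v ==> f (n+1) v (df X n v x) = df Y n v (f n v x)"
 shows "f : Ch X Y"
 by (rule chI[OF assms(3)]) (rule hom_gcomp_eqI[OF cx_df[OF assms(1)] assms(3) assms(3) cx_df[OF assms(2)] assms(4)])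

lemma ch_subspace:
 assumes "cx X" "cx Y"
 shows "cvec.subspace (Ch X Y)"
proof (rule cvec.subspaceI)
 note H = hom_0[OF cx_rep[OF assms(1)] cx_rep[OF assms(2)]] hom_add[OF cx_rep[OF assms(1)] cx_rep[OF assms(2)]]
  hom_scale[OF cx_rep[OF assms(1)] cx_rep[OF assms(2)]]
 show "0 : Ch X Y"
  by (rule chI) (simp_all add: plus_fun_apply zero_fun_apply[of "_ :: int"] H gcomp_zero_left comp_zero[OF cx_df[OF assms(2)]])
 fix f g assume f: "f : Ch X Y" and g: "g : Ch X Y"
 show "f + g : Ch X Y"
  by (rule chI) (simp_all add: plus_fun_apply[of f] H ch_hom[OF f] ch_hom[OF g] gcomp_add_left
    comp_add[OF cx_df[OF assms(2)] ch_hom[OF f] ch_hom[OF g] cx_rep[OF assms(2)]] ch_comm[OF f] ch_comm[OF g])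
next
 fix c f assume f: "f : Ch X Y"
 note H = hom_scale[OF cx_rep[OF assms(1)] cx_rep[OF assms(2)]]
 show "cscale c f : Ch X Y"
  by (rule chI) (simp_all add: cscale_def H ch_hom[OF f] gcomp_scale_left
    comp_scale[OF cx_df[OF assms(2)] ch_hom[OF f] cx_rep[OF assms(2)]] ch_comm[OF f])
qed

lemmas ch_0 = cvec.subspace_0[OF ch_subspace]
 and ch_add = cvec.subspace_add[OF ch_subspace]
 and ch_diff = cvec.subspace_diff[OF ch_subspace]
 and ch_scale = cvec.subspace_scale[OF ch_subspace]

definition
 "htpy X Y s = (%n. gcomp (df Y (n-1)) (s n) + gcomp (s (n+1)) (df X n))"

lemma htpy_apply: "htpy X Y s n v x = df Y (n-1) v (s n v x) + s (n+1) v (df X n v x)"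
 by (simp add: htpy_def plus_fun_apply gcomp_apply)

lemma nul_iff: "f : nul X Y \<longleftrightarrow> (EX s. (ALL n. s n : Hom (ob X n) (ob Y (n-1))) & f = htpy X Y s)"
 unfolding null_homotopic_def htpy_def fun_eq_iff[of f] by simp

lemma nulI: "(!!n. s n : Hom (ob X n) (ob Y (n-1))) ==> htpy X Y s : nul X Y"
 by (auto simp: nul_iff)

lemma s_hom': "(!!n. s n : Hom (ob X n) (ob Y (n-1))) ==> s (n+1) : Hom (ob X (n+1)) (ob Y n)"
 by (metis add_diff_cancel_right')

lemma nul_ch:
 assumes X: "cx X" and Y: "cx Y"
 shows "nul X Y <= Ch X Y"
proof
 fix f assume "f : nul X Y"
 then obtain s where s: "!!n. s n : Hom (ob X n) (ob Y (n-1))" and f: "f = htpy X Y s" by (auto simp: nul_iff)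
 have h: "gcomp (df Y (n-1)) (s n) : Hom (ob X n) (ob Y n)" "gcomp (s (n+1)) (df X n) : Hom (ob X n) (ob Y n)" for n
  using hom_comp[OF s cx_df'[OF Y]] hom_comp[OF cx_df[OF X] s_hom'[of s X Y, OF s]] by simp_all
 have fn: "f n : Hom (ob X n) (ob Y n)" for n
  unfolding f htpy_def by (rule hom_add[OF cx_rep[OF X] cx_rep[OF Y] h])
 show "f : Ch X Y"
 proof (rule chI'[OF X Y fn])
  fix n v x assume v: "v : vs" and x: "x : sp (ob X n) v"
  have "df Y n v (f n v x) = df Y n v (df Y (n-1) v (s n v x)) + df Y n v (s (n+1) v (df X n v x))"
   unfolding f htpy_apply
   using lin_maps_add[OF hom_lin[OF cx_df[OF Y] v], of "df Y (n-1) v (s n v x)" n "s (n+1) v (df X n v x)"]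
    hom_mem[OF h(1) v x] hom_mem[OF h(2) v x] by (simp add: gcomp_apply)
  moreover have "f (n+1) v (df X n v x) = df Y n v (s (n+1) v (df X n v x)) + s (n+1 + 1) v (df X (n+1) v (df X n v x))"
   unfolding f htpy_apply by (simp only: add_diff_cancel_right')
  ultimately show "f (n+1) v (df X n v x) = df Y n v (f n v x)"
   by (simp add: cx_dd_apply[OF X] cx_dd_apply'[OF Y] hom_zero[OF s])
 qed
qed

lemma htpy_at: "htpy X Y s n = gcomp (df Y (n-1)) (s n) + gcomp (s (n+1)) (df X n)"
 by (simp add: htpy_def)

lemma htpy_lin:
 assumes X: "cx X" and Y: "cx Y" and s: "!!n. s n : Hom (ob X n) (ob Y (n-1))" and t: "!!n. t n : Hom (ob X n) (ob Y (n-1))"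
 shows "htpy X Y (s + t) = htpy X Y s + htpy X Y t" "htpy X Y (cscale c s) = cscale c (htpy X Y s)"
proof -
 show "htpy X Y (s + t) = htpy X Y s + htpy X Y t"
  by (rule ext) (simp add: htpy_at plus_fun_apply[of s] plus_fun_apply[of "htpy X Y s"]
    comp_add[OF cx_df'[OF Y] s t cx_rep[OF Y]] gcomp_add_left algebra_simps)
 show "htpy X Y (cscale c s) = cscale c (htpy X Y s)"
  by (rule ext) (simp add: htpy_def cscale_def comp_scale[OF cx_df'[OF Y] s cx_rep[OF Y]] gcomp_scale_left gvec.scale_right_distrib)
qed

lemma htpy_0: "cx Y ==> htpy X Y 0 = 0"
 by (rule ext) (simp add: htpy_def zero_fun_apply[of "_ :: int"] comp_zero[OF cx_df] gcomp_zero_left)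

lemma nul_subspace:
 assumes X: "cx X" and Y: "cx Y"
 shows "cvec.subspace (nul X Y)"
proof (rule cvec.subspaceI)
 have "htpy X Y 0 : nul X Y"
  by (rule nulI) (simp add: zero_fun_apply[of "_ :: int"] hom_0[OF cx_rep[OF X] cx_rep[OF Y]])
 thus "0 : nul X Y" by (simp add: htpy_0[OF Y])
 fix f g assume "f : nul X Y" "g : nul X Y"
 then obtain s t where s: "!!n. s n : Hom (ob X n) (ob Y (n-1))" "f = htpy X Y s"
  and t: "!!n. t n : Hom (ob X n) (ob Y (n-1))" "g = htpy X Y t" by (auto simp: nul_iff)
 show "f + g : nul X Y" unfolding s(2) t(2) htpy_lin(1)[of X Y s t, OF X Y s(1) t(1), symmetric]
  by (rule nulI) (simp add: plus_fun_apply[of s] hom_add[OF cx_rep[OF X] cx_rep[OF Y] s(1) t(1)])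
next
 fix c f assume "f : nul X Y"
 then obtain s where s: "!!n. s n : Hom (ob X n) (ob Y (n-1))" "f = htpy X Y s" by (auto simp: nul_iff)
 show "cscale c f : nul X Y" unfolding s(2) htpy_lin(2)[of X Y s s, OF X Y s(1) s(1), symmetric]
  by (rule nulI) (simp add: cscale_def hom_scale[OF cx_rep[OF X] cx_rep[OF Y] s(1)])
qed

lemmas nul_0 = cvec.subspace_0[OF nul_subspace]
 and nul_add = cvec.subspace_add[OF nul_subspace]
 and nul_diff = cvec.subspace_diff[OF nul_subspace]
 and nul_neg = cvec.subspace_neg[OF nul_subspace]
 and nul_scale = cvec.subspace_scale[OF nul_subspace]

lemma ccomp_apply: "ccomp g f n = gcomp (g n) (f n)"
 by (simp add: ccomp_def)

lemma ccomp_assoc: "ccomp h (ccomp g f) = ccomp (ccomp h g) f"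
 by (simp add: ccomp_def gcomp_assoc)

lemma ccomp_ch: assumes "f : Ch X Y" "g : Ch Y Z" shows "ccomp g f : Ch X Z"
proof (rule chI)
 show "ccomp g f n : Hom (ob X n) (ob Z n)" for n
  unfolding ccomp_apply by (rule hom_comp[OF ch_hom[OF assms(1)] ch_hom[OF assms(2)]])
 show "gcomp (ccomp g f (n+1)) (df X n) = gcomp (df Z n) (ccomp g f n)" for n
  unfolding ccomp_apply using ch_comm[OF assms(1), of n] ch_comm[OF assms(2), of n] by (metis gcomp_assoc)
qed

lemma cid_ch: "cx X ==> cid Q X : Ch X X"
 by (rule chI) (simp_all add: cid_def ident_hom cx_rep ident_left[OF cx_df] ident_right[OF cx_df])

lemma ccomp_cid: "f : Ch X Y ==> cx Y ==> ccomp (cid Q Y) f = f" "f : Ch X Y ==> ccomp f (cid Q X) = f"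
 by (rule ext, simp add: ccomp_apply cid_def ident_left[OF ch_hom] cx_rep)
  (rule ext, simp add: ccomp_apply cid_def ident_right[OF ch_hom])

lemma ccomp_left: "ccomp (g + h) f = ccomp g f + ccomp h f" "ccomp (g - h) f = ccomp g f - ccomp h f"
  "ccomp (- g) f = - ccomp g f" "ccomp 0 f = 0" "ccomp (cscale c g) f = cscale c (ccomp g f)"
 by (auto simp: ccomp_def cscale_def gcomp_def gscale_def fun_ops fun_eq_iff)

lemma ccomp_right:
 assumes g: "g : Ch Y Z" and f: "f : Ch X Y" and h: "h : Ch X Y" and Y: "cx Y"
 shows "ccomp g (f + h) = ccomp g f + ccomp g h" "ccomp g (f - h) = ccomp g f - ccomp g h"
  "ccomp g (cscale c f) = cscale c (ccomp g f)"
 by (rule ext, simp add: ccomp_apply plus_fun_apply[of f] plus_fun_apply[of "ccomp g f"] minus_apply[of f] minus_apply[of "ccomp g f"]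
  cscale_def comp_add[OF ch_hom[OF g] ch_hom[OF f] ch_hom[OF h] cx_rep[OF Y]]
  comp_diff[OF ch_hom[OF g] ch_hom[OF f] ch_hom[OF h] cx_rep[OF Y]] comp_scale[OF ch_hom[OF g] ch_hom[OF f] cx_rep[OF Y]])+

lemma ccomp_zero_right: "g : Ch Y Z ==> ccomp g 0 = 0"
 by (rule ext) (simp add: ccomp_apply zero_fun_apply[of "_ :: int"] comp_zero[OF ch_hom])

lemma nul_left:
 assumes X: "cx X" and Y: "cx Y" and Z: "cx Z" and f: "f : nul X Y" and g: "g : Ch Y Z"
 shows "ccomp g f : nul X Z"
proof -
 obtain s where s: "!!n. s n : Hom (ob X n) (ob Y (n-1))" "f = htpy X Y s" using f by (auto simp: nul_iff)
 have st: "gcomp (g (n-1)) (s n) : Hom (ob X n) (ob Z (n-1))" for n by (rule hom_comp[OF s(1) ch_hom[OF g]])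
 have "ccomp g f = htpy X Z (%n. gcomp (g (n-1)) (s n))"
 proof
  fix n
  have "ccomp g f n = gcomp (g n) (gcomp (df Y (n-1)) (s n)) + gcomp (g n) (gcomp (s (n+1)) (df X n))"
   unfolding ccomp_apply s(2) htpy_def
   by (rule comp_add[OF ch_hom[OF g] hom_comp[OF s(1) cx_df'[OF Y]] hom_comp[OF cx_df[OF X] s_hom'[of s X Y, OF s(1)]] cx_rep[OF Y]])
  also have "\<dots> = gcomp (df Z (n-1)) (gcomp (g (n-1)) (s n)) + gcomp (gcomp (g n) (s (n+1))) (df X n)"
   by (simp add: gcomp_assoc ch_comm'[OF g])
  finally show "ccomp g f n = htpy X Z (%n. gcomp (g (n-1)) (s n)) n" by (simp add: htpy_def)
 qed
 thus ?thesis using nulI[of "%n. gcomp (g (n-1)) (s n)" X Z, OF st] by simp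
qed

lemma nul_right:
 assumes X: "cx X" and Y: "cx Y" and f: "f : Ch X Y" and g: "g : nul Y Z"
 shows "ccomp g f : nul X Z"
proof -
 obtain s where s: "!!n. s n : Hom (ob Y n) (ob Z (n-1))" "g = htpy Y Z s" using g by (auto simp: nul_iff)
 have st: "gcomp (s n) (f n) : Hom (ob X n) (ob Z (n-1))" for n by (rule hom_comp[OF ch_hom[OF f] s(1)])
 have "ccomp g f = htpy X Z (%n. gcomp (s n) (f n))"
 proof
  fix n
  have "gcomp (gcomp (s (n+1)) (df Y n)) (f n) = gcomp (gcomp (s (n+1)) (f (n+1))) (df X n)"
   unfolding gcomp_assoc[symmetric] by (simp add: ch_comm[OF f])
  thus "ccomp g f n = htpy X Z (%n. gcomp (s n) (f n)) n"
   by (simp add: s(2) ccomp_apply htpy_def gcomp_add_left gcomp_assoc)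
 qed
 thus ?thesis using nulI[of "%n. gcomp (s n) (f n)" X Z, OF st] by simp
qed

lemma cx_bound: assumes "cx X" obtains m where "!!n. abs n > m ==> zrep (ob X n)"
 using assms by (auto simp: is_complex_def)

lemma fd_bounded_families:
 assumes "finite I" "!!n. n : I ==> gvec.fd (V n)"
 shows "cvec.fd {f. (ALL n:I. f n : V n) & (ALL n. n ~: I --> f n = 0)}"
 using assms
proof (induction I rule: finite_induct)
 case empty
 have "{f. (ALL n:{}. f n : V n) & (ALL n. n ~: {} --> f n = 0)} = {0}" by (auto simp: fun_eq_iff fun_ops)
 thus ?case by simp
next
 case (insert m I)
 let ?U = "%I. {f. (ALL n:I. f n : V n) & (ALL n. n ~: I --> f n = 0)}"
 let ?j = "%x n. if n = m then x else 0"
 have sub: "gvec.subspace (V n)" if "n : insert m I" for n using gvec.fd_subspace insert.prems that by blast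
 have lin: "lin_on gscale cscale (V m) ?j"
  by (rule lin_onI) (auto simp: fun_eq_iff fun_ops cscale_def)
 have "cvec.fd (?j ` V m)" using rank_nullity(1)[OF gvec_vs cvec_vs _ lin] insert.prems by simp
 moreover have "cvec.fd (?U I)" using insert by simp
 moreover have "cvec.subspace (?U (insert m I))"
  using gvec.subspace_0[OF sub] gvec.subspace_add[OF sub] gvec.subspace_scale[OF sub]
  by (intro cvec.subspaceI CollectI) (simp_all add: cfun_ops)
 moreover have "EX a:?j ` V m. EX b:?U I. u = a + b" if u: "u : ?U (insert m I)" for u
 proof (intro bexI)
  show "u = ?j (u m) + u(m := 0)" by (rule ext) (simp add: plus_fun_apply[of "%n. if n = m then u m else 0"])
  show "u(m := 0) : ?U I" using u insert.hyps by auto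
  show "?j (u m) : ?j ` V m" using u by simp
 qed
 ultimately show ?case by (rule cvec.fd_sum)
qed

text \<open>A chain map out of a bounded complex lives in finitely many degrees.\<close>

lemma ch_fd:
 assumes X: "cx X" and Y: "cx Y"
 shows "cvec.fd (Ch X Y)"
proof -
 obtain m where m: "!!n. abs n > m ==> zrep (ob X n)" using cx_bound[OF X] by blast
 have "cvec.fd {f. (ALL n:{-m..m}. f n : Hom (ob X n) (ob Y n)) & (ALL n. n ~: {-m..m} --> f n = 0)}"
  by (rule fd_bounded_families) (use hom_fd[OF cx_rep[OF X] cx_rep[OF Y]] in auto)
 moreover have "Ch X Y <= {f. (ALL n:{-m..m}. f n : Hom (ob X n) (ob Y n)) & (ALL n. n ~: {-m..m} --> f n = 0)}"
 proof (intro subsetI CollectI conjI ballI allI impI)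
  fix f n assume f: "f : Ch X Y"
  show "f n : Hom (ob X n) (ob Y n)" by (rule ch_hom[OF f])
  assume "n ~: {-m..m}"
  hence "abs n > m" by auto
  thus "f n = 0" using hom_from_zero[OF ch_hom[OF f] m] by blast
 qed
 ultimately show ?thesis using cvec.fd_sub(1) ch_subspace[OF X Y] by blast
qed

end

section \<open>Contracting chain maps from complexes of projectives\<close>

context quiver
begin

text \<open>Vanishing of the \<open>n\<close>-th cohomology; the opposite inclusion holds in every
  complex.\<close>

definition
 "exact X n \<longleftrightarrow> (ALL v:vs. ALL x:sp (ob X n) v. df X n v x = 0 --> x : df X (n-1) v ` sp (ob X (n-1)) v)"

lemma exact_lift:
 assumes A: "cx A" and ex: "exact A n" and P: "proj P" and g: "g : Hom P (ob A n)" and dg: "gcomp (df A n) g = 0"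
 obtains s where "s : Hom P (ob A (n-1))" "g = gcomp (df A (n-1)) s"
proof -
 let ?K = "%v. {x : sp (ob A n) v. df A n v x = 0}"
 let ?L = "sub_rep (ob A n) ?K"
 have rP: "rep P" using P by (simp add: projective_def)
 note r = cx_rep[OF A]
 have K: "subrep Q (ob A n) ?K" by (rule subrep_kernel[OF r r cx_df[OF A]])
 have L: "rep ?L" by (rule sub_rep_rep[OF r K])
 have d: "df A (n-1) : Hom (ob A (n-1)) ?L"
  by (rule hom_sub_rep[OF r r K cx_df'[OF A]]) (simp add: hom_mem[OF cx_df'[OF A]] cx_dd_apply'[OF A])
 have gL: "g : Hom P ?L"
  by (rule hom_sub_rep[OF rP r K g]) (simp add: hom_mem[OF g] gcomp_zeroD[OF dg])
 have "ALL v:vs. df A (n-1) v ` sp (ob A (n-1)) v = sp ?L v"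
  using ex hom_mem[OF cx_df'[OF A]] cx_dd_apply'[OF A] by (auto simp: exact_def)
 then obtain s where "s : Hom P (ob A (n-1))" "g = gcomp (df A (n-1)) s"
  using projective_lift[OF P r L d gL] by blast
 thus thesis by (rule that)
qed

text \<open>The homotopy is built downwards from a degree above the support of \<open>P\<close>. In
  each step the error \<open>f - s d\<close> is a cycle of \<open>A\<close>; it lifts through the
  differential by exactness and projectivity, or vanishes because \<open>P\<close> does.\<close>

lemma partial_homotopy:
 assumes P: "cx P" and A: "cx A" and proj: "!!n. proj (ob P n)" and f: "f : Ch P A"
  and ex: "!!n. n >= b ==> exact A n \<or> zrep (ob P n)"
 obtains s where "!!n. s n : Hom (ob P n) (ob A (n-1))" "!!n. n >= b ==> f n = htpy P A s n"
proof -
 obtain m where m: "!!n. abs n > m ==> zrep (ob P n)" using cx_bound[OF P] by blast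
 define N where "N = abs m+1"
 have N: "zrep (ob P n)" if "n >= N" for n using m[of n] that by (simp add: N_def)
 note rP = cx_rep[OF P] and rA = cx_rep[OF A]
 \<comment> \<open>The second clause says that the error in the next lower degree will be a
   cycle.\<close>
 let ?inv = "%n s. s : Hom (ob P n) (ob A (n-1)) & (n >= b --> gcomp (f n - gcomp (df A (n-1)) s) (df P (n-1)) = 0)"
 have step: "EX t. ?inv (n-1) t & (n-1 >= b --> f (n-1) = gcomp (df A (n-1 - 1)) t + gcomp s (df P (n-1)))"
  if s: "?inv n s" for n s
 proof (cases "n-1 >= b")
  case True
  have sh: "s : Hom (ob P n) (ob A (n-1))" using s by blast
  define g where "g = f (n-1) - gcomp s (df P (n-1))"
  have sd: "gcomp s (df P (n-1)) : Hom (ob P (n-1)) (ob A (n-1))" by (rule hom_comp[OF cx_df'[OF P] sh])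
  have g: "g : Hom (ob P (n-1)) (ob A (n-1))"
   unfolding g_def by (rule hom_diff[OF rP rA ch_hom[OF f] sd])
  have "gcomp (df A (n-1)) g = gcomp (df A (n-1)) (f (n-1)) - gcomp (df A (n-1)) (gcomp s (df P (n-1)))"
   unfolding g_def by (rule comp_diff[OF cx_df[OF A] ch_hom[OF f] sd rA])
  also have "\<dots> = gcomp (f n - gcomp (df A (n-1)) s) (df P (n-1))"
   by (simp add: gcomp_diff_left gcomp_assoc ch_comm'[OF f])
  also have "\<dots> = 0" using s True by simp
  finally have dg: "gcomp (df A (n-1)) g = 0" .
  have "EX t:Hom (ob P (n-1)) (ob A (n-1 - 1)). g = gcomp (df A (n-1 - 1)) t"
  proof (cases "exact A (n-1)")
   case True
   show ?thesis using exact_lift[OF A True proj g dg] by blast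
  next
   case False
   hence z: "zrep (ob P (n-1))" using ex[OF True] by blast
   hence "g = gcomp (df A (n-1 - 1)) 0"
    using hom_from_zero[OF g z] comp_zero[OF cx_df[OF A]] by simp
   thus ?thesis using hom_0[OF rP rA] by blast
  qed
  then obtain t where t: "t : Hom (ob P (n-1)) (ob A (n-1 - 1))" "g = gcomp (df A (n-1 - 1)) t" by blast
  have "gcomp (f (n-1) - gcomp (df A (n-1 - 1)) t) (df P (n-1 - 1)) = gcomp (gcomp s (df P (n-1))) (df P (n-1 - 1))"
   using t(2) by (simp add: g_def algebra_simps)
  also have "\<dots> = gcomp s 0" unfolding gcomp_assoc[symmetric] cx_dd'[OF P] ..
  also have "\<dots> = 0" by (rule comp_zero[OF sh])
  finally show ?thesis using t by (intro exI[of _ t]) (simp add: g_def algebra_simps)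
 qed (use hom_0[OF rP rA] in auto)
 have init: "?inv (N - int 0) 0"
  using hom_0[OF rP rA, of N "N - 1"] hom_from_zero[OF ch_hom[OF f, of N] N] by (simp add: comp_zero[OF cx_df'[OF A]] gcomp_zero_left)
 \<comment> \<open>Dependent choice runs over \<open>k\<close>, with \<open>\<sigma> k\<close> the
   homotopy in degree \<open>N - k\<close>.\<close>
 have "EX \<sigma>. ALL k. ?inv (N - int k) (\<sigma> k) & (N - int (Suc k) >= b -->
   f (N - int (Suc k)) = gcomp (df A (N - int (Suc k) - 1)) (\<sigma> (Suc k)) + gcomp (\<sigma> k) (df P (N - int (Suc k))))"
 proof (rule dependent_nat_choice)
  show "EX s. ?inv (N - int 0) s" using init by blast
  fix s k assume "?inv (N - int k) s"
  from step[OF this] show "EX t. ?inv (N - int (Suc k)) t & (N - int (Suc k) >= b -->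
    f (N - int (Suc k)) = gcomp (df A (N - int (Suc k) - 1)) t + gcomp s (df P (N - int (Suc k))))"
   by (simp add: algebra_simps)
 qed
 then obtain \<sigma> where \<sigma>: "!!k. ?inv (N - int k) (\<sigma> k)"
  "!!k. N - int (Suc k) >= b ==> f (N - int (Suc k)) = gcomp (df A (N - int (Suc k) - 1)) (\<sigma> (Suc k)) + gcomp (\<sigma> k) (df P (N - int (Suc k)))"
  by metis
 define s where "s n = (if n <= N then \<sigma> (nat (N - n)) else 0)" for n
 have s: "s n : Hom (ob P n) (ob A (n-1))" for n
  using \<sigma>(1)[of "nat (N - n)"] hom_0[OF rP rA] by (auto simp: s_def)
 have "f n = htpy P A s n" if n: "n >= b" for n
 proof (cases "n < N")
  case True
  define k where "k = nat (N - n) - 1"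
  have k: "N - int (Suc k) = n" using True by (simp add: k_def)
  have "s n = \<sigma> (Suc k)" "s (n+1) = \<sigma> k" using True by (auto simp: s_def k_def intro!: arg_cong[of _ _ \<sigma>])
  thus ?thesis using \<sigma>(2)[of k] n unfolding k by (simp add: htpy_at)
 next
  case False
  hence z: "zrep (ob P n)" using N by simp
  have "htpy P A s : Ch P A" using nul_ch[OF P A] nulI[of s P A, OF s] by blast
  thus ?thesis using hom_from_zero[OF ch_hom[OF f] z] hom_from_zero[OF ch_hom z] by metis
 qed
 thus thesis using that s by blast
qed

text \<open>A partial homotopy that reaches below the support of \<open>P\<close> is a full
  one.\<close>

theorem null_of_exact:
 assumes P: "cx P" and A: "cx A" and proj: "!!n. proj (ob P n)" and f: "f : Ch P A"
  and ex: "!!n. exact A n \<or> zrep (ob P n)"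
 shows "f : nul P A"
proof -
 obtain m where m: "!!n. abs n > m ==> zrep (ob P n)" using cx_bound[OF P] by blast
 obtain s where s: "!!n. s n : Hom (ob P n) (ob A (n-1))" "!!n. n >= - abs m ==> f n = htpy P A s n"
  by (rule partial_homotopy[OF P A proj f ex]) blast
 have n: "htpy P A s : nul P A" by (rule nulI[OF s(1)])
 have "f n = htpy P A s n" if "n < - abs m" for n
  using hom_from_zero[OF ch_hom[OF f] m] hom_from_zero[OF ch_hom[OF subsetD[OF nul_ch[OF P A] n]] m] that by simp
 hence "f = htpy P A s" using s(2) by (intro ext) (metis not_le)
 thus ?thesis using n by simp
qed

section \<open>Shifts of complexes, chain maps and homotopies\<close>

lemma shift_ob [simp]: "ob (shift k X) n = ob X (n + k)"
 and shift_df: "df (shift k X) n = (if even k then df X (n + k) else - df X (n + k))"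
 by (simp_all add: shift_def)

lemma shift_shift: "shift a (shift b X) = shift (a + b) X"
 by (simp add: shift_def fun_eq_iff add.commute add.left_commute)

lemma shift_0 [simp]: "shift 0 X = X"
 by (simp add: shift_def)

lemma shift_df_zero: "df (shift k X) n v x = 0 \<longleftrightarrow> df X (n + k) v x = 0"
 by (simp add: shift_df fun_ops)

lemma shift_cx: assumes X: "cx X" shows "cx (shift k X)"
 unfolding is_complex_def
proof (intro conjI allI)
 fix n
 have d: "df X (n + k) : Hom (ob X (n + k)) (ob X (n+1 + k))" using cx_df[OF X, of "n + k"] by (simp add: algebra_simps)
 show "rep (ob (shift k X) n)" by (simp add: cx_rep[OF X])
 show "df (shift k X) n : Hom (ob (shift k X) n) (ob (shift k X) (n+1))"
  using d hom_neg[OF cx_rep[OF X] cx_rep[OF X] d] by (simp add: shift_df)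
 have "gcomp (df X (n+1 + k)) (df X (n + k)) = 0" using cx_dd[OF X, of "n + k"] by (simp add: algebra_simps)
 thus "gcomp (df (shift k X) (n+1)) (df (shift k X) n) = 0"
  using comp_neg[OF cx_df[OF X] d cx_rep[OF X]] by (simp add: shift_df gcomp_neg_left)
next
 obtain m where m: "!!n. abs n > m ==> zrep (ob X n)" using cx_bound[OF X] by blast
 show "EX m. ALL n. abs n > m --> zrep (ob (shift k X) n)"
  by (rule exI[of _ "m + abs k"]) (use m in auto)
qed

lemma shift_im:
 assumes X: "cx X" and v: "v : vs"
 shows "df (shift k X) n v ` sp (ob (shift k X) n) v = df X (n + k) v ` sp (ob X (n + k)) v"
proof (cases "even k")
 case False
 let ?U = "sp (ob X (n + k)) v" and ?d = "df X (n + k) v"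
 have neg: "- x : ?U" "?d (- x) = - ?d x" if "x : ?U" for x
  using kvec.subspace_neg[OF rep_sub[OF cx_rep[OF X] v] that] lin_maps_uminus[OF hom_lin[OF cx_df[OF X] v] that] .
 have "(%x. - ?d x) ` ?U = ?d ` ?U"
 proof -
  have "- ?d x : ?d ` ?U" "?d x : (%x. - ?d x) ` ?U" if x: "x : ?U" for x
   using neg[OF x] by (auto intro!: image_eqI[of _ _ "- x"])
  thus ?thesis by blast
 qed
 moreover have "df (shift k X) n v = (%x. - ?d x)" using False by (auto simp: shift_df fun_ops fun_eq_iff)
 ultimately show ?thesis by simp
qed (simp add: shift_df)

lemma shift_exact: "cx X ==> exact (shift k X) n \<longleftrightarrow> exact X (n + k)"
 using shift_im[of X _ k "n-1"] by (auto simp: exact_def shift_df_zero algebra_simps)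

lemma shift_map_shift_map: "shift_map a (shift_map b f) = shift_map (a + b) f"
 by (simp add: shift_map_def fun_eq_iff add.commute add.left_commute)

lemma shift_map_0 [simp]: "shift_map 0 f = f"
 by (simp add: shift_map_def)

lemma shift_map_lin: "shift_map k (f + g) = shift_map k f + shift_map k g" "shift_map k (f - g) = shift_map k f - shift_map k g"
 "shift_map k (cscale c f) = cscale c (shift_map k f)" "shift_map k (ccomp f g) = ccomp (shift_map k f) (shift_map k g)"
 "shift_map k 0 = 0" "shift_map k (cid Q X) = cid Q (shift k X)"
 by (auto simp: shift_map_def cscale_def ccomp_def cid_def fun_eq_iff fun_ops)

lemma shift_ch: assumes X: "cx X" and Y: "cx Y" and f: "f : Ch X Y" shows "shift_map k f : Ch (shift k X) (shift k Y)"
proof (rule chI)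
 fix n
 show "shift_map k f n : Hom (ob (shift k X) n) (ob (shift k Y) n)" by (simp add: shift_map_def ch_hom[OF f])
 have "gcomp (f (n+1 + k)) (df X (n + k)) = gcomp (df Y (n + k)) (f (n + k))"
  using ch_comm[OF f, of "n + k"] by (simp add: algebra_simps)
 moreover have "gcomp (f (n+1 + k)) (- df X (n + k)) = - gcomp (f (n+1 + k)) (df X (n + k))"
  using comp_neg[OF ch_hom[OF f, of "n + k+1"] cx_df[OF X] cx_rep[OF X]] by (simp add: algebra_simps)
 ultimately show "gcomp (shift_map k f (n+1)) (df (shift k X) n) = gcomp (df (shift k Y) n) (shift_map k f n)"
  by (simp add: shift_df shift_map_def gcomp_neg_left)
qed

text \<open>For odd \<open>k\<close> the shifted differentials carry a sign, and so must the
  homotopy.\<close>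

lemma shift_nul:
 assumes X: "cx X" and Y: "cx Y" and f: "f : nul X Y"
 shows "shift_map k f : nul (shift k X) (shift k Y)"
proof -
 obtain s where s: "!!n. s n : Hom (ob X n) (ob Y (n-1))" "f = htpy X Y s" using f by (auto simp: nul_iff)
 define t where "t n = (if even k then s (n + k) else - s (n + k))" for n
 have s': "s (n + k) : Hom (ob X (n + k)) (ob Y (n-1 + k))" for n using s(1)[of "n + k"] by (simp add: algebra_simps)
 have t: "t n : Hom (ob (shift k X) n) (ob (shift k Y) (n-1))" for n
  using s'[of n] hom_neg[OF cx_rep[OF X] cx_rep[OF Y] s'[of n]] by (simp add: t_def)
 have "shift_map k f = htpy (shift k X) (shift k Y) t"
 proof
  fix n
  have d: "df Y (n-1 + k) : Hom (ob Y (n-1 + k)) (ob Y (n + k))" using cx_df[OF Y, of "n-1 + k"] by (simp add: algebra_simps)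
  have "shift_map k f n = gcomp (df Y (n-1 + k)) (s (n + k)) + gcomp (s (n+1 + k)) (df X (n + k))"
   by (simp add: s(2) shift_map_def htpy_at algebra_simps)
  moreover have "gcomp (- df Y (n-1 + k)) (- s (n + k)) = gcomp (df Y (n-1 + k)) (s (n + k))"
   using comp_neg[OF d s' cx_rep[OF Y]] by (simp add: gcomp_neg_left)
  moreover have "gcomp (- s (n+1 + k)) (- df X (n + k)) = gcomp (s (n+1 + k)) (df X (n + k))"
   using comp_neg[OF s(1)[of "n + k+1"] cx_df[OF X] cx_rep[OF X]] by (simp add: gcomp_neg_left algebra_simps)
  ultimately show "shift_map k f n = htpy (shift k X) (shift k Y) t n"
   by (simp add: htpy_at shift_df t_def)
 qed
 thus ?thesis using nulI[of t "shift k X" "shift k Y", OF t] by simp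
qed

lemma shift_nul_iff: assumes X: "cx X" and Y: "cx Y" shows "shift_map k f : nul (shift k X) (shift k Y) \<longleftrightarrow> f : nul X Y"
 using shift_nul[OF X Y, of f k] shift_nul[OF shift_cx[OF X] shift_cx[OF Y], of "shift_map k f" k k "- k"]
 by (auto simp: shift_shift shift_map_shift_map)

lemma shift_quasi_iso:
 assumes X: "cx X" and Y: "cx Y" and s: "qis X Y s"
 shows "qis (shift k X) (shift k Y) (shift_map k s)"
 unfolding quasi_iso_def
proof (intro conjI allI ballI)
 show "shift_map k s : Ch (shift k X) (shift k Y)" using shift_ch[OF X Y] s by (simp add: quasi_iso_def)
 fix n v assume v: "v : vs"
 note q = s[unfolded quasi_iso_def, THEN conjunct2, rule_format, OF v, of "n + k"]
 have imX: "df (shift k X) (n-1) v ` sp (ob (shift k X) (n-1)) v = df X (n + k-1) v ` sp (ob X (n + k-1)) v"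
  using shift_im[OF X v, of k "n-1"] by (simp add: algebra_simps)
 have imY: "df (shift k Y) (n-1) v ` sp (ob (shift k Y) (n-1)) v = df Y (n + k-1) v ` sp (ob Y (n + k-1)) v"
  using shift_im[OF Y v, of k "n-1"] by (simp add: algebra_simps)
 fix x assume x: "x : sp (ob (shift k X) n) v"
 show "df (shift k X) n v x = 0 & shift_map k s n v x : df (shift k Y) (n-1) v ` sp (ob (shift k Y) (n-1)) v -->
    x : df (shift k X) (n-1) v ` sp (ob (shift k X) (n-1)) v"
  unfolding imX imY shift_df_zero using q x by (simp add: shift_map_def)
next
 fix n v assume v: "v : vs"
 note q = s[unfolded quasi_iso_def, THEN conjunct2, rule_format, OF v, of "n + k"]
 have imY: "df (shift k Y) (n-1) v ` sp (ob (shift k Y) (n-1)) v = df Y (n + k-1) v ` sp (ob Y (n + k-1)) v"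
  using shift_im[OF Y v, of k "n-1"] by (simp add: algebra_simps)
 fix y assume y: "y : sp (ob (shift k Y) n) v"
 show "df (shift k Y) n v y = 0 --> (EX x:sp (ob (shift k X) n) v. df (shift k X) n v x = 0 &
   y - shift_map k s n v x : df (shift k Y) (n-1) v ` sp (ob (shift k Y) (n-1)) v)"
  unfolding imY shift_df_zero using q y by (simp add: shift_map_def)
qed

end

section \<open>Mapping cones and lifting along quasi-isomorphisms\<close>

context quiver
begin

definition
 "prl M N = (%v z. if v : vs & z : sum_sp M N v then evens z else 0)"

definition
 "prr M N = (%v z. if v : vs & z : sum_sp M N v then odds z else 0)"

definition
 "hpair P f g = (%v x. if v : vs & x : sp P v then pair (f v x) (g v x) else 0)"

lemma hom_formula:
 assumes M: "rep M" and N: "rep N"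
  and f: "!!v x. v : vs ==> x : sp M v ==> f v x : sp N v"
  and add: "!!v x y. v : vs ==> x : sp M v ==> y : sp M v ==> f v (x + y) = f v x + f v y"
  and scale: "!!v c x. v : vs ==> x : sp M v ==> f v (kscale c x) = kscale c (f v x)"
  and comm: "!!e x. e : arcs Q ==> x : sp M (src e) ==> f (tgt e) (act M e x) = act N e (f (src e) x)"
  and out: "!!v x. ~ (v : vs & x : sp M v) ==> f v x = 0"
 shows "f : Hom M N"
proof (rule homI[OF M N _ comm])
 show "f : C0 M N"
 proof (rule ghI)
  fix v assume v: "v : vs"
  show "f v : lin_maps (sp M v) (sp N v)"
   by (rule lin_mapsI) (use f add scale out v in auto)
 next
  fix v assume "v ~: vs"
  thus "f v = 0" using out by (auto simp: fun_eq_iff fun_ops)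
 qed
qed

lemma sum_sp_sub: "rep M ==> rep N ==> v : vs ==> kvec.subspace (sum_sp M N v)"
 using rep_sub[OF rep_sum_rep] by simp

lemma prl_hom:
 assumes M: "rep M" and N: "rep N"
 shows "prl M N : Hom (rep_sum Q M N) M" "prr M N : Hom (rep_sum Q M N) N"
proof -
 note S = rep_sum_rep[OF M N]
 note sub = sum_sp_sub[OF M N]
 have acts: "act (rep_sum Q M N) e x : sum_sp M N (tgt e)" if "e : arcs Q" "x : sum_sp M N (src e)" for e x
  using act_mem[OF S that(1)] that(2) by simp
 show "prl M N : Hom (rep_sum Q M N) M"
  using kvec.subspace_add[OF sub] kvec.subspace_scale[OF sub] acts
  by (intro hom_formula[OF S M]) (auto simp: prl_def evens_lin sum_sp_iff act_rep_sum)
 show "prr M N : Hom (rep_sum Q M N) N"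
  using kvec.subspace_add[OF sub] kvec.subspace_scale[OF sub] acts
  by (intro hom_formula[OF S N]) (auto simp: prr_def odds_lin sum_sp_iff act_rep_sum)
qed

lemma hpair_hom:
 assumes P: "rep P" and M: "rep M" and N: "rep N" and f: "f : Hom P M" and g: "g : Hom P N"
 shows "hpair P f g : Hom P (rep_sum Q M N)"
proof (rule hom_formula[OF P rep_sum_rep[OF M N]])
 fix v x assume v: "v : vs" and x: "x : sp P v"
 note fl = hom_lin[OF f v] and gl = hom_lin[OF g v]
 show "hpair P f g v x : sp (rep_sum Q M N) v" using v x hom_mem[OF f] hom_mem[OF g] by (simp add: hpair_def)
 show "hpair P f g v (kscale c x) = kscale c (hpair P f g v x)" for c
  using v x kvec.subspace_scale[OF rep_sub[OF P v] x] lin_maps_scale[OF fl x] lin_maps_scale[OF gl x] by (simp add: hpair_def pair_lin)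
 fix y assume y: "y : sp P v"
 show "hpair P f g v (x + y) = hpair P f g v x + hpair P f g v y"
  using v x y kvec.subspace_add[OF rep_sub[OF P v] x y] lin_maps_add[OF fl x y] lin_maps_add[OF gl x y] by (simp add: hpair_def pair_lin)
next
 fix e x assume e: "e : arcs Q" and x: "x : sp P (src e)"
 thus "hpair P f g (tgt e) (act P e x) = act (rep_sum Q M N) e (hpair P f g (src e) x)"
  using act_mem[OF P e x] hom_mem[OF f _ x] hom_mem[OF g _ x] hom_comm[OF f e] hom_comm[OF g e]
  by (simp add: hpair_def act_rep_sum)
qed (auto simp: hpair_def)

lemma hpair_apply: "v : vs ==> x : sp P v ==> hpair P f g v x = pair (f v x) (g v x)"
 by (simp add: hpair_def)

lemma prl_apply: "v : vs ==> z : sum_sp M N v ==> prl M N v z = evens z"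
 and prr_apply: "v : vs ==> z : sum_sp M N v ==> prr M N v z = odds z"
 by (simp_all add: prl_def prr_def)

lemma projective_rep_sum:
 assumes P: "proj P" and R: "proj R"
 shows "proj (rep_sum Q P R)"
 unfolding projective_def
proof (intro conjI allI impI)
 note rP = projective_rep[OF P] and rR = projective_rep[OF R]
 show S: "rep (rep_sum Q P R)" by (rule rep_sum_rep[OF rP rR])
 fix M N g f
 assume *: "rep M & rep N & g : Hom M N & f : Hom (rep_sum Q P R) N & (ALL v:vs. g v ` sp M v = sp N v)"
 hence M: "rep M" and N: "rep N" and g: "g : Hom M N" and f: "f : Hom (rep_sum Q P R) N"
  and surj: "!!v. v : vs ==> g v ` sp M v = sp N v" by blast+
 let ?i = "hpair P (ident P) 0" and ?j = "hpair R 0 (ident R)"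
 note i = hpair_hom[OF rP rP rR ident_hom[OF rP] hom_0[OF rP rR]] and j = hpair_hom[OF rR rP rR hom_0[OF rR rP] ident_hom[OF rR]]
 obtain h where h: "h : Hom P M" "gcomp f ?i = gcomp g h"
  using projective_lift[OF P M N g hom_comp[OF i f] surj] by blast
 obtain k where k: "k : Hom R M" "gcomp f ?j = gcomp g k"
  using projective_lift[OF R M N g hom_comp[OF j f] surj] by blast
 let ?l = "gcomp h (prl P R) + gcomp k (prr P R)"
 have l: "?l : Hom (rep_sum Q P R) M"
  by (rule hom_add[OF S M hom_comp[OF prl_hom(1)[OF rP rR] h(1)] hom_comp[OF prl_hom(2)[OF rP rR] k(1)]])
 moreover have "f = gcomp g ?l"
 proof (rule hom_eqI[OF f hom_comp[OF l g]])
  fix v z assume v: "v : vs" and "z : sp (rep_sum Q P R) v"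
  hence z: "z : sum_sp P R v" "evens z : sp P v" "odds z : sp R v" by (simp_all add: sum_sp_iff)
  have 0: "0 : sp P v" "0 : sp R v" using rep_0[OF rP v] rep_0[OF rR v] .
  have "f v (pair (evens z) 0) = g v (h v (evens z))" "f v (pair 0 (odds z)) = g v (k v (odds z))"
   using fun_cong2[OF h(2), of v, of "evens z"] fun_cong2[OF k(2), of v, of "odds z"] v z
   by (simp_all add: gcomp_def hpair_apply rep_id_def fun_ops)
  moreover have "f v z = f v (pair (evens z) 0) + f v (pair 0 (odds z))"
   using lin_maps_add[OF hom_lin[OF f v], of "pair (evens z) 0" "pair 0 (odds z)"] z 0 by (simp add: pair_lin)
  moreover have "g v (h v (evens z) + k v (odds z)) = g v (h v (evens z)) + g v (k v (odds z))"
   by (rule lin_maps_add[OF hom_lin[OF g v] hom_mem[OF h(1) v z(2)] hom_mem[OF k(1) v z(3)]])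
  ultimately show "f v z = gcomp g ?l v z"
   using prl_apply[OF v z(1)] prr_apply[OF v z(1)]
    by (simp add: gcomp_apply plus_fun_apply[of "gcomp h (prl P R)"] plus_fun_apply[of "gcomp h (prl P R) v"])
 qed
 ultimately show "EX h:Hom (rep_sum Q P R) M. f = gcomp g h" by blast
qed

lemma cone_ob [simp]: "ob (Cone A B f) n = rep_sum Q (ob A (n+1)) (ob B n)"
 by (simp add: cone_def)

lemma cone_df_apply: "v : vs ==> z : sum_sp (ob A (n+1)) (ob B n) v ==>
  df (Cone A B f) n v z = pair (- df A (n+1) v (evens z)) (f (n+1) v (evens z) + df B n v (odds z))"
 by (simp add: cone_def)

lemma cone_df_hom:
 assumes A: "cx A" and B: "cx B" and f: "f : Ch A B"
 shows "df (Cone A B f) n : Hom (ob (Cone A B f) n) (ob (Cone A B f) (n+1))"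
proof -
 note rA = cx_rep[OF A] and rB = cx_rep[OF B]
 let ?S = "rep_sum Q (ob A (n+1)) (ob B n)"
 note S = rep_sum_rep[OF rA rB, of "n+1" n]
 note p = prl_hom[OF rA rB, of "n+1" n]
 have "hpair ?S (- gcomp (df A (n+1)) (prl (ob A (n+1)) (ob B n)))
   (gcomp (f (n+1)) (prl (ob A (n+1)) (ob B n)) + gcomp (df B n) (prr (ob A (n+1)) (ob B n)))
   : Hom ?S (rep_sum Q (ob A (n+1 + 1)) (ob B (n+1)))"
  by (intro hpair_hom[OF S rA rB] hom_neg[OF S rA] hom_add[OF S rB] hom_comp[OF p(1) cx_df[OF A]]
    hom_comp[OF p(1) ch_hom[OF f]] hom_comp[OF p(2) cx_df[OF B]])
 also have "hpair ?S (- gcomp (df A (n+1)) (prl (ob A (n+1)) (ob B n)))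
   (gcomp (f (n+1)) (prl (ob A (n+1)) (ob B n)) + gcomp (df B n) (prr (ob A (n+1)) (ob B n))) = df (Cone A B f) n"
  by (rule ext, rule ext) (simp add: hpair_def cone_def prl_def prr_def gcomp_apply fun_ops)
 finally show ?thesis by simp
qed

lemma cone_cx:
 assumes A: "cx A" and B: "cx B" and f: "f : Ch A B"
 shows "cx (Cone A B f)"
 unfolding is_complex_def
proof (intro conjI allI)
 fix n
 let ?C = "Cone A B f"
 show "rep (ob ?C n)" using rep_sum_rep[OF cx_rep[OF A] cx_rep[OF B]] by simp
 hence r: "rep (ob ?C n)" for n using rep_sum_rep[OF cx_rep[OF A] cx_rep[OF B]] by simp
 note d = cone_df_hom[OF A B f]
 show "df ?C n : Hom (ob ?C n) (ob ?C (n+1))" by (rule d)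
 show "gcomp (df ?C (n+1)) (df ?C n) = 0"
 proof (rule hom_eqI[OF hom_comp[OF d d] hom_0[OF r r]])
  fix v z assume v: "v : vs" and z: "z : sp (ob ?C n) v"
  hence z': "z : sum_sp (ob A (n+1)) (ob B n) v" and e: "evens z : sp (ob A (n+1)) v" and o: "odds z : sp (ob B n) v"
   by (simp_all add: sum_sp_iff)
  have de: "df A (n+1) v (evens z) : sp (ob A (n+1 + 1)) v" using hom_mem[OF cx_df[OF A] v e] .
  have m: "df ?C n v z : sum_sp (ob A (n+1 + 1)) (ob B (n+1)) v"
   using hom_mem[OF d v, of z n] z by simp
  have fe: "f (n+1) v (evens z) : sp (ob B (n+1)) v" and dB: "df B n v (odds z) : sp (ob B (n+1)) v"
   using ch_mem[OF f v e] hom_mem[OF cx_df[OF B] v o] .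
  have "df ?C (n+1) v (df ?C n v z) = pair (- df A (n+1 + 1) v (- df A (n+1) v (evens z)))
   (f (n+1 + 1) v (- df A (n+1) v (evens z)) + df B (n+1) v (f (n+1) v (evens z) + df B n v (odds z)))"
   by (subst cone_df_apply[OF v m]) (simp only: cone_df_apply[OF v z'] evens_pair odds_pair)
  also have "\<dots> = pair 0 0"
   unfolding lin_maps_uminus[OF hom_lin[OF cx_df[OF A] v] de] lin_maps_uminus[OF hom_lin[OF ch_hom[OF f] v] de]
    lin_maps_add[OF hom_lin[OF cx_df[OF B] v] fe dB] cx_dd_apply[OF A] cx_dd_apply[OF B] ch_comm_apply[OF f]
   by simp
  finally show "gcomp (df ?C (n+1)) (df ?C n) v z = 0 v z" by (simp add: gcomp_apply pair_lin zero_fun_apply[of v] zero_fun_apply[of z])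
 qed
next
 obtain m m' where m: "!!n. abs n > m ==> zrep (ob A n)" and m': "!!n. abs n > m' ==> zrep (ob B n)"
  using cx_bound[OF A] cx_bound[OF B] by metis
 show "EX m. ALL n. abs n > m --> zrep (ob (Cone A B f) n)"
 proof (rule exI[of _ "abs m + \<bar>m'\<bar> + 1"], intro allI impI)
  fix n assume "abs n > abs m + \<bar>m'\<bar> + 1"
  hence "zrep (ob A (n+1))" "zrep (ob B n)" using m m' by auto
  thus "zrep (ob (Cone A B f) n)"
   by (auto simp: zrep_def sum_sp_def pair_lin)
 qed
qed

lemma cone_in_ch:
 assumes A: "cx A" and B: "cx B" and f: "f : Ch A B"
 shows "cone_in Q B : Ch B (Cone A B f)"
proof (rule chI'[OF B cone_cx[OF A B f]])
 fix n
 have "cone_in Q B n = hpair (ob B n) 0 (ident (ob B n))"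
  by (auto simp: cone_in_def hpair_def rep_id_def fun_eq_iff fun_ops)
 thus "cone_in Q B n : Hom (ob B n) (ob (Cone A B f) n)"
  using hpair_hom[OF cx_rep[OF B] cx_rep[OF A] cx_rep[OF B] hom_0[OF cx_rep[OF B] cx_rep[OF A]] ident_hom[OF cx_rep[OF B]]] by simp
 fix v x assume v: "v : vs" and x: "x : sp (ob B n) v"
 have 0: "0 : sp (ob A (n+1)) v" using kvec.subspace_0[OF rep_sub[OF cx_rep[OF A] v]] .
 have "pair 0 x : sum_sp (ob A (n+1)) (ob B n) v" using 0 x by simp
 thus "cone_in Q B (n+1) v (df B n v x) = df (Cone A B f) n v (cone_in Q B n v x)"
  using v x hom_mem[OF cx_df[OF B] v x] by (simp add: cone_in_def cone_df_apply hom_zero[OF cx_df[OF A]] hom_zero[OF ch_hom[OF f]])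
qed

lemma cone_pr_ch:
 assumes A: "cx A" and B: "cx B" and f: "f : Ch A B"
 shows "cone_pr Q A B : Ch (Cone A B f) (shift 1 A)"
proof (rule chI'[OF cone_cx[OF A B f] shift_cx[OF A]])
 fix n
 have pr: "cone_pr Q A B n = prl (ob A (n+1)) (ob B n)" for n by (simp add: cone_pr_def prl_def)
 show "cone_pr Q A B n : Hom (ob (Cone A B f) n) (ob (shift 1 A) n)"
  unfolding pr using prl_hom(1)[OF cx_rep[OF A] cx_rep[OF B]] by simp
 fix v z assume v: "v : vs" and "z : sp (ob (Cone A B f) n) v"
 hence z: "z : sum_sp (ob A (n+1)) (ob B n) v" by simp
 have "df (Cone A B f) n v z : sum_sp (ob A (n+1 + 1)) (ob B (n+1)) v"
  using hom_mem[OF cone_df_hom[OF A B f] v, of z n] z by simp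
 thus "cone_pr Q A B (n+1) v (df (Cone A B f) n v z) = df (shift 1 A) n v (cone_pr Q A B n v z)"
  unfolding pr prl_apply[OF v z] using v cone_df_apply[OF v z] by (simp add: prl_apply shift_df fun_ops)
qed

lemma quasi_isoD:
 assumes "qis X Y s" "v : vs"
 shows "s : Ch X Y"
  "x : sp (ob X n) v ==> df X n v x = 0 ==> s n v x : df Y (n-1) v ` sp (ob Y (n-1)) v ==> x : df X (n-1) v ` sp (ob X (n-1)) v"
  "y : sp (ob Y n) v ==> df Y n v y = 0 ==>
    EX x:sp (ob X n) v. df X n v x = 0 & y - s n v x : df Y (n-1) v ` sp (ob Y (n-1)) v"
 using assms unfolding quasi_iso_def by blast+

lemma quasi_iso_ch: "qis X Y s ==> s : Ch X Y"
 by (simp add: quasi_iso_def)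

text \<open>For a cycle \<open>(a, b)\<close> of the cone, injectivity of \<open>s\<close> on
  cohomology makes \<open>a\<close> a boundary, and surjectivity then corrects
  \<open>b\<close>.\<close>

lemma cone_exact:
 assumes A: "cx A" and B: "cx B" and s: "qis A B s"
 shows "exact (Cone A B s) n"
 unfolding exact_def
proof (intro ballI impI)
 have sc: "s : Ch A B" using s by (simp add: quasi_iso_def)
 fix v z assume v: "v : vs" and "z : sp (ob (Cone A B s) n) v" and dz: "df (Cone A B s) n v z = 0"
 hence z: "z : sum_sp (ob A (n+1)) (ob B n) v" by simp
 define a b where "a = evens z" and "b = odds z"
 have a: "a : sp (ob A (n+1)) v" and b: "b : sp (ob B n) v" using z by (simp_all add: sum_sp_iff a_def b_def)
 have "pair (- df A (n+1) v a) (s (n+1) v a + df B n v b) = pair 0 0"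
  using dz cone_df_apply[OF v z, of s] by (simp add: a_def b_def pair_lin)
 hence da: "df A (n+1) v a = 0" and sa: "s (n+1) v a = - df B n v b"
  by (simp_all add: pair_eq_iff eq_neg_iff_add_eq_0)
 have subB: "kvec.subspace (sp (ob B n) v)" and subA: "kvec.subspace (sp (ob A n) v)" for n
  using rep_sub[OF cx_rep[OF B] v] rep_sub[OF cx_rep[OF A] v] by blast+
 have "s (n+1) v a = df B n v (- b)" using lin_maps_uminus[OF hom_lin[OF cx_df[OF B] v] b] sa by simp
 hence "s (n+1) v a : df B (n+1 - 1) v ` sp (ob B (n+1 - 1)) v"
  using kvec.subspace_neg[OF subB b] by simp
 from quasi_isoD(2)[OF s v a da this] obtain a1 where a1: "a1 : sp (ob A n) v" "a = df A n v a1" by auto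
 have sa1: "s n v a1 : sp (ob B n) v" by (rule ch_mem[OF sc v a1(1)])
 have y: "b + s n v a1 : sp (ob B n) v" by (rule kvec.subspace_add[OF subB b sa1])
 have "df B n v (b + s n v a1) = df B n v b + s (n+1) v a"
  using lin_maps_add[OF hom_lin[OF cx_df[OF B] v] b sa1] ch_comm_apply[OF sc, of n v a1] a1(2) by simp
 also have "\<dots> = 0" using sa by simp
 finally have dy: "df B n v (b + s n v a1) = 0" .
 from quasi_isoD(3)[OF s v y dy] obtain a2 where a2: "a2 : sp (ob A n) v" "df A n v a2 = 0"
  "b + s n v a1 - s n v a2 : df B (n-1) v ` sp (ob B (n-1)) v" by blast
 from a2(3) obtain b' where b': "b' : sp (ob B (n-1)) v" "b + s n v a1 - s n v a2 = df B (n-1) v b'" by blast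
 have m: "a2 - a1 : sp (ob A n) v" by (rule kvec.subspace_diff[OF subA a2(1) a1(1)])
 have z': "pair (a2 - a1) b' : sum_sp (ob A (n-1 + 1)) (ob B (n-1)) v" using m b'(1) by simp
 have "df A n v (a2 - a1) = - a"
  using lin_maps_diff[OF hom_lin[OF cx_df[OF A] v] subA a2(1) a1(1)] a2(2) a1(2) by simp
 moreover have "s n v (a2 - a1) = s n v a2 - s n v a1"
  by (rule lin_maps_diff[OF hom_lin[OF ch_hom[OF sc] v] subA a2(1) a1(1)])
 ultimately have "df (Cone A B s) (n-1) v (pair (a2 - a1) b') = pair a (s n v a2 - s n v a1 + df B (n-1) v b')"
  unfolding cone_df_apply[OF v z'] by simp
 also have "\<dots> = z" unfolding b'(2)[symmetric] by (simp add: a_def b_def)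
 finally show "z : df (Cone A B s) (n-1) v ` sp (ob (Cone A B s) (n-1)) v"
  using m b'(1) by (auto intro!: image_eqI[of _ _ "pair (a2 - a1) b'"])
qed

text \<open>The two components of a null homotopy of \<open>P -> B -> cone\<close> are a chain map
  \<open>h : P -> A\<close> and a homotopy between \<open>g\<close> and \<open>s h\<close>.\<close>

lemma cone_null_lift:
 assumes P: "cx P" and A: "cx A" and B: "cx B" and s: "s : Ch A B" and g: "g : Ch P B"
  and null: "ccomp (cone_in Q B) g : nul P (Cone A B s)"
 obtains h where "h : Ch P A" "g - ccomp s h : nul P B"
proof -
 let ?C = "Cone A B s"
 obtain t where t0: "!!n. t n : Hom (ob P n) (ob ?C (n-1))" and eq: "ccomp (cone_in Q B) g = htpy P ?C t"
  using null by (auto simp: nul_iff)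
 have t: "t n : Hom (ob P n) (rep_sum Q (ob A n) (ob B (n-1)))" for n using t0[of n] by simp
 note rA = cx_rep[OF A] and rB = cx_rep[OF B]
 define h where "h n = gcomp (prl (ob A n) (ob B (n-1))) (t n)" for n
 define k where "k n = gcomp (prr (ob A n) (ob B (n-1))) (t n)" for n
 have h: "h n : Hom (ob P n) (ob A n)" for n unfolding h_def by (rule hom_comp[OF t prl_hom(1)[OF rA rB]])
 have k: "k n : Hom (ob P n) (ob B (n-1))" for n unfolding k_def by (rule hom_comp[OF t prl_hom(2)[OF rA rB]])
 have tv: "t n v x = pair (h n v x) (k n v x)" if v: "v : vs" and x: "x : sp (ob P n) v" for n v x
 proof -
  have "t n v x : sum_sp (ob A n) (ob B (n-1)) v" using hom_mem[OF t v x] by simp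
  thus ?thesis using v by (simp add: h_def k_def gcomp_apply prl_apply prr_apply)
 qed
 have E: "pair 0 (g n v x) = pair (- df A n v (h n v x) + h (n+1) v (df P n v x))
   (s n v (h n v x) + df B (n-1) v (k n v x) + k (n+1) v (df P n v x))"
  if v: "v : vs" and x: "x : sp (ob P n) v" for n v x
 proof -
  have m: "t n v x : sum_sp (ob A (n-1 + 1)) (ob B (n-1)) v" using hom_mem[OF t v x] by simp
  have dx: "df P n v x : sp (ob P (n+1)) v" by (rule hom_mem[OF cx_df[OF P] v x])
  have "pair 0 (g n v x) = ccomp (cone_in Q B) g n v x"
   using v ch_mem[OF g v x] by (simp add: ccomp_apply gcomp_apply cone_in_def)
  also have "\<dots> = df ?C (n-1) v (t n v x) + t (n+1) v (df P n v x)" unfolding eq htpy_apply ..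
  also have "\<dots> = pair (- df A n v (h n v x)) (s n v (h n v x) + df B (n-1) v (k n v x))
    + pair (h (n+1) v (df P n v x)) (k (n+1) v (df P n v x))"
   unfolding cone_df_apply[OF v m] tv[OF v dx] unfolding tv[OF v x] by simp
  finally show ?thesis by (simp add: pair_lin)
 qed
 have hc: "h : Ch P A"
 proof (rule chI'[OF P A h])
  fix n v x assume "v : vs" "x : sp (ob P n) v"
  from E[OF this] show "h (n+1) v (df P n v x) = df A n v (h n v x)" by (simp add: pair_eq_iff)
 qed
 have "g - ccomp s h = htpy P B k"
 proof
  fix n
  have "g - ccomp s h : Ch P B" by (rule ch_diff[OF P B g ccomp_ch[OF hc s]])
  moreover have "htpy P B k : Ch P B" using nul_ch[OF P B] nulI[of k P B, OF k] by blast
  ultimately show "(g - ccomp s h) n = htpy P B k n"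
  proof (intro hom_eqI[OF ch_hom ch_hom])
   fix v x assume "v : vs" "x : sp (ob P n) v"
   from E[OF this] show "(g - ccomp s h) n v x = htpy P B k n v x"
    by (simp add: pair_eq_iff htpy_apply ccomp_apply gcomp_apply minus_apply)
  qed
 qed
 hence "g - ccomp s h : nul P B" using nulI[of k P B, OF k] by simp
 with hc show thesis by (rule that)
qed

text \<open>The cone of \<open>s\<close> is exact, so the map from \<open>P\<close> into it is
  null-homotopic, and \<open>cone_null_lift\<close> applies.\<close>

lemma quasi_iso_lift:
 assumes P: "cx P" and proj: "!!n. proj (ob P n)" and A: "cx A" and B: "cx B"
  and s: "qis A B s" and g: "g : Ch P B"
 obtains h where "h : Ch P A" "g - ccomp s h : nul P B"
proof -
 have sc: "s : Ch A B" by (rule quasi_iso_ch[OF s])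
 have "ccomp (cone_in Q B) g : nul P (Cone A B s)"
  by (rule null_of_exact[OF P cone_cx[OF A B sc] proj ccomp_ch[OF g cone_in_ch[OF A B sc]]])
   (simp add: cone_exact[OF A B s])
 thus thesis using cone_null_lift[OF P A B sc g] that by blast
qed

text \<open>\<open>h\<close> and a null homotopy \<open>k\<close> of \<open>s h\<close> combine to a
  chain map into the cone shifted by -1. The latter is exact, and the first component of a
  contraction of this map contracts \<open>h\<close>.\<close>

lemma quasi_iso_cancel:
 assumes P: "cx P" and proj: "!!n. proj (ob P n)" and A: "cx A" and B: "cx B"
  and s: "qis A B s" and h: "h : Ch P A" and null: "ccomp s h : nul P B"
 shows "h : nul P A"
proof -
 have sc: "s : Ch A B" by (rule quasi_iso_ch[OF s])
 note rA = cx_rep[OF A] and rB = cx_rep[OF B] and rP = cx_rep[OF P]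
 obtain k where k: "!!n. k n : Hom (ob P n) (ob B (n-1))" and eq: "ccomp s h = htpy P B k"
  using null by (auto simp: nul_iff)
 let ?C = "Cone A B s" and ?D = "shift (-1) (Cone A B s)"
 have C: "cx ?C" by (rule cone_cx[OF A B sc])
 have D: "cx ?D" by (rule shift_cx[OF C])
 \<comment> \<open>The sign of \<open>k\<close> matches the sign of the differential of the shifted
   cone.\<close>
 define phi where "phi n = hpair (ob P n) (h n) (- k n)" for n
 have phih: "phi n : Hom (ob P n) (ob ?D n)" for n
  unfolding phi_def using hpair_hom[OF rP rA rB ch_hom[OF h] hom_neg[OF rP rB k], of n] by simp
 have Ddf: "df ?D n v z = pair (df A n v (evens z)) (- s n v (evens z) - df B (n-1) v (odds z))"
  if "v : vs" "z : sum_sp (ob A n) (ob B (n-1)) v" for n v z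
  using cone_df_apply[of v z A "n-1" B s] that
   pair_lin(2)[of "- 1" "- df A n v (evens z)" "s n v (evens z) + df B (n-1) v (odds z)"]
  by (simp add: shift_df fun_ops)
 have "phi : Ch P ?D"
 proof (rule chI'[OF P D phih])
  fix n v x assume v: "v : vs" and x: "x : sp (ob P n) v"
  have dx: "df P n v x : sp (ob P (n+1)) v" by (rule hom_mem[OF cx_df[OF P] v x])
  have kx: "k n v x : sp (ob B (n-1)) v" by (rule hom_mem[OF k v x])
  have m: "pair (h n v x) (- k n v x) : sum_sp (ob A n) (ob B (n-1)) v"
   using ch_mem[OF h v x] kvec.subspace_neg[OF rep_sub[OF rB v] kx] by simp
  have "s n v (h n v x) = df B (n-1) v (k n v x) + k (n+1) v (df P n v x)"
   using fun_cong2[OF fun_cong[OF eq, of n], of v, of x] by (simp add: ccomp_apply gcomp_apply htpy_apply)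
  moreover have neg: "(- k n) v x = - k n v x" for n v x by (simp add: fun_ops)
  ultimately show "phi (n+1) v (df P n v x) = df ?D n v (phi n v x)"
   unfolding phi_def hpair_apply[OF v dx] hpair_apply[OF v x] neg Ddf[OF v m]
   using lin_maps_uminus[OF hom_lin[OF cx_df'[OF B] v] kx] ch_comm_apply[OF h] by (simp add: pair_eq_iff)
 qed
 hence "phi : nul P ?D"
  by (rule null_of_exact[OF P D proj]) (simp add: shift_exact[OF C] cone_exact[OF A B s])
 then obtain u where u0: "!!n. u n : Hom (ob P n) (ob ?D (n-1))" and ueq: "phi = htpy P ?D u" by (auto simp: nul_iff)
 have u: "u n : Hom (ob P n) (rep_sum Q (ob A (n-1)) (ob B (n-1 - 1)))" for n using u0[of n] by simp
 define w where "w n = gcomp (prl (ob A (n-1)) (ob B (n-1 - 1))) (u n)" for n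
 have w: "w n : Hom (ob P n) (ob A (n-1))" for n unfolding w_def by (rule hom_comp[OF u prl_hom(1)[OF rA rB]])
 have wv: "w n v x = evens (u n v x)" if "v : vs" "x : sp (ob P n) v" for n v x
  using hom_mem[OF u that] that by (simp add: w_def gcomp_apply prl_apply)
 have "h = htpy P A w"
 proof
  fix n
  have "htpy P A w : Ch P A" using nul_ch[OF P A] nulI[of w P A, OF w] by blast
  thus "h n = htpy P A w n"
  proof (intro hom_eqI[OF ch_hom[OF h] ch_hom])
   fix v x assume v: "v : vs" and x: "x : sp (ob P n) v"
   have dx: "df P n v x : sp (ob P (n+1)) v" by (rule hom_mem[OF cx_df[OF P] v x])
   have "h n v x = evens (phi n v x)" unfolding phi_def hpair_apply[OF v x] by simp
   also have "\<dots> = evens (df ?D (n-1) v (u n v x)) + evens (u (n+1) v (df P n v x))"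
    unfolding ueq htpy_apply evens_lin ..
   also have "\<dots> = df A (n-1) v (w n v x) + w (n+1) v (df P n v x)"
    using hom_mem[OF u v x] by (simp add: Ddf[OF v] wv[OF v x] wv[OF v dx])
   finally show "h n v x = htpy P A w n v x" by (simp add: htpy_apply)
  qed
 qed
 thus ?thesis using nulI[of w P A, OF w] by simp
qed

end

section \<open>Cohomological properties of quasi-isomorphisms, resolutions\<close>

context quiver
begin

lemma nul_boundary:
 assumes "cx X" "cx Y" "f : nul X Y" "v : vs" "x : sp (ob X n) v" "df X n v x = 0"
 shows "f n v x : df Y (n-1) v ` sp (ob Y (n-1)) v"
proof -
 obtain s where s: "!!n. s n : Hom (ob X n) (ob Y (n-1))" "f = htpy X Y s" using assms(3) by (auto simp: nul_iff)
 have "f n v x = df Y (n-1) v (s n v x)" using assms(6) hom_zero[OF s(1)] by (simp add: s(2) htpy_apply)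
 thus ?thesis using hom_mem[OF s(1) assms(4,5)] by simp
qed

lemma boundary_subspace:
 assumes "cx Y" "v : vs"
 shows "kvec.subspace (df Y (n-1) v ` sp (ob Y (n-1)) v)"
 using subrepD(1)[OF subrep_image[OF cx_rep[OF assms(1)] cx_rep[OF assms(1)] cx_df'[OF assms(1)]] assms(2)] .

text \<open>On cycles, homotopic maps differ by boundaries.\<close>

lemma quasi_iso_htpy:
 assumes X: "cx X" and Y: "cx Y" and s: "qis X Y s" and s': "s' : Ch X Y" and null: "s - s' : nul X Y"
 shows "qis X Y s'"
 unfolding quasi_iso_def
proof (intro conjI allI ballI impI s')
 fix n v x assume v: "v : vs" and x: "x : sp (ob X n) v"
  and *: "df X n v x = 0 & s' n v x : df Y (n-1) v ` sp (ob Y (n-1)) v"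
 have "(s - s') n v x : df Y (n-1) v ` sp (ob Y (n-1)) v"
  by (rule nul_boundary[OF X Y null v x]) (use * in blast)
 from kvec.subspace_add[OF boundary_subspace[OF Y v] this conjunct2[OF *]]
 have "s n v x : df Y (n-1) v ` sp (ob Y (n-1)) v" by (simp add: fun_ops)
 thus "x : df X (n-1) v ` sp (ob X (n-1)) v" using quasi_isoD(2)[OF s v x] * by blast
next
 fix n v y assume v: "v : vs" and y: "y : sp (ob Y n) v" and dy: "df Y n v y = 0"
 obtain x where x: "x : sp (ob X n) v" "df X n v x = 0" "y - s n v x : df Y (n-1) v ` sp (ob Y (n-1)) v"
  using quasi_isoD(3)[OF s v y dy] by blast
 have "(s - s') n v x : df Y (n-1) v ` sp (ob Y (n-1)) v" by (rule nul_boundary[OF X Y null v x(1,2)])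
 from kvec.subspace_add[OF boundary_subspace[OF Y v] x(3) this]
 have "y - s' n v x : df Y (n-1) v ` sp (ob Y (n-1)) v"
  by (simp add: minus_apply[of s] minus_apply[of "s n"] minus_apply[of "s n v"])
 thus "EX x:sp (ob X n) v. df X n v x = 0 & y - s' n v x : df Y (n-1) v ` sp (ob Y (n-1)) v"
  using x by blast
qed

lemma quasi_iso_comp:
 assumes X: "cx X" and Y: "cx Y" and Z: "cx Z" and s: "qis X Y s" and t: "qis Y Z t"
 shows "qis X Z (ccomp t s)"
 unfolding quasi_iso_def
proof (intro conjI allI ballI impI)
 note sc = quasi_iso_ch[OF s] and tc = quasi_iso_ch[OF t]
 show "ccomp t s : Ch X Z" by (rule ccomp_ch[OF sc tc])
 fix n v x assume v: "v : vs" and x: "x : sp (ob X n) v"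
  and *: "df X n v x = 0 & ccomp t s n v x : df Z (n-1) v ` sp (ob Z (n-1)) v"
 have "df Y n v (s n v x) = 0" using * ch_comm_apply[OF sc, of n v x] hom_zero[OF ch_hom[OF sc]] by simp
 hence "s n v x : df Y (n-1) v ` sp (ob Y (n-1)) v"
  using quasi_isoD(2)[OF t v ch_mem[OF sc v x]] * by (simp add: ccomp_apply gcomp_apply)
 thus "x : df X (n-1) v ` sp (ob X (n-1)) v" using quasi_isoD(2)[OF s v x] * by blast
next
 note sc = quasi_iso_ch[OF s] and tc = quasi_iso_ch[OF t]
 fix n v z assume v: "v : vs" and z: "z : sp (ob Z n) v" and dz: "df Z n v z = 0"
 obtain y where y: "y : sp (ob Y n) v" "df Y n v y = 0" "z - t n v y : df Z (n-1) v ` sp (ob Z (n-1)) v"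
  using quasi_isoD(3)[OF t v z dz] by blast
 obtain x where x: "x : sp (ob X n) v" "df X n v x = 0" "y - s n v x : df Y (n-1) v ` sp (ob Y (n-1)) v"
  using quasi_isoD(3)[OF s v y(1,2)] by blast
 obtain b where b: "b : sp (ob Y (n-1)) v" "y - s n v x = df Y (n-1) v b" using x(3) by blast
 have "t n v (y - s n v x) = t n v y - t n v (s n v x)"
  by (rule lin_maps_diff[OF hom_lin[OF ch_hom[OF tc] v] rep_sub[OF cx_rep[OF Y] v] y(1) ch_mem[OF sc v x(1)]])
 hence "t n v y - t n v (s n v x) = df Z (n-1) v (t (n-1) v b)"
  using b(2) ch_comm_apply'[OF tc, of n v b] by simp
 hence "t n v y - t n v (s n v x) : df Z (n-1) v ` sp (ob Z (n-1)) v"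
  using ch_mem[OF tc v b(1)] by simp
 from kvec.subspace_add[OF boundary_subspace[OF Z v] y(3) this]
 have "z - ccomp t s n v x : df Z (n-1) v ` sp (ob Z (n-1)) v" by (simp add: ccomp_apply gcomp_apply)
 thus "EX x:sp (ob X n) v. df X n v x = 0 & z - ccomp t s n v x : df Z (n-1) v ` sp (ob Z (n-1)) v"
  using x by blast
qed

lemma quasi_iso_cid:
 assumes X: "cx X"
 shows "qis X X (cid Q X)"
 unfolding quasi_iso_def
proof (intro conjI allI ballI impI cid_ch[OF X])
 fix n v x assume v: "v : vs" and x: "x : sp (ob X n) v"
 have i: "cid Q X n v x = x" using v x by (simp add: cid_def rep_id_def)
 show "x : df X (n-1) v ` sp (ob X (n-1)) v"
  if "df X n v x = 0 & cid Q X n v x : df X (n-1) v ` sp (ob X (n-1)) v" using that unfolding i by blast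
 have "0 : df X (n-1) v ` sp (ob X (n-1)) v" by (rule kvec.subspace_0[OF boundary_subspace[OF X v]])
 thus "EX y:sp (ob X n) v. df X n v y = 0 & x - cid Q X n v y : df X (n-1) v ` sp (ob X (n-1)) v"
  if "df X n v x = 0" using that x i by (intro bexI[of _ x]) auto
qed

lemma quasi_iso_exact:
 assumes "cx X" "cx Y" "qis X Y s" "exact Y n"
 shows "exact X n"
 unfolding exact_def
proof (intro ballI impI)
 fix v x assume v: "v : vs" and x: "x : sp (ob X n) v" and dx: "df X n v x = 0"
 note sc = quasi_iso_ch[OF assms(3)]
 have "df Y n v (s n v x) = 0" using dx ch_comm_apply[OF sc, of n v x] hom_zero[OF ch_hom[OF sc]] by simp
 hence "s n v x : df Y (n-1) v ` sp (ob Y (n-1)) v"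
  using assms(4) ch_mem[OF sc v x] v by (simp add: exact_def)
 thus "x : df X (n-1) v ` sp (ob X (n-1)) v" by (rule quasi_isoD(2)[OF assms(3) v x dx])
qed

lemma zero_rep_rep: "rep (zero_rep :: ('v, 'e, 'k::field) qrep)"
proof -
 have "fd_subspace {0 :: nat => 'k}" by (simp add: fd_subspace_iff)
 moreover have "(%x. 0) : lin_maps {0} {0 :: nat => 'k}" by (rule lin_mapsI) auto
 ultimately show ?thesis by (simp add: is_rep_def zero_rep_def)
qed

lemma zero_rep_zero: "zrep zero_rep"
 by (simp add: zrep_def zero_rep_def)

text \<open>A projective resolution of an arbitrary bounded complex. It is bounded itself, which
  heredity makes possible.\<close>

definition
 "resolves P p X \<longleftrightarrow> cx P & cx X & (ALL n. proj (ob P n)) & qis P X p"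

lemma resolvesD:
 assumes "resolves P p X"
 shows "cx P" "cx X" "proj (ob P n)" "qis P X p" "p : Ch P X"
 using assms quasi_iso_ch by (auto simp: resolves_def)

lemma resolves_self: "cx P ==> (!!n. proj (ob P n)) ==> resolves P (cid Q P) P"
 by (simp add: resolves_def quasi_iso_cid)

lemma resolves_shift: "resolves P p X ==> resolves (shift k P) (shift_map k p) (shift k X)"
 by (simp add: resolves_def shift_cx shift_quasi_iso)

end

context positive_quiver
begin

text \<open>
 The boundaries of \<open>P\<close> are projective, so below degree \<open>a\<close> there is a contraction \<open>c\<close>, up to the
 projection \<open>e\<close> onto a complement of the cycles in degree \<open>a - 1\<close>. It is combined with a
 homotopy in degrees \<open>\<ge> a - 1\<close>.
\<close>

theorem null_of_gap:
 assumes P: "cx P" and proj: "!!n. proj (ob P n)" and ex: "!!n. n < a ==> exact P n"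
  and W: "cx W" and exW: "!!n. n >= a-1 ==> exact W n" and f: "f : Ch P W"
 shows "f : nul P W"
proof -
 note rP = cx_rep[OF P] and rW = cx_rep[OF W] and d = cx_df[OF P] and d' = cx_df'[OF P]
 define B where "B n = sub_rep (ob P n) (%v. df P (n-1) v ` sp (ob P (n-1)) v)" for n
 have sB: "subrep Q (ob P n) (%v. df P (n-1) v ` sp (ob P (n-1)) v)" for n by (rule subrep_image[OF rP rP d'])
 have rB: "rep (B n)" for n unfolding B_def by (rule sub_rep_rep[OF rP sB])
 have dB: "df P (n-1) : Hom (ob P (n-1)) (B n)" for n unfolding B_def by (rule hom_sub_rep[OF rP rP sB d']) blast
 have pB: "proj (B n)" for n unfolding B_def by (rule projective_sub_rep[OF proj sB])
 \<comment> \<open>A section of the differential onto its image, which exists because the image is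
   projective.\<close>
 have "EX \<sigma>:Hom (B n) (ob P (n-1)). ident (B n) = gcomp (df P (n-1)) \<sigma>" for n
  by (rule projective_lift[OF pB rP rB dB ident_hom[OF rB]]) (simp add: B_def)
 then obtain \<sigma> where \<sigma>: "!!n. \<sigma> n : Hom (B n) (ob P (n-1))" "!!n. ident (B n) = gcomp (df P (n-1)) (\<sigma> n)" by metis
 define e where "e n = gcomp (\<sigma> (n+1)) (df P n)" for n
 define c where "c n = gcomp (\<sigma> n) (ident (ob P n) - e n)" for n
 have e: "e n : Hom (ob P n) (ob P n)" for n
  using hom_comp[OF dB \<sigma>(1), of "n+1"] by (simp add: e_def)
 have i: "ident (ob P n) - e n : Hom (ob P n) (ob P n)" for n by (rule hom_diff[OF rP rP ident_hom[OF rP] e])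
 have de: "gcomp (df P n) (e n) = df P n" for n
  using \<sigma>(2)[of "n+1"] ident_left[OF dB rB, of "n+1"] by (simp add: e_def gcomp_assoc)
 have ed: "gcomp (e n) (df P (n-1)) = 0" for n
  using comp_zero[OF \<sigma>(1)[of "n+1"]] by (simp add: e_def gcomp_assoc[symmetric] cx_dd'[OF P])
 have iB: "ident (ob P n) - e n : Hom (ob P n) (B n)" if n: "n < a" for n
  unfolding B_def
 proof (rule hom_sub_rep[OF rP rP sB i])
  fix v x assume v: "v : vs" "x : sp (ob P n) v"
  have "gcomp (df P n) (ident (ob P n) - e n) = 0"
   by (simp add: comp_diff[OF d ident_hom[OF rP] e rP] de ident_right[OF d])
  hence "df P n v ((ident (ob P n) - e n) v x) = 0" by (rule gcomp_zeroD)
  thus "(ident (ob P n) - e n) v x : df P (n-1) v ` sp (ob P (n-1)) v"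
   using ex[OF n] hom_mem[OF i v] v(1) by (simp add: exact_def)
 qed
 have c: "c n : Hom (ob P n) (ob P (n-1))" if "n < a" for n unfolding c_def by (rule hom_comp[OF iB[OF that] \<sigma>(1)])
 have dc: "gcomp (df P (n-1)) (c n) = ident (ob P n) - e n" if "n < a" for n
  using ident_left[OF iB[OF that] rB] by (simp add: c_def gcomp_assoc \<sigma>(2)[symmetric])
 have cd: "gcomp (c (n+1)) (df P n) = e n" for n
  using ed[of "n+1"] ident_left[OF d rP] by (simp add: c_def gcomp_assoc[symmetric] gcomp_diff_left) (simp add: e_def)
 obtain s where s: "!!n. s n : Hom (ob P n) (ob W (n-1))" "!!n. n >= a-1 ==> f n = htpy P W s n"
  by (rule partial_homotopy[OF P W proj f disjI1[OF exW]]) (assumption, rule that)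
 let ?f = "%n. gcomp (f (n-1)) (c n)"
 have fc: "?f n : Hom (ob P n) (ob W (n-1))" if "n < a" for n by (rule hom_comp[OF c[OF that] ch_hom[OF f]])
 have dfc: "gcomp (df W (n-1)) (?f n) = f n - gcomp (f n) (e n)" if "n < a" for n
  using comp_diff[OF ch_hom[OF f] ident_hom[OF rP] e rP] ident_right[OF ch_hom[OF f]]
  by (simp add: gcomp_assoc ch_comm'[OF f, symmetric]) (simp add: gcomp_assoc[symmetric] dc[OF that])
 have se: "gcomp (s n) (e n) : Hom (ob P n) (ob W (n-1))" for n by (rule hom_comp[OF e s(1)])
 \<comment> \<open>From degree \<open>a\<close> on the homotopy \<open>s\<close> is used, below
   \<open>a - 1\<close> the contraction of \<open>P\<close> followed by \<open>f\<close>. In degree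
   \<open>a - 1\<close>, where they meet, the summand \<open>s e\<close> supplies the part of
   \<open>f\<close> on the complement of the cycles.\<close>
 define t where "t n = (if n >= a then s n else if n = a-1 then ?f n + gcomp (s n) (e n) else ?f n)" for n
 have t: "t n : Hom (ob P n) (ob W (n-1))" for n
  using s(1)[of n] fc[of n] hom_add[OF rP rW fc[of n] se[of n]]
  unfolding t_def by (simp only: not_le split: if_split) blast
 have "f n = htpy P W t n" for n
 proof -
  consider "n >= a" | "n = a-1" | "n < a-1" by linarith
  thus ?thesis
  proof cases
   case 1
   thus ?thesis using s(2)[of n] by (simp add: htpy_at t_def)
  next
   case 2
   hence n: "n < a" "n >= a-1" "n+1 = a" by simp_all
   have "gcomp (df W (n-1)) (gcomp (s n) (e n)) = gcomp (f n - gcomp (s (n+1)) (df P n)) (e n)"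
    using s(2)[OF n(2)] by (simp add: htpy_at gcomp_assoc)
   also have "\<dots> = gcomp (f n) (e n) - gcomp (s (n+1)) (df P n)"
    by (simp add: gcomp_diff_left gcomp_assoc[symmetric] de)
   finally show ?thesis
    using dfc[OF n(1)] comp_add[OF cx_df'[OF W] fc[OF n(1)] se rW] n by (simp add: htpy_at t_def)
  next
   case 3
   hence n: "n < a" "n+1 < a" by simp_all
   have "gcomp (?f (n+1)) (df P n) = gcomp (f n) (e n)" by (simp add: gcomp_assoc[symmetric] cd)
   moreover have "gcomp (gcomp (s (n+1)) (e (n+1))) (df P n) = 0"
    using ed[of "n+1"] comp_zero[OF s(1)[of "n+1"]] by (simp add: gcomp_assoc[symmetric])
   ultimately have "gcomp (t (n+1)) (df P n) = gcomp (f n) (e n)"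
    using n by (auto simp: t_def gcomp_add_left)
   thus ?thesis using dfc[OF n(1)] 3 by (simp add: htpy_at t_def)
  qed
 qed
 hence "f = htpy P W t" by (intro ext) simp
 thus ?thesis using nulI[of t P W, OF t] by simp
qed

text \<open>\<open>A\<close> is the degreewise free cover of \<open>X\<close> and \<open>K\<close>
  the kernel of \<open>A -> X\<close>, projective in each degree by heredity; the cone of
  \<open>K -> A\<close> is the resolution. The last clause records its support: a stalk in degree 0
  is resolved in degrees -1 and 0.\<close>

lemma resolution_exists:
 fixes X :: "('v, 'e, 'k::field) cplx"
 assumes X: "cx X"
 obtains P p where "resolves P p X"
  "!!n. zrep (ob X n) ==> zrep (ob X (n+1)) ==> zrep (ob P n)"
proof -
 note r = cx_rep[OF X]
 define A :: "('v, 'e, 'k) cplx" where "A = \<lparr>ob = (%n. P0 (ob X n)), df = (%n. P0map (ob X n) (ob X (n+1)) (df X n))\<rparr>"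
 have obA: "ob A n = P0 (ob X n)" and dfA: "df A n = P0map (ob X n) (ob X (n+1)) (df X n)" for n by (simp_all add: A_def)
 have rA: "rep (ob A n)" for n by (simp add: obA P0_rep[OF r])
 have dhA: "df A n : Hom (ob A n) (ob A (n+1))" for n unfolding obA dfA by (rule P0map_hom(1)[OF r r cx_df[OF X]])
 obtain m where m: "!!n. abs n > m ==> zrep (ob X n)" using cx_bound[OF X] by blast
 have A: "cx A" unfolding is_complex_def
 proof (intro conjI allI rA dhA)
  show "gcomp (df A (n+1)) (df A n) = 0" for n
   unfolding dfA by (rule P0map_comp_zero[OF r r r cx_df[OF X] cx_df[OF X] cx_dd[OF X]])
  show "EX m. ALL n. abs n > m --> zrep (ob A n)"
   by (rule exI[of _ m]) (simp add: obA P0_zero[OF r] m)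
 qed
 define E where "E n = eps (ob X n)" for n
 have Eh: "E n : Hom (ob A n) (ob X n)" for n unfolding E_def obA by (rule eps_hom[OF r])
 have Ec: "E : Ch A X"
 proof (rule chI[OF Eh])
  show "gcomp (E (n+1)) (df A n) = gcomp (df X n) (E n)" for n
   unfolding E_def dfA by (rule eps_natural[OF r r cx_df[OF X]])
 qed
 define Z where "Z n v = {x : sp (ob A n) v. E n v x = 0}" for n v
 have Z: "subrep Q (ob A n) (Z n)" for n unfolding Z_def by (rule subrep_kernel[OF rA r Eh])
 define K :: "('v, 'e, 'k) cplx" where "K = \<lparr>ob = (%n. sub_rep (ob A n) (Z n)), df = (%n. restr (Z n) (df A n))\<rparr>"
 have obK: "ob K n = sub_rep (ob A n) (Z n)" and dfK: "df K n = restr (Z n) (df A n)" for n by (simp_all add: K_def)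
 have rK: "rep (ob K n)" for n unfolding obK by (rule sub_rep_rep[OF rA Z])
 have dfK_apply: "df K n v x = df A n v x" if "v : vs" "x : Z n v" for n v x
  unfolding dfK using that by (rule restr_apply[where A = "Z n"])
 have ZA: "x : sp (ob A n) v" if "x : Z n v" for n v x using that by (simp add: Z_def)
 have dZ: "df A n v x : Z (n+1) v" if "v : vs" "x : Z n v" for n v x
  using that ch_comm_apply[OF Ec, of n v x] hom_mem[OF dhA that(1), of x n] hom_zero[OF cx_df[OF X]] by (simp add: Z_def)
 have dhK: "df K n : Hom (ob K n) (ob K (n+1))" for n
  unfolding obK dfK
 proof (rule hom_sub_rep[OF sub_rep_rep[OF rA Z] rA Z restr_hom[OF rA rA Z dhA]])
  fix v x assume v: "v : vs" and x: "x : sp (sub_rep (ob A n) (Z n)) v"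
  thus "restr (Z n) (df A n) v x : Z (n+1) v" using dfK_apply[OF v] dZ[OF v] by (simp add: dfK)
 qed
 have zK: "zrep (ob K n)" if "zrep (ob X n)" for n
 proof -
  have "zrep (ob A n)" using P0_zero[OF r that] by (simp add: obA)
  hence "Z n v <= {0}" if "v : vs" for v using ZA that unfolding zrep_def by blast
  moreover have "0 : Z n v" if "v : vs" for v using rep_0[OF rK that] by (simp add: obK)
  ultimately show ?thesis unfolding zrep_def obK sp_sub_rep by blast
 qed
 have K: "cx K" unfolding is_complex_def
 proof (intro conjI allI rK dhK)
  show "gcomp (df K (n+1)) (df K n) = 0" for n
  proof (rule hom_eqI[OF hom_comp[OF dhK dhK] hom_0[OF rK rK]])
   fix v x assume v: "v : vs" and "x : sp (ob K n) v"
   hence x: "x : Z n v" by (simp add: obK)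
   have "df K (n+1) v (df K n v x) = 0"
    using dfK_apply[OF v x] dfK_apply[OF v dZ[OF v x]] cx_dd_apply[OF A] by simp
   thus "gcomp (df K (n+1)) (df K n) v x = 0 v x" by (simp add: gcomp_apply zero_fun_apply[of v] zero_fun_apply[of x])
  qed
  show "EX m. ALL n. abs n > m --> zrep (ob K n)" using zK m by blast
 qed
 define i where "i n = ident (ob K n)" for n
 have ia: "i n v x = x" if "v : vs" "x : Z n v" for n v x using that by (simp add: i_def rep_id_def obK)
 have ic: "i : Ch K A"
 proof (rule chI'[OF K A])
  fix n
  show "i n : Hom (ob K n) (ob A n)"
   unfolding i_def obK by (rule sub_rep_incl[OF sub_rep_rep[OF rA Z] rA Z ident_hom[OF sub_rep_rep[OF rA Z]]])
  fix v x assume v: "v : vs" and "x : sp (ob K n) v"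
  hence x: "x : Z n v" by (simp add: obK)
  show "i (n+1) v (df K n v x) = df A n v (i n v x)"
   using ia[OF v x] ia[OF v dZ[OF v x]] dfK_apply[OF v x] by simp
 qed
 let ?P = "Cone K A i"
 have P: "cx ?P" by (rule cone_cx[OF K A ic])
 define p where "p n = gcomp (E n) (prr (ob K (n+1)) (ob A n))" for n
 have ph: "p n : Hom (ob ?P n) (ob X n)" for n
  unfolding p_def using hom_comp[OF prl_hom(2)[OF rK rA] Eh] by simp
 have pa: "p n v z = E n v (odds z)" if "v : vs" "z : sum_sp (ob K (n+1)) (ob A n) v" for n v z
  using that by (simp add: p_def gcomp_apply prr_apply)
 have dPa: "df ?P n v z = pair (- df A (n+1) v (evens z)) (evens z + df A n v (odds z))"
  if "v : vs" "z : sum_sp (ob K (n+1)) (ob A n) v" for n v z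
 proof -
  have "evens z : Z (n+1) v" using that(2) by (simp add: sum_sp_iff obK)
  thus ?thesis using cone_df_apply[OF that, of i] ia[OF that(1)] dfK_apply[OF that(1)] by simp
 qed
 have pc: "p : Ch ?P X"
 proof (rule chI'[OF P X ph])
  fix n v z assume v: "v : vs" and "z : sp (ob ?P n) v"
  hence z: "z : sum_sp (ob K (n+1)) (ob A n) v" by simp
  hence e: "evens z : Z (n+1) v" and o: "odds z : sp (ob A n) v" by (simp_all add: sum_sp_iff obK)
  have m: "df ?P n v z : sum_sp (ob K (n+1 + 1)) (ob A (n+1)) v"
   using hom_mem[OF cx_df[OF P] v, of z n] z by simp
  have "p (n+1) v (df ?P n v z) = E (n+1) v (evens z + df A n v (odds z))"
   unfolding pa[OF v m] unfolding dPa[OF v z] by simp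
  also have "\<dots> = E (n+1) v (evens z) + E (n+1) v (df A n v (odds z))"
   by (rule lin_maps_add[OF hom_lin[OF Eh v] ZA[OF e] hom_mem[OF dhA v o]])
  also have "\<dots> = df X n v (p n v z)" using e ch_comm_apply[OF Ec, of n v "odds z"] pa[OF v z] by (simp add: Z_def)
  finally show "p (n+1) v (df ?P n v z) = df X n v (p n v z)" .
 qed
 have Es: "EX b:sp (ob A n) v. E n v b = x" if "v : vs" "x : sp (ob X n) v" for n v x
 proof -
  have "x : E n v ` sp (ob A n) v" using eps_surj[OF r that(1), of n] that(2) unfolding E_def obA by blast
  thus ?thesis by (elim imageE) (intro bexI, simp_all)
 qed
 \<comment> \<open>A cycle \<open>(a, b)\<close> has \<open>a = - d b\<close>. If \<open>E b\<close>
   is the boundary of \<open>E y\<close>, then \<open>b - d y\<close> lies in \<open>K\<close> and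
   \<open>(b - d y, y)\<close> has the boundary \<open>(a, b)\<close>. A cycle of \<open>X\<close>
   is hit by \<open>(- d b, b)\<close> for any preimage \<open>b\<close>.\<close>
 have "qis ?P X p"
  unfolding quasi_iso_def
 proof (intro conjI allI ballI impI pc)
  fix n v z assume v: "v : vs" and "z : sp (ob ?P n) v"
   and *: "df ?P n v z = 0 & p n v z : df X (n-1) v ` sp (ob X (n-1)) v"
  hence z: "z : sum_sp (ob K (n+1)) (ob A n) v" by simp
  define a b where "a = evens z" and "b = odds z"
  have a: "a : Z (n+1) v" and b: "b : sp (ob A n) v" using z by (simp_all add: sum_sp_iff obK a_def b_def)
  have "pair (- df A (n+1) v a) (a + df A n v b) = pair 0 0" using * dPa[OF v z] by (simp add: a_def b_def pair_lin)
  hence ab: "a = - df A n v b" by (simp add: pair_eq_iff eq_neg_iff_add_eq_0)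
  obtain x where x: "x : sp (ob X (n-1)) v" "E n v b = df X (n-1) v x" using * pa[OF v z] by (auto simp: b_def)
  obtain y where y: "y : sp (ob A (n-1)) v" "E (n-1) v y = x" using Es[OF v x(1)] by blast
  have dy: "df A (n-1) v y : sp (ob A n) v" by (rule hom_mem[OF cx_df'[OF A] v y(1)])
  have mA: "b - df A (n-1) v y : sp (ob A n) v" by (rule kvec.subspace_diff[OF rep_sub[OF rA v] b dy])
  have "E n v (b - df A (n-1) v y) = E n v b - E n v (df A (n-1) v y)"
   by (rule lin_maps_diff[OF hom_lin[OF Eh v] rep_sub[OF rA v] b dy])
  hence bZ: "b - df A (n-1) v y : Z n v" using mA x(2) y(2) ch_comm_apply'[OF Ec, of n v y] by (simp add: Z_def)
  have w: "pair (b - df A (n-1) v y) y : sum_sp (ob K (n-1 + 1)) (ob A (n-1)) v" using bZ y(1) by (simp add: obK)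
  have "df A n v (b - df A (n-1) v y) = df A n v b"
   using lin_maps_diff[OF hom_lin[OF dhA v] rep_sub[OF rA v] b dy] cx_dd_apply'[OF A] by simp
  hence "df ?P (n-1) v (pair (b - df A (n-1) v y) y) = z"
  proof -
   have "pair a b = z" by (simp add: a_def b_def)
   thus ?thesis using dPa[OF v w] ab \<open>df A n v (b - df A (n - 1) v y) = df A n v b\<close> by simp
  qed
  thus "z : df ?P (n-1) v ` sp (ob ?P (n-1)) v" using w by (auto intro!: image_eqI)
 next
  fix n v x assume v: "v : vs" and x: "x : sp (ob X n) v" and dx: "df X n v x = 0"
  obtain b where b: "b : sp (ob A n) v" "E n v b = x" using Es[OF v x] by blast
  have db: "df A n v b : sp (ob A (n+1)) v" by (rule hom_mem[OF dhA v b(1)])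
  have "E (n+1) v (df A n v b) = 0" using ch_comm_apply[OF Ec, of n v b] b(2) dx by simp
  hence dZ': "df A n v b : Z (n+1) v" using db by (simp add: Z_def)
  have nZ: "- df A n v b : Z (n+1) v" by (rule kvec.subspace_neg[OF subrepD(1)[OF Z v] dZ'])
  have w: "pair (- df A n v b) b : sum_sp (ob K (n+1)) (ob A n) v" using nZ b(1) by (simp add: obK)
  have "df A (n+1) v (- df A n v b) = 0"
   using lin_maps_uminus[OF hom_lin[OF dhA v] db] cx_dd_apply[OF A] by simp
  hence "df ?P n v (pair (- df A n v b) b) = 0" using dPa[OF v w] by (simp add: pair_lin)
  moreover have "p n v (pair (- df A n v b) b) = x" using pa[OF v w] b(2) by simp
  moreover have "0 : df X (n-1) v ` sp (ob X (n-1)) v" by (rule kvec.subspace_0[OF boundary_subspace[OF X v]])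
  ultimately show "EX z:sp (ob ?P n) v. df ?P n v z = 0 & x - p n v z : df X (n-1) v ` sp (ob X (n-1)) v"
   using w by (intro bexI[of _ "pair (- df A n v b) b"]) simp_all
 qed
 moreover have "proj (ob ?P n)" for n
  unfolding cone_ob obK obA
  by (intro projective_rep_sum projective_sub_rep P0_projective[OF r] Z[unfolded obA])
 ultimately have "resolves ?P p X" using P X by (simp add: resolves_def)
 moreover have "zrep (ob ?P n)" if "zrep (ob X n)" "zrep (ob X (n+1))" for n
  using zK[OF that(2)] P0_zero[OF r that(1)]
  by (auto simp: zrep_def sum_sp_def pair_lin obA)
 ultimately show thesis using that by blast
qed

end

section \<open>The derived category in terms of resolutions\<close>

context quiver
begin

text \<open>The morphism of the derived category given by a chain map from a projective resolution \<open>p: P \<rightarrow> X\<close> to \<open>Y\<close>.\<close>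

definition
 "cls P p X Y f = {(W, s, h). (W, s, h) : roofs Q X Y &
   (EX u:Ch P W. ccomp s u - p : nul P X & ccomp h u - f : nul P Y)}"

lemma roofsD: "(W, s, h) : roofs Q X Y ==> cx W" "(W, s, h) : roofs Q X Y ==> qis W X s"
  "(W, s, h) : roofs Q X Y ==> h : Ch W Y" "(W, s, h) : roofs Q X Y ==> s : Ch W X"
 using quasi_iso_ch by (auto simp: roofs_def)

lemma roofsI: "cx W ==> qis W X s ==> h : Ch W Y ==> (W, s, h) : roofs Q X Y"
 by (simp add: roofs_def)

lemma nul_sym: "cx X ==> cx Y ==> f - g : nul X Y ==> g - f : nul X Y"
 using nul_neg[of X Y "f - g"] by simp

lemma nul_trans: "cx X ==> cx Y ==> f - g : nul X Y ==> g - h : nul X Y ==> f - h : nul X Y"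
 using nul_add[of X Y "f - g" "g - h"] by simp

lemma nul_refl: "cx X ==> cx Y ==> f - f : nul X Y"
 using nul_0 by simp

lemma nul_comp_left:
 assumes "cx X" "cx Y" "cx Z" "f : Ch X Y" "f' : Ch X Y" "f - f' : nul X Y" "g : Ch Y Z"
 shows "ccomp g f - ccomp g f' : nul X Z"
 using nul_left[OF assms(1-3,6,7)] ccomp_right(2)[OF assms(7,4,5,2)] by simp

lemma nul_comp_right:
 assumes "cx X" "cx Y" "f : Ch X Y" "g - g' : nul Y Z"
 shows "ccomp g f - ccomp g' f : nul X Z"
 using nul_right[OF assms(1-4)] by (simp add: ccomp_left)

lemma resolve_lift:
 assumes R: "resolves P p X" and W: "cx W" and s: "qis W X s"
 obtains u where "u : Ch P W" "ccomp s u - p : nul P X"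
proof -
 note r = resolvesD[OF R]
 obtain u where "u : Ch P W" "p - ccomp s u : nul P X"
  by (rule quasi_iso_lift[OF r(1,3) W r(2) s r(5)])
 thus thesis using that nul_sym[OF r(1,2)] by blast
qed

lemma resolve_lift_unique:
 assumes R: "resolves P p X" and W: "cx W" and X': "cx X'" and s: "qis W X' s" and u: "u : Ch P W" and u': "u' : Ch P W"
  and eq: "ccomp s u - ccomp s u' : nul P X'"
 shows "u - u' : nul P W"
proof -
 note r = resolvesD[OF R]
 have "ccomp s (u - u') : nul P X'" using eq ccomp_right(2)[OF quasi_iso_ch[OF s] u u' W] by simp
 thus ?thesis using quasi_iso_cancel[OF r(1,3) W X' s ch_diff[OF r(1) W u u']] by blast
qed

lemma cls_cong:
 assumes R: "resolves P p X" and Y: "cx Y" and fg: "f - g : nul P Y"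
 shows "cls P p X Y f = cls P p X Y g"
proof -
 note r = resolvesD[OF R]
 have "cls P p X Y f <= cls P p X Y g" if "f - g : nul P Y" for f g
  unfolding cls_def using nul_trans[OF r(1) Y _ that] by blast
 thus ?thesis using fg nul_sym[OF r(1) Y fg] by blast
qed

text \<open>Lifts of \<open>p\<close> through \<open>s\<close> are unique up to homotopy, so a
  single lift \<open>u\<close> decides membership.\<close>

lemma cls_mem_iff:
 assumes R: "resolves P p X" and Y: "cx Y" and W: "(W, s, h) : roofs Q X Y"
  and u: "u : Ch P W" "ccomp s u - p : nul P X"
 shows "(W, s, h) : cls P p X Y f \<longleftrightarrow> ccomp h u - f : nul P Y"
proof
 note r = resolvesD[OF R] and w = roofsD[OF W]
 assume "(W, s, h) : cls P p X Y f"
 then obtain u' where u': "u' : Ch P W" "ccomp s u' - p : nul P X" "ccomp h u' - f : nul P Y" by (auto simp: cls_def)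
 have "ccomp s u - ccomp s u' : nul P X" by (rule nul_trans[OF r(1,2) u(2) nul_sym[OF r(1,2) u'(2)]])
 hence "u - u' : nul P W" by (rule resolve_lift_unique[OF R w(1) r(2) w(2) u(1) u'(1)])
 hence "ccomp h u - ccomp h u' : nul P Y" by (rule nul_comp_left[OF r(1) w(1) Y u(1) u'(1) _ w(3)])
 thus "ccomp h u - f : nul P Y" using nul_trans[OF r(1) Y] u'(3) by blast
qed (use W u in \<open>auto simp: cls_def\<close>)

lemma cls_self: "resolves P p X ==> cx Y ==> f : Ch P Y ==> (P, p, f) : cls P p X Y f"
proof -
 assume R: "resolves P p X" and Y: "cx Y" and f: "f : Ch P Y"
 note r = resolvesD[OF R]
 show ?thesis unfolding cls_def
  using roofsI[OF r(1,4) f] cid_ch[OF r(1)] ccomp_cid(2)[OF r(5)] ccomp_cid(2)[OF f] nul_0[OF r(1,2)] nul_0[OF r(1) Y]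
  by (auto intro!: bexI[of _ "cid Q P"])
qed

lemma cls_roofs: "cls P p X Y f <= roofs Q X Y"
 by (auto simp: cls_def)

lemma cls_cover:
 assumes R: "resolves P p X" and Y: "cx Y" and W: "(W, s, h) : roofs Q X Y"
 obtains f where "f : Ch P Y" "(W, s, h) : cls P p X Y f"
proof -
 note r = resolvesD[OF R] and w = roofsD[OF W]
 obtain u where u: "u : Ch P W" "ccomp s u - p : nul P X" by (rule resolve_lift[OF R w(1,2)])
 have "(W, s, h) : cls P p X Y (ccomp h u)"
  using cls_mem_iff[OF R Y W u] nul_refl[OF r(1) Y] by blast
 thus thesis using that ccomp_ch[OF u(1) w(3)] by blast
qed

lemma cls_eq_iff:
 assumes R: "resolves P p X" and Y: "cx Y" and f: "f : Ch P Y" and g: "g : Ch P Y"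
 shows "cls P p X Y f = cls P p X Y g \<longleftrightarrow> f - g : nul P Y"
proof
 note r = resolvesD[OF R]
 assume "cls P p X Y f = cls P p X Y g"
 hence m: "(P, p, f) : cls P p X Y g" using cls_self[OF R Y f] by blast
 have "ccomp p (cid Q P) - p : nul P X" using ccomp_cid(2)[OF r(5)] nul_0[OF r(1,2)] by simp
 from cls_mem_iff[OF R Y roofsI[OF r(1,4) f] cid_ch[OF r(1)] this, of g] m
 show "f - g : nul P Y" using ccomp_cid(2)[OF f] by simp
qed (rule cls_cong[OF R Y])

text \<open>The roof \<open>U\<close> that witnesses an equivalence receives a lift of
  \<open>p\<close>, which transports the comparison to \<open>P\<close>. Conversely, lifts of
  \<open>p\<close> to two roofs form such a witness with \<open>P\<close> itself as apex.\<close>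

lemma cls_roof_eq:
 assumes R: "resolves P p X" and Y: "cx Y" and f: "f : Ch P Y" and m: "(W, s, h) : cls P p X Y f"
 shows "roof_eq Q X Y `` {(W, s, h)} = cls P p X Y f"
proof
 note r = resolvesD[OF R]
 have W: "(W, s, h) : roofs Q X Y" using m cls_roofs by blast
 note w = roofsD[OF W]
 show "roof_eq Q X Y `` {(W, s, h)} <= cls P p X Y f"
 proof
  fix z assume "z : roof_eq Q X Y `` {(W, s, h)}"
  then obtain W' s' h' U v v' where z: "z = (W', s', h')" and W': "(W', s', h') : roofs Q X Y"
   and U: "cx U" and v: "v : Ch U W" and v': "v' : Ch U W'" and qi: "qis U X (ccomp s v)"
   and n1: "ccomp s v - ccomp s' v' : nul U X" and n2: "ccomp h v - ccomp h' v' : nul U Y"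
   by (auto simp: roof_eq_def)
  note w' = roofsD[OF W']
  obtain t where t: "t : Ch P U" "ccomp (ccomp s v) t - p : nul P X" by (rule resolve_lift[OF R U qi])
  have a: "ccomp v t : Ch P W" "ccomp s (ccomp v t) - p : nul P X"
   using ccomp_ch[OF t(1) v] t(2) by (simp_all add: ccomp_assoc)
  have "ccomp (ccomp s v) t - ccomp (ccomp s' v') t : nul P X" by (rule nul_comp_right[OF r(1) U t(1) n1])
  hence "ccomp (ccomp s' v') t - p : nul P X" using nul_trans[OF r(1,2) nul_sym[OF r(1,2)] t(2)] by blast
  hence b: "ccomp v' t : Ch P W'" "ccomp s' (ccomp v' t) - p : nul P X"
   using ccomp_ch[OF t(1) v'] by (simp_all add: ccomp_assoc)
  have c: "ccomp h (ccomp v t) - f : nul P Y" using cls_mem_iff[OF R Y W a] m by blast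
  have "ccomp (ccomp h v) t - ccomp (ccomp h' v') t : nul P Y" by (rule nul_comp_right[OF r(1) U t(1) n2])
  hence "ccomp h' (ccomp v' t) - f : nul P Y"
   using nul_trans[OF r(1) Y nul_sym[OF r(1) Y] c] by (simp add: ccomp_assoc)
  thus "z : cls P p X Y f" unfolding z using cls_mem_iff[OF R Y W' b] by blast
 qed
 show "cls P p X Y f <= roof_eq Q X Y `` {(W, s, h)}"
 proof
  fix z assume z: "z : cls P p X Y f"
  obtain W' s' h' where zz: "z = (W', s', h')" by (cases z)
  obtain u where u: "u : Ch P W" "ccomp s u - p : nul P X" "ccomp h u - f : nul P Y" using m by (auto simp: cls_def)
  obtain u' where u': "u' : Ch P W'" "ccomp s' u' - p : nul P X" "ccomp h' u' - f : nul P Y"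
   using z by (auto simp: cls_def zz)
  have W': "(W', s', h') : roofs Q X Y" using z zz cls_roofs by blast
  have "qis P X (ccomp s u)"
   by (rule quasi_iso_htpy[OF r(1,2,4) ccomp_ch[OF u(1) w(4)] nul_sym[OF r(1,2) u(2)]])
  moreover have "ccomp s u - ccomp s' u' : nul P X" by (rule nul_trans[OF r(1,2) u(2) nul_sym[OF r(1,2) u'(2)]])
  moreover have "ccomp h u - ccomp h' u' : nul P Y" by (rule nul_trans[OF r(1) Y u(3) nul_sym[OF r(1) Y u'(3)]])
  ultimately show "z : roof_eq Q X Y `` {(W, s, h)}"
   unfolding zz roof_eq_def using W W' r(1) u(1) u'(1) by blast
 qed
qed

text \<open>The operations on morphisms close a set of roofs under \<open>roof_eq\<close>; it
  suffices that this set is nonempty and lies in one class.\<close>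

lemma cls_image:
 assumes R: "resolves P p X" and Y: "cx Y" and f: "f : Ch P Y" and S: "S ~= {}" "S <= cls P p X Y f"
 shows "roof_eq Q X Y `` S = cls P p X Y f"
proof -
 have "roof_eq Q X Y `` {r} = cls P p X Y f" if "r : S" for r
  using cls_roof_eq[OF R Y f, of "fst r" "fst (snd r)" "snd (snd r)"] S(2) that by auto
 moreover have "roof_eq Q X Y `` S = (\<Union>r\<in>S. roof_eq Q X Y `` {r})" by blast
 ultimately show ?thesis using S(1) by auto
qed

lemma D_hom_eq:
 assumes R: "resolves P p X" and Y: "cx Y"
 shows "DH X Y = cls P p X Y ` Ch P Y"
proof
 show "DH X Y <= cls P p X Y ` Ch P Y"
 proof
  fix z assume "z : DH X Y"
  then obtain W s h where W: "(W, s, h) : roofs Q X Y" "z = roof_eq Q X Y `` {(W, s, h)}"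
   by (auto simp: D_hom_def quotient_def)
  obtain f where f: "f : Ch P Y" "(W, s, h) : cls P p X Y f" by (rule cls_cover[OF R Y W(1)])
  thus "z : cls P p X Y ` Ch P Y" using cls_roof_eq[OF R Y f] W(2) by blast
 qed
 show "cls P p X Y ` Ch P Y <= DH X Y"
 proof
  fix z assume "z : cls P p X Y ` Ch P Y"
  then obtain f where f: "f : Ch P Y" "z = cls P p X Y f" by blast
  have m: "(P, p, f) : cls P p X Y f" by (rule cls_self[OF R Y f(1)])
  hence "(P, p, f) : roofs Q X Y" using cls_roofs by blast
  thus "z : DH X Y" unfolding f(2) cls_roof_eq[OF R Y f(1) m, symmetric] D_hom_def by (rule quotientI)
 qed
qed

lemma D_homE:
 assumes "\<xi> : DH X Y" "resolves P p X" "cx Y"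
 obtains f where "f : Ch P Y" "\<xi> = cls P p X Y f"
 using assms D_hom_eq[OF assms(2,3)] by blast

lemma cls_D_hom: "resolves P p X ==> cx Y ==> f : Ch P Y ==> cls P p X Y f : DH X Y"
 using D_hom_eq by blast

lemma D_map_cls:
 assumes R: "resolves P p X" and Y: "cx Y" and f: "f : Ch X Y"
 shows "DM X Y f = cls P p X Y (ccomp f p)"
proof -
 note r = resolvesD[OF R]
 have "(X, cid Q X, f) : roofs Q X Y" by (rule roofsI[OF r(2) quasi_iso_cid[OF r(2)] f])
 moreover have "ccomp (cid Q X) p - p : nul P X" using ccomp_cid(1)[OF r(5,2)] nul_0[OF r(1,2)] by simp
 moreover have "ccomp f p - ccomp f p : nul P Y" by (rule nul_refl[OF r(1) Y])
 ultimately have "(X, cid Q X, f) : cls P p X Y (ccomp f p)" unfolding cls_def using r(5) by blast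
 thus ?thesis unfolding D_map_def by (rule cls_roof_eq[OF R Y ccomp_ch[OF r(5) f]])
qed

lemma D_id_cls: assumes R: "resolves P p X" shows "DI X = cls P p X X p"
 using D_map_cls[OF R resolvesD(2)[OF R] cid_ch[OF resolvesD(2)[OF R]]] ccomp_cid(1)[OF resolvesD(5)[OF R] resolvesD(2)[OF R]]
 by (simp add: D_id_def)

lemma D_zero_cls: assumes R: "resolves P p X" and Y: "cx Y" shows "D0 X Y = cls P p X Y 0"
 using D_map_cls[OF R Y ch_0[OF resolvesD(2)[OF R] Y]] by (simp add: D_zero_def ccomp_left)

lemma D_add_cls:
 assumes R: "resolves P p X" and Y: "cx Y" and f: "f : Ch P Y" and g: "g : Ch P Y"
 shows "D_add Q X Y (cls P p X Y f) (cls P p X Y g) = cls P p X Y (f + g)"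
 unfolding D_add_def
proof (rule cls_image[OF R Y])
 note r = resolvesD[OF R]
 show "f + g : Ch P Y" by (rule ch_add[OF r(1) Y f g])
 show "{(W, s, f' + g') | W s f' g'. (W, s, f') : cls P p X Y f & (W, s, g') : cls P p X Y g} ~= {}"
  using cls_self[OF R Y f] cls_self[OF R Y g] by blast
 show "{(W, s, f' + g') | W s f' g'. (W, s, f') : cls P p X Y f & (W, s, g') : cls P p X Y g} <= cls P p X Y (f + g)"
 proof (intro subsetI, elim CollectE exE conjE)
  fix z W s f' g' assume z: "z = (W, s, f' + g')" and f': "(W, s, f') : cls P p X Y f" and g': "(W, s, g') : cls P p X Y g"
  have rf: "(W, s, f') : roofs Q X Y" and rg: "(W, s, g') : roofs Q X Y" using f' g' cls_roofs by blast+
  note w = roofsD[OF rf] and w' = roofsD[OF rg]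
  obtain u where u: "u : Ch P W" "ccomp s u - p : nul P X" by (rule resolve_lift[OF R w(1,2)])
  have "ccomp f' u - f : nul P Y" "ccomp g' u - g : nul P Y"
   using cls_mem_iff[OF R Y rf u] cls_mem_iff[OF R Y rg u] f' g' by blast+
  from nul_add[OF r(1) Y this] have "ccomp (f' + g') u - (f + g) : nul P Y" by (simp add: ccomp_left algebra_simps)
  moreover have "(W, s, f' + g') : roofs Q X Y" by (rule roofsI[OF w(1,2) ch_add[OF w(1) Y w(3) w'(3)]])
  ultimately show "z : cls P p X Y (f + g)" unfolding z using cls_mem_iff[OF R Y _ u] by blast
 qed
qed

lemma D_scale_cls:
 assumes R: "resolves P p X" and Y: "cx Y" and f: "f : Ch P Y"
 shows "D_scale Q X Y c (cls P p X Y f) = cls P p X Y (cscale c f)"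
 unfolding D_scale_def
proof (rule cls_image[OF R Y])
 note r = resolvesD[OF R]
 show "cscale c f : Ch P Y" by (rule ch_scale[OF r(1) Y f])
 show "{(W, s, %n. gscale c (f' n)) | W s f'. (W, s, f') : cls P p X Y f} ~= {}"
  using cls_self[OF R Y f] by blast
 show "{(W, s, %n. gscale c (f' n)) | W s f'. (W, s, f') : cls P p X Y f} <= cls P p X Y (cscale c f)"
 proof (intro subsetI, elim CollectE exE conjE)
  fix z W s f' assume z: "z = (W, s, %n. gscale c (f' n))" and f': "(W, s, f') : cls P p X Y f"
  have rf: "(W, s, f') : roofs Q X Y" using f' cls_roofs by blast
  note w = roofsD[OF rf]
  obtain u where u: "u : Ch P W" "ccomp s u - p : nul P X" by (rule resolve_lift[OF R w(1,2)])
  have "ccomp f' u - f : nul P Y" using cls_mem_iff[OF R Y rf u] f' by blast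
  from nul_scale[OF r(1) Y this, of c] have "ccomp (cscale c f') u - cscale c f : nul P Y"
   by (simp add: ccomp_left cvec.scale_right_diff_distrib)
  moreover have "(W, s, cscale c f') : roofs Q X Y" by (rule roofsI[OF w(1,2) ch_scale[OF w(1) Y w(3)]])
  ultimately show "z : cls P p X Y (cscale c f)" unfolding z cscale_def[of c f', symmetric] using cls_mem_iff[OF R Y _ u] by blast
 qed
qed

lemma D_comp_cls:
 assumes R: "resolves P p X" and R': "resolves P' p' Y" and Z: "cx Z"
  and f: "f : Ch P Y" and g: "g : Ch P' Z" and l: "l : Ch P P'" and eq: "ccomp p' l - f : nul P Y"
 shows "DC X Y Z (cls P' p' Y Z g) (cls P p X Y f) = cls P p X Z (ccomp g l)"
 unfolding D_comp_def
proof (rule cls_image[OF R Z])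
 note r = resolvesD[OF R] and r' = resolvesD[OF R']
 let ?S = "{(U, ccomp s t', ccomp k f') | U W V s t' h f' t k.
    (W, s, h) : cls P p X Y f & (V, t, k) : cls P' p' Y Z g & is_complex Q U & qis U W t' &
    f' : Ch U V & ccomp h t' - ccomp t f' : nul U Y}"
 show "ccomp g l : Ch P Z" by (rule ccomp_ch[OF l g])
 have "(P, p, f) : cls P p X Y f" by (rule cls_self[OF R r'(2) f])
 moreover have "(P', p', g) : cls P' p' Y Z g" by (rule cls_self[OF R' Z g])
 moreover have "ccomp f (cid Q P) - ccomp p' l : nul P Y" using nul_sym[OF r(1) r'(2) eq] ccomp_cid(2)[OF f] by simp
 ultimately show "?S ~= {}" using r(1) quasi_iso_cid[OF r(1)] l by blast
 show "?S <= cls P p X Z (ccomp g l)"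
 proof (intro subsetI, elim CollectE exE conjE)
  fix z U W V s t' h f' t k
  assume z: "z = (U, ccomp s t', ccomp k f')" and W: "(W, s, h) : cls P p X Y f" and V: "(V, t, k) : cls P' p' Y Z g"
   and U: "cx U" and t': "qis U W t'" and f': "f' : Ch U V" and n: "ccomp h t' - ccomp t f' : nul U Y"
  have rW: "(W, s, h) : roofs Q X Y" and rV: "(V, t, k) : roofs Q Y Z" using W V cls_roofs by blast+
  note w = roofsD[OF rW] and v = roofsD[OF rV] and tc = quasi_iso_ch[OF t']
  have st: "qis U X (ccomp s t')" by (rule quasi_iso_comp[OF U w(1) r(2) t' w(2)])
  obtain u where u: "u : Ch P U" "ccomp (ccomp s t') u - p : nul P X" by (rule resolve_lift[OF R U st])
  obtain b where b: "b : Ch P' V" "ccomp t b - p' : nul P' Y" by (rule resolve_lift[OF R' v(1,2)])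
  have kb: "ccomp k b - g : nul P' Z" using cls_mem_iff[OF R' Z rV b] V by blast
  have tu: "ccomp t' u : Ch P W" "ccomp s (ccomp t' u) - p : nul P X"
   using ccomp_ch[OF u(1) tc] u(2) by (simp_all add: ccomp_assoc)
  have 1: "ccomp h (ccomp t' u) - f : nul P Y" using cls_mem_iff[OF R r'(2) rW tu] W by blast
  have 2: "ccomp (ccomp h t') u - ccomp (ccomp t f') u : nul P Y" by (rule nul_comp_right[OF r(1) U u(1) n])
  have 3: "ccomp (ccomp t b) l - ccomp p' l : nul P Y" by (rule nul_comp_right[OF r(1) r'(1) l b(2)])
  have "ccomp (ccomp t f') u - f : nul P Y"
   using nul_trans[OF r(1) r'(2) nul_sym[OF r(1) r'(2) 2]] 1 by (simp add: ccomp_assoc)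
  moreover have "ccomp (ccomp t b) l - f : nul P Y" by (rule nul_trans[OF r(1) r'(2) 3 eq])
  ultimately have "ccomp (ccomp t f') u - ccomp (ccomp t b) l : nul P Y"
   using nul_trans[OF r(1) r'(2) _ nul_sym[OF r(1) r'(2)]] by blast
  hence "ccomp t (ccomp f' u) - ccomp t (ccomp b l) : nul P Y" by (simp add: ccomp_assoc)
  hence "ccomp f' u - ccomp b l : nul P V"
   by (rule resolve_lift_unique[OF R v(1) r'(2) v(2) ccomp_ch[OF u(1) f'] ccomp_ch[OF l b(1)]])
  hence "ccomp k (ccomp f' u) - ccomp k (ccomp b l) : nul P Z"
   by (rule nul_comp_left[OF r(1) v(1) Z ccomp_ch[OF u(1) f'] ccomp_ch[OF l b(1)] _ v(3)])
  moreover have "ccomp (ccomp k b) l - ccomp g l : nul P Z" by (rule nul_comp_right[OF r(1) r'(1) l kb])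
  ultimately have "ccomp (ccomp k f') u - ccomp g l : nul P Z"
   using nul_trans[OF r(1) Z] by (simp add: ccomp_assoc)
  moreover have "(U, ccomp s t', ccomp k f') : roofs Q X Z" by (rule roofsI[OF U st ccomp_ch[OF f' v(3)]])
  ultimately show "z : cls P p X Z (ccomp g l)" unfolding z using cls_mem_iff[OF R Z _ u] by blast
 qed
qed

lemma D_shift_cls:
 assumes R: "resolves P p X" and Y: "cx Y" and f: "f : Ch P Y"
 shows "DS k X Y (cls P p X Y f) = cls (shift k P) (shift_map k p) (shift k X) (shift k Y) (shift_map k f)"
 unfolding D_shift_def
proof (rule cls_image[OF resolves_shift[OF R] shift_cx[OF Y]])
 note r = resolvesD[OF R]
 show "shift_map k f : Ch (shift k P) (shift k Y)" by (rule shift_ch[OF r(1) Y f])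
 let ?S = "{(shift k W, shift_map k s, shift_map k f') | W s f'. (W, s, f') : cls P p X Y f}"
 show "?S ~= {}" using cls_self[OF R Y f] by blast
 show "?S <= cls (shift k P) (shift_map k p) (shift k X) (shift k Y) (shift_map k f)"
 proof (intro subsetI, elim CollectE exE conjE)
  fix z W s f' assume z: "z = (shift k W, shift_map k s, shift_map k f')" and f': "(W, s, f') : cls P p X Y f"
  have rf: "(W, s, f') : roofs Q X Y" using f' cls_roofs by blast
  note w = roofsD[OF rf]
  obtain u where u: "u : Ch P W" "ccomp s u - p : nul P X" by (rule resolve_lift[OF R w(1,2)])
  have "ccomp f' u - f : nul P Y" using cls_mem_iff[OF R Y rf u] f' by blast
  from shift_nul[OF r(1) Y this, of k] shift_nul[OF r(1,2) u(2), of k]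
  have "ccomp (shift_map k f') (shift_map k u) - shift_map k f : nul (shift k P) (shift k Y)"
   "ccomp (shift_map k s) (shift_map k u) - shift_map k p : nul (shift k P) (shift k X)" by (simp_all add: shift_map_lin)
  moreover have "(shift k W, shift_map k s, shift_map k f') : roofs Q (shift k X) (shift k Y)"
   by (rule roofsI[OF shift_cx[OF w(1)] shift_quasi_iso[OF w(1) r(2) w(2)] shift_ch[OF w(1) Y w(3)]])
  ultimately show "z : cls (shift k P) (shift_map k p) (shift k X) (shift k Y) (shift_map k f)"
   unfolding z cls_def using shift_ch[OF r(1) w(1) u(1)] by blast
 qed
qed

lemma has_kdim_D_hom:
 assumes R: "resolves P p X" and Y: "cx Y"
 shows "has_kdim (D_hom_mod Q X Y) (cvec.dim (Ch P Y) - cvec.dim (nul P Y))"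
proof (rule has_kdim_quot[where phi = "cls P p X Y"])
 note r = resolvesD[OF R]
 show "vector_space (cscale :: 'a => (int => ('v, 'a) gmap) => _)" by (rule cvec_vs)
 show "cvec.fd (Ch P Y)" by (rule ch_fd[OF r(1) Y])
 show "cvec.subspace (nul P Y)" by (rule nul_subspace[OF r(1) Y])
 show "nul P Y <= Ch P Y" by (rule nul_ch[OF r(1) Y])
 show "cls P p X Y f = cls P p X Y g \<longleftrightarrow> f - g : nul P Y" if "f : Ch P Y" "g : Ch P Y" for f g
  by (rule cls_eq_iff[OF R Y that])
 show "cls P p X Y ` Ch P Y = carrier (D_hom_mod Q X Y)" by (simp add: D_hom_mod_def D_hom_eq[OF R Y])
 show "cls P p X Y (f + g) = cls P p X Y f \<oplus>\<^bsub>D_hom_mod Q X Y\<^esub> cls P p X Y g" if "f : Ch P Y" "g : Ch P Y" for f g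
  using D_add_cls[OF R Y that] by (simp add: D_hom_mod_def)
 show "cls P p X Y (cscale c f) = c \<odot>\<^bsub>D_hom_mod Q X Y\<^esub> cls P p X Y f" if "f : Ch P Y" for c f
  using D_scale_cls[OF R Y that] by (simp add: D_hom_mod_def)
 show "cls P p X Y 0 = \<zero>\<^bsub>D_hom_mod Q X Y\<^esub>"
  using D_zero_cls[OF R Y] by (simp add: D_hom_mod_def)
qed

end

section \<open>Morphisms as chain maps between resolutions\<close>

context quiver
begin

text \<open>Both ends are resolved, so that composition of morphisms becomes composition of chain
  maps.\<close>

definition
 "mo P p X p' Y l = cls P p X Y (ccomp p' l)"

lemma mo_obtain:
 assumes "\<xi> : DH X Y" and R: "resolves P p X" and R': "resolves P' p' Y"
 obtains l where "l : Ch P P'" "\<xi> = mo P p X p' Y l"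
proof -
 note r = resolvesD[OF R] and r' = resolvesD[OF R']
 obtain f where f: "f : Ch P Y" "\<xi> = cls P p X Y f" by (rule D_homE[OF assms(1) R r'(2)])
 obtain l where l: "l : Ch P P'" "f - ccomp p' l : nul P Y"
  by (rule quasi_iso_lift[OF r(1,3) r'(1,2,4) f(1)])
 thus thesis using that f(2) cls_cong[OF R r'(2) l(2)] by (simp add: mo_def)
qed

lemma mo_D_hom: "resolves P p X ==> resolves P' p' Y ==> l : Ch P P' ==> mo P p X p' Y l : DH X Y"
 unfolding mo_def by (rule cls_D_hom[OF _ resolvesD(2) ccomp_ch[OF _ resolvesD(5)]])

lemma mo_eq_iff:
 assumes R: "resolves P p X" and R': "resolves P' p' Y" and l: "l : Ch P P'" and l': "l' : Ch P P'"
 shows "mo P p X p' Y l = mo P p X p' Y l' \<longleftrightarrow> l - l' : nul P P'"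
proof -
 note r = resolvesD[OF R] and r' = resolvesD[OF R']
 have "mo P p X p' Y l = mo P p X p' Y l' \<longleftrightarrow> ccomp p' l - ccomp p' l' : nul P Y"
  unfolding mo_def by (rule cls_eq_iff[OF R r'(2) ccomp_ch[OF l r'(5)] ccomp_ch[OF l' r'(5)]])
 also have "\<dots> \<longleftrightarrow> l - l' : nul P P'"
  using resolve_lift_unique[OF R r'(1,2,4) l l'] nul_comp_left[OF r(1) r'(1,2) l l' _ r'(5)] by blast
 finally show ?thesis .
qed

lemma mo_comp:
 assumes R: "resolves P p X" and R': "resolves P' p' Y" and R'': "resolves P'' p'' Z"
  and l: "l : Ch P P'" and m: "m : Ch P' P''"
 shows "DC X Y Z (mo P' p' Y p'' Z m) (mo P p X p' Y l) = mo P p X p'' Z (ccomp m l)"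
proof -
 note r = resolvesD[OF R] and r' = resolvesD[OF R'] and r'' = resolvesD[OF R'']
 show ?thesis
  using D_comp_cls[OF R R' r''(2) ccomp_ch[OF l r'(5)] ccomp_ch[OF m r''(5)] l nul_refl[OF r(1) r'(2)]]
  by (simp add: mo_def ccomp_assoc)
qed

lemma mo_id: "resolves P p X ==> DI X = mo P p X p X (cid Q P)"
 using D_id_cls[of P p X] ccomp_cid(2)[OF resolvesD(5), of P p X] by (simp add: mo_def)

lemma mo_zero: "resolves P p X ==> resolves P' p' Y ==> D0 X Y = mo P p X p' Y 0"
 using D_zero_cls[of P p X Y] resolvesD(2)[of P' p' Y] ccomp_zero_right[OF resolvesD(5), of P' p' Y] by (simp add: mo_def)

lemma mo_add:
 assumes R: "resolves P p X" and R': "resolves P' p' Y" and l: "l : Ch P P'" and m: "m : Ch P P'"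
 shows "D_add Q X Y (mo P p X p' Y l) (mo P p X p' Y m) = mo P p X p' Y (l + m)"
 using D_add_cls[OF R resolvesD(2)[OF R'] ccomp_ch[OF l resolvesD(5)[OF R']] ccomp_ch[OF m resolvesD(5)[OF R']]]
  ccomp_right(1)[OF resolvesD(5)[OF R'] l m resolvesD(1)[OF R']] by (simp add: mo_def)

lemma mo_shift:
 assumes R: "resolves P p X" and R': "resolves P' p' Y" and l: "l : Ch P P'"
 shows "DS k X Y (mo P p X p' Y l) = mo (shift k P) (shift_map k p) (shift k X) (shift_map k p') (shift k Y) (shift_map k l)"
 using D_shift_cls[OF R resolvesD(2)[OF R'] ccomp_ch[OF l resolvesD(5)[OF R']], of k] by (simp add: mo_def shift_map_lin)

end

section \<open>Category laws and the shift functor\<close>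

context positive_quiver
begin

lemma resolves_ex: "cx X ==> EX P p. resolves P p X"
 using resolution_exists[of X] by metis

lemma D_comp_hom:
 assumes "cx X" "cx Y" "cx Z" "\<xi> : DH X Y" "\<eta> : DH Y Z"
 shows "DC X Y Z \<eta> \<xi> : DH X Z"
proof -
 obtain P p P' p' P'' p'' where R: "resolves P p X" "resolves P' p' Y" "resolves P'' p'' Z"
  using resolves_ex assms(1-3) by metis
 obtain l where l: "l : Ch P P'" "\<xi> = mo P p X p' Y l" by (rule mo_obtain[OF assms(4) R(1,2)])
 obtain m where m: "m : Ch P' P''" "\<eta> = mo P' p' Y p'' Z m" by (rule mo_obtain[OF assms(5) R(2,3)])
 show ?thesis unfolding l(2) m(2) mo_comp[OF R l(1) m(1)] by (rule mo_D_hom[OF R(1,3) ccomp_ch[OF l(1) m(1)]])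
qed

lemma D_comp_assoc:
 assumes "cx W" "cx X" "cx Y" "cx Z" "\<xi> : DH W X" "\<eta> : DH X Y" "\<zeta> : DH Y Z"
 shows "DC W Y Z \<zeta> (DC W X Y \<eta> \<xi>) = DC W X Z (DC X Y Z \<zeta> \<eta>) \<xi>"
proof -
 obtain PW w PX x PY y PZ z where R: "resolves PW w W" "resolves PX x X" "resolves PY y Y" "resolves PZ z Z"
  using resolves_ex assms(1-4) by metis
 obtain l where l: "l : Ch PW PX" "\<xi> = mo PW w W x X l" by (rule mo_obtain[OF assms(5) R(1,2)])
 obtain m where m: "m : Ch PX PY" "\<eta> = mo PX x X y Y m" by (rule mo_obtain[OF assms(6) R(2,3)])
 obtain n where n: "n : Ch PY PZ" "\<zeta> = mo PY y Y z Z n" by (rule mo_obtain[OF assms(7) R(3,4)])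
 show ?thesis unfolding l(2) m(2) n(2)
  by (simp add: mo_comp[OF R(1,2,3) l(1) m(1)] mo_comp[OF R(1,3,4) ccomp_ch[OF l(1) m(1)] n(1)]
    mo_comp[OF R(2,3,4) m(1) n(1)] mo_comp[OF R(1,2,4) l(1) ccomp_ch[OF m(1) n(1)]] ccomp_assoc)
qed

lemma D_comp_id:
 assumes "cx X" "cx Y" "\<xi> : DH X Y"
 shows "DC X Y Y (DI Y) \<xi> = \<xi>" "DC X X Y \<xi> (DI X) = \<xi>"
proof -
 obtain P p P' p' where R: "resolves P p X" "resolves P' p' Y" using resolves_ex assms(1,2) by metis
 obtain l where l: "l : Ch P P'" "\<xi> = mo P p X p' Y l" by (rule mo_obtain[OF assms(3) R])
 note c = resolvesD(1)[OF R(1)] resolvesD(1)[OF R(2)]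
 show "DC X Y Y (DI Y) \<xi> = \<xi>"
  unfolding l(2) mo_id[OF R(2)] mo_comp[OF R(1,2,2) l(1) cid_ch[OF c(2)]] ccomp_cid(1)[OF l(1) c(2)] ..
 show "DC X X Y \<xi> (DI X) = \<xi>"
  unfolding l(2) mo_id[OF R(1)] mo_comp[OF R(1,1,2) cid_ch[OF c(1)] l(1)] ccomp_cid(2)[OF l(1)] ..
qed

lemma D_comp_zero:
 assumes "cx X" "cx Y" "cx Z"
 shows "\<xi> : DH X Y ==> DC X Y Z (D0 Y Z) \<xi> = D0 X Z"
  "\<eta> : DH Y Z ==> DC X Y Z \<eta> (D0 X Y) = D0 X Z"
proof -
 obtain P p P' p' P'' p'' where R: "resolves P p X" "resolves P' p' Y" "resolves P'' p'' Z"
  using resolves_ex assms(1-3) by metis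
 note c = resolvesD(1)[OF R(1)] resolvesD(1)[OF R(2)] resolvesD(1)[OF R(3)]
 show "DC X Y Z (D0 Y Z) \<xi> = D0 X Z" if xi: "\<xi> : DH X Y"
 proof -
  obtain l where l: "l : Ch P P'" "\<xi> = mo P p X p' Y l" by (rule mo_obtain[OF xi R(1,2)])
  show ?thesis unfolding l(2) mo_zero[OF R(2,3)] mo_zero[OF R(1,3)] mo_comp[OF R l(1) ch_0[OF c(2,3)]] ccomp_left ..
 qed
 show "DC X Y Z \<eta> (D0 X Y) = D0 X Z" if xi: "\<eta> : DH Y Z"
 proof -
  obtain l where l: "l : Ch P' P''" "\<eta> = mo P' p' Y p'' Z l" by (rule mo_obtain[OF xi R(2,3)])
  show ?thesis unfolding l(2) mo_zero[OF R(1,2)] mo_zero[OF R(1,3)] mo_comp[OF R ch_0[OF c(1,2)] l(1)] ccomp_zero_right[OF l(1)] ..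
 qed
qed

lemma D_shift_hom:
 assumes "cx X" "cx Y" "\<xi> : DH X Y"
 shows "DS k X Y \<xi> : DH (shift k X) (shift k Y)"
proof -
 obtain P p P' p' where R: "resolves P p X" "resolves P' p' Y" using resolves_ex assms(1,2) by metis
 obtain l where l: "l : Ch P P'" "\<xi> = mo P p X p' Y l" by (rule mo_obtain[OF assms(3) R])
 show ?thesis unfolding l(2) mo_shift[OF R l(1)]
  by (rule mo_D_hom[OF resolves_shift[OF R(1)] resolves_shift[OF R(2)] shift_ch[OF resolvesD(1)[OF R(1)] resolvesD(1)[OF R(2)] l(1)]])
qed

lemma D_shift_comp:
 assumes "cx X" "cx Y" "cx Z" "\<xi> : DH X Y" "\<eta> : DH Y Z"
 shows "DS k X Z (DC X Y Z \<eta> \<xi>)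
  = DC (shift k X) (shift k Y) (shift k Z) (DS k Y Z \<eta>) (DS k X Y \<xi>)"
proof -
 obtain P p P' p' P'' p'' where R: "resolves P p X" "resolves P' p' Y" "resolves P'' p'' Z"
  using resolves_ex assms(1-3) by metis
 obtain l where l: "l : Ch P P'" "\<xi> = mo P p X p' Y l" by (rule mo_obtain[OF assms(4) R(1,2)])
 obtain m where m: "m : Ch P' P''" "\<eta> = mo P' p' Y p'' Z m" by (rule mo_obtain[OF assms(5) R(2,3)])
 note c = resolvesD(1)[OF R(1)] resolvesD(1)[OF R(2)] resolvesD(1)[OF R(3)]
 note S = resolves_shift[OF R(1)] resolves_shift[OF R(2)] resolves_shift[OF R(3)]
 show ?thesis unfolding l(2) m(2) mo_comp[OF R l(1) m(1)] mo_shift[OF R(1,2) l(1)] mo_shift[OF R(2,3) m(1)]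
   mo_shift[OF R(1,3) ccomp_ch[OF l(1) m(1)]] mo_comp[OF S shift_ch[OF c(1,2) l(1)] shift_ch[OF c(2,3) m(1)]] shift_map_lin ..
qed

lemma D_shift_id: "cx X ==> DS k X X (DI X) = DI (shift k X)"
proof -
 assume "cx X"
 then obtain P p where R: "resolves P p X" using resolves_ex by metis
 note c = resolvesD(1)[OF R]
 show ?thesis unfolding mo_id[OF R] mo_shift[OF R R cid_ch[OF c]] mo_id[OF resolves_shift[OF R]] shift_map_lin ..
qed

lemma D_shift_zero: "cx X ==> cx Y ==> DS k X Y (D0 X Y) = D0 (shift k X) (shift k Y)"
proof -
 assume "cx X" "cx Y"
 then obtain P p P' p' where R: "resolves P p X" "resolves P' p' Y" using resolves_ex by metis
 note c = resolvesD(1)[OF R(1)] resolvesD(1)[OF R(2)]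
 show ?thesis unfolding mo_zero[OF R] mo_shift[OF R ch_0[OF c]] mo_zero[OF resolves_shift[OF R(1)] resolves_shift[OF R(2)]] shift_map_lin ..
qed

lemma D_map_hom: "cx X ==> cx Y ==> f : Ch X Y ==> DM X Y f : DH X Y"
proof -
 assume X: "cx X" and Y: "cx Y" and f: "f : Ch X Y"
 obtain P p where R: "resolves P p X" using resolves_ex X by metis
 show ?thesis unfolding D_map_cls[OF R Y f] by (rule cls_D_hom[OF R Y ccomp_ch[OF resolvesD(5)[OF R] f]])
qed

text \<open>\<open>f p\<close> is first lifted to the resolution of \<open>Y\<close>, so that
  \<open>D_comp_cls\<close> applies.\<close>

lemma D_map_comp:
 assumes X: "cx X" and Y: "cx Y" and Z: "cx Z" and f: "f : Ch X Y" and g: "g : Ch Y Z"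
 shows "DC X Y Z (DM Y Z g) (DM X Y f) = DM X Z (ccomp g f)"
proof -
 obtain P p P' p' where R: "resolves P p X" "resolves P' p' Y" using resolves_ex X Y by metis
 note r = resolvesD[OF R(1)] and r' = resolvesD[OF R(2)]
 have fp: "ccomp f p : Ch P Y" by (rule ccomp_ch[OF r(5) f])
 obtain l where l: "l : Ch P P'" "ccomp f p - ccomp p' l : nul P Y"
  by (rule quasi_iso_lift[OF r(1,3) r'(1,2,4) fp])
 have "DC X Y Z (DM Y Z g) (DM X Y f) = cls P p X Z (ccomp (ccomp g p') l)"
  unfolding D_map_cls[OF R(1) Y f] D_map_cls[OF R(2) Z g]
  by (rule D_comp_cls[OF R Z fp ccomp_ch[OF r'(5) g] l(1) nul_sym[OF r(1) Y l(2)]])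
 also have "\<dots> = cls P p X Z (ccomp (ccomp g f) p)"
  using nul_comp_left[OF r(1) Y Z ccomp_ch[OF l(1) r'(5)] fp nul_sym[OF r(1) Y l(2)] g]
  by (intro cls_cong[OF R(1) Z]) (simp add: ccomp_assoc)
 finally show ?thesis unfolding D_map_cls[OF R(1) Z ccomp_ch[OF f g]] .
qed

lemma D_map_shift:
 assumes X: "cx X" and Y: "cx Y" and f: "f : Ch X Y"
 shows "DS k X Y (DM X Y f) = DM (shift k X) (shift k Y) (shift_map k f)"
proof -
 obtain P p where R: "resolves P p X" using resolves_ex X by metis
 show ?thesis
  unfolding D_map_cls[OF R Y f] D_map_cls[OF resolves_shift[OF R] shift_cx[OF Y] shift_ch[OF X Y f]]
   D_shift_cls[OF R Y ccomp_ch[OF resolvesD(5)[OF R] f]] shift_map_lin ..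
qed

lemma D_map_null: assumes X: "cx X" and Y: "cx Y" and f: "f : nul X Y" shows "DM X Y f = D0 X Y"
proof -
 obtain P p where R: "resolves P p X" using resolves_ex X by metis
 note r = resolvesD[OF R]
 have fc: "f : Ch X Y" using nul_ch[OF X Y] f by blast
 have "ccomp f p - 0 : nul P Y" using nul_right[OF r(1) X r(5) f] by simp
 thus ?thesis unfolding D_map_cls[OF R Y fc] D_zero_cls[OF R Y] by (rule cls_cong[OF R Y])
qed

end

section \<open>Null homotopies at a mapping cone\<close>

context quiver
begin

lemma cone_pr_in: "cx A ==> cx B ==> f : Ch A B ==> ccomp (cone_pr Q A B) (cone_in Q B) = 0"
 by (rule ext) (auto simp: ccomp_apply gcomp_def cone_pr_def cone_in_def fun_eq_iff fun_ops sum_sp_iff evens_lin)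

text \<open>The homotopy is the projection of the cone to its second summand.\<close>

lemma cone_pr_null:
 assumes A: "cx A" and B: "cx B" and f: "f : Ch A B"
 shows "ccomp (shift_map 1 f) (cone_pr Q A B) : nul (Cone A B f) (shift 1 B)"
proof -
 let ?C = "Cone A B f"
 note rA = cx_rep[OF A] and rB = cx_rep[OF B] and C = cone_cx[OF A B f]
 define s where "s n = prr (ob A (n+1)) (ob B n)" for n
 have s: "s n : Hom (ob ?C n) (ob (shift 1 B) (n-1))" for n
  unfolding s_def using prl_hom(2)[OF rA rB] by simp
 have n: "htpy ?C (shift 1 B) s : nul ?C (shift 1 B)" by (rule nulI[OF s])
 have l: "ccomp (shift_map 1 f) (cone_pr Q A B) : Ch ?C (shift 1 B)"
  by (rule ccomp_ch[OF cone_pr_ch[OF A B f] shift_ch[OF A B f]])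
 have "ccomp (shift_map 1 f) (cone_pr Q A B) = htpy ?C (shift 1 B) s"
 proof
  fix n
  show "ccomp (shift_map 1 f) (cone_pr Q A B) n = htpy ?C (shift 1 B) s n"
  proof (rule hom_eqI[OF ch_hom[OF l] ch_hom[OF subsetD[OF nul_ch[OF C shift_cx[OF B]] n]]])
   fix v z assume v: "v : vs" and "z : sp (ob ?C n) v"
   hence z: "z : sum_sp (ob A (n+1)) (ob B n) v" by simp
   have m: "df ?C n v z : sum_sp (ob A (n+1 + 1)) (ob B (n+1)) v"
    using hom_mem[OF cx_df[OF C] v, of z n] z by simp
   have "s (n+1) v (df ?C n v z) = odds (df ?C n v z)" unfolding s_def by (rule prr_apply[OF v m])
   also have "\<dots> = f (n+1) v (evens z) + df B n v (odds z)" by (simp add: cone_df_apply[OF v z])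
   finally show "ccomp (shift_map 1 f) (cone_pr Q A B) n v z = htpy ?C (shift 1 B) s n v z"
    unfolding htpy_apply using z v
    by (simp add: s_def prr_apply shift_df fun_ops ccomp_apply gcomp_apply shift_map_def cone_pr_def)
  qed
 qed
 thus ?thesis using n by simp
qed

text \<open>The homotopy is the inclusion of the first summand of the cone.\<close>

lemma cone_in_null:
 assumes A: "cx A" and B: "cx B" and f: "f : Ch A B"
 shows "ccomp (cone_in Q B) f : nul A (Cone A B f)"
proof -
 let ?C = "Cone A B f"
 note rA = cx_rep[OF A] and rB = cx_rep[OF B] and C = cone_cx[OF A B f]
 define s where "s n = hpair (ob A n) (ident (ob A n)) (0 :: ('v, 'a) gmap)" for n
 have s: "s n : Hom (ob A n) (ob ?C (n-1))" for n
  unfolding s_def using hpair_hom[OF rA rA rB ident_hom[OF rA] hom_0[OF rA rB]] by simp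
 have sa: "s n v x = pair x 0" if "v : vs" "x : sp (ob A n) v" for n v x
  using that by (simp add: s_def hpair_apply rep_id_def fun_ops)
 have n: "htpy A ?C s : nul A ?C" by (rule nulI[OF s])
 have l: "ccomp (cone_in Q B) f : Ch A ?C" by (rule ccomp_ch[OF f cone_in_ch[OF A B f]])
 have "ccomp (cone_in Q B) f = htpy A ?C s"
 proof
  fix n
  show "ccomp (cone_in Q B) f n = htpy A ?C s n"
  proof (rule hom_eqI[OF ch_hom[OF l] ch_hom[OF subsetD[OF nul_ch[OF A C] n]]])
   fix v x assume v: "v : vs" and x: "x : sp (ob A n) v"
   have dx: "df A n v x : sp (ob A (n+1)) v" by (rule hom_mem[OF cx_df[OF A] v x])
   have m: "pair x 0 : sum_sp (ob A (n-1 + 1)) (ob B (n-1)) v"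
    using x rep_0[OF rB v] by simp
   show "ccomp (cone_in Q B) f n v x = htpy A ?C s n v x"
    unfolding htpy_apply sa[OF v x] sa[OF v dx] cone_df_apply[OF v m]
    using v ch_mem[OF f v x] by (simp add: ccomp_apply gcomp_apply cone_in_def pair_lin hom_zero[OF cx_df[OF B]])
  qed
 qed
 thus ?thesis using n by simp
qed

text \<open>The cone is a weak cokernel: the null homotopy restricted to the summand
  \<open>B\<close> is the extension \<open>h\<close>, and restricted to \<open>A\<close> it is, up
  to sign, a homotopy between \<open>g\<close> and \<open>h f\<close>.\<close>

lemma cone_null_extend:
 assumes A: "cx A" and B: "cx B" and T: "cx T" and f: "f : Ch A B" and g: "g : Ch A T"
  and null: "ccomp (shift_map 1 g) (cone_pr Q A B) : nul (Cone A B f) (shift 1 T)"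
 obtains h where "h : Ch B T" "g - ccomp h f : nul A T"
proof -
 let ?C = "Cone A B f"
 note rA = cx_rep[OF A] and rB = cx_rep[OF B] and rT = cx_rep[OF T]
 obtain s where s0: "!!n. s n : Hom (ob ?C n) (ob (shift 1 T) (n-1))"
  and eq: "ccomp (shift_map 1 g) (cone_pr Q A B) = htpy ?C (shift 1 T) s" using null by (auto simp: nul_iff)
 have s: "s n : Hom (rep_sum Q (ob A (n+1)) (ob B n)) (ob T n)" for n using s0[of n] by simp
 define i1 where "i1 n = hpair (ob A n) (ident (ob A n)) (0 :: ('v, 'a) gmap)" for n
 define i2 where "i2 n = hpair (ob B n) (0 :: ('v, 'a) gmap) (ident (ob B n))" for n
 have i1: "i1 n : Hom (ob A n) (rep_sum Q (ob A n) (ob B m))" for n m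
  unfolding i1_def by (rule hpair_hom[OF rA rA rB ident_hom[OF rA] hom_0[OF rA rB]])
 have i2: "i2 n : Hom (ob B n) (rep_sum Q (ob A m) (ob B n))" for n m
  unfolding i2_def by (rule hpair_hom[OF rB rA rB hom_0[OF rB rA] ident_hom[OF rB]])
 have i1a: "i1 n v x = pair x 0" if "v : vs" "x : sp (ob A n) v" for n v x
  using that by (simp add: i1_def hpair_apply rep_id_def zero_fun_apply[of v] zero_fun_apply[of x])
 have i2a: "i2 n v x = pair 0 x" if "v : vs" "x : sp (ob B n) v" for n v x
  using that by (simp add: i2_def hpair_apply rep_id_def zero_fun_apply[of v] zero_fun_apply[of x])
 define h where "h n = gcomp (s n) (i2 n)" for n
 define t where "t n = - gcomp (s (n-1)) (i1 n)" for n
 have h: "h n : Hom (ob B n) (ob T n)" for n unfolding h_def by (rule hom_comp[OF i2 s])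
 have t: "t n : Hom (ob A n) (ob T (n-1))" for n
  unfolding t_def using hom_neg[OF rA rT hom_comp[OF i1[of n "n-1"] s[of "n-1", simplified]]] by simp
 have ha: "s n v (pair 0 x) = h n v x" if "v : vs" "x : sp (ob B n) v" for n v x
  using i2a[OF that] by (simp add: h_def gcomp_apply)
 have ta: "s n v (pair x 0) = - t (n+1) v x" if "v : vs" "x : sp (ob A (n+1)) v" for n v x
  using i1a[OF that] by (simp add: t_def gcomp_apply uminus_apply[of "gcomp (s n) (i1 (n+1))"] uminus_apply[of "gcomp (s n) (i1 (n+1)) v"])
 have z: "0 : sp (ob A n) v" "0 : sp (ob B n) v" if "v : vs" for n v
  using rep_0[OF rA that] rep_0[OF rB that] .
 have E: "g (n+1) v (evens c) = - df T n v (s n v c) + s (n+1) v (df ?C n v c)"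
  if v: "v : vs" and c: "c : sum_sp (ob A (n+1)) (ob B n) v" for n v c
 proof -
  have "g (n+1) v (evens c) = ccomp (shift_map 1 g) (cone_pr Q A B) n v c"
   using v c by (simp add: ccomp_apply gcomp_apply shift_map_def cone_pr_def)
  also have "\<dots> = df (shift 1 T) (n-1) v (s n v c) + s (n+1) v (df ?C n v c)" unfolding eq htpy_apply ..
  finally show ?thesis by (simp add: shift_df uminus_apply[of "df T n"] uminus_apply[of "df T n v"])
 qed
 have hc: "h : Ch B T"
 proof (rule chI'[OF B T h])
  fix n v x assume v: "v : vs" and x: "x : sp (ob B n) v"
  have m: "pair 0 x : sum_sp (ob A (n+1)) (ob B n) v" using z[OF v] x by simp
  have dx: "df B n v x : sp (ob B (n+1)) v" by (rule hom_mem[OF cx_df[OF B] v x])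
  have "df ?C n v (pair 0 x) = pair 0 (df B n v x)"
   unfolding cone_df_apply[OF v m] by (simp add: hom_zero[OF cx_df[OF A]] hom_zero[OF ch_hom[OF f]])
  hence "0 = - df T n v (h n v x) + h (n+1) v (df B n v x)"
   using E[OF v m] ha[OF v x] ha[OF v dx] hom_zero[OF ch_hom[OF g]] by simp
  thus "h (n+1) v (df B n v x) = df T n v (h n v x)" by (simp add: add_eq_0_iff2)
 qed
 have gn: "g - ccomp h f : Ch A T" by (rule ch_diff[OF A T g ccomp_ch[OF f hc]])
 have n: "htpy A T t : nul A T" by (rule nulI[OF t])
 have "g - ccomp h f = htpy A T t"
 proof
  fix k
  define n :: int where "n = k-1"
  have k: "k = n+1" by (simp add: n_def)
  show "(g - ccomp h f) k = htpy A T t k"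
  proof (rule hom_eqI[OF ch_hom[OF gn] ch_hom[OF subsetD[OF nul_ch[OF A T] n]]])
   fix v x assume v: "v : vs" and "x : sp (ob A k) v"
   hence x: "x : sp (ob A (n+1)) v" by (simp add: k)
   have m: "pair x 0 : sum_sp (ob A (n+1)) (ob B n) v" using z[OF v] x by simp
   have dx: "df A (n+1) v x : sp (ob A (n+1 + 1)) v" by (rule hom_mem[OF cx_df[OF A] v x])
   have ndx: "- df A (n+1) v x : sp (ob A (n+1 + 1)) v" by (rule kvec.subspace_neg[OF rep_sub[OF rA v] dx])
   have fx: "f (n+1) v x : sp (ob B (n+1)) v" by (rule ch_mem[OF f v x])
   have m2: "pair (- df A (n+1) v x) 0 : sum_sp (ob A (n+1 + 1)) (ob B (n+1)) v"
    "pair 0 (f (n+1) v x) : sum_sp (ob A (n+1 + 1)) (ob B (n+1)) v" using z[OF v] ndx fx by simp_all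
   have "df ?C n v (pair x 0) = pair (- df A (n+1) v x) 0 + pair 0 (f (n+1) v x)"
    unfolding cone_df_apply[OF v m] by (simp add: hom_zero[OF cx_df[OF B]] pair_lin)
   hence "s (n+1) v (df ?C n v (pair x 0)) = s (n+1) v (pair (- df A (n+1) v x) 0) + s (n+1) v (pair 0 (f (n+1) v x))"
    using lin_maps_add[OF hom_lin[OF s v], of "pair (- df A (n+1) v x) 0" "n+1" "pair 0 (f (n+1) v x)"] m2 by simp
   also have "\<dots> = t (n+1 + 1) v (df A (n+1) v x) + h (n+1) v (f (n+1) v x)"
    unfolding ta[OF v ndx] ha[OF v fx] using lin_maps_uminus[OF hom_lin[OF t v] dx] by simp
   finally have s1: "s (n+1) v (df ?C n v (pair x 0)) = t (n+1 + 1) v (df A (n+1) v x) + h (n+1) v (f (n+1) v x)" .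
   have tx: "t (n+1) v x : sp (ob T n) v" using hom_mem[OF t v x] by simp
   have "df T n v (s n v (pair x 0)) = - df T n v (t (n+1) v x)"
    unfolding ta[OF v x] by (rule lin_maps_uminus[OF hom_lin[OF cx_df[OF T] v] tx])
   hence "g (n+1) v x = df T n v (t (n+1) v x) + (t (n+1 + 1) v (df A (n+1) v x) + h (n+1) v (f (n+1) v x))"
    using E[OF v m] s1 by simp
   moreover have "(g - ccomp h f) k v x = g k v x - h k v (f k v x)"
    by (simp add: minus_apply[of g] minus_apply[of "g k"] minus_apply[of "g k v"] ccomp_apply gcomp_apply)
   ultimately show "(g - ccomp h f) k v x = htpy A T t k v x"
    unfolding htpy_apply k by (simp add: algebra_simps)
  qed
 qed
 thus thesis using that hc n by simp
qed

text \<open>Up to homotopy, \<open>Hom(P, -)\<close> inverts quasi-isomorphisms: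
  \<open>quasi_iso_cancel\<close> gives injectivity and \<open>quasi_iso_lift\<close>
  surjectivity.\<close>

lemma dim_hom_quasi_iso:
 assumes R: "resolves P p X" and A: "cx A" and B: "cx B" and s: "qis A B s"
 shows "cvec.dim (Ch P A) - cvec.dim (nul P A) = cvec.dim (Ch P B) - cvec.dim (nul P B)"
proof (rule dim_quot_eq[OF cvec_vs cvec_vs, where f = "ccomp s"])
 note r = resolvesD[OF R] and sc = quasi_iso_ch[OF s]
 show "cvec.fd (Ch P A)" "cvec.fd (Ch P B)" by (rule ch_fd[OF r(1) A] ch_fd[OF r(1) B])+
 show "cvec.subspace (nul P A)" "cvec.subspace (nul P B)" by (rule nul_subspace[OF r(1) A] nul_subspace[OF r(1) B])+
 show "nul P A <= Ch P A" "nul P B <= Ch P B" by (rule nul_ch[OF r(1) A] nul_ch[OF r(1) B])+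
 show "lin_on cscale cscale (Ch P A) (ccomp s)"
  by (rule lin_onI) (simp_all add: ccomp_right[OF sc _ _ A])
 show "ccomp s ` Ch P A <= Ch P B" using ccomp_ch[OF _ sc] by blast
 show "ccomp s x : nul P B \<longleftrightarrow> x : nul P A" if "x : Ch P A" for x
  using quasi_iso_cancel[OF r(1,3) A B s that] nul_left[OF r(1) A B _ sc] by blast
 show "EX x:Ch P A. y - ccomp s x : nul P B" if "y : Ch P B" for y
  using quasi_iso_lift[OF r(1,3) A B s that] by metis
qed

end

section \<open>Auslander--Reiten duality\<close>

context positive_quiver
begin

lemma split_mono_zero:
 assumes "cx X" "cx Y" "cx Z" and g: "g : DH X Y" and a: "a : DH Y Z" "a' : DH Z Y"
  and "DC Y Z Y a' a = DI Y" and z: "DC X Y Z a g = D0 X Z"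
 shows "g = D0 X Y"
proof -
 have "g = DC X Y Y (DC Y Z Y a' a) g" unfolding assms(7) D_comp_id(1)[OF assms(1,2) g] ..
 also have "\<dots> = D0 X Y"
  unfolding D_comp_assoc[OF assms(1-3,2) g a, symmetric] z by (rule D_comp_zero(2)[OF assms(1,3,2) a(2)])
 finally show ?thesis .
qed

text \<open>Both composites vanish for the triangle of a cone. The isomorphisms to that triangle
  carry this over, and a left inverse of the shifted isomorphism removes the last one.\<close>

lemma triangle_comp_zero:
 assumes "D_triangle Q X Y Z u v w"
 shows "DC Y Z (shift 1 X) w v = D0 Y (shift 1 X)"
  and "DC Z (shift 1 X) (shift 1 Y) (DS 1 X Y u) w = D0 Z (shift 1 Y)"
proof -
 from assms obtain A B f a b c where c: "cx X" "cx Y" "cx Z" and u: "u : DH X Y" and v: "v : DH Y Z"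
  and w: "w : DH Z (shift 1 X)" and A: "cx A" and B: "cx B" and f: "f : Ch A B"
  and ia: "D_iso Q X A a" and ib: "D_iso Q Y B b" and ic: "D_iso Q Z (Cone A B f) c"
  and e1: "DC X A B (DM A B f) a = DC X Y B b u"
  and e2: "DC Y B (Cone A B f) (DM B (Cone A B f) (cone_in Q B)) b = DC Y Z (Cone A B f) c v"
  and e3: "DC Z (Cone A B f) (shift 1 A) (DM (Cone A B f) (shift 1 A) (cone_pr Q A B)) c
     = DC Z (shift 1 X) (shift 1 A) (DS 1 X A a) w"
  unfolding D_triangle_def by (elim conjE exE) metis
 let ?C = "Cone A B f"
 let ?X = "shift 1 X" and ?Y = "shift 1 Y" and ?A = "shift 1 A" and ?B = "shift 1 B"
 have C: "cx ?C" by (rule cone_cx[OF A B f])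
 note s = shift_cx[OF c(1), of 1] shift_cx[OF c(2), of 1] shift_cx[OF A, of 1] shift_cx[OF B, of 1]
 have a: "a : DH X A" and b: "b : DH Y B" and cc: "c : DH Z ?C"
  using ia ib ic by (simp_all add: D_iso_def)
 have cin: "cone_in Q B : Ch B ?C" and cpr: "cone_pr Q A B : Ch ?C ?A"
  by (rule cone_in_ch[OF A B f], rule cone_pr_ch[OF A B f])
 have mf: "DM A B f : DH A B" and mi: "DM B ?C (cone_in Q B) : DH B ?C"
  and mp: "DM ?C ?A (cone_pr Q A B) : DH ?C ?A"
  by (rule D_map_hom[OF A B f], rule D_map_hom[OF B C cin], rule D_map_hom[OF C s(3) cpr])
 have sa: "DS 1 X A a : DH ?X ?A" and sb: "DS 1 Y B b : DH ?Y ?B" and su: "DS 1 X Y u : DH ?X ?Y"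
  by (rule D_shift_hom[OF c(1) A a], rule D_shift_hom[OF c(2) B b], rule D_shift_hom[OF c(1,2) u])
 obtain a' where a': "a' : DH A X" "DC X A X a' a = DI X" using ia by (auto simp: D_iso_def)
 obtain b' where b': "b' : DH B Y" "DC Y B Y b' b = DI Y" using ib by (auto simp: D_iso_def)
 have sa': "DS 1 A X a' : DH ?A ?X" and sb': "DS 1 B Y b' : DH ?B ?Y"
  by (rule D_shift_hom[OF A c(1) a'(1)], rule D_shift_hom[OF B c(2) b'(1)])
 have inva: "DC ?X ?A ?X (DS 1 A X a') (DS 1 X A a) = DI ?X"
  using D_shift_comp[OF c(1) A c(1) a a'(1), of 1] a'(2) D_shift_id[OF c(1), of 1] by simp
 have invb: "DC ?Y ?B ?Y (DS 1 B Y b') (DS 1 Y B b) = DI ?Y"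
  using D_shift_comp[OF c(2) B c(2) b b'(1), of 1] b'(2) D_shift_id[OF c(2), of 1] by simp
 have wv: "DC Y Z ?X w v : DH Y ?X" by (rule D_comp_hom[OF c(2,3) s(1) v w])
 have uw: "DC Z ?X ?Y (DS 1 X Y u) w : DH Z ?Y" by (rule D_comp_hom[OF c(3) s(1,2) w su])
 have "DC Y ?X ?A (DS 1 X A a) (DC Y Z ?X w v)
   = DC Y Z ?A (DC Z ?X ?A (DS 1 X A a) w) v"
  by (rule D_comp_assoc[OF c(2,3) s(1,3) v w sa])
 also have "\<dots> = DC Y ?C ?A (DM ?C ?A (cone_pr Q A B)) (DC Y Z ?C c v)"
  unfolding e3[symmetric] by (rule D_comp_assoc[OF c(2,3) C s(3) v cc mp, symmetric])
 also have "\<dots> = DC Y B ?A (DC B ?C ?A (DM ?C ?A (cone_pr Q A B)) (DM B ?C (cone_in Q B))) b"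
  unfolding e2[symmetric] by (rule D_comp_assoc[OF c(2) B C s(3) b mi mp])
 also have "\<dots> = DC Y B ?A (D0 B ?A) b"
  unfolding D_map_comp[OF B C s(3) cin cpr] cone_pr_in[OF A B f] D_zero_def ..
 also have "\<dots> = D0 Y ?A" by (rule D_comp_zero(1)[OF c(2) B s(3) b])
 finally have "DC Y ?X ?A (DS 1 X A a) (DC Y Z ?X w v) = D0 Y ?A" .
 from split_mono_zero[OF c(2) s(1,3) wv sa sa' inva this] show "DC Y Z ?X w v = D0 Y ?X" .
 have sf: "shift_map 1 f : Ch ?A ?B" by (rule shift_ch[OF A B f])
 have smf: "DM ?A ?B (shift_map 1 f) : DH ?A ?B" by (rule D_map_hom[OF s(3,4) sf])
 have e1': "DC ?X ?Y ?B (DS 1 Y B b) (DS 1 X Y u) = DC ?X ?A ?B (DM ?A ?B (shift_map 1 f)) (DS 1 X A a)"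
  unfolding D_map_shift[OF A B f, symmetric] D_shift_comp[OF c(1) A B a mf, symmetric] e1 D_shift_comp[OF c(1,2) B u b] ..
 have "DC Z ?Y ?B (DS 1 Y B b) (DC Z ?X ?Y (DS 1 X Y u) w)
   = DC Z ?X ?B (DC ?X ?Y ?B (DS 1 Y B b) (DS 1 X Y u)) w"
  by (rule D_comp_assoc[OF c(3) s(1,2,4) w su sb])
 also have "\<dots> = DC Z ?A ?B (DM ?A ?B (shift_map 1 f)) (DC Z ?X ?A (DS 1 X A a) w)"
  unfolding e1' by (rule D_comp_assoc[OF c(3) s(1,3,4) w sa smf, symmetric])
 also have "\<dots> = DC Z ?C ?B (DC ?C ?A ?B (DM ?A ?B (shift_map 1 f)) (DM ?C ?A (cone_pr Q A B))) c"
  unfolding e3[symmetric] by (rule D_comp_assoc[OF c(3) C s(3,4) cc mp smf])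
 also have "\<dots> = DC Z ?C ?B (D0 ?C ?B) c"
  unfolding D_map_comp[OF C s(3,4) cpr sf] D_map_null[OF C s(4) cone_pr_null[OF A B f]] ..
 also have "\<dots> = D0 Z ?B" by (rule D_comp_zero(1)[OF c(3) C s(4) cc])
 finally have "DC Z ?Y ?B (DS 1 Y B b) (DC Z ?X ?Y (DS 1 X Y u) w) = D0 Z ?B" .
 from split_mono_zero[OF c(3) s(2,4) uw sb sb' invb this] show "DC Z ?X ?Y (DS 1 X Y u) w = D0 Z ?Y" .
qed

lemma cone_projective:
 assumes "!!n. proj (ob A n)" "!!n. proj (ob B n)"
 shows "proj (ob (shift k (Cone A B f)) n)"
 using projective_rep_sum[OF assms] by simp

text \<open>
 The connecting morphism \<open>w\<close> of an Auslander--Reiten triangle factors through every nonzero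
 morphism out of its source and through every nonzero morphism into its target, so a linear
 functional that does not vanish on \<open>w\<close> gives a perfect pairing.
\<close>

theorem AR_duality:
 fixes T E X Y :: "('v, 'e, 'k::field) cplx"
 assumes AR: "AR_triangle Q T E X u v w" and Y: "cx Y"
  and kX: "has_kdim (D_hom_mod Q X Y) m" and kY: "has_kdim (D_hom_mod Q Y (shift 1 T)) n"
 shows "m = n"
proof -
 have tri: "D_triangle Q T E X u v w" using AR by (simp add: AR_triangle_def)
 have cT: "cx T" and cE: "cx E" and cX: "cx X" and u: "u : DH T E" and v: "v : DH E X" and w: "w : DH X (shift 1 T)"
  using tri unfolding D_triangle_def by blast+
 have w0: "w ~= D0 X (shift 1 T)" using AR by (simp add: AR_triangle_def)
 have arv: "EX h:DH W E. DC W E X v h = f"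
  if "f : DH W X" "cx W" "~ (EX g:DH X W. DC X W X f g = DI X)" for W f
  using AR that unfolding AR_triangle_def by blast
 have aru: "EX h:DH E W. DC T E W h u = f"
  if "f : DH T W" "cx W" "~ (EX g:DH W T. DC T W T g f = DI T)" for W f
  using AR that unfolding AR_triangle_def by blast
 let ?T = "shift 1 T"
 have sT: "cx ?T" by (rule shift_cx[OF cT])
 obtain PX pX where RX: "resolves PX pX X" using resolves_ex[OF cX] by blast
 obtain PY pY where RY: "resolves PY pY Y" using resolves_ex[OF Y] by blast
 obtain PT pT where RT: "resolves PT pT T" using resolves_ex[OF cT] by blast
 obtain PE pE where RE: "resolves PE pE E" using resolves_ex[OF cE] by blast
 note rX = resolvesD[OF RX] and rY = resolvesD[OF RY] and rT = resolvesD[OF RT]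
 let ?PT = "shift 1 PT" and ?pT = "shift_map 1 pT"
 note RsT = resolves_shift[OF RT, of 1]
 note rsT = resolvesD[OF RsT]
 obtain \<omega> where \<omega>: "\<omega> : Ch PX ?PT" "w = mo PX pX X ?pT ?T \<omega>" by (rule mo_obtain[OF w RX RsT])
 have \<omega>n: "\<omega> ~: nul PX ?PT"
  using w0 mo_zero[OF RX RsT] mo_eq_iff[OF RX RsT \<omega>(1) ch_0[OF rX(1) rsT(1)]] \<omega>(2) by auto
 \<comment> \<open>The cocone of \<open>phi\<close> maps to \<open>X\<close> by \<open>?pr\<close>,
   and \<open>phi\<close> annihilates this map. Were it a split epimorphism, \<open>phi\<close>
   would be 0. So it factors through \<open>v\<close>, hence \<open>w\<close> annihilates it as
   well, and \<open>w\<close> extends along \<open>phi\<close>.\<close>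
 have left: "EX \<gamma>:Ch PY ?PT. \<omega> - ccomp \<gamma> phi : nul PX ?PT" if phi: "phi : Ch PX PY" and phin: "phi ~: nul PX PY" for phi
 proof -
  let ?K = "Cone PX PY phi" and ?C = "shift (-1) (Cone PX PY phi)"
  let ?pr = "shift_map (-1) (cone_pr Q PX PY)"
  have K: "cx ?K" by (rule cone_cx[OF rX(1) rY(1) phi])
  have C: "cx ?C" by (rule shift_cx[OF K])
  have RC: "resolves ?C (cid Q ?C) ?C" by (rule resolves_self[OF C cone_projective[OF rX(3) rY(3)]])
  have pr: "?pr : Ch ?C PX"
   using shift_ch[OF K shift_cx[OF rX(1)] cone_pr_ch[OF rX(1) rY(1) phi], of "- 1"] by (simp add: shift_shift)
  have sn: "ccomp (shift_map (-1) (shift_map 1 phi)) ?pr : nul ?C (shift (-1) (shift 1 PY))"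
   using shift_nul[OF K shift_cx[OF rY(1)] cone_pr_null[OF rX(1) rY(1) phi], of "- 1"] by (simp only: shift_map_lin)
  hence prn: "ccomp phi ?pr : nul ?C PY" by (simp add: shift_shift shift_map_shift_map)
  let ?\<xi> = "mo ?C (cid Q ?C) ?C pX X ?pr"
  have \<xi>: "?\<xi> : DH ?C X" by (rule mo_D_hom[OF RC RX pr])
  have "~ (EX g:DH X ?C. DC X ?C X ?\<xi> g = DI X)"
  proof
   assume "EX g:DH X ?C. DC X ?C X ?\<xi> g = DI X"
   then obtain g where g: "g : DH X ?C" "DC X ?C X ?\<xi> g = DI X" by blast
   obtain h where h: "h : Ch PX ?C" "g = mo PX pX X (cid Q ?C) ?C h" by (rule mo_obtain[OF g(1) RX RC])
   have ph: "ccomp ?pr h : Ch PX PX" by (rule ccomp_ch[OF h(1) pr])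
   have "mo PX pX X pX X (ccomp ?pr h) = mo PX pX X pX X (cid Q PX)"
    using g(2) unfolding h(2) mo_comp[OF RX RC RX h(1) pr] mo_id[OF RX] .
   hence "ccomp ?pr h - cid Q PX : nul PX PX" using mo_eq_iff[OF RX RX ph cid_ch[OF rX(1)]] by blast
   from nul_comp_left[OF rX(1) rX(1) rY(1) ph cid_ch[OF rX(1)] this phi]
   have 1: "ccomp phi (ccomp ?pr h) - phi : nul PX PY" by (simp add: ccomp_cid(2)[OF phi])
   have 2: "ccomp phi (ccomp ?pr h) : nul PX PY" using nul_right[OF rX(1) C h(1) prn] by (simp add: ccomp_assoc)
   have "phi : nul PX PY" using nul_diff[OF rX(1) rY(1) 2 1] by simp
   thus False using phin by simp
  qed
  then obtain k where k: "k : DH ?C E" "DC ?C E X v k = ?\<xi>" using arv[OF \<xi> C] by blast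
  have "DC ?C X ?T w ?\<xi> = DC ?C E ?T (DC E X ?T w v) k"
   unfolding k(2)[symmetric] by (rule D_comp_assoc[OF C cE cX sT k(1) v w])
  also have "\<dots> = D0 ?C ?T" unfolding triangle_comp_zero(1)[OF tri] by (rule D_comp_zero(1)[OF C cE sT k(1)])
  finally have "mo ?C (cid Q ?C) ?C ?pT ?T (ccomp \<omega> ?pr) = mo ?C (cid Q ?C) ?C ?pT ?T 0"
   unfolding \<omega>(2) mo_comp[OF RC RX RsT pr \<omega>(1)] mo_zero[OF RC RsT] .
  hence "ccomp \<omega> ?pr : nul ?C ?PT"
   using mo_eq_iff[OF RC RsT ccomp_ch[OF pr \<omega>(1)] ch_0[OF C rsT(1)]] by simp
  from shift_nul[OF C rsT(1) this, of 1]
  have "ccomp (shift_map 1 \<omega>) (cone_pr Q PX PY) : nul ?K (shift 1 ?PT)"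
   by (simp add: shift_map_lin shift_shift shift_map_shift_map)
  from cone_null_extend[OF rX(1) rY(1) rsT(1) phi \<omega>(1) this] show ?thesis by metis
 qed
 \<comment> \<open>Dually, with the cone of \<open>\<gamma>\<close> shifted by -1: the map from
   \<open>T\<close> into it is not a split monomorphism, so it factors through \<open>u\<close>. Its
   shift composed with \<open>w\<close> is 0, and \<open>w\<close> lifts through
   \<open>\<gamma>\<close>.\<close>
 have right: "EX phi:Ch PX PY. \<omega> - ccomp \<gamma> phi : nul PX ?PT" if \<gamma>: "\<gamma> : Ch PY ?PT" and \<gamma>n: "\<gamma> ~: nul PY ?PT" for \<gamma>
 proof -
  let ?PY = "shift (-1) PY" and ?PX = "shift (-1) PX"
  define g where "g = shift_map (-1) \<gamma>"
  have sPY: "cx ?PY" and sPX: "cx ?PX" by (rule shift_cx[OF rY(1)], rule shift_cx[OF rX(1)])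
  have g: "g : Ch ?PY PT" using shift_ch[OF rY(1) rsT(1) \<gamma>, of "- 1"] by (simp add: g_def shift_shift)
  have gn: "g ~: nul ?PY PT"
  proof
   assume "g : nul ?PY PT"
   from shift_nul[OF sPY rT(1) this, of 1] show False using \<gamma>n by (simp add: g_def shift_shift shift_map_shift_map)
  qed
  let ?D = "Cone ?PY PT g"
  have D: "cx ?D" by (rule cone_cx[OF sPY rT(1) g])
  have "proj (ob ?D n)" for n
   using projective_rep_sum[OF rY(3) rT(3)] by simp
  hence RD: "resolves ?D (cid Q ?D) ?D" by (rule resolves_self[OF D])
  let ?in = "cone_in Q PT"
  have i: "?in : Ch PT ?D" by (rule cone_in_ch[OF sPY rT(1) g])
  let ?\<xi> = "mo PT pT T (cid Q ?D) ?D ?in"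
  have \<xi>: "?\<xi> : DH T ?D" by (rule mo_D_hom[OF RT RD i])
  have "~ (EX h:DH ?D T. DC T ?D T h ?\<xi> = DI T)"
  proof
   assume "EX h:DH ?D T. DC T ?D T h ?\<xi> = DI T"
   then obtain h where h: "h : DH ?D T" "DC T ?D T h ?\<xi> = DI T" by blast
   obtain k where k: "k : Ch ?D PT" "h = mo ?D (cid Q ?D) ?D pT T k" by (rule mo_obtain[OF h(1) RD RT])
   have ki: "ccomp k ?in : Ch PT PT" by (rule ccomp_ch[OF i k(1)])
   have "mo PT pT T pT T (ccomp k ?in) = mo PT pT T pT T (cid Q PT)"
    using h(2) unfolding k(2) mo_comp[OF RT RD RT i k(1)] mo_id[OF RT] .
   hence "ccomp k ?in - cid Q PT : nul PT PT" using mo_eq_iff[OF RT RT ki cid_ch[OF rT(1)]] by blast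
   from nul_comp_right[OF sPY rT(1) g this]
   have 1: "ccomp (ccomp k ?in) g - g : nul ?PY PT" by (simp add: ccomp_cid(1)[OF g rT(1)])
   have 2: "ccomp (ccomp k ?in) g : nul ?PY PT"
    using nul_left[OF sPY D rT(1) cone_in_null[OF sPY rT(1) g] k(1)] by (simp add: ccomp_assoc)
   have "g : nul ?PY PT" using nul_diff[OF sPY rT(1) 2 1] by simp
   thus False using gn by simp
  qed
  then obtain h where h: "h : DH E ?D" "DC T E ?D h u = ?\<xi>" using aru[OF \<xi> D] by blast
  have sD: "cx (shift 1 ?D)" and sE: "cx (shift 1 E)" by (rule shift_cx[OF D], rule shift_cx[OF cE])
  note RsD = resolves_shift[OF RD, of 1]
  have "DC X ?T (shift 1 ?D) (DS 1 T ?D ?\<xi>) w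
    = DC X (shift 1 E) (shift 1 ?D) (DS 1 E ?D h) (DC X ?T (shift 1 E) (DS 1 T E u) w)"
   unfolding h(2)[symmetric] D_shift_comp[OF cT cE D u h(1)]
   by (rule D_comp_assoc[OF cX sT sE sD w D_shift_hom[OF cT cE u] D_shift_hom[OF cE D h(1)], symmetric])
  also have "\<dots> = D0 X (shift 1 ?D)"
   unfolding triangle_comp_zero(2)[OF tri] by (rule D_comp_zero(2)[OF cX sE sD D_shift_hom[OF cE D h(1)]])
  finally have "mo PX pX X (shift_map 1 (cid Q ?D)) (shift 1 ?D) (ccomp (shift_map 1 ?in) \<omega>)
    = mo PX pX X (shift_map 1 (cid Q ?D)) (shift 1 ?D) 0"
   unfolding \<omega>(2) mo_shift[OF RT RD i] mo_comp[OF RX RsT RsD \<omega>(1) shift_ch[OF rT(1) D i]] mo_zero[OF RX RsD] .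
  hence "ccomp (shift_map 1 ?in) \<omega> : nul PX (shift 1 ?D)"
   using mo_eq_iff[OF RX RsD ccomp_ch[OF \<omega>(1) shift_ch[OF rT(1) D i]] ch_0[OF rX(1) sD]] by simp
  from shift_nul[OF rX(1) sD this, of "- 1"]
  have null: "ccomp ?in (shift_map (-1) \<omega>) : nul ?PX ?D"
   by (simp add: shift_map_lin shift_shift shift_map_shift_map)
  have so: "shift_map (-1) \<omega> : Ch ?PX PT" using shift_ch[OF rX(1) rsT(1) \<omega>(1), of "- 1"] by (simp add: shift_shift)
  obtain phi where phi: "phi : Ch ?PX ?PY" "shift_map (-1) \<omega> - ccomp g phi : nul ?PX PT"
   by (rule cone_null_lift[OF sPX sPY rT(1) g so null])
  have "shift_map 1 phi : Ch PX PY" using shift_ch[OF sPX sPY phi(1), of 1] by (simp add: shift_shift)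
  moreover have "\<omega> - ccomp \<gamma> (shift_map 1 phi) : nul PX ?PT"
   using shift_nul[OF sPX rT(1) phi(2), of 1] by (simp add: g_def shift_map_lin shift_shift shift_map_shift_map)
  ultimately show ?thesis by blast
 qed
 \<comment> \<open>On the factorisations found above the pairing takes the value
   \<open>th \<omega> = 1\<close>, which gives nondegeneracy on both sides.\<close>
 obtain th :: "(int => ('v, 'k) gmap) => 'k" where th: "Vector_Spaces.linear cscale (*) th" "th \<omega> = 1" "!!y. y : nul PX ?PT ==> th y = 0"
  by (rule linear_functional[OF cvec_vs nul_subspace[OF rX(1) rsT(1)] \<omega>n]) blast
 interpret th: Vector_Spaces.linear "cscale :: 'k => (int => ('v, 'k) gmap) => _" "(*)" th by (rule th(1))
 have theq: "th (ccomp \<gamma> phi) = 1" if "\<omega> - ccomp \<gamma> phi : nul PX ?PT" for \<gamma> phi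
  using th(3)[OF that] th.diff[of \<omega> "ccomp \<gamma> phi"] th(2) by simp
 note fds = ch_fd[OF rX(1) rY(1)] nul_subspace[OF rX(1) rY(1)] nul_ch[OF rX(1) rY(1)]
  ch_fd[OF rY(1) rsT(1)] nul_subspace[OF rY(1) rsT(1)] nul_ch[OF rY(1) rsT(1)]
 have lin1: "lin_on cscale (*) (Ch PX PY) (ccomp' \<gamma>)" if "\<gamma> : Ch PY ?PT" "ccomp' = (%\<gamma> phi. th (ccomp \<gamma> phi))" for \<gamma> ccomp'
  unfolding that(2) by (rule lin_onI) (simp_all add: ccomp_right[OF that(1) _ _ rY(1)] th.add th.scale)
 have lin2: "lin_on cscale (*) (Ch PY ?PT) (%\<gamma>. th (ccomp \<gamma> phi))" for phi
  by (rule lin_onI) (simp_all add: ccomp_left th.add th.scale)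
 have z1: "th (ccomp \<gamma> phi) = 0" if "phi : nul PX PY" "\<gamma> : Ch PY ?PT" for phi \<gamma>
  by (rule th(3)[OF nul_left[OF rX(1) rY(1) rsT(1) that]])
 have z2: "th (ccomp \<gamma> phi) = 0" if "phi : Ch PX PY" "\<gamma> : nul PY ?PT" for phi \<gamma>
  by (rule th(3)[OF nul_right[OF rX(1) rY(1) that]])
 have le1: "cvec.dim (Ch PX PY) - cvec.dim (nul PX PY) <= cvec.dim (Ch PY ?PT) - cvec.dim (nul PY ?PT)"
 proof (rule dim_pairing_le[OF cvec_vs cvec_vs fds, where \<beta> = "%phi \<gamma>. th (ccomp \<gamma> phi)"])
  show "EX \<gamma>:Ch PY ?PT. th (ccomp \<gamma> phi) ~= 0" if "phi : Ch PX PY" "phi ~: nul PX PY" for phi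
  proof -
   from left[OF that] obtain \<gamma> where "\<gamma> : Ch PY ?PT" "\<omega> - ccomp \<gamma> phi : nul PX ?PT" by blast
   thus ?thesis using theq by (intro bexI[of _ \<gamma>]) simp_all
  qed
 qed (use lin1 lin2 z1 z2 in simp_all)
 have le2: "cvec.dim (Ch PY ?PT) - cvec.dim (nul PY ?PT) <= cvec.dim (Ch PX PY) - cvec.dim (nul PX PY)"
 proof (rule dim_pairing_le[OF cvec_vs cvec_vs fds(4-6) fds(1-3), where \<beta> = "%\<gamma> phi. th (ccomp \<gamma> phi)"])
  show "EX phi:Ch PX PY. th (ccomp \<gamma> phi) ~= 0" if "\<gamma> : Ch PY ?PT" "\<gamma> ~: nul PY ?PT" for \<gamma>
  proof -
   from right[OF that] obtain phi where "phi : Ch PX PY" "\<omega> - ccomp \<gamma> phi : nul PX ?PT" by blast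
   thus ?thesis using theq by (intro bexI[of _ phi]) simp_all
  qed
 qed (use lin1 lin2 z1 z2 in simp_all)
 \<comment> \<open>The pairing lives on resolutions; \<open>dim_hom_quasi_iso\<close> returns to
   \<open>Y\<close> and \<open>shift 1 T\<close>.\<close>
 have "m = cvec.dim (Ch PX Y) - cvec.dim (nul PX Y)"
  using has_kdim_kdim[OF kX] has_kdim_kdim[OF has_kdim_D_hom[OF RX Y]] by simp
 moreover have "n = cvec.dim (Ch PY ?T) - cvec.dim (nul PY ?T)"
  using has_kdim_kdim[OF kY] has_kdim_kdim[OF has_kdim_D_hom[OF RY sT]] by simp
 ultimately show ?thesis
  using le1 le2 dim_hom_quasi_iso[OF RX rY(1) Y rY(4)] dim_hom_quasi_iso[OF RY rsT(1) sT rsT(4)] by simp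
qed

end

section \<open>Vanishing of morphisms between stalk complexes and their translates\<close>

context quiver
begin

lemma stalk_ob: "ob (stalk M) n = (if n = 0 then M else zero_rep)"
 and stalk_df: "df (stalk M) n = 0"
 by (simp_all add: stalk_def fun_ops)

lemma stalk_cx: assumes M: "rep M" shows "cx (stalk M)"
proof -
 have r: "rep (ob (stalk M) n)" for n by (simp add: stalk_ob M zero_rep_rep)
 show ?thesis unfolding is_complex_def stalk_df
 proof (intro conjI allI r)
  show "0 : Hom (ob (stalk M) n) (ob (stalk M) (n+1))" for n by (rule hom_0[OF r r])
  show "EX m. ALL n. m < abs n --> zrep (ob (stalk M) n)"
   by (rule exI[of _ 0]) (simp add: stalk_ob zero_rep_zero)
 qed (simp add: gcomp_zero_left)
qed

lemma stalk_zero: "n ~= 0 ==> zrep (ob (stalk M) n)"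
 by (simp add: stalk_ob zero_rep_zero)

lemma zero_exact: assumes "cx X" "zrep (ob X n)" shows "exact X n"
 using assms kvec.subspace_0[OF boundary_subspace[OF assms(1)]] by (auto simp: exact_def zrep_def)

lemma stalk_exact: "rep M ==> n ~= - k ==> exact (shift k (stalk M)) n"
 by (rule zero_exact[OF shift_cx[OF stalk_cx]]) (simp_all add: stalk_zero)

lemma has_kdim_unique: "has_kdim V m ==> has_kdim V n ==> m = n"
 using has_kdim_kdim by blast

text \<open>Read: the space of morphisms from \<open>X\<close> to \<open>Y\<close> in the derived
  category has the given dimension.\<close>

abbreviation Dd :: "('v, 'e, 'k::field) cplx => ('v, 'e, 'k) cplx => nat => bool" where
 "Dd X Y == has_kdim (D_hom_mod Q X Y)"

lemma Dd_zeroI: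
 assumes "resolves P p X" "cx Y" "!!f. f : Ch P Y ==> f : nul P Y"
 shows "Dd X Y 0"
proof -
 have "Ch P Y = nul P Y" using assms(3) nul_ch[OF resolvesD(1)[OF assms(1)] assms(2)] by blast
 thus ?thesis using has_kdim_D_hom[OF assms(1,2)] by simp
qed

lemma Dd_zeroD:
 assumes R: "resolves P p X" and Y: "cx Y" and z: "Dd X Y 0" and f: "f : Ch P Y"
 shows "f : nul P Y"
proof -
 have "cls P p X Y f = D0 X Y"
  using has_kdim_0D[OF z] cls_D_hom[OF R Y f] by (auto simp: D_hom_mod_def)
 thus ?thesis
  using cls_eq_iff[OF R Y f ch_0[OF resolvesD(1)[OF R] Y]] by (simp add: D_zero_cls[OF R Y])
qed

lemma stalk_resolves: "proj P ==> resolves (shift k (stalk P)) (cid Q (shift k (stalk P))) (shift k (stalk P))"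
proof (rule resolves_self)
 assume P: "proj P"
 hence "rep P" by (simp add: projective_def)
 thus "cx (shift k (stalk P))" by (rule shift_cx[OF stalk_cx])
 show "proj (ob (shift k (stalk P)) n)" for n
  by (simp add: stalk_ob P projective_zero[OF zero_rep_rep zero_rep_zero])
qed

text \<open>For projective \<open>P\<close>, \<open>Hom(P[k], W)\<close> is
  \<open>Hom(P, H^(-k)(W))\<close>.\<close>

lemma Dd_projective:
 assumes P: "proj P" and W: "cx W" and ex: "exact W (- k)"
 shows "Dd (shift k (stalk P)) W 0"
proof (rule Dd_zeroI[OF stalk_resolves[OF P] W])
 note R = stalk_resolves[OF P, of k]
 fix f assume f: "f : Ch (shift k (stalk P)) W"
 show "f : nul (shift k (stalk P)) W"
 proof (rule null_of_exact[OF resolvesD(1)[OF R] W resolvesD(3)[OF R] f])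
  fix n
  show "exact W n \<or> zrep (ob (shift k (stalk P)) n)"
   using ex stalk_zero[of "n + k" P] by (cases "n = - k") auto
 qed
qed

end

section \<open>Vanishing by heredity, and tests of exactness by indecomposable projectives\<close>

context positive_quiver
begin

lemma Dd_ex: "cx X ==> cx Y ==> EX n. Dd X Y n"
 using resolves_ex[of X] has_kdim_D_hom[of _ _ X Y] by metis

lemma Dd_shift:
 assumes X: "cx X" and Y: "cx Y" and d: "Dd X Y n"
 shows "Dd (shift k X) (shift k Y) n"
proof -
 obtain P p where R: "resolves P p X" using resolves_ex[OF X] by blast
 note r = resolvesD[OF R]
 note s = shift_cx[OF r(1), of k] shift_cx[OF Y, of k]
 have "cvec.dim (Ch P Y) - cvec.dim (nul P Y)
  = cvec.dim (Ch (shift k P) (shift k Y)) - cvec.dim (nul (shift k P) (shift k Y))"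
 proof (rule dim_quot_eq[OF cvec_vs cvec_vs, where f = "shift_map k"])
  show "cvec.fd (Ch P Y)" "cvec.fd (Ch (shift k P) (shift k Y))" by (rule ch_fd[OF r(1) Y] ch_fd[OF s])+
  show "cvec.subspace (nul P Y)" "cvec.subspace (nul (shift k P) (shift k Y))"
   by (rule nul_subspace[OF r(1) Y] nul_subspace[OF s])+
  show "nul P Y <= Ch P Y" "nul (shift k P) (shift k Y) <= Ch (shift k P) (shift k Y)"
   by (rule nul_ch[OF r(1) Y] nul_ch[OF s])+
  show "lin_on cscale cscale (Ch P Y) (shift_map k)" by (rule lin_onI) (simp_all add: shift_map_lin)
  show "shift_map k ` Ch P Y <= Ch (shift k P) (shift k Y)" using shift_ch[OF r(1) Y] by blast
  show "shift_map k f : nul (shift k P) (shift k Y) \<longleftrightarrow> f : nul P Y" for f by (rule shift_nul_iff[OF r(1) Y])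
  show "EX f:Ch P Y. g - shift_map k f : nul (shift k P) (shift k Y)" if "g : Ch (shift k P) (shift k Y)" for g
  proof (rule bexI)
   show "shift_map (- k) g : Ch P Y" using shift_ch[OF s that, of "- k"] by (simp add: shift_shift)
   show "g - shift_map k (shift_map (- k) g) : nul (shift k P) (shift k Y)"
    using nul_0[OF s] by (simp add: shift_map_shift_map)
  qed
 qed
 hence "n = cvec.dim (Ch (shift k P) (shift k Y)) - cvec.dim (nul (shift k P) (shift k Y))"
  using has_kdim_unique[OF d has_kdim_D_hom[OF R Y]] by simp
 thus ?thesis using has_kdim_D_hom[OF resolves_shift[OF R] s(2)] by simp
qed

lemma Dd_shift_iff:
 assumes X: "cx X" and Y: "cx Y"
 shows "Dd (shift k X) (shift k Y) n \<longleftrightarrow> Dd X Y n"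
 using Dd_shift[OF X Y, of n k] Dd_shift[OF shift_cx[OF X] shift_cx[OF Y], of k k n "- k"] by (auto simp: shift_shift)

text \<open>The cohomology of \<open>X\<close> begins in degree \<open>a\<close> and that of
  \<open>W\<close> ends in degree \<open>a - 2\<close>, so only \<open>Ext^i\<close> with
  \<open>i >= 2\<close> could contribute, and these vanish for a quiver.\<close>

lemma Dd_gap:
 assumes X: "cx X" and W: "cx W" and ex: "!!n. n < a ==> exact X n" and exW: "!!n. n >= a-1 ==> exact W n"
 shows "Dd X W 0"
proof -
 obtain P p where R: "resolves P p X" using resolves_ex[OF X] by blast
 note r = resolvesD[OF R]
 show ?thesis
  using Dd_zeroI[OF R W] null_of_gap[OF r(1,3) quasi_iso_exact[OF r(1,2,4) ex] W exW] by blast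
qed

lemma AR_duality_iff:
 assumes AR: "AR_triangle Q T E X u v w" and Y: "cx Y"
 shows "Dd X Y n \<longleftrightarrow> Dd Y (shift 1 T) n"
proof -
 have "cx X" "cx (shift 1 T)" using AR shift_cx by (auto simp: AR_triangle_def D_triangle_def)
 then obtain m m' where m: "Dd X Y m" "Dd Y (shift 1 T) m'" using Dd_ex Y by metis
 moreover have "m = m'" by (rule AR_duality[OF AR Y m])
 ultimately show ?thesis using has_kdim_unique by blast
qed

lemma simple_rep_rep: "rep (simple_rep i :: ('v, 'e, 'k::field) qrep)"
proof -
 have "fd_subspace (kvec.span {%n. if n = 0 then 1 else 0 :: 'k})" unfolding fd_subspace_def by blast
 moreover have "fd_subspace {0 :: nat => 'k}" by (simp add: fd_subspace_iff)
 moreover have "(%x. 0) : lin_maps U W" if "kvec.subspace W" for U W :: "(nat => 'k) set"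
  using lin_maps_0[OF that, of U] by (simp add: zero_fun_def)
 ultimately show ?thesis
  by (auto simp: is_rep_def simple_rep_def kvec.subspace_span kvec.subspace_0)
qed

lemma simple_rep_sp: "sp (simple_rep i) v = (if v = i then kvec.span {%n. if n = 0 then 1 else 0} else {0})"
 by (simp add: simple_rep_def)

lemma delta_nonzero: "(%n. if n = 0 then 1 else 0 :: 'k::field) ~= (0 :: nat => 'k)"
 by (auto simp: fun_eq_iff fun_ops)

lemma simple_rep_dim: "kvec.dim (sp (simple_rep i :: ('v, 'e, 'k::field) qrep) v) = (if v = i then 1 else 0)"
 by (simp add: simple_rep_sp kvec.fd_span1(2)[OF delta_nonzero] del: kvec.dim_span)

text \<open>A concrete model of the indecomposable projective at \<open>i\<close>, on which
  dimensions can be computed; \<open>proj_at_facts\<close> transfers them to the chosen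
  \<open>proj_at\<close>.\<close>

definition Pv :: "'v => ('v, 'e, 'k::field) qrep" where
 "Pv i = P0 (simple_rep i)"

lemma Pv_projective: "proj (Pv i)"
 unfolding Pv_def by (rule P0_projective[OF simple_rep_rep])

lemma Pv_rep: "rep (Pv i)"
 unfolding Pv_def by (rule P0_rep[OF simple_rep_rep])

lemma Pv_hom_dim:
 assumes i: "i : vs" and N: "rep N"
 shows "gvec.dim (Hom (Pv i) N) = kvec.dim (sp N i)"
proof -
 have "gvec.dim (Hom (Pv i) N) = gvec.dim (C0 (simple_rep i) N)"
  unfolding Pv_def by (rule P0_hom_dim[OF simple_rep_rep N])
 also have "\<dots> = (SUM v:vs. if v = i then kvec.dim (sp N v) else 0)"
  unfolding C0_fd(2)[OF simple_rep_rep N] by (intro sum.cong) (simp_all add: simple_rep_dim)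
 also have "\<dots> = kvec.dim (sp N i)" using i by simp
 finally show ?thesis .
qed

lemma Pv_unreachable:
 assumes "w : vs" "(i, w) ~: {(src e, tgt e) | e. e : arcs Q}\<^sup>*"
 shows "sp (Pv i :: ('v, 'e, 'k::field) qrep) w = {0}"
 using assms
proof (induction w rule: vertex_induct)
 case (step w)
 have "z = 0" if z: "z : sp (Pv i :: ('v, 'e, 'k) qrep) w" for z
 proof (rule cmp_eqI)
  fix j
  have "w ~= i" using step.prems by blast
  hence z0: "cmp 0 z = 0" using z by (simp add: Pv_def P0_mem_iff[of z] simple_rep_sp)
  have ze: "cmp (ix e) z = 0" if e: "e : into w" for e
  proof -
   have "(src e, w) : {(src e, tgt e) | e. e : arcs Q}" using e by blast
   hence "(i, src e) ~: {(src e, tgt e) | e. e : arcs Q}\<^sup>*" using step.prems by (meson rtrancl.rtrancl_into_rtrancl)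
   hence "sp (Pv i :: ('v, 'e, 'k) qrep) (src e) = {0}" by (rule step.IH[OF e])
   thus ?thesis using z e by (auto simp: Pv_def P0_mem_iff[of z])
  qed
  show "cmp j z = cmp j 0"
  proof (cases "j = 0 \<or> j : ix ` into w")
   case True
   thus ?thesis using z0 ze by (auto simp: cmp_lin)
  next
   case False
   thus ?thesis using z by (simp add: Pv_def P0_mem_iff[of z] cmp_lin)
  qed
 qed
 thus ?case using kvec.subspace_0[OF rep_sub[OF Pv_rep step.hyps]] by blast
qed

text \<open>Without oriented cycles the trivial path is the only path from \<open>i\<close> to
  \<open>i\<close>, so the space of \<open>Pv i\<close> at \<open>i\<close>, whose dimension is that
  of \<open>Hom(Pv i, Pv i)\<close>, is one-dimensional.\<close>

lemma Pv_brick: assumes i: "i : vs" shows "brick (Pv i :: ('v, 'e, 'k::field) qrep)"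
proof -
 let ?S = "simple_rep i :: ('v, 'e, 'k) qrep"
 let ?A = "{(src e, tgt e) | e. e : arcs Q}"
 have "sp (Pv i) i = put 0 ` sp ?S i"
 proof
  show "put 0 ` sp ?S i <= sp (Pv i) i" using P0_put0[OF simple_rep_rep i] by (auto simp: Pv_def)
  show "sp (Pv i) i <= put 0 ` sp ?S i"
  proof
   fix z assume z: "z : sp (Pv i :: ('v, 'e, 'k) qrep) i"
   have z0: "cmp 0 z : sp ?S i" using z by (simp add: Pv_def P0_mem_iff[of z])
   have "cmp j z = cmp j (put 0 (cmp 0 z))" for j
   proof (cases "j = 0")
    case False
    have "cmp (ix e) z = 0" if e: "e : into i" for e
    proof -
     have "(i, src e) ~: ?A\<^sup>*"
     proof
      assume "(i, src e) : ?A\<^sup>*"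
      moreover have "(src e, i) : ?A" using e by blast
      ultimately have "(i, i) : ?A\<^sup>+" by (rule rtrancl_into_trancl1)
      thus False using wf_acyclic[OF wf_arrows] by (auto simp: acyclic_def)
     qed
     hence "sp (Pv i :: ('v, 'e, 'k) qrep) (src e) = {0}" using e by (intro Pv_unreachable) auto
     thus ?thesis using z e by (auto simp: Pv_def P0_mem_iff[of z])
    qed
    hence "cmp j z = 0" using z False by (cases "j : ix ` into i") (auto simp: Pv_def P0_mem_iff[of z])
    thus ?thesis using False by (simp add: cmp_put)
   qed (simp add: cmp_put)
   hence "z = put 0 (cmp 0 z)" by (rule cmp_eqI)
   thus "z : put 0 ` sp ?S i" using z0 by (rule image_eqI)
  qed
 qed
 moreover have "kvec.dim (put 0 ` sp ?S i) = kvec.dim (sp ?S i)"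
 proof (rule dim_inj[OF kvec_vs kvec_vs])
  show "kvec.fd (sp ?S i)" by (rule rep_fd[OF simple_rep_rep i])
  show "lin_on kscale kscale (sp ?S i) (put 0)" by (rule linear_lin_on[OF put_linear])
  show "x = 0" if "put 0 x = 0" for x :: "nat => 'k"
   using cmp_put[of 0 0 x] unfolding that by (simp add: cmp_lin)
 qed
 ultimately show ?thesis
  unfolding brick_def Pv_hom_dim[OF i Pv_rep] using Pv_rep by (simp add: simple_rep_dim)
qed

text \<open>A cycle \<open>x\<close> at \<open>v\<close> is the image of the generator under a map
  from \<open>Pv v\<close> placed in degree \<open>n\<close>; a null homotopy of this map exhibits
  \<open>x\<close> as a boundary.\<close>

lemma exactI_Pv:
 assumes Z: "cx Z" and d: "!!v. v : vs ==> Dd (shift (- n) (stalk (Pv v))) Z 0"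
 shows "exact Z n"
 unfolding exact_def
proof (intro ballI impI)
 fix v and x :: "nat => 'a" assume v: "v : vs" and x: "x : sp (ob Z n) v" and dx: "df Z n v x = 0"
 let ?S = "simple_rep v :: ('v, 'e, 'a) qrep" and ?P = "Pv v :: ('v, 'e, 'a) qrep"
 let ?C = "shift (- n) (stalk ?P)"
 let ?\<delta> = "%n. if n = 0 then 1 else 0 :: 'a"
 note R = stalk_resolves[OF Pv_projective, of "- n" v]
 note r = resolvesD[OF R]
 have ds: "?\<delta> : sp ?S v" by (simp add: simple_rep_sp kvec.span_base)
 obtain L where L: "Vector_Spaces.linear kscale kscale L" "L ?\<delta> = x"
 proof -
  have "kvec.independent {?\<delta>}" using delta_nonzero by (simp add: kvec.dependent_single)
  from kk.linear_independent_extend[OF this, of "%_. x"] show ?thesis using that by auto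
 qed
 have Lm: "L y : sp (ob Z n) v & df Z n v (L y) = 0" if y: "y : sp ?S v" for y
 proof -
  obtain c where "y = kscale c ?\<delta>" using y by (auto simp: simple_rep_sp kvec.span_singleton)
  hence "L y = kscale c x" using L(2) lin_on_scale[OF linear_lin_on[OF L(1)], of ?\<delta> UNIV c] by simp
  thus ?thesis
   using kvec.subspace_scale[OF rep_sub[OF cx_rep[OF Z] v] x] lin_maps_scale[OF hom_lin[OF cx_df[OF Z] v] x] dx
   by (simp add: kvec.scale_zero_right)
 qed
 define g where "g w = (if w = v then (%y. if y : sp ?S v then L y else 0) else 0)" for w
 have g: "g : C0 ?S (ob Z n)"
 proof (rule ghI)
  fix w assume w: "w : vs"
  show "g w : lin_maps (sp ?S w) (sp (ob Z n) w)"
  proof (cases "w = v")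
   case True
   have "(%y. if y : sp ?S v then L y else 0) : lin_maps (sp ?S v) (sp (ob Z n) v)"
    by (rule lin_maps_restrict[OF linear_lin_on[OF L(1)] rep_sub[OF simple_rep_rep v]]) (simp add: Lm)
   thus ?thesis using True by (simp add: g_def)
  next
   case False
   thus ?thesis using lin_maps_0[OF rep_sub[OF cx_rep[OF Z] w]] by (simp add: g_def)
  qed
 qed (use v in \<open>auto simp: g_def\<close>)
 define F where "F = P0hom ?S (ob Z n) g"
 have F: "F : Hom ?P (ob Z n)" and Fp: "!!w y. w : vs ==> y : sp ?S w ==> F w (put 0 y) = g w y"
  unfolding F_def Pv_def using P0hom[OF simple_rep_rep cx_rep[OF Z] g] by blast+
 have dF: "gcomp (df Z n) F = 0"
 proof (rule P0_hom_zero[OF simple_rep_rep cx_rep[OF Z]])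
  show "gcomp (df Z n) F : Hom (P0 ?S) (ob Z (n+1))" using hom_comp[OF F cx_df[OF Z]] by (simp add: Pv_def)
  fix w y assume w: "w : vs" and y: "y : sp ?S w"
  show "gcomp (df Z n) F w (put 0 y) = 0"
   unfolding gcomp_apply Fp[OF w y] using Lm y hom_zero[OF cx_df[OF Z]] by (simp add: g_def fun_ops)
 qed
 define f where "f m = (if m = n then F else 0)" for m
 have rC: "rep (ob ?C m)" for m by (rule cx_rep[OF r(1)])
 have C0: "df ?C m = 0" for m by (simp add: shift_df stalk_df)
 have "f : Ch ?C Z"
 proof (rule chI)
  fix m
  show "f m : Hom (ob ?C m) (ob Z m)" using F hom_0[OF rC cx_rep[OF Z], of m m] by (auto simp: f_def stalk_ob)
  thus "gcomp (f (m+1)) (df ?C m) = gcomp (df Z m) (f m)"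
   using dF comp_zero[OF cx_df[OF Z]] comp_zero[OF F] by (simp add: f_def C0 gcomp_zero_left)
 qed
 from Dd_zeroD[OF R Z d[OF v] this] obtain s where s: "!!m. s m : Hom (ob ?C m) (ob Z (m-1))" "f = htpy ?C Z s"
  by (auto simp: nul_iff)
 have "F = f n" by (simp add: f_def)
 also have "\<dots> = gcomp (df Z (n-1)) (s n)"
  unfolding s(2) htpy_at C0 using comp_zero[OF s(1)[of "n+1"]] by simp
 finally have FF: "F = gcomp (df Z (n-1)) (s n)" .
 have p0: "put 0 ?\<delta> : sp ?P v" unfolding Pv_def by (rule P0_put0[OF simple_rep_rep v ds])
 have "x = F v (put 0 ?\<delta>)" using Fp[OF v ds] ds L(2) by (simp add: g_def)
 also have "\<dots> = df Z (n-1) v (s n v (put 0 ?\<delta>))" unfolding FF gcomp_apply ..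
 finally show "x : df Z (n-1) v ` sp (ob Z (n-1)) v"
  using hom_mem[OF s(1)[of n] v, of "put 0 ?\<delta>"] p0 by (auto simp: stalk_ob)
qed

lemma D_shift_add:
 assumes "cx X" "cx Y" "\<xi> : DH X Y" "\<eta> : DH X Y"
 shows "DS k X Y (D_add Q X Y \<xi> \<eta>) = D_add Q (shift k X) (shift k Y) (DS k X Y \<xi>) (DS k X Y \<eta>)"
proof -
 obtain P p P' p' where R: "resolves P p X" "resolves P' p' Y" using resolves_ex assms(1,2) by metis
 obtain l where l: "l : Ch P P'" "\<xi> = mo P p X p' Y l" by (rule mo_obtain[OF assms(3) R])
 obtain m where m: "m : Ch P P'" "\<eta> = mo P p X p' Y m" by (rule mo_obtain[OF assms(4) R])
 note c = resolvesD(1)[OF R(1)] resolvesD(1)[OF R(2)]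
 note S = resolves_shift[OF R(1)] resolves_shift[OF R(2)]
 show ?thesis unfolding l(2) m(2) mo_add[OF R l(1) m(1)] mo_shift[OF R l(1)] mo_shift[OF R m(1)]
   mo_shift[OF R ch_add[OF c l(1) m(1)]] mo_add[OF S shift_ch[OF c l(1)] shift_ch[OF c m(1)]] shift_map_lin ..
qed

lemma D_is_zero_shift: "cx X ==> D_is_zero Q X ==> D_is_zero Q (shift k X)"
 unfolding D_is_zero_def using D_shift_id[of X k] D_shift_zero[of X X k] by simp

lemma D_is_zero_shift_iff: "cx X ==> D_is_zero Q (shift k X) \<longleftrightarrow> D_is_zero Q X"
 using D_is_zero_shift[of X k] D_is_zero_shift[of "shift k X" "- k"] shift_cx[of X k] by (auto simp: shift_shift)

lemma D_biproduct_shift: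
 assumes c: "cx X" "cx A" "cx B" and b: "D_biproduct Q X A B"
 shows "D_biproduct Q (shift k X) (shift k A) (shift k B)"
proof -
 from b obtain i j p q where h: "i : DH A X" "j : DH B X" "p : DH X A" "q : DH X B"
  and e: "DC A X A p i = DI A" "DC B X B q j = DI B"
   "DC A X B q i = D0 A B" "DC B X A p j = D0 B A"
   "D_add Q X X (DC X A X i p) (DC X B X j q) = DI X"
  unfolding D_biproduct_def by blast
 have "DS k A X i : DH (shift k A) (shift k X)" "DS k B X j : DH (shift k B) (shift k X)"
  "DS k X A p : DH (shift k X) (shift k A)" "DS k X B q : DH (shift k X) (shift k B)"
  using D_shift_hom[OF c(2,1) h(1)] D_shift_hom[OF c(3,1) h(2)] D_shift_hom[OF c(1,2) h(3)] D_shift_hom[OF c(1,3) h(4)] by blast+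
 moreover note D_shift_comp[OF c(2,1,2) h(1,3), of k, unfolded e D_shift_id[OF c(2)], symmetric]
  D_shift_comp[OF c(3,1,3) h(2,4), of k, unfolded e D_shift_id[OF c(3)], symmetric]
  D_shift_comp[OF c(2,1,3) h(1,4), of k, unfolded e D_shift_zero[OF c(2,3)], symmetric]
  D_shift_comp[OF c(3,1,2) h(2,3), of k, unfolded e D_shift_zero[OF c(3,2)], symmetric]
  D_shift_add[OF c(1,1) D_comp_hom[OF c(1,2,1) h(3,1)] D_comp_hom[OF c(1,3,1) h(4,2)], of k, unfolded e D_shift_id[OF c(1)]
   D_shift_comp[OF c(1,2,1) h(3,1)] D_shift_comp[OF c(1,3,1) h(4,2)], symmetric]
 ultimately show ?thesis unfolding D_biproduct_def by blast
qed

lemma D_indec_shift: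
 assumes "Dind X"
 shows "Dind (shift k X)"
proof -
 have X: "cx X" and nz: "~ D_is_zero Q X"
  and i: "!!A B. cx A ==> cx B ==> D_biproduct Q X A B ==> D_is_zero Q A \<or> D_is_zero Q B"
  using assms by (auto simp: D_indec_def)
 have "D_is_zero Q A \<or> D_is_zero Q B" if A: "cx A" and B: "cx B" and b: "D_biproduct Q (shift k X) A B" for A B
 proof -
  have "D_biproduct Q X (shift (- k) A) (shift (- k) B)"
   using D_biproduct_shift[OF shift_cx[OF X] A B b, of "- k"] by (simp add: shift_shift)
  from i[OF shift_cx[OF A] shift_cx[OF B] this] show ?thesis
   using D_is_zero_shift_iff[OF A] D_is_zero_shift_iff[OF B] by simp
 qed
 thus ?thesis using shift_cx[OF X] nz D_is_zero_shift_iff[OF X] by (auto simp: D_indec_def)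
qed

text \<open>A biproduct gives the idempotent \<open>i p\<close>; if it is 0, the first summand is 0,
  and if it is the identity, the second one is.\<close>

lemma D_indecI:
 assumes X: "cx X" and nz: "~ D_is_zero Q X"
  and idem: "!!e. e : DH X X ==> DC X X X e e = e ==> e = D0 X X \<or> e = DI X"
 shows "Dind X"
proof -
 have "D_is_zero Q A \<or> D_is_zero Q B" if A: "cx A" and B: "cx B" and b: "D_biproduct Q X A B" for A B
 proof -
  from b obtain i j p q where h: "i : DH A X" "j : DH B X" "p : DH X A" "q : DH X B"
   and e: "DC A X A p i = DI A" "DC B X B q j = DI B" "DC A X B q i = D0 A B"
   unfolding D_biproduct_def by blast
  let ?e = "DC X A X i p"
  have eh: "?e : DH X X" by (rule D_comp_hom[OF X A X h(3,1)])
  have ei: "DC A X X ?e i = i"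
   using D_comp_assoc[OF A X A X h(1,3,1)] D_comp_id(2)[OF A X h(1)] by (simp add: e)
  have "DC X X X ?e ?e = ?e"
   using D_comp_assoc[OF X A X X h(3,1) eh] by (simp add: ei)
  then consider "?e = D0 X X" | "?e = DI X" using idem[OF eh] by blast
  thus ?thesis
  proof cases
   case 1
   have "DI A = DC A X A p (DC A X X ?e i)" by (simp add: ei e)
   also have "\<dots> = D0 A A"
    unfolding 1 using D_comp_zero(1)[OF A X X h(1)] D_comp_zero(2)[OF A X A h(3)] by simp
   finally show ?thesis by (simp add: D_is_zero_def)
  next
   case 2
   have "q = DC X X B q ?e" unfolding 2 by (rule D_comp_id(2)[OF X B h(4), symmetric])
   also have "\<dots> = DC X A B (DC A X B q i) p" by (rule D_comp_assoc[OF X A X B h(3,1,4)])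
   also have "\<dots> = D0 X B" unfolding e by (rule D_comp_zero(1)[OF X A B h(3)])
   finally have "DC B X B q j = D0 B B" using D_comp_zero(1)[OF B X B h(2)] by simp
   thus ?thesis by (simp add: e D_is_zero_def)
  qed
 qed
 thus ?thesis using X nz by (auto simp: D_indec_def)
qed

text \<open>\<open>h\<close> is a graded section of \<open>p\<close>; \<open>f h\<close> commutes
  with the arrows because \<open>f\<close> is constant on the fibres of \<open>p\<close>.\<close>

lemma hom_factor:
 assumes A: "rep A" and B: "rep B" and C: "rep C" and p: "p : Hom A B" and f: "f : Hom A C"
  and surj: "!!v. v : vs ==> sp B v <= p v ` sp A v"
  and ker: "!!v x. v : vs ==> x : sp A v ==> p v x = 0 ==> f v x = 0"
 obtains phi where "phi : Hom B C" "f = gcomp phi p"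
proof -
 have "EX h:C0 B A. ALL v:vs. ALL x:sp B v. p v (h v x) = ident B v x"
  by (rule gh_lift[OF _ _ _ _ hom_gh[OF ident_hom[OF B]]]) (use rep_sub A B hom_lin[OF p] surj in auto)
 then obtain h where h: "h : C0 B A" "ALL v:vs. ALL x:sp B v. p v (h v x) = ident B v x" by blast
 have ph: "p v (h v x) = x" and hm: "h v x : sp A v" if "v : vs" "x : sp B v" for v x
  using h(2) that lin_maps_mem[OF ghD[OF h(1) that(1)] that(2)] by (simp_all add: rep_id_def)
 have fe: "f v x = f v y" if "v : vs" "x : sp A v" "y : sp A v" "p v x = p v y" for v x y
 proof -
  note s = rep_sub[OF A that(1)]
  have "f v (x - y) = 0"
   using ker[OF that(1) kvec.subspace_diff[OF s that(2,3)]] lin_maps_diff[OF hom_lin[OF p that(1)] s that(2,3)] that(4) by simp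
  thus ?thesis using lin_maps_diff[OF hom_lin[OF f that(1)] s that(2,3)] by simp
 qed
 have g: "gcomp f h : Hom B C"
 proof (rule homI[OF B C gh_comp[OF h(1) hom_gh[OF f]]])
  fix e x assume e: "e : arcs Q" and x: "x : sp B (src e)"
  hence v: "src e : vs" "tgt e : vs" by simp_all
  have ax: "act B e x : sp B (tgt e)" by (rule act_mem[OF B e x])
  have "p (tgt e) (act A e (h (src e) x)) = act B e x" using hom_comm[OF p e] ph[OF v(1) x] by simp
  hence "f (tgt e) (h (tgt e) (act B e x)) = f (tgt e) (act A e (h (src e) x))"
   using fe[OF v(2) hm[OF v(2) ax] act_mem[OF A e hm[OF v(1) x]]] ph[OF v(2) ax] by simp
  thus "gcomp f h (tgt e) (act B e x) = act C e (gcomp f h (src e) x)"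
   using hom_comm[OF f e] by (simp add: gcomp_apply)
 qed
 moreover have "f = gcomp (gcomp f h) p"
 proof (rule hom_eqI[OF f hom_comp[OF p g]])
  fix v x assume v: "v : vs" and x: "x : sp A v"
  note px = hom_mem[OF p v x]
  show "f v x = gcomp (gcomp f h) p v x"
   using fe[OF v x hm[OF v px]] ph[OF v px] by (simp add: gcomp_apply)
 qed
 ultimately show thesis by (rule that)
qed

text \<open>Chain maps from the resolution of \<open>M\<close> to \<open>M\<close> come from
  endomorphisms of \<open>M\<close>, hence are multiples of \<open>p\<close>; an idempotent is then
  given by a scalar with \<open>c * c = c\<close>.\<close>

lemma D_indec_stalk:
 fixes M :: "('v, 'e, 'k::field) qrep"
 assumes M: "brick M"
 shows "Dind (stalk M)"
proof -
 have rM: "rep M" using M by (simp add: brick_def)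
 let ?X = "stalk M"
 have X: "cx ?X" by (rule stalk_cx[OF rM])
 obtain P p where R: "resolves P p ?X"
  and Pz: "!!n. zrep (ob ?X n) ==> zrep (ob ?X (n+1)) ==> zrep (ob P n)"
  using resolution_exists[OF X] by metis
 note r = resolvesD[OF R]
 have P1: "zrep (ob P 1)" by (rule Pz) (simp_all add: stalk_zero)
 have p0: "p 0 : Hom (ob P 0) M" using ch_hom[OF r(5), of 0] by (simp add: stalk_ob)
 \<comment> \<open>The resolution of the stalk stops in degree 0, so every element of degree 0 is a
   cycle.\<close>
 have dP0: "df P 0 = 0" using hom_to_zero[OF cx_df[OF r(1), of 0]] P1 by simp
 have imX: "df ?X n v ` sp (ob ?X n) v <= {0}" for n v by (auto simp: stalk_df fun_ops)
 have surj: "sp M v <= p 0 v ` sp (ob P 0) v" if v: "v : vs" for v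
 proof
  fix y assume "y : sp M v"
  hence "y : sp (ob ?X 0) v" "df ?X 0 v y = 0" by (simp_all add: stalk_ob stalk_df fun_ops)
  from quasi_isoD(3)[OF r(4) v this] imX[of "0 - 1" v] show "y : p 0 v ` sp (ob P 0) v" by auto
 qed
 have scal: "EX c. f = cscale c p" if f: "f : Ch P ?X" for f
 proof -
  have f0: "f 0 : Hom (ob P 0) M" using ch_hom[OF f, of 0] by (simp add: stalk_ob)
  have "f 0 v x = 0" if v: "v : vs" and x: "x : sp (ob P 0) v" and px: "p 0 v x = 0" for v x
  proof -
   have "df P 0 v x = 0" by (simp add: dP0 fun_ops)
   moreover have "p 0 v x : df ?X (0 - 1) v ` sp (ob ?X (0 - 1)) v"
    unfolding px by (rule kvec.subspace_0[OF boundary_subspace[OF X v]])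
   ultimately obtain b where "x = df P (0 - 1) v b" using quasi_isoD(2)[OF r(4) v x] by blast
   thus ?thesis using ch_comm_apply'[OF f, of 0 v b] by (simp add: stalk_df fun_ops)
  qed
  then obtain phi where phi: "phi : Hom M M" "f 0 = gcomp phi (p 0)"
   using hom_factor[OF cx_rep[OF r(1)] rM rM p0 f0 surj] by blast
  obtain c where c: "phi = gscale c (ident M)" by (rule brick_scalar[OF M phi(1)])
  have "f n = cscale c p n" for n
  proof (cases "n = 0")
   case True
   thus ?thesis using phi(2) ident_left[OF p0 rM] by (simp add: c gcomp_scale_left cscale_def)
  next
   case False
   note z = stalk_zero[OF False, of M]
   show ?thesis
    using hom_to_zero[OF ch_hom[OF f] z] hom_to_zero[OF ch_hom[OF ch_scale[OF r(1) X r(5)]] z] by simp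
  qed
  thus ?thesis by blast
 qed
 have pn: "p ~: nul P ?X"
 proof
  assume "p : nul P ?X"
  then obtain s where s: "!!n. s n : Hom (ob P n) (ob ?X (n-1))" "p = htpy P ?X s" by (auto simp: nul_iff)
  have "p 0 = 0"
   using comp_zero[OF s(1)[of 1]] by (simp add: s(2) htpy_at stalk_df gcomp_zero_left dP0)
  hence "ALL v:vs. sp M v = {0}" using surj kvec.subspace_0[OF rep_sub[OF rM]] by (fastforce simp: fun_ops)
  thus False using M brick_not_zero zero_rep_iff[OF rM] by (auto simp: zrep_def)
 qed
 have id: "DI ?X = cls P p ?X ?X p" by (rule D_id_cls[OF R])
 have zero: "D0 ?X ?X = cls P p ?X ?X 0" by (rule D_zero_cls[OF R X])
 have nz: "~ D_is_zero Q ?X"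
  unfolding D_is_zero_def id zero cls_eq_iff[OF R X r(5) ch_0[OF r(1) X]] using pn by simp
 show ?thesis
 proof (rule D_indecI[OF X nz])
  fix e assume e: "e : DH ?X ?X" and ee: "DC ?X ?X ?X e e = e"
  obtain f where f: "f : Ch P ?X" "e = cls P p ?X ?X f" by (rule D_homE[OF e R X])
  obtain c where c: "f = cscale c p" using scal[OF f(1)] by blast
  have l: "cscale c (cid Q P) : Ch P P" by (rule ch_scale[OF r(1,1) cid_ch[OF r(1)]])
  have pl: "ccomp p (cscale c (cid Q P)) = f"
   using ccomp_right(3)[OF r(5) cid_ch[OF r(1)] cid_ch[OF r(1)] r(1)] ccomp_cid(2)[OF r(5)] by (simp add: c)
  hence "DC ?X ?X ?X e e = cls P p ?X ?X (ccomp f (cscale c (cid Q P)))"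
   unfolding f(2) using nul_0[OF r(1) X] by (intro D_comp_cls[OF R R X f(1) f(1) l]) simp
  also have "ccomp f (cscale c (cid Q P)) = cscale c f"
   unfolding c ccomp_left using pl by (simp add: c)
  finally have "cls P p ?X ?X (cscale c f) = cls P p ?X ?X f" using ee f(2) by simp
  hence "cscale c f - f : nul P ?X" using cls_eq_iff[OF R X ch_scale[OF r(1) X f(1)] f(1)] by blast
  hence n: "cscale (c * c - c) p : nul P ?X" by (simp add: c cvec.scale_left_diff_distrib)
  have "c * c - c = 0"
  proof (rule ccontr)
   assume "c * c - c ~= 0"
   hence "p : nul P ?X" using nul_scale[OF r(1) X n, of "inverse (c * c - c)"] by simp
   thus False using pn by simp
  qed
  hence "c = 0 \<or> c = 1" by (metis eq_iff_diff_eq_0 mult_cancel_right1)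
  thus "e = D0 ?X ?X \<or> e = DI ?X" unfolding f(2) id zero by (auto simp: c)
 qed
qed

end

section \<open>Cohomological bounds for translates and for powers of F\<close>

context positive_quiver
begin

context
 fixes \<tau> \<tau>inv :: "('v, 'e, 'k::field) cplx => ('v, 'e, 'k) cplx"
 assumes AR: "AR_translation Q \<tau> \<tau>inv"
begin

text \<open>Apart from being indecomposable, the translates are accessible only through these
  equalities of dimensions.\<close>

lemma tau_facts:
 assumes "Dind X"
 shows "Dind (\<tau> X)" "Dind (\<tau>inv X)"
  "cx Y ==> Dd X Y n \<longleftrightarrow> Dd Y (shift 1 (\<tau> X)) n"
  "cx Y ==> Dd (\<tau>inv X) Y n \<longleftrightarrow> Dd Y (shift 1 X) n"
proof -
 obtain E u v w where 1: "AR_triangle Q (\<tau> X) E X u v w" using AR assms unfolding AR_translation_def by blast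
 obtain E' u' v' w' where 2: "AR_triangle Q X E' (\<tau>inv X) u' v' w'" using AR assms unfolding AR_translation_def by blast
 show "Dind (\<tau> X)" "Dind (\<tau>inv X)" using 1 2 by (simp_all add: AR_triangle_def)
 show "cx Y ==> Dd X Y n \<longleftrightarrow> Dd Y (shift 1 (\<tau> X)) n" by (rule AR_duality_iff[OF 1])
 show "cx Y ==> Dd (\<tau>inv X) Y n \<longleftrightarrow> Dd Y (shift 1 X) n" by (rule AR_duality_iff[OF 2])
qed

lemma indec_cx: "Dind X ==> cx X"
 by (simp add: D_indec_def)

lemma Pv_stalk_cx: "cx (shift k (stalk (Pv v)))"
 by (rule shift_cx[OF stalk_cx[OF Pv_rep]])

lemma Pv_indec: "v : vs ==> Dind (shift k (stalk (Pv v)))"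
 by (rule D_indec_shift[OF D_indec_stalk[OF Pv_brick]])

text \<open>By duality, \<open>Hom(P_v[-n], \<tau> X)\<close> has the dimension of
  \<open>Hom(X, P_v[1 - n])\<close>, and the \<open>P_v\<close> detect cohomology.\<close>

lemma exact_tauI:
 assumes X: "Dind X" and d: "!!v. v : vs ==> Dd X (shift (1 - n) (stalk (Pv v))) 0"
 shows "exact (\<tau> X) n"
proof (rule exactI_Pv)
 note cT = indec_cx[OF tau_facts(1)[OF X]]
 show "cx (\<tau> X)" by (rule cT)
 fix v assume v: "v : vs"
 have "Dd (shift (1 - n) (stalk (Pv v))) (shift 1 (\<tau> X)) 0"
  using d[OF v] tau_facts(3)[OF X Pv_stalk_cx] by blast
 hence "Dd (shift 1 (shift (- n) (stalk (Pv v)))) (shift 1 (\<tau> X)) 0" by (simp add: shift_shift)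
 thus "Dd (shift (- n) (stalk (Pv v))) (\<tau> X) 0" using Dd_shift_iff[OF Pv_stalk_cx cT] by blast
qed

text \<open>\<open>P_v[1 - n]\<close> has cohomology in degree \<open>n - 1 <= a - 2\<close> only,
  which leaves the gap of \<open>Dd_gap\<close>.\<close>

lemma tau_exact:
 assumes X: "Dind X" and ex: "!!n. n < a ==> exact X n" and n: "n < a"
 shows "exact (\<tau> X) n"
proof (rule exact_tauI[OF X])
 fix v
 show "Dd X (shift (1 - n) (stalk (Pv v))) 0"
  using n by (intro Dd_gap[OF indec_cx[OF X] Pv_stalk_cx ex] stalk_exact[OF Pv_rep]) auto
qed

text \<open>For projective \<open>P\<close> the bound of \<open>tau_exact\<close> improves by one
  degree, as \<open>\<tau> P\<close> is an injective placed in degree 1.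
  \<open>Dd_projective\<close> yields this because it looks at a single degree and requires no
  gap.\<close>

lemma tau_projective_exact:
 assumes X: "Dind (shift k (stalk P))" and P: "proj P" and n: "n < 1 - k"
 shows "exact (\<tau> (shift k (stalk P))) n"
proof (rule exact_tauI[OF X])
 fix v
 show "Dd (shift k (stalk P)) (shift (1 - n) (stalk (Pv v))) 0"
  using n by (intro Dd_projective[OF P Pv_stalk_cx] stalk_exact[OF Pv_rep]) auto
qed

text \<open>Two applications of the duality turn \<open>Hom(P_v[-n], \<tau>inv X)\<close> into
  \<open>Hom(\<tau> (P_v[-n]), X)\<close>. The improved bound of \<open>tau_projective_exact\<close>
  opens the gap needed for \<open>Dd_gap\<close>.\<close>

lemma tauinv_exact:
 assumes X: "Dind X" and ex: "!!n. n > b ==> exact X n" and n: "n > b"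
 shows "exact (\<tau>inv X) n"
proof (rule exactI_Pv)
 note cT = indec_cx[OF tau_facts(2)[OF X]]
 show "cx (\<tau>inv X)" by (rule cT)
 fix v assume v: "v : vs"
 let ?P = "shift (- n) (stalk (Pv v))"
 note P = Pv_indec[OF v, of "- n"]
 note ctP = indec_cx[OF tau_facts(1)[OF P]]
 have "Dd (\<tau> ?P) X 0"
 proof (rule Dd_gap[OF ctP indec_cx[OF X]])
  show "exact (\<tau> ?P) m" if "m < n+1" for m
   using tau_projective_exact[OF P Pv_projective] that by simp
  show "exact X m" if "m >= n+1 - 1" for m using ex n that by simp
 qed
 hence "Dd (shift 1 (\<tau> ?P)) (shift 1 X) 0" by (rule Dd_shift[OF ctP indec_cx[OF X]])
 hence "Dd (\<tau>inv X) (shift 1 (\<tau> ?P)) 0" using tau_facts(4)[OF X shift_cx[OF ctP]] by blast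
 thus "Dd ?P (\<tau>inv X) 0" using tau_facts(3)[OF P cT] by blast
qed

text \<open>\<open>\<tau>inv\<close> keeps the upper bound on the cohomology, and the shift lowers
  it by one.\<close>

lemma F_power_exact:
 assumes X: "Dind X" and ex: "!!n. n > 0 ==> exact X n"
 shows "Dind (((%X. shift 1 (\<tau>inv X)) ^^ k) X) & (ALL n > - int k. exact (((%X. shift 1 (\<tau>inv X)) ^^ k) X) n)"
proof (induction k)
 case (Suc k)
 let ?Z = "((%X. shift 1 (\<tau>inv X)) ^^ k) X"
 have Z: "Dind ?Z" using Suc by blast
 have "exact (\<tau>inv ?Z) n" if "n > - int k" for n
  by (rule tauinv_exact[OF Z _ that]) (use Suc in blast)
 hence "exact (shift 1 (\<tau>inv ?Z)) n" if "n > - int (Suc k)" for n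
  using that by (simp add: shift_exact[OF indec_cx[OF tau_facts(2)[OF Z]]])
 thus ?case using D_indec_shift[OF tau_facts(2)[OF Z]] by simp
qed (use assms in simp)

text \<open>The shift by -1 moves cohomology upwards, and \<open>\<tau>\<close> keeps the lower
  bound.\<close>

lemma F_inv_power_exact:
 assumes X: "Dind X" and ex: "!!n. n < 1 ==> exact X n"
 shows "Dind (((%X. \<tau> (shift (-1) X)) ^^ k) X) & (ALL n < 1. exact (((%X. \<tau> (shift (-1) X)) ^^ k) X) n)"
proof (induction k)
 case (Suc k)
 let ?Z = "((%X. \<tau> (shift (-1) X)) ^^ k) X"
 have Z: "Dind ?Z" using Suc by blast
 have sZ: "Dind (shift (-1) ?Z)" by (rule D_indec_shift[OF Z])
 have "exact (shift (-1) ?Z) n" if "n < 1" for n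
  using Suc that by (simp add: shift_exact[OF indec_cx[OF Z]])
 hence "exact (\<tau> (shift (-1) ?Z)) n" if "n < 1" for n by (rule tau_exact[OF sZ _ that])
 thus ?case using tau_facts(1)[OF sZ] by simp
qed (use assms in simp)

text \<open>
 The properties of the objects \<open>M\<^sub>Q(\<alpha>)\<close> that make only the powers \<open>F\<^sup>0\<close> and \<open>F\<^sup>1\<close> contribute to
 \<open>Ext\<^sup>1\<close> in the cluster category.
\<close>

definition fundamental :: "('v, 'e, 'k) cplx => bool" where
 "fundamental X \<longleftrightarrow> Dind X & (ALL n>0. exact X n) & (ALL n<1. exact (\<tau> (shift (-1) X)) n) &
   (ALL W. cx W --> (ALL n>-2. exact W n) --> Dd X W 0)"

text \<open>A module sits in degree 0 and its shift by -1 in degree 1, so \<open>tau_exact\<close>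
  keeps the translate exact below 1. The last clause is \<open>Dd_gap\<close> for
  \<open>a = 0\<close>.\<close>

lemma fundamental_module:
 assumes "brick M"
 shows "fundamental (stalk M)"
proof -
 have M: "rep M" using assms by (simp add: brick_def)
 have I: "Dind (stalk M)" by (rule D_indec_stalk[OF assms])
 have ex: "exact (shift k (stalk M)) n" if "n ~= - k" for n k by (rule stalk_exact[OF M that])
 have "exact (\<tau> (shift (-1) (stalk M))) n" if "n < 1" for n
  by (rule tau_exact[OF D_indec_shift[OF I] _ that]) (simp add: ex)
 moreover have "Dd (stalk M) W 0" if "cx W" "ALL n>-2. exact W n" for W
  using ex[of _ 0] that by (intro Dd_gap[of "stalk M" W 0] stalk_cx[OF M]) auto
 ultimately show ?thesis using I ex[of _ 0] by (simp add: fundamental_def)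
qed

text \<open>\<open>P[1]\<close> sits in degree -1, one lower than a module, so the general bounds
  are too weak by one degree; projectivity makes up for this through
  \<open>tau_projective_exact\<close> in the third clause and \<open>Dd_projective\<close> in the
  last.\<close>

lemma fundamental_projective:
 assumes "brick P" "proj P"
 shows "fundamental (shift 1 (stalk P))"
proof -
 have P: "rep P" using assms by (simp add: brick_def)
 have I: "Dind (shift k (stalk P))" for k by (rule D_indec_shift[OF D_indec_stalk[OF assms(1)]])
 have ex: "exact (shift k (stalk P)) n" if "n ~= - k" for n k by (rule stalk_exact[OF P that])
 have "exact (\<tau> (shift (-1) (shift 1 (stalk P)))) n" if "n < 1" for n
  using tau_projective_exact[OF I[of 0] assms(2), of n] that by (simp add: shift_shift)
 moreover have "Dd (shift 1 (stalk P)) W 0" if "cx W" "ALL n>-2. exact W n" for W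
  using that by (intro Dd_projective[OF assms(2)]) auto
 ultimately show ?thesis using I[of 1] ex[of _ 1] by (simp add: fundamental_def)
qed

text \<open>The summand at \<open>i >= 1\<close> is turned by duality into maps from
  \<open>Y\<close> to the shift of \<open>F^(i - 1) X\<close>. This is \<open>Hom(Y, X[1])\<close>
  for \<open>i = 1\<close>, and for larger \<open>i\<close> the cohomology of the target ends too
  low. For negative \<open>i\<close> that of \<open>F^i X\<close> begins too high.\<close>

theorem cluster_Ext1_dim:
 assumes X: "fundamental X" and Y: "fundamental Y" and m: "Dd X (shift 1 Y) m" and n: "Dd Y (shift 1 X) n"
 shows "has_kdim (cluster_Ext1 Q \<tau> \<tau>inv X Y) (m + n)"
 unfolding cluster_Ext1_def cluster_hom_def
proof (rule has_kdim_coprod)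
 have IX: "Dind X" and IY: "Dind Y" using X Y by (simp_all add: fundamental_def)
 note cX = indec_cx[OF IX] and cY = indec_cx[OF IY]
 have sY: "cx (shift 1 Y)" by (rule shift_cx[OF cY])
 show "Dd (F_pow \<tau> \<tau>inv 0 X) (shift 1 Y) m" using m by (simp add: F_pow_def)
 have pos: "Dd (shift 1 (\<tau>inv Z)) (shift 1 Y) l \<longleftrightarrow> Dd Y (shift 1 Z) l" if Z: "Dind Z" for Z l
  using Dd_shift_iff[OF indec_cx[OF tau_facts(2)[OF Z]] cY] tau_facts(4)[OF Z cY] by blast
 show "Dd (F_pow \<tau> \<tau>inv 1 X) (shift 1 Y) n" using n pos[OF IX] by (simp add: F_pow_def)
 fix i :: int assume i: "i ~= 0" "i ~= 1"
 show "Dd (F_pow \<tau> \<tau>inv i X) (shift 1 Y) 0"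
 proof (cases "i > 0")
  case True
  \<comment> \<open>Since \<open>k >= 1\<close>, the bound \<open>- k\<close> for \<open>Z\<close>
    makes \<open>Z[1]\<close> exact above degree -2, as the last clause of
    \<open>fundamental\<close> demands.\<close>
  then obtain k where k: "nat i = Suc k" "k >= 1" using i by (intro that[of "nat i-1"]) auto
  let ?Z = "((%X. shift 1 (\<tau>inv X)) ^^ k) X"
  have Z: "Dind ?Z" "ALL n > - int k. exact ?Z n"
   using F_power_exact[OF IX, of k] X by (auto simp: fundamental_def)
  have "exact (shift 1 ?Z) n" if "n > -2" for n
   using Z(2) k(2) that by (simp add: shift_exact[OF indec_cx[OF Z(1)]])
  hence "Dd Y (shift 1 ?Z) 0" using Y shift_cx[OF indec_cx[OF Z(1)]] by (simp add: fundamental_def)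
  hence "Dd (shift 1 (\<tau>inv ?Z)) (shift 1 Y) 0" using pos[OF Z(1)] by blast
  thus ?thesis using True k(1) by (simp add: F_pow_def)
 next
  case False
  \<comment> \<open>The first inverse power is split off: the lower bound is part of
    \<open>fundamental\<close> for \<open>\<tau> (X[-1])\<close> and fails for \<open>X\<close>
    itself in general.\<close>
  then obtain k where k: "nat (- i) = Suc k" using i by (intro that[of "nat (- i) - 1"]) auto
  let ?X = "\<tau> (shift (-1) X)"
  have IX': "Dind ?X" by (rule tau_facts(1)[OF D_indec_shift[OF IX]])
  let ?Z = "((%X. \<tau> (shift (-1) X)) ^^ k) ?X"
  have Z: "Dind ?Z" "ALL n<1. exact ?Z n"
   using F_inv_power_exact[OF IX', of k] X by (auto simp: fundamental_def)
  have "Dd ?Z (shift 1 Y) 0"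
  proof (rule Dd_gap[OF indec_cx[OF Z(1)] sY])
   show "exact ?Z n" if "n < 1" for n using Z(2) that by blast
   show "exact (shift 1 Y) n" if "n >= 1 - 1" for n
    using Y that by (simp add: shift_exact[OF cY] fundamental_def)
  qed
  moreover have "F_pow \<tau> \<tau>inv i X = ?Z"
   using False i k funpow_swap1[of "%X. \<tau> (shift (-1) X)" k X] by (simp add: F_pow_def)
  ultimately show ?thesis by simp
 qed
qed

end

section \<open>Extensions of representations and the chosen projectives in the derived
  category\<close>

lemma coset_quot:
 assumes W: "gvec.subspace W"
 shows "(%w. f + w) ` W = (%w. g + w) ` W \<longleftrightarrow> f - g : W"
proof
 assume "(%w. f + w) ` W = (%w. g + w) ` W"
 moreover have "f : (%w. f + w) ` W" using gvec.subspace_0[OF W] by (auto intro!: image_eqI[of _ _ 0])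
 ultimately obtain w where "w : W" "f = g + w" by blast
 thus "f - g : W" by simp
next
 have "(%w. f + w) ` W <= (%w. g + w) ` W" if "f - g : W" for f g
 proof
  fix x assume "x : (%w. f + w) ` W"
  then obtain w where "w : W" "x = f + w" by blast
  thus "x : (%w. g + w) ` W"
   using gvec.subspace_add[OF W that] by (intro image_eqI[of _ _ "f - g + w"]) simp_all
 qed
 moreover assume "f - g : W"
 moreover have "g - f : W" using gvec.subspace_neg[OF W \<open>f - g \<in> W\<close>] by simp
 ultimately show "(%w. f + w) ` W = (%w. g + w) ` W" by blast
qed

lemma has_kdim_quot_mod:
 fixes U W :: "('v, 'k::field) gmap set"
 assumes U: "gvec.fd U" and W: "gvec.subspace W" "W <= U"
 shows "has_kdim (quot_mod U W) (gvec.dim U - gvec.dim W)"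
proof (rule has_kdim_quot[OF gvec_vs U W, where phi = "%f. (%w. f + w) ` W"])
 show "(%w. f + w) ` W = (%w. g + w) ` W \<longleftrightarrow> f - g : W" for f g by (rule coset_quot[OF W(1)])
 show "(%f. (%w. f + w) ` W) ` U = carrier (quot_mod U W)" by (auto simp: quot_mod_def)
 show "(%w. (f + g) + w) ` W = (%w. f + w) ` W \<oplus>\<^bsub>quot_mod U W\<^esub> (%w. g + w) ` W" for f g
 proof -
  have "(%w. (f + g) + w) ` W = {a + b | a b. a : (%w. f + w) ` W & b : (%w. g + w) ` W}"
  proof (intro equalityI subsetI)
   fix x assume "x : (%w. (f + g) + w) ` W"
   then obtain w where w: "w : W" "x = (f + g) + w" by blast
   have "x = (f + w) + (g + 0)" by (simp add: w(2))
   moreover have "f + w : (%w. f + w) ` W" "g + 0 : (%w. g + w) ` W" using w(1) gvec.subspace_0[OF W(1)] by blast+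
   ultimately show "x : {a + b | a b. a : (%w. f + w) ` W & b : (%w. g + w) ` W}" by blast
  next
   fix x assume "x : {a + b | a b. a : (%w. f + w) ` W & b : (%w. g + w) ` W}"
   then obtain w w' where w: "w : W" "w' : W" "x = (f + w) + (g + w')" by blast
   have "x = (f + g) + (w + w')" by (simp add: w(3))
   thus "x : (%w. (f + g) + w) ` W" using gvec.subspace_add[OF W(1) w(1,2)] by blast
  qed
  thus ?thesis by (simp add: quot_mod_def)
 qed
 show "(%w. gscale c f + w) ` W = c \<odot>\<^bsub>quot_mod U W\<^esub> (%w. f + w) ` W" for c f
 proof -
  have "(%w. gscale c f + w) ` W = {gscale c a + w | a w. a : (%w. f + w) ` W & w : W}"
  proof (intro equalityI subsetI)
   fix x assume "x : (%w. gscale c f + w) ` W"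
   then obtain w where w: "w : W" "x = gscale c (f + 0) + w" by auto
   moreover have "f + 0 : (%w. f + w) ` W" using gvec.subspace_0[OF W(1)] by blast
   ultimately show "x : {gscale c a + w | a w. a : (%w. f + w) ` W & w : W}" by blast
  next
   fix x assume "x : {gscale c a + w | a w. a : (%w. f + w) ` W & w : W}"
   then obtain w w' where w: "w : W" "w' : W" "x = gscale c (f + w) + w'" by blast
   have "x = gscale c f + (gscale c w + w')" by (simp add: w(3) gvec.scale_right_distrib)
   thus "x : (%w. gscale c f + w) ` W"
    using gvec.subspace_add[OF W(1) gvec.subspace_scale[OF W(1) w(1)] w(2)] by blast
  qed
  thus ?thesis by (simp add: quot_mod_def)
 qed
 have "(%w. 0 + w) ` W = W" by simp
 thus "(%w. 0 + w) ` W = \<zero>\<^bsub>quot_mod U W\<^esub>" by (simp add: quot_mod_def)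
qed

text \<open>For the resolution chosen in \<open>rep_Ext1\<close>, a chain map to \<open>N[1]\<close>
  amounts to its component in degree -1, which is a cocycle of \<open>Hom(P, N)\<close>; the
  null-homotopic maps are the coboundaries.\<close>

lemma rep_Ext1_Dd:
 fixes M N :: "('v, 'e, 'k::field) qrep"
 assumes M: "rep M" and N: "rep N" and d: "Dd (stalk M) (shift 1 (stalk N)) n"
 shows "has_kdim (rep_Ext1 Q M N) n"
proof -
 have "EX P. proj_resolution Q M P"
 proof -
  obtain P p where P: "resolves P p (stalk M)"
   "!!n. zrep (ob (stalk M) n) ==> zrep (ob (stalk M) (n+1)) ==> zrep (ob P n)"
   using resolution_exists[OF stalk_cx[OF M]] by metis
  have "zrep (ob P n)" if "n > 0" for n using that by (intro P(2) stalk_zero) auto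
  thus ?thesis using P(1) by (auto simp: proj_resolution_def resolves_def)
 qed
 hence pr: "proj_resolution Q M (SOME P. proj_resolution Q M P)" by (rule someI_ex)
 define P where "P = (SOME P. proj_resolution Q M P)"
 obtain p where R: "resolves P p (stalk M)" and Pz: "ALL n>0. zrep (ob P n)"
  using pr stalk_cx[OF M] unfolding P_def[symmetric] by (auto simp: proj_resolution_def resolves_def)
 note r = resolvesD[OF R]
 let ?N = "shift 1 (stalk N)"
 have cN: "cx ?N" by (rule shift_cx[OF stalk_cx[OF N]])
 define U where "U = {f : Hom (ob P (-1)) N. gcomp f (df P (-2)) = 0}"
 define W where "W = {gcomp g (df P (-1)) | g. g : Hom (ob P 0) N}"
 have E: "rep_Ext1 Q M N = quot_mod U W" unfolding rep_Ext1_def U_def W_def Let_def P_def ..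
 have rP: "rep (ob P n)" for n by (rule cx_rep[OF r(1)])
 have dP: "df P (-1) : Hom (ob P (-1)) (ob P 0)" "df P (-2) : Hom (ob P (-2)) (ob P (-1))"
  using cx_df[OF r(1), of "- 1"] cx_df[OF r(1), of "- 2"] by simp_all
 have dd: "gcomp (df P (-1)) (df P (-2)) = 0" using cx_dd[OF r(1), of "- 2"] by simp
 have WU: "W <= U"
 proof
  fix f assume "f : W"
  then obtain g where g: "g : Hom (ob P 0) N" "f = gcomp g (df P (-1))" by (auto simp: W_def)
  have "gcomp f (df P (-2)) = gcomp g (gcomp (df P (-1)) (df P (-2)))" unfolding g(2) gcomp_assoc ..
  also have "\<dots> = 0" unfolding dd by (rule comp_zero[OF g(1)])
  finally show "f : U" using hom_comp[OF dP(1) g(1)] g(2) by (simp add: U_def)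
 qed
 have Us: "gvec.subspace U"
  by (rule gvec.subspaceI)
   (auto simp: U_def gcomp_zero_left gcomp_add_left gcomp_scale_left hom_0[OF rP N] hom_add[OF rP N] hom_scale[OF rP N])
 have Uf: "gvec.fd U" by (rule gvec.fd_sub(1)[OF hom_fd[OF rP N] Us]) (auto simp: U_def)
 have "lin_on gscale gscale (Hom (ob P 0) N) (%g. gcomp g (df P (-1)))"
  by (rule lin_onI) (simp_all add: gcomp_add_left gcomp_scale_left)
 moreover have "W = (%g. gcomp g (df P (-1))) ` Hom (ob P 0) N" by (auto simp: W_def)
 ultimately have Ws: "gvec.subspace W"
  using gvec.fd_subspace[OF rank_nullity(1)[OF gvec_vs gvec_vs hom_fd[OF rP N]]] by simp
 have N0: "df ?N n = 0" for n by (simp add: shift_df stalk_df)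
 have Nob: "ob ?N (-1) = N" by (simp add: stalk_ob)
 have Nz: "zrep (ob ?N n)" if "n ~= - 1" for n using stalk_zero[of "n+1" N] that by simp
 have "cvec.dim (Ch P ?N) - cvec.dim (nul P ?N) = gvec.dim U - gvec.dim W"
 proof (rule dim_quot_eq[OF cvec_vs gvec_vs ch_fd[OF r(1) cN] nul_subspace[OF r(1) cN] nul_ch[OF r(1) cN] Uf Ws WU, where f = "%f. f (-1)"])
  show "lin_on cscale gscale (Ch P ?N) (%f. f (-1))" by (rule lin_onI) (simp_all add: cfun_ops)
  show "(%f. f (-1)) ` Ch P ?N <= U"
  proof (rule image_subsetI)
   fix f assume f: "f : Ch P ?N"
   show "f (-1) : U" using ch_hom[OF f, of "- 1"] ch_comm[OF f, of "- 2"] by (simp add: U_def stalk_ob N0 gcomp_zero_left)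
  qed
  show "EX f:Ch P ?N. y - f (-1) : W" if y: "y : U" for y
  proof
   let ?f = "%n. if n = - 1 then y else (0 :: ('v, 'k) gmap)"
   have y': "y : Hom (ob P (-1)) N" "gcomp y (df P (-2)) = 0" using y by (simp_all add: U_def)
   show "?f : Ch P ?N"
   proof (rule chI)
    fix n :: int
    show "?f n : Hom (ob P n) (ob ?N n)"
     using y'(1) Nob hom_0[OF rP cx_rep[OF cN], of n n] by (cases "n = - 1") (simp_all del: shift_ob)
    show "gcomp (?f (n+1)) (df P n) = gcomp (df ?N n) (?f n)"
     using y'(2) by (cases "n = - 2") (simp_all add: N0 gcomp_zero_left)
   qed
   show "y - ?f (-1) : W" using gvec.subspace_0[OF Ws] by simp
  qed
  show "f (-1) : W \<longleftrightarrow> f : nul P ?N" if f: "f : Ch P ?N" for f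
  proof
   assume "f (-1) : W"
   then obtain g where g: "g : Hom (ob P 0) N" "f (-1) = gcomp g (df P (-1))" by (auto simp: W_def)
   let ?s = "%n. if n = 0 then g else (0 :: ('v, 'k) gmap)"
   have s: "?s n : Hom (ob P n) (ob ?N (n-1))" for n :: int
    using g(1) Nob hom_0[OF rP cx_rep[OF cN], of n "n-1"] by (cases "n = 0") (simp_all del: shift_ob)
   have "f = htpy P ?N ?s"
   proof
    fix n
    show "f n = htpy P ?N ?s n"
    proof (cases "n = - 1")
     case True
     thus ?thesis using g(2) by (simp add: htpy_at N0 gcomp_zero_left)
    next
     case False
     thus ?thesis using hom_to_zero[OF ch_hom[OF f] Nz[OF False]] by (simp add: htpy_at N0 gcomp_zero_left)
    qed
   qed
   thus "f : nul P ?N" using nulI[of ?s P ?N, OF s] by simp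
  next
   assume "f : nul P ?N"
   then obtain s where s: "!!n. s n : Hom (ob P n) (ob ?N (n-1))" "f = htpy P ?N s" by (auto simp: nul_iff)
   have "f (-1) = gcomp (s 0) (df P (-1))" by (simp add: s(2) htpy_at N0 gcomp_zero_left)
   thus "f (-1) : W" using s(1)[of 0] Nob by (auto simp: W_def simp del: shift_ob)
  qed
 qed
 thus ?thesis
  using has_kdim_quot_mod[OF Uf Ws WU] has_kdim_unique[OF d has_kdim_D_hom[OF R cN]] by (simp add: E)
qed

text \<open>Between complexes concentrated in degree 0 there are no nonzero homotopies.\<close>

lemma Dd_projective_stalk:
 assumes P: "proj P" and N: "rep N"
 shows "Dd (stalk P) (stalk N) (gvec.dim (Hom P N))"
proof -
 have R: "resolves (stalk P) (cid Q (stalk P)) (stalk P)" using stalk_resolves[OF P, of 0] by simp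
 note r = resolvesD[OF R]
 have rP: "rep P" using P by (simp add: projective_def)
 have cN: "cx (stalk N)" by (rule stalk_cx[OF N])
 have nz: "nul (stalk P) (stalk N) = {0}"
 proof
  show "nul (stalk P) (stalk N) <= {0}"
  proof
   fix f assume "f : nul (stalk P) (stalk N)"
   then obtain s where s: "!!n. s n : Hom (ob (stalk P) n) (ob (stalk N) (n-1))" "f = htpy (stalk P) (stalk N) s"
    by (auto simp: nul_iff)
   have "f n = 0" for n using comp_zero[OF s(1)[of "n+1"]] by (simp add: s(2) htpy_at stalk_df gcomp_zero_left)
   thus "f : {0}" by (auto simp: fun_eq_iff[of f] zero_fun_apply[of "_ :: int"])
  qed
  show "{0} <= nul (stalk P) (stalk N)" using nul_0[OF r(1) cN] by simp
 qed
 have lin: "lin_on cscale gscale (Ch (stalk P) (stalk N)) (%f. f 0)" by (rule lin_onI) (simp_all add: cfun_ops)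
 have "(%f. f 0) ` Ch (stalk P) (stalk N) = Hom P N"
 proof
  show "(%f. f 0) ` Ch (stalk P) (stalk N) <= Hom P N"
  proof (rule image_subsetI)
   fix f assume "f : Ch (stalk P) (stalk N)"
   from ch_hom[OF this, of 0] show "f 0 : Hom P N" by (simp add: stalk_ob)
  qed
  show "Hom P N <= (%f. f 0) ` Ch (stalk P) (stalk N)"
  proof
   fix g assume g: "g : Hom P N"
   let ?f = "%n :: int. if n = 0 then g else 0"
   have h: "?f n : Hom (ob (stalk P) n) (ob (stalk N) n)" for n
    using g hom_0[OF cx_rep[OF r(1)] cx_rep[OF cN], of n n] by (auto simp: stalk_ob)
   have "?f : Ch (stalk P) (stalk N)"
    by (rule chI[OF h]) (simp_all add: stalk_df gcomp_zero_left comp_zero[OF g])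
   thus "g : (%f. f 0) ` Ch (stalk P) (stalk N)" by (rule image_eqI[rotated]) simp
  qed
 qed
 moreover have "f = 0" if "f : Ch (stalk P) (stalk N)" "f 0 = 0" for f
 proof
  fix n
  show "f n = 0 n"
   using that(2) hom_to_zero[OF ch_hom[OF that(1)] stalk_zero[of n N]] by (cases "n = 0") (simp_all add: cfun_ops)
 qed
 ultimately have "gvec.dim (Hom P N) = cvec.dim (Ch (stalk P) (stalk N))"
  using dim_inj[OF cvec_vs gvec_vs ch_fd[OF r(1) cN] lin] by simp
 thus ?thesis using has_kdim_D_hom[OF R cN] by (simp add: nz)
qed

text \<open>The chosen representation is compared with \<open>Pv i\<close> by lifting the maps to
  the simple top in both directions. The composite on the brick \<open>Pv i\<close> is a scalar
  compatible with a nonzero map, hence 1. The other composite is then a nonzero idempotent on an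
  indecomposable, hence the identity.\<close>

lemma proj_at_facts:
 fixes i :: 'v
 assumes i: "i : vs"
 defines "P == proj_at Q i :: ('v, 'e, 'k::alg_closed_field) qrep"
 shows "proj P" "indec P" "rep N ==> gvec.dim (Hom P N) = kvec.dim (sp N i)"
proof -
 let ?S = "simple_rep i :: ('v, 'e, 'k) qrep" and ?R = "Pv i :: ('v, 'e, 'k) qrep"
 have R: "rep ?R" "proj ?R" "brick ?R" using Pv_rep Pv_projective Pv_brick[OF i] by blast+
 have S: "rep ?S" by (rule simple_rep_rep)
 let ?\<delta> = "%n :: nat. if n = 0 then 1 else 0 :: 'k"
 have ds: "?\<delta> : sp ?S i" by (simp add: simple_rep_sp kvec.span_base)
 have e: "eps ?S : Hom ?R ?S" unfolding Pv_def by (rule eps_hom[OF S])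
 have e0: "eps ?S ~= 0"
 proof
  assume "eps ?S = 0"
  hence "?\<delta> = 0" using eps_put[OF S i ds] by (simp add: fun_ops)
  thus False using delta_nonzero by blast
 qed
 have "EX P :: ('v, 'e, 'k) qrep. proj P & indec P & (EX f:Hom P ?S. f ~= 0)"
  using R brick_indec[OF R(3)] e e0 by blast
 hence P: "proj P & indec P & (EX f:Hom P ?S. f ~= 0)"
  unfolding P_def proj_at_def by (rule someI_ex)
 thus pP: "proj P" and "indec P" by blast+
 hence rP: "rep P" by (simp add: rep_indec_def)
 obtain f where f: "f : Hom P ?S" "f ~= 0" using P by blast
 have surj: "f v ` sp P v = sp ?S v" if v: "v : vs" for v
 proof -
  let ?I = "f v ` sp P v"
  note I = subrepD(1,2)[OF subrep_image[OF rP S f(1)] v] and fS = rep_fd[OF S v]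
  show ?thesis
  proof (cases "v = i")
   case False
   thus ?thesis using I kvec.subspace_0[OF I(1)] by (auto simp: simple_rep_sp)
  next
   case True
   have "?I ~= {0}"
   proof
    assume n: "?I = {0}"
    have "f = 0"
    proof (rule hom_eqI[OF f(1) hom_0[OF rP S]])
     fix v x assume v: "v : vs" and x: "x : sp P v"
     show "f v x = 0 v x"
      using n x True hom_mem[OF f(1) v x] by (cases "v = i") (auto simp: simple_rep_sp fun_ops)
    qed
    thus False using f(2) by blast
   qed
   hence "kvec.dim ?I ~= 0" using kvec.fd_dim_0[OF kvec.fd_sub(1)[OF fS I]] by blast
   hence "kvec.dim ?I = kvec.dim (sp ?S v)"
    using kvec.fd_sub(2)[OF fS I] True by (simp add: simple_rep_dim le_Suc_eq)
   thus ?thesis by (rule kvec.fd_sub(3)[OF fS I])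
  qed
 qed
 have "EX h:Hom P ?R. f = gcomp (eps ?S) h"
  using projective_lift[OF pP R(1) S e f(1)] eps_surj[OF S] unfolding Pv_def by blast
 then obtain h where h: "h : Hom P ?R" "f = gcomp (eps ?S) h" by blast
 have "EX h':Hom ?R P. eps ?S = gcomp f h'"
  using projective_lift[OF R(2) rP S f(1) e surj] by blast
 then obtain h' where h': "h' : Hom ?R P" "eps ?S = gcomp f h'" by blast
 have hh: "gcomp h h' : Hom ?R ?R" by (rule hom_comp[OF h'(1) h(1)])
 obtain c where c: "gcomp h h' = gscale c (ident ?R)" by (rule brick_scalar[OF R(3) hh])
 have "eps ?S = gcomp (eps ?S) (gcomp h h')" using h(2) h'(2) by (simp add: gcomp_assoc)
 also have "\<dots> = gscale c (eps ?S)"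
  unfolding c comp_scale[OF e ident_hom[OF R(1)] R(1)] ident_right[OF e] ..
 finally have "gscale (1 - c) (eps ?S) = 0" by (simp add: gvec.scale_left_diff_distrib)
 hence "c = 1" using e0 by simp
 hence hh1: "gcomp h h' = ident ?R" using c by simp
 have k: "gcomp h' h : Hom P P" by (rule hom_comp[OF h(1) h'(1)])
 have "gcomp (gcomp h' h) (gcomp h' h) = gcomp h' (gcomp (gcomp h h') h)" by (simp add: gcomp_assoc)
 also have "\<dots> = gcomp h' h" unfolding hh1 ident_left[OF h(1) R(1)] ..
 finally have "gcomp h' h = 0 \<or> gcomp h' h = ident P"
  using \<open>indec P\<close> k unfolding rep_indec_iff by blast
 moreover have "gcomp h' h ~= 0"
 proof
  assume "gcomp h' h = 0"
  have "ident ?R = gcomp h (gcomp (gcomp h' h) h')"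
   using hh1 ident_right[OF ident_hom[OF R(1)]] by (simp add: gcomp_assoc[symmetric]) (simp add: gcomp_assoc hh1)
  also have "\<dots> = 0" unfolding \<open>gcomp h' h = 0\<close> gcomp_zero_left by (rule comp_zero[OF h(1)])
  finally show False using brick_not_zero[OF R(3)] by blast
 qed
 ultimately have kk: "gcomp h' h = ident P" by blast
 assume N: "rep N"
 have le: "kvec.dim (sp A v) <= kvec.dim (sp B v)"
  if r: "rep A" "rep B" and g: "g : Hom A B" "gcomp g' g = ident A" "g' : Hom B A" and v: "v : vs" for A B :: "('v, 'e, 'k) qrep" and g g' v
 proof -
  have "x = 0" if "x : sp A v" "g v x = 0" for x
   using fun_cong2[OF g(2), of v x] that v hom_zero[OF g(3)] by (simp add: rep_id_def gcomp_apply)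
  hence "kvec.dim (g v ` sp A v) = kvec.dim (sp A v)"
   using dim_inj[OF kvec_vs kvec_vs rep_fd[OF r(1) v] lin_maps_lin_on[OF hom_lin[OF g(1) v]]] by blast
  thus ?thesis using kvec.fd_sub(2)[OF rep_fd[OF r(2) v] subrepD(1,2)[OF subrep_image[OF r g(1)] v]] by simp
 qed
 \<comment> \<open>As \<open>Ext^1\<close> vanishes on both projectives, equal dimension vectors
   give equal \<open>dim Hom(-, N)\<close> by the Euler form.\<close>
 have "dimv P = dimv ?R"
  using le[OF rP R(1) h(1) kk h'(1)] le[OF R(1) rP h'(1) hh1 h(1)] by (auto simp: dimv_def fun_eq_iff intro: antisym)
 thus "gvec.dim (Hom P N) = kvec.dim (sp N i)"
  using projective_ext0[OF pP N] projective_ext0[OF R(2) N] Pv_hom_dim[OF i N] by (simp add: euler(2)[OF rP N] euler(2)[OF R(1) N])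
qed

end

section \<open>Decorated representations and the main theorem\<close>

context positive_quiver
begin

lemma stalk_quasi_iso:
 assumes M: "rep M" and M': "rep M'" and iso: "riso M M'"
 obtains s where "qis (stalk M) (stalk M') s"
proof -
 obtain f g where f: "f : Hom M M'" and g: "g : Hom M' M" and gf: "gcomp g f = ident M" and fg: "gcomp f g = ident M'"
  using iso by (auto simp: riso_def)
 note c = stalk_cx[OF M] stalk_cx[OF M']
 define s where "s n = (if n = 0 then f else 0)" for n :: int
 have sh: "s n : Hom (ob (stalk M) n) (ob (stalk M') n)" for n
  using f hom_0[OF cx_rep[OF c(1)] cx_rep[OF c(2)], of n n] by (auto simp: s_def stalk_ob)
 have sc: "s : Ch (stalk M) (stalk M')"
  by (rule chI[OF sh]) (simp add: stalk_df gcomp_zero_left comp_zero[OF sh])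
 have "qis (stalk M) (stalk M') s"
  unfolding quasi_iso_def
 proof (intro conjI allI ballI impI sc)
  fix n v x assume v: "v : vs" and x: "x : sp (ob (stalk M) n) v"
   and *: "df (stalk M) n v x = 0 & s n v x : df (stalk M') (n-1) v ` sp (ob (stalk M') (n-1)) v"
  have "x = 0"
  proof (cases "n = 0")
   case True
   hence xM: "x : sp M v" using x by (simp add: stalk_ob)
   have "f v x = 0" using * True by (auto simp: s_def stalk_df fun_ops)
   hence "gcomp g f v x = 0" by (simp add: gcomp_apply hom_zero[OF g])
   thus ?thesis using v xM unfolding gf by (simp add: rep_id_def)
  next
   case False
   thus ?thesis using x v stalk_zero[OF False, of M] by (auto simp: zrep_def)
  qed
  thus "x : df (stalk M) (n-1) v ` sp (ob (stalk M) (n-1)) v"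
   using kvec.subspace_0[OF boundary_subspace[OF c(1) v]] by simp
 next
  fix n v y assume v: "v : vs" and y: "y : sp (ob (stalk M') n) v"
  have "EX x:sp (ob (stalk M) n) v. s n v x = y"
  proof (cases "n = 0")
   case True
   hence yM: "y : sp M' v" using y by (simp add: stalk_ob)
   have "gcomp f g v y = y" unfolding fg using v yM by (simp add: rep_id_def)
   thus ?thesis using hom_mem[OF g v yM] True by (auto simp: s_def stalk_ob gcomp_apply)
  next
   case False
   hence "y = 0" using y v stalk_zero[OF False, of M'] by (auto simp: zrep_def)
   thus ?thesis using kvec.subspace_0[OF rep_sub[OF cx_rep[OF c(1)] v]] hom_zero[OF sh] by blast
  qed
  then obtain x where x: "x : sp (ob (stalk M) n) v" "s n v x = y" by blast
  have "y - s n v x : df (stalk M') (n-1) v ` sp (ob (stalk M') (n-1)) v"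
   using kvec.subspace_0[OF boundary_subspace[OF c(2) v]] x(2) by simp
  moreover have "df (stalk M) n v x = 0" by (simp add: stalk_df fun_ops)
  ultimately show "EX x:sp (ob (stalk M) n) v. df (stalk M) n v x = 0 &
    y - s n v x : df (stalk M') (n-1) v ` sp (ob (stalk M') (n-1)) v" using x(1) by blast
 qed
 thus thesis by (rule that)
qed

text \<open>Transports dimensions between representatives that were picked independently on the two
  sides of the theorem.\<close>

lemma Dd_stalk_iso:
 assumes reps: "rep M" "rep M'" "rep N" "rep N'" and iso: "riso M M'" "riso N N'"
  and d: "Dd (stalk M) (shift 1 (stalk N)) n"
 shows "Dd (stalk M') (shift 1 (stalk N')) n"
proof -
 obtain s where s: "qis (stalk M) (stalk M') s" by (rule stalk_quasi_iso[OF reps(1,2) iso(1)])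
 obtain t where t: "qis (stalk N) (stalk N') t" by (rule stalk_quasi_iso[OF reps(3,4) iso(2)])
 note c = stalk_cx[OF reps(1)] stalk_cx[OF reps(2)] stalk_cx[OF reps(3)] stalk_cx[OF reps(4)]
 obtain P p where R: "resolves P p (stalk M)" using resolves_ex[OF c(1)] by blast
 note r = resolvesD[OF R]
 have R': "resolves P (ccomp s p) (stalk M')"
  using r c quasi_iso_comp[OF r(1) c(1,2) r(4) s] by (simp add: resolves_def)
 have t': "qis (shift 1 (stalk N)) (shift 1 (stalk N')) (shift_map 1 t)" by (rule shift_quasi_iso[OF c(3,4) t])
 show ?thesis
  using has_kdim_D_hom[OF R' shift_cx[OF c(4)], of 1] has_kdim_unique[OF d has_kdim_D_hom[OF R shift_cx[OF c(3)]]]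
   dim_hom_quasi_iso[OF R shift_cx[OF c(3)] shift_cx[OF c(4)] t'] by simp
qed

lemma Dd_stalk_zero:
 assumes M: "rep M" and N: "rep N" and z: "zrep M \<or> zrep N"
 shows "Dd (stalk M) (shift 1 (stalk N)) 0"
proof -
 note c = stalk_cx[OF M] shift_cx[OF stalk_cx[OF N], of 1]
 show ?thesis
 proof (cases "zrep M")
  case True
  have "exact (stalk M) n" for n
   by (rule zero_exact[OF c(1)]) (simp add: stalk_ob True zero_rep_zero)
  thus ?thesis using stalk_exact[OF N, of _ 1] by (intro Dd_gap[OF c, of 1]) auto
 next
  case False
  hence "zrep N" using z by blast
  hence "exact (shift 1 (stalk N)) n" for n
   by (intro zero_exact[OF c(2)]) (simp add: stalk_ob zero_rep_zero)
  thus ?thesis using stalk_exact[OF M, of _ 0] by (intro Dd_gap[OF c, of 0]) auto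
 qed
qed

end

lemma has_kdim_hom_mod:
 fixes U :: "('v, 'k::field) gmap set"
 assumes "gvec.fd U"
 shows "has_kdim (hom_mod U) (gvec.dim U)"
proof -
 have "has_kdim (hom_mod U) (gvec.dim U - gvec.dim ({0} :: ('v, 'k) gmap set))"
  using gvec.fd_subspace[OF assms]
  by (intro has_kdim_quot[OF gvec_vs assms, where phi = id])
   (auto simp: hom_mod_def gvec.subspace_0)
 thus ?thesis by simp
qed

context quiver
begin

abbreviation "DQ == decorated_quiver Q"

lemma plus_part_rep:
 assumes "is_rep DQ M"
 shows "rep (plus_part M)"
 using assms by (auto simp: is_rep_def plus_part_def decorated_quiver_def)

lemma minus_part_fd: "is_rep DQ M ==> v : vs ==> kvec.fd (minus_part M v)"
 by (auto simp: is_rep_def minus_part_def decorated_quiver_def fd_subspace_iff)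

lemma decorated_subrep:
 assumes M: "is_rep DQ M"
 shows "subrep DQ M A \<longleftrightarrow> subrep Q (plus_part M) (A o Inl) & (ALL v:vs. kvec.subspace (A (Inr v)) & A (Inr v) <= minus_part M v)"
 by (auto simp: subrep_def plus_part_def minus_part_def decorated_quiver_def)

text \<open>There are no arrows at the new vertices, so \<open>M\<close> is the direct sum of its
  two parts, and one of them vanishes.\<close>

lemma decorated_indec_cases:
 assumes I: "rep_indec DQ M"
 shows "((ALL v:vs. minus_part M v = {0}) & indec (plus_part M)) \<or> zrep (plus_part M)"
proof -
 have M: "is_rep DQ M" and nz: "~ is_zero_rep DQ M" using I by (auto simp: rep_indec_def)
 note P = plus_part_rep[OF M]
 have ind: "(ALL v:verts DQ. A v = {0}) \<or> (ALL v:verts DQ. B v = {0})"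
  if "subrep DQ M A" "subrep DQ M B" "ALL v:verts DQ. A v Int B v = {0} & sp M v = {a + b | a b. a : A v & b : B v}" for A B
  using I that unfolding rep_indec_def by blast
 have sP: "kvec.subspace (sp M (Inl v))" if "v : vs" for v using rep_sub[OF P that] by (simp add: plus_part_def)
 have sM: "kvec.subspace (sp M (Inr v))" if "v : vs" for v
  using kvec.fd_subspace[OF minus_part_fd[OF M that]] by (simp add: minus_part_def)
 have V: "verts DQ = Inl ` vs Un Inr ` vs" by (simp add: decorated_quiver_def)
 define A where "A = case_sum (%v :: 'v. sp M (Inl v)) (%v :: 'v. {0 :: nat => 'a})"
 define B where "B = case_sum (%v :: 'v. {0 :: nat => 'a}) (%v :: 'v. sp M (Inr v))"
 have sA: "subrep DQ M A"
  unfolding decorated_subrep[OF M] unfolding subrep_def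
  using sP kvec.subspace_0[OF sM] act_mem[OF P] by (auto simp: A_def plus_part_def minus_part_def)
 have sB: "subrep DQ M B"
  unfolding decorated_subrep[OF M] unfolding subrep_def
  using sM kvec.subspace_0[OF sP] lin_maps_zero[OF act_lin[OF P]] by (auto simp: B_def plus_part_def minus_part_def)
 have "(ALL v:verts DQ. A v = {0}) \<or> (ALL v:verts DQ. B v = {0})"
  using kvec.subspace_0[OF sP] kvec.subspace_0[OF sM]
  by (intro ind[OF sA sB]) (auto simp: V A_def B_def)
 then consider "ALL v:vs. sp M (Inl v) = {0}" | "ALL v:vs. sp M (Inr v) = {0}" by (auto simp: V A_def B_def ball_Un)
 thus ?thesis
 proof cases
  case 1
  thus ?thesis by (auto simp: zrep_def plus_part_def)
 next
  case 2
  have "indec (plus_part M)"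
   unfolding rep_indec_def
  proof (intro conjI allI impI P)
   show "~ zrep (plus_part M)"
    using nz 2 by (auto simp: zrep_def plus_part_def V)
   fix C D assume *: "subrep Q (plus_part M) C & subrep Q (plus_part M) D &
    (ALL v:vs. C v Int D v = {0} & sp (plus_part M) v = {a + b | a b. a : C v & b : D v})"
   let ?C = "case_sum C (%v :: 'v. {0 :: nat => 'a})" and ?D = "case_sum D (%v :: 'v. {0 :: nat => 'a})"
   have o: "case_sum C' (%v :: 'v. {0 :: nat => 'a}) o Inl = C'" for C' :: "'v => _" by (auto simp: fun_eq_iff)
   have "subrep DQ M ?C" "subrep DQ M ?D"
    unfolding decorated_subrep[OF M] o using * 2 by (auto simp: minus_part_def kvec.subspace_0)
   hence "(ALL v:verts DQ. ?C v = {0}) \<or> (ALL v:verts DQ. ?D v = {0})"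
    by (rule ind) (use * 2 in \<open>simp add: V plus_part_def ball_Un\<close>)
   thus "(ALL v:vs. C v = {0}) \<or> (ALL v:vs. D v = {0})" by (simp add: V ball_Un)
  qed
  thus ?thesis using 2 by (auto simp: minus_part_def)
 qed
qed

lemma sdim_apply: "v : vs ==> sdim Q M v = int (kvec.dim (sp (plus_part M) v)) - int (kvec.dim (minus_part M v))"
 by (simp add: sdim_def)

text \<open>Together with \<open>decorated_of_vertex\<close> this makes the choice in
  \<open>decorated_indec\<close> meaningful for all almost positive roots.\<close>

lemma decorated_of_module:
 assumes N: "indec N"
 defines "M == \<lparr>sp = case_sum (sp N) (%v. {0}), act = act N\<rparr>"
 shows "rep_indec DQ M" "sdim Q M = dimv N"
proof -
 have rN: "rep N" and nz: "~ zrep N"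
  and ind: "!!A B. subrep Q N A ==> subrep Q N B ==> ALL v:vs. A v Int B v = {0} & sp N v = {a + b | a b. a : A v & b : B v} ==>
   (ALL v:vs. A v = {0}) \<or> (ALL v:vs. B v = {0})"
  using N unfolding rep_indec_def by blast+
 have pM: "plus_part M = N" and mM: "minus_part M v = {0}" for v
  by (simp_all add: plus_part_def minus_part_def M_def o_def)
 have M: "is_rep DQ M"
  using rN kvec.fd_singleton_0(1) by (auto simp: is_rep_def decorated_quiver_def M_def fd_subspace_iff)
 have V: "verts DQ = Inl ` vs Un Inr ` vs" by (simp add: decorated_quiver_def)
 show "rep_indec DQ M"
  unfolding rep_indec_def
 proof (intro conjI allI impI M)
  show "~ is_zero_rep DQ M" using nz by (simp add: zrep_def V M_def ball_Un)
  fix A B assume *: "subrep DQ M A & subrep DQ M B &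
   (ALL v:verts DQ. A v Int B v = {0} & sp M v = {a + b | a b. a : A v & b : B v})"
  hence s: "subrep Q N (A o Inl)" "subrep Q N (B o Inl)"
   and z: "!!v. v : vs ==> A (Inr v) = {0} & B (Inr v) = {0}"
   using kvec.subspace_0 unfolding decorated_subrep[OF M] pM mM by blast+
  have "(ALL v:vs. (A o Inl) v = {0}) \<or> (ALL v:vs. (B o Inl) v = {0})"
   by (rule ind[OF s]) (use * in \<open>simp add: V M_def ball_Un\<close>)
  thus "(ALL v:verts DQ. A v = {0}) \<or> (ALL v:verts DQ. B v = {0})" using z by (simp add: V ball_Un)
 qed
 show "sdim Q M = dimv N" by (auto simp: sdim_def dimv_def pM mM)
qed

end

context positive_quiver
begin

lemma decorated_of_vertex:
 assumes i: "i : vs"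
 defines "M == \<lparr>sp = (%x. if x = Inr i then kvec.span {%n. if n = 0 then 1 else 0} else {0}), act = (%e x. 0)\<rparr>
  :: ('v + 'v, 'e, 'k::field) qrep"
 shows "rep_indec DQ M" "sdim Q M = - simple_root i"
proof -
 let ?L = "kvec.span {%n :: nat. if n = 0 then 1 else 0 :: 'k}"
 have L: "kvec.fd ?L" "kvec.dim ?L = 1" by (rule kvec.fd_span1[OF delta_nonzero])+
 have L0: "?L ~= {0}" using kvec.fd_dim_0[OF L(1)] L(2) by (simp del: kvec.dim_span)
 have V: "verts DQ = Inl ` vs Un Inr ` vs" by (simp add: decorated_quiver_def)
 have z: "(%x. 0) : lin_maps {0} {0 :: nat => 'k}" by (rule lin_mapsI) auto
 have M: "is_rep DQ M"
  using L(1) z kvec.fd_singleton_0(1) by (auto simp: is_rep_def decorated_quiver_def M_def fd_subspace_iff)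
 show "rep_indec DQ M"
  unfolding rep_indec_def
 proof (intro conjI allI impI M)
  show "~ is_zero_rep DQ M" using i L0 by (auto simp: zrep_def V M_def)
  fix A B assume *: "subrep DQ M A & subrep DQ M B &
   (ALL v:verts DQ. A v Int B v = {0} & sp M v = {a + b | a b. a : A v & b : B v})"
  have iV: "Inr i : verts DQ" using i by (simp add: V)
  have sAB: "subrep DQ M A" "subrep DQ M B" using * by simp_all
  have sub: "kvec.subspace (A x)" "A x <= sp M x" "kvec.subspace (B x)" "B x <= sp M x" if "x : verts DQ" for x
   using sAB that by (simp_all add: subrep_def)
  have o: "A x = {0} & B x = {0}" if "x : verts DQ" "x ~= Inr i" for x
   using sub[OF that(1)] kvec.subspace_0 that(2) by (auto simp: M_def)
  have Mi: "sp M (Inr i) = ?L" by (simp add: M_def)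
  have "A (Inr i) = {0} \<or> B (Inr i) = {0}"
  proof (rule ccontr)
   assume n: "~ ?thesis"
   then obtain a where a: "a : A (Inr i)" "a ~= 0" using kvec.subspace_0[OF sub(1)[OF iV]] by blast
   obtain b where b: "b : B (Inr i)" "b ~= 0" using n kvec.subspace_0[OF sub(3)[OF iV]] by blast
   have "a : ?L" "b : ?L" using sub(2,4)[OF iV] a b Mi by auto
   then obtain c where "b = kscale c a" using kvec.fd_dim_1[OF L(1,2) _ a(2)] by metis
   hence "b : A (Inr i)" using kvec.subspace_scale[OF sub(1)[OF iV] a(1)] by simp
   moreover have "A (Inr i) Int B (Inr i) = {0}" using * iV by blast
   ultimately show False using b by blast
  qed
  thus "(ALL v:verts DQ. A v = {0}) \<or> (ALL v:verts DQ. B v = {0})" using o by metis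
 qed
 show "sdim Q M = - simple_root i"
  by (rule ext) (use i L(2) in \<open>auto simp: sdim_def plus_part_def minus_part_def M_def simple_root_def fun_ops simp del: kvec.dim_span\<close>)
qed

end

section \<open>Objects attached to almost positive roots\<close>

context dynkin_quiver_loc
begin

lemma positive_rootD:
 assumes "\<alpha> : positive_roots Q"
 shows "v ~: vs ==> \<alpha> v = 0" "\<alpha> v >= 0" "eform \<alpha> \<alpha> = 1" "EX v:vs. \<alpha> v > 0"
proof -
 have r: "\<alpha> : roots Q" "!!v. \<alpha> v >= 0" using assms by (auto simp: positive_roots_def)
 show s: "v ~: vs ==> \<alpha> v = 0" "\<alpha> v >= 0" and e: "eform \<alpha> \<alpha> = 1" for v using roots_support_eform[OF r(1)] r(2) by auto
 show "EX v:vs. \<alpha> v > 0"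
 proof (rule ccontr)
  assume "~ ?thesis"
  hence "\<alpha> v = 0" for v using s[of v] by (cases "v : vs") force+
  hence "eform \<alpha> \<alpha> = 0" by (simp add: eform_def)
  thus False using e by simp
 qed
qed

text \<open>\<open>decorated_indec\<close> and \<open>indec_rep\<close> choose independently;
  \<open>indec_unique\<close> identifies the plus part of the first with the second.\<close>

lemma positive_root_objects:
 fixes \<alpha> :: "'v => int"
 assumes a: "\<alpha> : positive_roots Q"
 defines "M == decorated_indec Q \<alpha> :: ('v + 'v, 'e, 'k::alg_closed_field) qrep"
  and "A == indec_rep Q \<alpha> :: ('v, 'e, 'k) qrep"
 shows "is_rep DQ M" "!!v. v : vs ==> minus_part M v = {0}"
  "rep A" "brick A" "riso (plus_part M) A" "M_Q Q \<alpha> = stalk A"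
  "!!v. v : vs ==> kvec.dim (sp (plus_part M) v) = kvec.dim (sp A v)"
proof -
 note r = positive_rootD[OF a]
 have dimv_iff: "dimv N = \<alpha> \<longleftrightarrow> (ALL v:vs. int (kvec.dim (sp N v)) = \<alpha> v)" for N :: "('v, 'e, 'k) qrep"
  using r(1) by (auto simp: dimv_def fun_eq_iff)
 obtain N :: "('v, 'e, 'k) qrep" where N: "indec N" "dimv N = \<alpha>" using indec_exists[OF r(1,2,3)] by blast
 have "EX N :: ('v, 'e, 'k) qrep. indec N & (ALL v:vs. int (kvec.dim (sp N v)) = \<alpha> v)"
  using N dimv_iff by blast
 hence A: "indec A & (ALL v:vs. int (kvec.dim (sp A v)) = \<alpha> v)"
  unfolding A_def indec_rep_def by (rule someI_ex)
 thus "rep A" "brick A" using indec_brick by (auto simp: rep_indec_def)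
 have dA: "dimv A = \<alpha>" using A dimv_iff by blast
 have "EX M :: ('v + 'v, 'e, 'k) qrep. rep_indec DQ M & sdim Q M = \<alpha>"
  using decorated_of_module[OF N(1)] N(2) by metis
 hence M: "rep_indec DQ M & sdim Q M = \<alpha>" unfolding M_def decorated_indec_def by (rule someI_ex)
 thus "is_rep DQ M" by (simp add: rep_indec_def)
 have "~ zrep (plus_part M)"
 proof
  assume z: "zrep (plus_part M)"
  obtain v where v: "v : vs" "\<alpha> v > 0" using r(4) by blast
  have "sdim Q M v <= 0" using z v(1) by (simp add: sdim_apply zrep_def)
  thus False using M v(2) by simp
 qed
 hence P: "ALL v:vs. minus_part M v = {0}" "indec (plus_part M)" using decorated_indec_cases M by blast+
 thus "!!v. v : vs ==> minus_part M v = {0}" by blast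
 have dP: "dimv (plus_part M) = \<alpha>" unfolding dimv_iff
 proof
  fix v assume v: "v : vs"
  have "sdim Q M v = \<alpha> v" using M by simp
  thus "int (kvec.dim (sp (plus_part M) v)) = \<alpha> v" using P(1) v by (simp add: sdim_apply)
 qed
 show "riso (plus_part M) A" by (rule indec_unique[OF P(2)]) (use A dA dP in auto)
 show "M_Q Q \<alpha> = stalk A" using a by (simp add: M_Q_def A_def)
 show "kvec.dim (sp (plus_part M) v) = kvec.dim (sp A v)" if "v : vs" for v
  using dP dA that unfolding dimv_iff by (metis of_nat_eq_iff)
qed

text \<open>A negative entry of the signed dimension vector prevents the minus part from vanishing,
  so the plus part vanishes.\<close>

lemma negative_simple_objects:
 assumes i: "i : vs"
 defines "M == decorated_indec Q (- simple_root i) :: ('v + 'v, 'e, 'k::alg_closed_field) qrep"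
 shows "is_rep DQ M" "zrep (plus_part M)"
  "!!v. v : vs ==> kvec.dim (minus_part M v) = (if v = i then 1 else 0)"
  "M_Q Q (- simple_root i) = shift 1 (stalk (proj_at Q i :: ('v, 'e, 'k) qrep))"
proof -
 have "EX M :: ('v + 'v, 'e, 'k) qrep. rep_indec DQ M & sdim Q M = - simple_root i"
  using decorated_of_vertex[OF i] by metis
 hence M: "rep_indec DQ M & sdim Q M = - simple_root i" unfolding M_def decorated_indec_def by (rule someI_ex)
 thus "is_rep DQ M" by (simp add: rep_indec_def)
 have s: "sdim Q M v = (if v = i then - 1 else 0)" for v using M by (simp add: simple_root_def fun_ops)
 show z: "zrep (plus_part M)"
 proof (rule ccontr)
  assume "~ ?thesis"
  hence "minus_part M i = {0}" using decorated_indec_cases M i by blast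
  thus False using s[of i] i by (simp add: sdim_apply)
 qed
 show "kvec.dim (minus_part M v) = (if v = i then 1 else 0)" if "v : vs" for v
  using s[of v] z that by (auto simp: sdim_apply zrep_def split: if_splits)
 have "- simple_root i ~: positive_roots Q"
 proof
  assume "- simple_root i : positive_roots Q"
  hence "(- simple_root i) i >= (0 :: int)" by (auto simp: positive_roots_def)
  thus False by (simp add: simple_root_def fun_ops)
 qed
 moreover have "(THE j. j : vs & - simple_root i = - simple_root j) = i"
 proof (rule the_equality)
  fix j assume "j : vs & - simple_root i = - simple_root j"
  hence "simple_root i = simple_root j" by (metis minus_minus)
  hence "simple_root i i = simple_root j i" by simp
  thus "j = i" by (auto simp: simple_root_def split: if_splits)
 qed (use i in simp)
 ultimately show "M_Q Q (- simple_root i) = shift 1 (stalk (proj_at Q i :: ('v, 'e, 'k) qrep))" by (simp add: M_Q_def)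
qed

lemma E_mod_dim:
 fixes M N :: "('v + 'v, 'e, 'k::field) qrep"
 assumes M: "is_rep DQ M" and N: "is_rep DQ N"
  and m: "Dd (stalk (plus_part M)) (shift 1 (stalk (plus_part N))) m"
  and n: "Dd (stalk (plus_part N)) (shift 1 (stalk (plus_part M))) n"
 shows "kdim (E_mod Q M N) = m + n + (SUM v:vs. kvec.dim (sp (plus_part M) v) * kvec.dim (minus_part N v))
   + (SUM v:vs. kvec.dim (minus_part M v) * kvec.dim (sp (plus_part N) v))"
proof -
 note r = plus_part_rep[OF M] plus_part_rep[OF N]
 have h: "has_kdim (hom_mod (graded_hom Q A B)) (SUM v:vs. kvec.dim (A v) * kvec.dim (B v))"
  if "!!v. v : vs ==> kvec.fd (A v)" "!!v. v : vs ==> kvec.fd (B v)" for A B :: "'v => (nat => 'k) set"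
  using has_kdim_hom_mod[OF gh_fd(1)[OF finite_verts that]] gh_fd(2)[OF finite_verts that] by (simp add: graded_hom_gh)
 show ?thesis
  unfolding E_mod_def
  using has_kdim_kdim[OF has_kdim_direct_sum[OF rep_Ext1_Dd[OF r m]
    has_kdim_direct_sum[OF rep_Ext1_Dd[OF r(2,1) n] has_kdim_direct_sum[OF
     h[OF rep_fd[OF r(1)] minus_part_fd[OF N]] h[OF minus_part_fd[OF M] rep_fd[OF r(2)]]]]]]
  by (simp add: add.assoc)
qed

text \<open>Two positive roots give the two \<open>Ext^1\<close> terms. In the mixed cases
  \<open>Hom(P_i[1], M[1])\<close> has dimension \<open>dim M_i\<close>, like the space of graded
  maps in the compatibility degree, while the opposite direction is an \<open>Ext^2\<close> and
  vanishes. Two negative simple roots give 0 on both sides.\<close>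

theorem compat_degree_cluster:
 fixes \<tau> \<tau>inv :: "('v, 'e, 'k::alg_closed_field) cplx => ('v, 'e, 'k) cplx"
 assumes AR: "AR_translation Q \<tau> \<tau>inv"
  and a: "\<alpha> : almost_positive_roots Q" and b: "\<beta> : almost_positive_roots Q"
 shows "compat_degree TYPE('k) Q \<alpha> \<beta> = kdim (cluster_Ext1 Q \<tau> \<tau>inv (M_Q Q \<alpha>) (M_Q Q \<beta>))"
proof -
 let ?M = "%\<alpha>. decorated_indec Q \<alpha> :: ('v + 'v, 'e, 'k) qrep" and ?A = "%\<alpha>. indec_rep Q \<alpha> :: ('v, 'e, 'k) qrep"
  and ?P = "%i. proj_at Q i :: ('v, 'e, 'k) qrep"
 have fundP: "fundamental \<tau> (shift 1 (stalk (?P i)))" if "i : vs" for i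
  using fundamental_projective[OF AR indec_brick[OF proj_at_facts(2)[OF that]] proj_at_facts(1)[OF that]] .
 have fundA: "fundamental \<tau> (stalk (?A \<alpha>))" if "\<alpha> : positive_roots Q" for \<alpha>
  using fundamental_module[OF AR positive_root_objects(4)[OF that]] .
 have zd: "kvec.dim (sp (plus_part M) v) = 0" if "zrep (plus_part M)" "v : vs" for M :: "('v + 'v, 'e, 'k) qrep" and v
  using that by (simp add: zrep_def)
 have rP: "rep (?P i)" if "i : vs" for i by (rule conjunct1[OF proj_at_facts(1)[OF that, unfolded projective_def]])
 have PA: "Dd (shift 1 (stalk (?P i))) (shift 1 (stalk (?A \<alpha>))) (kvec.dim (sp (?A \<alpha>) i))"
  if i: "i : vs" and \<alpha>: "\<alpha> : positive_roots Q" for i \<alpha>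
 proof -
  have rA: "rep (?A \<alpha>)" by (rule positive_root_objects(3)[OF \<alpha>])
  show ?thesis
   using Dd_shift[OF stalk_cx[OF rP[OF i]] stalk_cx[OF rA] Dd_projective_stalk[OF proj_at_facts(1)[OF i] rA]]
   unfolding proj_at_facts(3)[OF i rA] .
 qed
 have AP: "Dd (stalk (?A \<alpha>)) (shift 1 (shift 1 (stalk (?P i)))) 0"
  if i: "i : vs" and \<alpha>: "\<alpha> : positive_roots Q" for i \<alpha>
 proof -
  have rA: "rep (?A \<alpha>)" by (rule positive_root_objects(3)[OF \<alpha>])
  show ?thesis unfolding shift_shift
   using stalk_exact[OF rA, of _ 0] stalk_exact[OF rP[OF i], of _ 2]
   by (intro Dd_gap[OF stalk_cx[OF rA] shift_cx[OF stalk_cx[OF rP[OF i]]], of 0]) auto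
 qed
 \<comment> \<open>Maps from \<open>P_i[1]\<close> see only cohomology in degree -1, and
   \<open>P_j[2]\<close> has none there.\<close>
 have PP: "Dd (shift 1 (stalk (?P i))) (shift 1 (shift 1 (stalk (?P j)))) 0" if "i : vs" "j : vs" for i j
  unfolding shift_shift using stalk_exact[OF rP[OF that(2)], of "- 1" 2]
  by (intro Dd_projective[OF proj_at_facts(1)[OF that(1)] shift_cx[OF stalk_cx[OF rP[OF that(2)]]]]) simp
 have sum_i: "(SUM v:vs. f v * (if v = i then 1 else 0)) = f i" "(SUM v:vs. (if v = i then 1 else 0) * f v) = f i"
  if "i : vs" for f :: "'v => nat" and i
  using that by (simp_all add: if_distrib[of "%x. f _ * x"] if_distrib[of "%x. x * f _"] cong: if_cong)
 have C: "compat_degree TYPE('k) Q \<alpha> \<beta> = kdim (E_mod Q (?M \<alpha>) (?M \<beta>))" for \<alpha> \<beta> by (simp add: compat_degree_def)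
 consider (pp) "\<alpha> : positive_roots Q" "\<beta> : positive_roots Q"
  | (pn) j where "\<alpha> : positive_roots Q" "j : vs" "\<beta> = - simple_root j"
  | (np) i where "i : vs" "\<alpha> = - simple_root i" "\<beta> : positive_roots Q"
  | (nn) i j where "i : vs" "\<alpha> = - simple_root i" "j : vs" "\<beta> = - simple_root j"
  using a b unfolding almost_positive_roots_def by blast
 thus ?thesis
 proof cases
  case pp
  note A = positive_root_objects[where ?'k = 'k, OF pp(1)] and B = positive_root_objects[where ?'k = 'k, OF pp(2)]
  note rA = plus_part_rep[OF A(1)] and rB = plus_part_rep[OF B(1)]
  obtain m where m: "Dd (stalk (plus_part (?M \<alpha>))) (shift 1 (stalk (plus_part (?M \<beta>)))) m"
   using Dd_ex[OF stalk_cx[OF rA] shift_cx[OF stalk_cx[OF rB]]] by blast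
  obtain n where n: "Dd (stalk (plus_part (?M \<beta>))) (shift 1 (stalk (plus_part (?M \<alpha>)))) n"
   using Dd_ex[OF stalk_cx[OF rB] shift_cx[OF stalk_cx[OF rA]]] by blast
  have "kdim (E_mod Q (?M \<alpha>) (?M \<beta>)) = m + n"
   unfolding E_mod_dim[OF A(1) B(1) m n] using A(2) B(2) by simp
  moreover have "has_kdim (cluster_Ext1 Q \<tau> \<tau>inv (M_Q Q \<alpha>) (M_Q Q \<beta>)) (m + n)"
   unfolding A(6) B(6)
   by (rule cluster_Ext1_dim[OF AR fundA[OF pp(1)] fundA[OF pp(2)]
      Dd_stalk_iso[OF rA A(3) rB B(3) A(5) B(5) m] Dd_stalk_iso[OF rB B(3) rA A(3) B(5) A(5) n]])
  ultimately show ?thesis unfolding C using has_kdim_kdim by metis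
 next
  case pn
  note A = positive_root_objects[where ?'k = 'k, OF pn(1)] and B = negative_simple_objects[where ?'k = 'k, OF pn(2)]
  note rA = plus_part_rep[OF A(1)] and rB = plus_part_rep[OF B(1)]
  have "kdim (E_mod Q (?M \<alpha>) (?M \<beta>)) = kvec.dim (sp (?A \<alpha>) j)"
   unfolding pn(3) E_mod_dim[OF A(1) B(1) Dd_stalk_zero[OF rA rB disjI2[OF B(2)]] Dd_stalk_zero[OF rB rA disjI1[OF B(2)]]]
   using A(2,7) sum_i(1)[OF pn(2)] pn(2) by (simp add: B(3))
  moreover have "has_kdim (cluster_Ext1 Q \<tau> \<tau>inv (M_Q Q \<alpha>) (M_Q Q \<beta>)) (0 + kvec.dim (sp (?A \<alpha>) j))"
   unfolding A(6) pn(3) B(4) by (rule cluster_Ext1_dim[OF AR fundA[OF pn(1)] fundP[OF pn(2)] AP[OF pn(2,1)] PA[OF pn(2,1)]])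
  ultimately show ?thesis unfolding C using has_kdim_kdim by fastforce
 next
  case np
  note A = negative_simple_objects[where ?'k = 'k, OF np(1)] and B = positive_root_objects[where ?'k = 'k, OF np(3)]
  note rA = plus_part_rep[OF A(1)] and rB = plus_part_rep[OF B(1)]
  have "kdim (E_mod Q (?M \<alpha>) (?M \<beta>)) = kvec.dim (sp (?A \<beta>) i)"
   unfolding np(2) E_mod_dim[OF A(1) B(1) Dd_stalk_zero[OF rA rB disjI1[OF A(2)]] Dd_stalk_zero[OF rB rA disjI2[OF A(2)]]]
   using B(2,7) sum_i(2)[OF np(1)] np(1) by (simp add: A(3))
  moreover have "has_kdim (cluster_Ext1 Q \<tau> \<tau>inv (M_Q Q \<alpha>) (M_Q Q \<beta>)) (kvec.dim (sp (?A \<beta>) i) + 0)"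
   unfolding B(6) np(2) A(4) by (rule cluster_Ext1_dim[OF AR fundP[OF np(1)] fundA[OF np(3)] PA[OF np(1,3)] AP[OF np(1,3)]])
  ultimately show ?thesis unfolding C using has_kdim_kdim by fastforce
 next
  case nn
  note A = negative_simple_objects[where ?'k = 'k, OF nn(1)] and B = negative_simple_objects[where ?'k = 'k, OF nn(3)]
  note rA = plus_part_rep[OF A(1)] and rB = plus_part_rep[OF B(1)]
  have "kdim (E_mod Q (?M \<alpha>) (?M \<beta>)) = 0"
   unfolding nn(2,4) E_mod_dim[OF A(1) B(1) Dd_stalk_zero[OF rA rB disjI1[OF A(2)]] Dd_stalk_zero[OF rB rA disjI2[OF A(2)]]]
   using zd[OF A(2)] zd[OF B(2)] by simp
  moreover have "has_kdim (cluster_Ext1 Q \<tau> \<tau>inv (M_Q Q \<alpha>) (M_Q Q \<beta>)) (0 + 0)"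
   unfolding nn(2,4) A(4) B(4)
   by (rule cluster_Ext1_dim[OF AR fundP[OF nn(1)] fundP[OF nn(3)] PP[OF nn(1,3)] PP[OF nn(3,1)]])
  ultimately show ?thesis unfolding C using has_kdim_kdim by fastforce
 qed
qed

end

theorem corollary4p3:
  fixes \<Delta> :: dynkin
    and Q :: "('v, 'e) pre_digraph"
    and \<tau> \<tau>inv :: "('v, 'e, 'k::alg_closed_field) cplx \<Rightarrow> ('v, 'e, 'k) cplx"
    and \<alpha> \<beta> :: "'v \<Rightarrow> int"
  assumes "dynkin_quiver \<Delta> Q"
    and "AR_translation Q \<tau> \<tau>inv"
    and "\<alpha> \<in> almost_positive_roots Q"
    and "\<beta> \<in> almost_positive_roots Q"
  shows "compat_degree TYPE('k) Q \<alpha> \<beta> = kdim (cluster_Ext1 Q \<tau> \<tau>inv (M_Q Q \<alpha>) (M_Q Q \<beta>))"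
proof -
  interpret dynkin_quiver_loc \<Delta> Q by unfold_locales (rule assms(1))
  show ?thesis by (rule compat_degree_cluster[OF assms(2-4)])
qed

end
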